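(* In the setting described in the context, suppose the treatments are assigned by rerandomization (RR) with threshold $a>0$ based on the Mahalanobis distance. Let $\bm{\Sigma}=\mathrm{diag}(\mathrm{Var}(X_1),\dots,\mathrm{Var}(X_{p+q}))$, let $\bm{D}\sim N(\bm{0},\mathbf{I}_{p+q})$, let $\bm{\xi}^{\mathrm{RR}}$ be a random vector distributed as $\bm{\Sigma}^{1/2}\bm{D}$ conditionally on $\bm{D}^t\bm{D}<a$, and let $\bm{\xi}^{\mathrm{RR}}_{\mathrm{ex}}$ be its last $q$ coordinates. Let $Z$ be standard normal, independent of $\bm{\xi}^{\mathrm{RR}}_{\mathrm{ex}}$, and $\lambda_1=\sigma_\epsilon/\sigma_w$, $\lambda_2=1/\sigma_w$. 1. If $\mu_1-\mu_2=0$, then $S\overset{d}{\rightarrow}\lambda_1Z+\lambda_2\bm{\beta}_{\mathrm{ex}}^t\bm{\xi}^{\mathrm{RR}}_{\mathrm{ex}}$. 2. If $\mu_1-\mu_2=\delta/\sqrt{n}$ for a fixed $\delta\neq0$, then $S\overset{d}{\rightarrow}\lambda_1Z+\lambda_2\bm{\beta}_{\mathrm{ex}}^t\bm{\xi}^{\mathrm{RR}}_{\mathrm{ex}}+\lambda_2\delta/2$.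
   Context: Setting. Fix integers $p,q\ge 0$. For each $n$ there are $n$ units; $T_i\in\{0,1\}$ is the treatment assignment of unit $i$ ($T_i=1$ for treatment 1, $T_i=0$ for treatment 2), possibly depending on $n$, and $\bm{x}_i=(x_{i,1},\dots,x_{i,p+q})^t$ is its covariate vector. The vectors $\bm{x}_i$ are i.i.d. over $i$; $x_{i,j}$ is distributed as $X_j$, the covariates $X_1,\dots,X_{p+q}$ are independent of each other, with $\mathbb{E}X_j=0$ and $0<\mathrm{Var}(X_j)<\infty$. The outcomes follow the true linear model $$Y_i=\mu_1T_i+\mu_2(1-T_i)+\sum_{j=1}^{p+q}\beta_jx_{i,j}+\epsilon_i,$$ where $\epsilon_1,\dots,\epsilon_n$ are i.i.d. with mean $0$ and variance $\sigma_\epsilon^2\in(0,\infty)$, independent of the covariates. The randomization uses only covariate information and external randomness: $(T_1,\dots,T_n)$ and all covariates are jointly independent of $(\epsilon_1,\dots,\epsilon_n)$. Rerandomization. Complete randomization (CR) assigns each unit independently to either treatment with probability $1/2$, independently of the covariates. Rerandomization repeats CR for all $n$ units (given the observed covariates) until $M<a$; the accepted assignment is used. Thus, given the covariates, $(T_1,\dots,T_n)$ has the CR distribution conditioned on $M<a$ (arbitrary if no assignment satisfies it). Here $M$ is the Mahalanobis distance $$M=(\bar{\bm{x}}_1-\bar{\bm{x}}_2)^t\,\mathrm{Cov}(\bar{\bm{x}}_1-\bar{\bm{x}}_2)^{-1}(\bar{\bm{x}}_1-\bar{\bm{x}}_2),$$ with $\bar{\bm{x}}_1,\bar{\bm{x}}_2$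 the sample means of the covariates in the two treatment groups. Under the assumption of independent covariates it is used through the representation, valid under CR, $$M=\sum_{j=1}^{p+q}\left(\frac{\sum_{i=1}^n(2T_i-1)x_{i,j}}{\sqrt{n\,\mathrm{Var}(X_j)}}\right)^2+o_P(1).$$ Working model. Only the first $p$ covariates are included: $\mathbb{E}[Y_i]=\mu_1T_i+\mu_2(1-T_i)+\sum_{j=1}^p\beta_jx_{i,j}$. Write $\bm{Y}=(Y_1,\dots,Y_n)^t$, $\bm{T}=(T_1,\dots,T_n)^t$, $\mathbf{X}_{\mathrm{in}}=(x_{i,j})_{1\le i\le n,1\le j\le p}$, $\bm{\beta}_{\mathrm{in}}=(\beta_1,\dots,\beta_p)^t$, $\bm{\beta}_{\mathrm{ex}}=(\beta_{p+1},\dots,\beta_{p+q})^t$, $\bm{1}_n$ the vector of $n$ ones, $\mathbf{G}=[\bm{T};\bm{1}_n-\bm{T};\mathbf{X}_{\mathrm{in}}]$ (an $n\times(p+2)$ matrix, columns juxtaposed), and $\bm{\theta}=(\mu_1,\mu_2,\bm{\beta}_{\mathrm{in}}^t)^t$. The OLS estimator is $\hat{\bm{\theta}}=(\mathbf{G}^t\mathbf{G})^{-1}\mathbf{G}^t\bm{Y}$ (defined arbitrarily when $\mathbf{G}^t\mathbf{G}$ is singular). Test statistic for the treatment effect ($H_0:\mu_1-\mu_2=0$): $$S=\frac{\bm{L}^t\hat{\bm{\theta}}}{\sqrt{\hat\sigma_w^2\,\bm{L}^t(\mathbf{G}^t\mathbf{G})^{-1}\bm{L}}},\qquad \bm{L}=(1,-1,0,\dots,0)^t\in\mathbb{R}^{p+2},\qquad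 \hat\sigma_w^2=\frac{\Vert\bm{Y}-\mathbf{G}\hat{\bm{\theta}}\Vert^2}{n-p-2}.$$ Also $\sigma_w^2=\sigma_\epsilon^2+\sum_{j=1}^q\beta_{p+j}^2\mathrm{Var}(X_{p+j})$. *)

theory Defs
  imports "HOL-Probability.Probability" "Jordan_Normal_Form.Gauss_Jordan_Elimination"
begin

unbundle no vec_syntax and no inner_syntax

text \<open>
  Units and covariates are indexed from 0: unit \<open>i < n\<close>, covariate \<open>j < p + q\<close>, of which the
  covariates \<open>j < p\<close> enter the working model. An assignment is a function \<open>t :: nat \<Rightarrow> bool\<close> with
  \<open>t i\<close> true for treatment 1, and \<open>x i j\<close> is the value of covariate \<open>j\<close> for unit \<open>i\<close>; only the
  values at \<open>i < n\<close> matter.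
\<close>

text \<open>The value at singular matrices is an arbitrary convention.\<close>

definition minv :: "real mat \<Rightarrow> real mat" where
  "minv A = (case mat_inverse A of Some B \<Rightarrow> B | None \<Rightarrow> 0\<^sub>m (dim_row A) (dim_col A))"

text \<open>
  Independence of random variables with possibly different range types; the library's
  \<open>indep_var\<close> requires both to take values in the same type.
\<close>

definition indep_rv ::
  "'a measure \<Rightarrow> 'b measure \<Rightarrow> ('a \<Rightarrow> 'b) \<Rightarrow> 'c measure \<Rightarrow> ('a \<Rightarrow> 'c) \<Rightarrow> bool" where
  "indep_rv P A f B g \<longleftrightarrow> f \<in> measurable P A \<and> g \<in> measurable P B \<and>
     prob_space.indep_set P {f -` E \<inter> space P | E. E \<in> sets A} {g -` E \<inter> space P | E. E \<in> sets B}"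


subsection \<open>Complete randomization and the Mahalanobis distance\<close>

definition CR :: "nat \<Rightarrow> (nat \<Rightarrow> bool) pmf" where
  "CR n = Pi_pmf {..<n} False (\<lambda>_. bernoulli_pmf (1/2))"

text \<open>The mean over an empty group is 0, since \<open>0 / 0 = 0\<close>.\<close>

definition group_mean :: "nat \<Rightarrow> bool \<Rightarrow> (nat \<Rightarrow> nat \<Rightarrow> real) \<Rightarrow> (nat \<Rightarrow> bool) \<Rightarrow> nat \<Rightarrow> real" where
  "group_mean n b x t j =
     (\<Sum>i | i < n \<and> t i = b. x i j) / real (card {i. i < n \<and> t i = b})"

definition mean_diff :: "nat \<Rightarrow> nat \<Rightarrow> (nat \<Rightarrow> nat \<Rightarrow> real) \<Rightarrow> (nat \<Rightarrow> bool) \<Rightarrow> real Matrix.vec" where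
  "mean_diff n d x t = Matrix.vec d (\<lambda>j. group_mean n True x t j - group_mean n False x t j)"

definition cov_mat :: "nat \<Rightarrow> 'a measure \<Rightarrow> ('a \<Rightarrow> real Matrix.vec) \<Rightarrow> real mat" where
  "cov_mat d N f = Matrix.mat d d (\<lambda>(j, k).
     (LINT \<omega>|N. (f \<omega> $ j - (LINT \<omega>'|N. f \<omega>' $ j)) * (f \<omega> $ k - (LINT \<omega>'|N. f \<omega>' $ k))))"

text \<open>
  The joint law of covariates and assignment under complete randomization, when the covariate
  vectors of the units are i.i.d. with law \<open>\<nu>\<close>.
\<close>

definition CR_law :: "nat \<Rightarrow> (nat \<Rightarrow> real) measure \<Rightarrow> ((nat \<Rightarrow> nat \<Rightarrow> real) \<times> (nat \<Rightarrow> bool)) measure" where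
  "CR_law n \<nu> = PiM {..<n} (\<lambda>_. \<nu>) \<Otimes>\<^sub>M measure_pmf (CR n)"

text \<open>
  The covariance matrix in the Mahalanobis distance is that of the difference of the group means
  under complete randomization.
\<close>

definition mahalanobis ::
  "nat \<Rightarrow> nat \<Rightarrow> (nat \<Rightarrow> real) measure \<Rightarrow> (nat \<Rightarrow> nat \<Rightarrow> real) \<Rightarrow> (nat \<Rightarrow> bool) \<Rightarrow> real" where
  "mahalanobis n d \<nu> x t =
     mean_diff n d x t \<bullet>
       (minv (cov_mat d (CR_law n \<nu>) (\<lambda>(x', t'). mean_diff n d x' t')) *\<^sub>v mean_diff n d x t)"

abbreviation covariate_space :: "nat \<Rightarrow> (nat \<Rightarrow> real) measure" where
  "covariate_space d \<equiv> PiM {..<d} (\<lambda>_. borel)"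

abbreviation covariate_law :: "nat \<Rightarrow> 'a measure \<Rightarrow> (nat \<Rightarrow> 'a \<Rightarrow> real) \<Rightarrow> (nat \<Rightarrow> real) measure" where
  "covariate_law d Q X \<equiv> distr Q (covariate_space d) (\<lambda>\<omega>. \<lambda>j\<in>{..<d}. X j \<omega>)"

text \<open>
  Given the covariates of all \<open>n\<close> units, the assignment has the law of complete randomization
  conditioned on \<open>Mdist < a\<close>. Nothing is required on the event that no assignment is acceptable.
\<close>

definition rerandomized ::
  "'a measure \<Rightarrow> nat \<Rightarrow> nat \<Rightarrow> ((nat \<Rightarrow> nat \<Rightarrow> real) \<Rightarrow> (nat \<Rightarrow> bool) \<Rightarrow> real) \<Rightarrow> real
     \<Rightarrow> (nat \<Rightarrow> nat \<Rightarrow> 'a \<Rightarrow> real) \<Rightarrow> (nat \<Rightarrow> 'a \<Rightarrow> bool) \<Rightarrow> bool" where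
  "rerandomized P n d Mdist a x T \<longleftrightarrow>
     (let F = vimage_algebra (space P) (\<lambda>\<omega>. \<lambda>i\<in>{..<n}. \<lambda>j\<in>{..<d}. x i j \<omega>)
                (PiM {..<n} (\<lambda>_. covariate_space d));
          acc = (\<lambda>\<omega>. {t. Mdist (\<lambda>i j. x i j \<omega>) t < a})
      in \<forall>t\<in>set_pmf (CR n). AE \<omega> in P. set_pmf (CR n) \<inter> acc \<omega> \<noteq> {} \<longrightarrow>
           real_cond_exp P F (indicator {\<omega>'. \<forall>i<n. T i \<omega>' = t i}) \<omega>
             = pmf (cond_pmf (CR n) (acc \<omega>)) t)"


subsection \<open>Outcomes, working model and test statistic\<close>

definition outcome ::
  "nat \<Rightarrow> nat \<Rightarrow> real \<Rightarrow> real \<Rightarrow> (nat \<Rightarrow> real) \<Rightarrow> (nat \<Rightarrow> bool) \<Rightarrow> (nat \<Rightarrow> nat \<Rightarrow> real) \<Rightarrow> (nat \<Rightarrow> real)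
     \<Rightarrow> real Matrix.vec" where
  "outcome n d \<mu>1 \<mu>2 \<beta> t x e = Matrix.vec n (\<lambda>i.
     \<mu>1 * of_bool (t i) + \<mu>2 * (1 - of_bool (t i)) + (\<Sum>j<d. \<beta> j * x i j) + e i)"

definition design :: "nat \<Rightarrow> nat \<Rightarrow> (nat \<Rightarrow> bool) \<Rightarrow> (nat \<Rightarrow> nat \<Rightarrow> real) \<Rightarrow> real mat" where
  "design n p t x = Matrix.mat n (p + 2) (\<lambda>(i, k).
     if k = 0 then of_bool (t i) else if k = 1 then 1 - of_bool (t i) else x i (k - 2))"

definition ols :: "real mat \<Rightarrow> real Matrix.vec \<Rightarrow> real Matrix.vec" where
  "ols G Y = minv (G\<^sup>T * G) *\<^sub>v (G\<^sup>T *\<^sub>v Y)"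

definition resid_var :: "real mat \<Rightarrow> real Matrix.vec \<Rightarrow> real" where
  "resid_var G Y = (let r = Y - G *\<^sub>v ols G Y in (r \<bullet> r) / (real (dim_row G) - real (dim_col G)))"

definition contrast :: "nat \<Rightarrow> real Matrix.vec" where
  "contrast p = Matrix.vec (p + 2) (\<lambda>k. if k = 0 then 1 else if k = 1 then - 1 else 0)"

definition test_stat ::
  "nat \<Rightarrow> nat \<Rightarrow> (nat \<Rightarrow> bool) \<Rightarrow> (nat \<Rightarrow> nat \<Rightarrow> real) \<Rightarrow> real Matrix.vec \<Rightarrow> real" where
  "test_stat n p t x Y =
     (let G = design n p t x; L = contrast p
      in (L \<bullet> ols G Y) / sqrt (resid_var G Y * (L \<bullet> (minv (G\<^sup>T * G) *\<^sub>v L))))"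


subsection \<open>The limiting vector\<close>

text \<open>The law of \<open>\<Sigma>\<^sup>1\<^sup>/\<^sup>2 D\<close> given \<open>D\<^sup>t D < a\<close>, with \<open>\<Sigma> = diag (v 0, \<dots>, v (d - 1))\<close>.\<close>

definition xi_RR_law :: "nat \<Rightarrow> (nat \<Rightarrow> real) \<Rightarrow> real \<Rightarrow> (nat \<Rightarrow> real) measure" where
  "xi_RR_law d v a =
     distr (uniform_measure (PiM {..<d} (\<lambda>_. std_normal_distribution))
              {D \<in> space (PiM {..<d} (\<lambda>_. std_normal_distribution)). (\<Sum>j<d. (D j)\<^sup>2) < a})
       (covariate_space d) (\<lambda>D. \<lambda>j\<in>{..<d}. sqrt (v j) * D j)"

end

theory Submission
  imports Defs "Jordan_Normal_Form.Determinant" "HOL-Real_Asymp.Real_Asymp"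
begin

text \<open>
  Under complete randomization, up to terms vanishing in probability, the statistic is
  \<open>(\<delta> / 2 + n\<^sup>-\<^sup>1\<^sup>/\<^sup>2 \<Sum>\<^sub>i (2 T\<^sub>i - 1) r\<^sub>i) / \<sigma>\<^sub>w\<close>, where \<open>r\<^sub>i\<close> is the part of the outcome left out of the
  working model, and the Mahalanobis distance is the sum of the squares of
  \<open>U\<^sub>j = \<Sum>\<^sub>i (2 T\<^sub>i - 1) x\<^sub>i\<^sub>j / (n Var X\<^sub>j)\<^sup>1\<^sup>/\<^sup>2\<close>. The central limit theorem makes the errors' sum and the \<open>U\<^sub>j\<close>
  jointly Gaussian with independent limits.

  Rerandomization reweights this law by the indicator of \<open>M < a\<close> over the acceptance probability
  \<open>A(x)\<close> given the covariates. That probability concentrates at \<open>c = P (D\<^sup>t D < a)\<close>: its first moment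
  is the probability that one assignment is accepted, its second that two independent assignments
  of the same covariates are, and the \<open>U\<^sub>j\<close> of the two assignments are asymptotically independent. So
  \<open>P (S \<le> y)\<close> under rerandomization has the limit of \<open>P (S \<le> y, M < a) / c\<close> under complete randomization.
\<close>

section \<open>Weighted continuity theorem for characteristic functions\<close>

text \<open>The obstacle is that \<open>M < a\<close> is a nonlinear event, while the central limit
  theorem delivers characteristic functions of linear combinations. The statistic and both distances
  are, up to vanishing terms, sums of linear and quadratic functions of single coordinates without
  mixed terms. So the exponential of any combination of them is a product of bounded continuous
  functions of one coordinate each, and convergence against such products is enough. A bounded
  weight stands for the other factors, which is why Levy's theorem is needed in a weighted form.
  Covariates, errors and the signs of two assignments form one array of independent centred columns.
  Products over distinct sets of columns are uncorrelated, which makes the Gaussian limits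
  independent. The covariance in \<open>M\<close> is computed exactly under complete randomization:
  it is diagonal with entries \<open>w * Var X_j\<close>, and \<open>n * w\<close> tends to 4. The
  same 4 is the limit of \<open>n * L^t (G^t G)^-1 L\<close>, so the denominator of the statistic
  behaves like 2 \<sigma>w / sqrt n, and the drift \<delta> / sqrt n turns into \<delta> / (2
  \<sigma>w).\<close>

definition tilted :: "'a measure \<Rightarrow> ('a \<Rightarrow> real) \<Rightarrow> ('a \<Rightarrow> real) \<Rightarrow> real measure" where
  "tilted M H W = distr (density M (\<lambda>x. ennreal (H x / (\<integral>x. H x \<partial>M)))) borel W"

text \<open>The lower bound 1 on the weight keeps the normalizing constant of \<open>tilted\<close>
  away from 0.\<close>

lemma (in prob_space) integral_ge_1:
  fixes H :: "'a \<Rightarrow> real"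
  assumes "H \<in> borel_measurable M" "\<And>x. 1 \<le> H x" "\<And>x. H x \<le> B"
  shows "integrable M H" "1 \<le> integral\<^sup>L M H"
proof -
  show i: "integrable M H"
    using assms by (intro integrable_const_bound[where B=B]) (auto intro!: AE_I2 simp: abs_le_iff intro: order_trans[of _ "-1"], smt (verit) assms)
  have "(\<integral>x. 1 \<partial>M) \<le> integral\<^sup>L M H"
    using assms i by (intro integral_mono) auto
  then show "1 \<le> integral\<^sup>L M H" by (simp add: prob_space)
qed

lemma (in prob_space)
  fixes H W :: "'a \<Rightarrow> real"
  assumes [measurable]: "H \<in> borel_measurable M" "W \<in> borel_measurable M"
    and H: "\<And>x. 1 \<le> H x" "\<And>x. H x \<le> B"
  shows real_distribution_tilted: "real_distribution (tilted M H W)"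
    and integral_tilted: "g \<in> borel_measurable borel \<Longrightarrow>
      integral\<^sup>L (tilted M H W) (g :: real \<Rightarrow> complex) = (\<integral>x. H x *\<^sub>R g (W x) \<partial>M) / of_real (\<integral>x. H x \<partial>M)"
    and AE_tilted: "AE x in M. P (W x) \<Longrightarrow> {x. P x} \<in> sets borel \<Longrightarrow> AE x in tilted M H W. P x"
proof -
  note I = integral_ge_1[OF assms(1) H]
  let ?c = "integral\<^sup>L M H"
  let ?D = "density M (\<lambda>x. ennreal (H x / ?c))"
  have pos: "0 \<le> H x / ?c" for x
    using H(1)[of x] I(2) by simp
  have "emeasure ?D (space ?D) = (\<integral>\<^sup>+x. ennreal (H x / ?c) \<partial>M)"
    by (simp add: emeasure_density cong: nn_integral_cong_simp)
  also have "\<dots> = ennreal (\<integral>x. H x / ?c \<partial>M)"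
    using I pos by (intro nn_integral_eq_integral) auto
  also have "\<dots> = 1" using I by simp
  finally interpret D: prob_space ?D by (intro prob_spaceI)
  show "real_distribution (tilted M H W)"
    unfolding tilted_def by (intro D.real_distribution_distr) simp
  show "integral\<^sup>L (tilted M H W) g = (\<integral>x. H x *\<^sub>R g (W x) \<partial>M) / of_real (\<integral>x. H x \<partial>M)"
    if [measurable]: "g \<in> borel_measurable borel" for g :: "real \<Rightarrow> complex"
  proof -
    have "integral\<^sup>L (tilted M H W) g = (\<integral>x. g (W x) \<partial>?D)"
      unfolding tilted_def by (rule integral_distr) auto
    also have "\<dots> = (\<integral>x. (H x / ?c) *\<^sub>R g (W x) \<partial>M)"
      using pos by (intro integral_density) auto
    also have "\<dots> = (\<integral>x. (H x *\<^sub>R g (W x)) / of_real ?c \<partial>M)"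
      by (intro Bochner_Integration.integral_cong) (auto simp: scaleR_conv_of_real)
    finally show ?thesis by simp
  qed
  show "AE x in tilted M H W. P x" if "AE x in M. P (W x)" "{x. P x} \<in> sets borel"
    unfolding tilted_def using that
    by (subst AE_distr_iff) (auto simp: AE_density elim: eventually_mono)
qed

text \<open>At \<open>t = 0\<close> the hypothesis says that the normalizing constants converge, and
  for other \<open>t\<close> it then says that the characteristic functions of the tilted laws do.
  Levy's theorem gives weak convergence, and multiplying by the constants restores the weighted
  integrals.\<close>

lemma tilted_weak_conv:
  fixes H W :: "nat \<Rightarrow> 'a \<Rightarrow> real" and H' W' :: "'l \<Rightarrow> real" and f :: "real \<Rightarrow> complex"
  assumes M: "prob_space M" and L: "prob_space L"
    and [measurable]: "\<And>n. H n \<in> borel_measurable M" "\<And>n. W n \<in> borel_measurable M"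
      "H' \<in> borel_measurable L" "W' \<in> borel_measurable L" "f \<in> borel_measurable borel"
    and H: "\<And>n x. 1 \<le> H n x" "\<And>n x. H n x \<le> B" and H': "\<And>x. 1 \<le> H' x" "\<And>x. H' x \<le> B"
    and conv: "\<And>t. (\<lambda>n. \<integral>x. H n x *\<^sub>R iexp (t * W n x) \<partial>M) \<longlonglongrightarrow> (\<integral>x. H' x *\<^sub>R iexp (t * W' x) \<partial>L)"
    and f: "\<And>x. norm (f x) \<le> C" "AE x in L. isCont f (W' x)"
  shows "(\<lambda>n. \<integral>x. H n x *\<^sub>R f (W n x) \<partial>M) \<longlonglongrightarrow> (\<integral>x. H' x *\<^sub>R f (W' x) \<partial>L)"
proof -
  interpret M: prob_space M by fact
  interpret L: prob_space L by fact
  let ?m = "\<lambda>n. tilted M (H n) (W n)" and ?l = "tilted L H' W'"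
  have rd: "real_distribution (?m n)" "real_distribution ?l" for n
    using H H' by (auto intro!: M.real_distribution_tilted L.real_distribution_tilted)
  have int: "integral\<^sup>L (?m n) g = (\<integral>x. H n x *\<^sub>R g (W n x) \<partial>M) / of_real (\<integral>x. H n x \<partial>M)"
     "integral\<^sup>L ?l g = (\<integral>x. H' x *\<^sub>R g (W' x) \<partial>L) / of_real (\<integral>x. H' x \<partial>L)"
    if "g \<in> borel_measurable borel" for g :: "real \<Rightarrow> complex" and n
    using H H' that by (auto intro!: M.integral_tilted L.integral_tilted)
  have c0: "(\<lambda>n. complex_of_real (\<integral>x. H n x \<partial>M)) \<longlonglongrightarrow> complex_of_real (\<integral>x. H' x \<partial>L)"
    using conv[of 0] by (simp add: scaleR_conv_of_real)
  have ge: "1 \<le> (\<integral>x. H n x \<partial>M)" "1 \<le> (\<integral>x. H' x \<partial>L)" for n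
    using H H' by (auto intro!: M.integral_ge_1 L.integral_ge_1)
  have ne: "(\<integral>x. H n x \<partial>M) \<noteq> 0" "(\<integral>x. H' x \<partial>L) \<noteq> 0" for n
    using ge(1)[of n] ge(2) by auto
  have weak: "weak_conv_m ?m ?l"
  proof (rule levy_continuity[OF rd])
    fix t
    have mI: "(\<lambda>w. iexp (t * w)) \<in> borel_measurable borel" by simp
    show "(\<lambda>n. char (?m n) t) \<longlonglongrightarrow> char ?l t"
      unfolding char_def int(1)[OF mI] int(2)[OF mI] using ne
      by (intro tendsto_divide conv c0) simp
  qed
  have "(\<lambda>n. integral\<^sup>L (?m n) f) \<longlonglongrightarrow> integral\<^sup>L ?l f"
  proof (rule weak_conv_imp_bdd_ae_continuous_conv[OF rd weak _ f(1)])
    \<comment> \<open>Tilting only inserts a density, so what holds almost surely for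
      \<open>W'\<close> under \<open>L\<close> holds almost surely under the tilted law.\<close>
    have "AE x in ?l. isCont f x"
      using H' f(2) by (intro L.AE_tilted) (auto simp: isCont_borel)
    then show "emeasure ?l {x. \<not> isCont f x} = 0"
      by (subst (asm) AE_iff_measurable[OF _ refl]) (auto simp: tilted_def)
  qed simp
  from tendsto_mult[OF this c0] show ?thesis
    by (simp add: int ne)
qed

lemma (in prob_space) integrable_bounded_complex:
  fixes g :: "'a \<Rightarrow> complex"
  assumes "g \<in> borel_measurable M" "\<And>x. norm (g x) \<le> B"
  shows "integrable M g"
  using assms by (intro integrable_const_bound[where B=B]) auto

text \<open>A weight bounded by \<open>B\<close> in absolute value becomes admissible after adding
  \<open>1 + B\<close>. The surplus is a multiple of the unweighted integral, whose convergence is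
  the case of weight 1; hence the separate hypothesis \<open>conv1\<close>.\<close>

lemma weighted_levy_real:
  fixes H W :: "nat \<Rightarrow> 'a \<Rightarrow> real" and H' W' :: "'l \<Rightarrow> real" and f :: "real \<Rightarrow> complex"
  assumes M: "prob_space M" and L: "prob_space L"
    and [measurable]: "\<And>n. H n \<in> borel_measurable M" "\<And>n. W n \<in> borel_measurable M"
      "H' \<in> borel_measurable L" "W' \<in> borel_measurable L" "f \<in> borel_measurable borel"
    and H: "\<And>n x. \<bar>H n x\<bar> \<le> B" "\<And>x. \<bar>H' x\<bar> \<le> B"
    and conv1: "\<And>t. (\<lambda>n. \<integral>x. iexp (t * W n x) \<partial>M) \<longlonglongrightarrow> (\<integral>x. iexp (t * W' x) \<partial>L)"
    and conv: "\<And>t. (\<lambda>n. \<integral>x. H n x *\<^sub>R iexp (t * W n x) \<partial>M) \<longlonglongrightarrow> (\<integral>x. H' x *\<^sub>R iexp (t * W' x) \<partial>L)"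
    and f: "\<And>x. norm (f x) \<le> C" "AE x in L. isCont f (W' x)"
  shows "(\<lambda>n. \<integral>x. H n x *\<^sub>R f (W n x) \<partial>M) \<longlonglongrightarrow> (\<integral>x. H' x *\<^sub>R f (W' x) \<partial>L)"
proof -
  interpret M: prob_space M by fact
  interpret L: prob_space L by fact
  have B: "0 \<le> B" using H(2) abs_ge_zero order_trans by blast
  have bd: "norm (h *\<^sub>R g) \<le> B * K" if "\<bar>h\<bar> \<le> B" "norm g \<le> K" for h K and g :: complex
    using that B by (auto intro!: mult_mono)
  have split: "(\<integral>x. (1 + B + H n x) *\<^sub>R g (W n x) \<partial>M) = (1 + B) *\<^sub>R (\<integral>x. g (W n x) \<partial>M) + (\<integral>x. H n x *\<^sub>R g (W n x) \<partial>M)"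
    "(\<integral>x. (1 + B + H' x) *\<^sub>R g (W' x) \<partial>L) = (1 + B) *\<^sub>R (\<integral>x. g (W' x) \<partial>L) + (\<integral>x. H' x *\<^sub>R g (W' x) \<partial>L)"
    if [measurable]: "g \<in> borel_measurable borel" and g: "\<And>x. norm (g x) \<le> K" for g :: "real \<Rightarrow> complex" and n K
  proof -
    have "integrable M (\<lambda>x. g (W n x))" "integrable L (\<lambda>x. g (W' x))"
      using g by (auto intro!: M.integrable_bounded_complex[of _ K] L.integrable_bounded_complex[of _ K])
    moreover have "integrable M (\<lambda>x. H n x *\<^sub>R g (W n x))" "integrable L (\<lambda>x. H' x *\<^sub>R g (W' x))"
      using H bd[OF _ g] by (auto intro!: M.integrable_bounded_complex[of _ "B * K"]
          L.integrable_bounded_complex[of _ "B * K"] simp del: norm_scaleR)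
    ultimately have i: "integrable M (\<lambda>x. g (W n x))" "integrable M (\<lambda>x. H n x *\<^sub>R g (W n x))"
       "integrable L (\<lambda>x. g (W' x))" "integrable L (\<lambda>x. H' x *\<^sub>R g (W' x))" by simp_all
    show "(\<integral>x. (1 + B + H n x) *\<^sub>R g (W n x) \<partial>M) = (1 + B) *\<^sub>R (\<integral>x. g (W n x) \<partial>M) + (\<integral>x. H n x *\<^sub>R g (W n x) \<partial>M)"
      using i by (subst scaleR_left_distrib) simp
    show "(\<integral>x. (1 + B + H' x) *\<^sub>R g (W' x) \<partial>L) = (1 + B) *\<^sub>R (\<integral>x. g (W' x) \<partial>L) + (\<integral>x. H' x *\<^sub>R g (W' x) \<partial>L)"
      using i by (subst scaleR_left_distrib) simp
  qed
  have shift: "(\<lambda>n. \<integral>x. (1 + B + H n x) *\<^sub>R g (W n x) \<partial>M) \<longlonglongrightarrow> (\<integral>x. (1 + B + H' x) *\<^sub>R g (W' x) \<partial>L)"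
    if "g \<in> borel_measurable borel" "\<And>x. norm (g x) \<le> C" "AE x in L. isCont g (W' x)" for g :: "real \<Rightarrow> complex" and C
  proof (rule tilted_weak_conv[OF M L, where B="1 + B + B" and H="\<lambda>n x. 1 + B + H n x" and H'="\<lambda>x. 1 + B + H' x"
        and W=W and W'=W' and f=g and C=C])
    fix t
    have mI: "(\<lambda>w. iexp (t * w)) \<in> borel_measurable borel" "norm (iexp (t * w)) \<le> 1" for w by simp_all
    show "(\<lambda>n. \<integral>x. (1 + B + H n x) *\<^sub>R iexp (t * W n x) \<partial>M) \<longlonglongrightarrow> (\<integral>x. (1 + B + H' x) *\<^sub>R iexp (t * W' x) \<partial>L)"
      unfolding split(1)[OF mI] split(2)[OF mI] by (intro tendsto_add tendsto_scaleR tendsto_const conv conv1)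
    show "1 \<le> 1 + B + H n x" "1 + B + H n x \<le> 1 + B + B" "1 \<le> 1 + B + H' y" "1 + B + H' y \<le> 1 + B + B" for n x y
      using H(1)[of n x] H(2)[of y] by linarith+
  qed (use that in auto)
  have "(\<lambda>n. \<integral>x. 1 *\<^sub>R f (W n x) \<partial>M) \<longlonglongrightarrow> (\<integral>x. 1 *\<^sub>R f (W' x) \<partial>L)"
    by (rule tilted_weak_conv[OF M L, where B=1 and C=C]) (use f conv1 in auto)
  then have "(\<lambda>n. (\<integral>x. (1 + B + H n x) *\<^sub>R f (W n x) \<partial>M) - (1 + B) *\<^sub>R (\<integral>x. f (W n x) \<partial>M)) \<longlonglongrightarrow>
     (\<integral>x. (1 + B + H' x) *\<^sub>R f (W' x) \<partial>L) - (1 + B) *\<^sub>R (\<integral>x. f (W' x) \<partial>L)"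
    using f by (intro tendsto_diff tendsto_scaleR shift) auto
  then show ?thesis using f by (simp add: split[of f C])
qed

text \<open>The real and imaginary parts of the weight are combinations of the weight and its
  conjugate, which reduces the claim to real weights.\<close>

lemma weighted_levy:
  fixes H :: "nat \<Rightarrow> 'a \<Rightarrow> complex" and W :: "nat \<Rightarrow> 'a \<Rightarrow> real" and H' :: "'l \<Rightarrow> complex"
    and W' :: "'l \<Rightarrow> real" and f :: "real \<Rightarrow> complex"
  assumes M: "prob_space M" and L: "prob_space L"
    and [measurable]: "\<And>n. H n \<in> borel_measurable M" "\<And>n. W n \<in> borel_measurable M"
      "H' \<in> borel_measurable L" "W' \<in> borel_measurable L" "f \<in> borel_measurable borel"
    and H: "\<And>n x. norm (H n x) \<le> B" "\<And>x. norm (H' x) \<le> B"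
    and conv1: "\<And>t. (\<lambda>n. \<integral>x. iexp (t * W n x) \<partial>M) \<longlonglongrightarrow> (\<integral>x. iexp (t * W' x) \<partial>L)"
    and conv: "\<And>t. (\<lambda>n. \<integral>x. H n x * iexp (t * W n x) \<partial>M) \<longlonglongrightarrow> (\<integral>x. H' x * iexp (t * W' x) \<partial>L)"
    and f: "\<And>x. norm (f x) \<le> C" "AE x in L. isCont f (W' x)"
  shows "(\<lambda>n. \<integral>x. H n x * f (W n x) \<partial>M) \<longlonglongrightarrow> (\<integral>x. H' x * f (W' x) \<partial>L)"
proof -
  interpret M: prob_space M by fact
  interpret L: prob_space L by fact
  have bd: "norm (h * g) \<le> B * K" if "norm h \<le> B" "norm g \<le> K" for h g :: complex and K
    using that by (auto simp: norm_mult intro!: mult_mono order_trans[OF norm_ge_zero])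
  have cnj_borel [measurable (raw)]: "h \<in> borel_measurable N \<Longrightarrow> (\<lambda>x. cnj (h x)) \<in> borel_measurable N"
    for h :: "'z \<Rightarrow> complex" and N
    by (rule measurable_compose[OF _ borel_measurable_continuous_onI]) (auto intro: continuous_intros)
  have intM: "integrable M (\<lambda>x. H n x * g (W n x))" "integrable M (\<lambda>x. cnj (H n x) * g (W n x))"
    and intL: "integrable L (\<lambda>x. H' x * g (W' x))" "integrable L (\<lambda>x. cnj (H' x) * g (W' x))"
    if [measurable]: "g \<in> borel_measurable borel" and g: "\<And>x. norm (g x) \<le> K" for g :: "real \<Rightarrow> complex" and n K
    using H bd[OF _ g]
    by (auto intro!: M.integrable_bounded_complex[of _ "B * K"] L.integrable_bounded_complex[of _ "B * K"])
  \<comment> \<open>Conjugating the integral at frequency \<open>- t\<close> turns the weight into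
    its conjugate and moves the exponential to frequency \<open>t\<close>.\<close>
  have cnj_conv: "(\<lambda>n. \<integral>x. cnj (H n x) * iexp (t * W n x) \<partial>M) \<longlonglongrightarrow> (\<integral>x. cnj (H' x) * iexp (t * W' x) \<partial>L)" for t
  proof -
    have "(\<lambda>n. cnj (\<integral>x. H n x * iexp (- t * W n x) \<partial>M)) \<longlonglongrightarrow> cnj (\<integral>x. H' x * iexp (- t * W' x) \<partial>L)"
      by (intro tendsto_cnj conv)
    then show ?thesis by (simp add: Bochner_Integration.integral_cnj[symmetric] exp_cnj del: Bochner_Integration.integral_cnj)
  qed
  have Re: "Re h *\<^sub>R g = (h * g + cnj h * g) / 2" and Im: "Im h *\<^sub>R g = (h * g - cnj h * g) / (2 * \<i>)" for h g
    by (auto simp: complex_eq_iff Re_divide Im_divide power2_eq_square)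
  let ?I = "\<lambda>t w. iexp (t * w)"
  have mI: "?I t \<in> borel_measurable borel" "norm (?I t x) \<le> 1" for t x by auto
  note iM = intM[OF mI] and iL = intL[OF mI]
  have cRe: "(\<lambda>n. \<integral>x. Re (H n x) *\<^sub>R f (W n x) \<partial>M) \<longlonglongrightarrow> (\<integral>x. Re (H' x) *\<^sub>R f (W' x) \<partial>L)"
  proof (rule weighted_levy_real[OF M L, where B=B])
    show "(\<lambda>n. \<integral>x. Re (H n x) *\<^sub>R ?I t (W n x) \<partial>M) \<longlonglongrightarrow> (\<integral>x. Re (H' x) *\<^sub>R ?I t (W' x) \<partial>L)" for t
      unfolding Re using tendsto_divide[OF tendsto_add[OF conv[of t] cnj_conv[of t]] tendsto_const[of 2]] iM[of _ t] iL[of t] by simp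
  qed (use H f conv1 in \<open>auto intro: order_trans[OF abs_Re_le_cmod]\<close>)
  have cIm: "(\<lambda>n. \<integral>x. Im (H n x) *\<^sub>R f (W n x) \<partial>M) \<longlonglongrightarrow> (\<integral>x. Im (H' x) *\<^sub>R f (W' x) \<partial>L)"
  proof (rule weighted_levy_real[OF M L, where B=B])
    show "(\<lambda>n. \<integral>x. Im (H n x) *\<^sub>R ?I t (W n x) \<partial>M) \<longlonglongrightarrow> (\<integral>x. Im (H' x) *\<^sub>R ?I t (W' x) \<partial>L)" for t
      unfolding Im using tendsto_divide[OF tendsto_diff[OF conv[of t] cnj_conv[of t]] tendsto_const[of "2 * \<i>"]] iM[of _ t] iL[of t] by simp
  qed (use H f conv1 in \<open>auto intro: order_trans[OF abs_Im_le_cmod]\<close>)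
  have ReIm: "h * g = Re h *\<^sub>R g + \<i> * (Im h *\<^sub>R g)" for h g
    by (auto simp: complex_eq_iff)
  have bd': "norm (Re h *\<^sub>R g) \<le> B * K \<and> norm (Im h *\<^sub>R g) \<le> B * K" if "norm h \<le> B" "norm g \<le> K" for h g :: complex and K
    using that abs_Re_le_cmod[of h] abs_Im_le_cmod[of h]
    by (auto intro!: mult_mono order_trans[OF norm_ge_zero])
  have i: "integrable M (\<lambda>x. Re (H n x) *\<^sub>R f (W n x))" "integrable M (\<lambda>x. Im (H n x) *\<^sub>R f (W n x))"
    "integrable L (\<lambda>x. Re (H' x) *\<^sub>R f (W' x))" "integrable L (\<lambda>x. Im (H' x) *\<^sub>R f (W' x))" for n
    using H bd'[OF _ f(1)]
    by (auto intro!: M.integrable_bounded_complex[of _ "B * C"] L.integrable_bounded_complex[of _ "B * C"] simp del: norm_scaleR)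
  show ?thesis
  proof -
    have "(\<integral>x. H n x * f (W n x) \<partial>M) = (\<integral>x. Re (H n x) *\<^sub>R f (W n x) + \<i> * (Im (H n x) *\<^sub>R f (W n x)) \<partial>M)" for n
      by (intro Bochner_Integration.integral_cong refl ReIm)
    then have "(\<integral>x. H n x * f (W n x) \<partial>M) = (\<integral>x. Re (H n x) *\<^sub>R f (W n x) \<partial>M) + \<i> * (\<integral>x. Im (H n x) *\<^sub>R f (W n x) \<partial>M)" for n
      using i(1,2)[of n] by (simp del: mult_scaleR_right)
    moreover have "(\<integral>x. H' x * f (W' x) \<partial>L) = (\<integral>x. Re (H' x) *\<^sub>R f (W' x) + \<i> * (Im (H' x) *\<^sub>R f (W' x)) \<partial>L)"
      by (intro Bochner_Integration.integral_cong refl ReIm)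
    then have "(\<integral>x. H' x * f (W' x) \<partial>L) = (\<integral>x. Re (H' x) *\<^sub>R f (W' x) \<partial>L) + \<i> * (\<integral>x. Im (H' x) *\<^sub>R f (W' x) \<partial>L)"
      using i(3,4) by (simp del: mult_scaleR_right)
    ultimately show ?thesis
      by (simp only:) (intro tendsto_add tendsto_mult tendsto_const cRe cIm)
  qed
qed

text \<open>
  The exponentials are traded for general test functions one coordinate at a time; the other factors
  serve as a bounded weight in Levy's continuity theorem.
\<close>

lemma joint_char_imp_prod_conv:
  fixes U :: "nat \<Rightarrow> nat \<Rightarrow> 'a \<Rightarrow> real" and U' :: "nat \<Rightarrow> 'l \<Rightarrow> real" and f :: "nat \<Rightarrow> real \<Rightarrow> complex"
  assumes M: "prob_space M" and L: "prob_space L"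
    and [measurable]: "\<And>k n. k < m \<Longrightarrow> U k n \<in> borel_measurable M" "\<And>k. k < m \<Longrightarrow> U' k \<in> borel_measurable L"
      "\<And>k. k < m \<Longrightarrow> f k \<in> borel_measurable borel"
    and conv: "\<And>t. (\<lambda>n. \<integral>x. iexp (\<Sum>k<m. t k * U k n x) \<partial>M) \<longlonglongrightarrow> (\<integral>x. iexp (\<Sum>k<m. t k * U' k x) \<partial>L)"
    and f: "\<And>k x. k < m \<Longrightarrow> norm (f k x) \<le> C" "\<And>k. k < m \<Longrightarrow> AE x in L. isCont (f k) (U' k x)"
  shows "(\<lambda>n. \<integral>x. (\<Prod>k<m. f k (U k n x)) \<partial>M) \<longlonglongrightarrow> (\<integral>x. (\<Prod>k<m. f k (U' k x)) \<partial>L)"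
proof -
  \<comment> \<open>The coordinates below \<open>j\<close> already carry their test functions. The
    frequencies \<open>t\<close> stay arbitrary, as the inductive step varies the one at
    \<open>j\<close>.\<close>
  have "(\<lambda>n. \<integral>x. (\<Prod>k<m. if k < j then f k (U k n x) else iexp (t k * U k n x)) \<partial>M) \<longlonglongrightarrow>
        (\<integral>x. (\<Prod>k<m. if k < j then f k (U' k x) else iexp (t k * U' k x)) \<partial>L)" if "j \<le> m" for j t
    using that
  proof (induction j arbitrary: t)
    case 0
    show ?case using conv[of t]
      by (simp add: exp_sum[symmetric] sum_distrib_left)
  next
    case (Suc j)
    then have j: "j < m" by simp
    define g where "g k u = (if k < j then f k u else iexp (t k * u))" for k u
    have g: "g k \<in> borel_measurable borel" "norm (g k u) \<le> max 1 C" if "k < m" for k u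
      using f(1)[of k u] that assms(5)[of k] by (auto simp: g_def[abs_def])
    \<comment> \<open>The product over the coordinates other than \<open>j\<close> is the bounded
      weight, and \<open>s\<close> is the frequency of coordinate \<open>j\<close> in the
      characteristic function.\<close>
    have eq: "(\<Prod>k<m. if k < j then f k (V k) else iexp ((t(j := s)) k * V k)) = (\<Prod>k\<in>{..<m} - {j}. g k (V k)) * iexp (s * V j)"
       "(\<Prod>k<m. if k < Suc j then f k (V k) else iexp (t k * V k)) = (\<Prod>k\<in>{..<m} - {j}. g k (V k)) * f j (V j)" for V s
    proof -
      have r: "(\<Prod>k<m. h k) = h j * (\<Prod>k\<in>{..<m} - {j}. h k)" for h :: "nat \<Rightarrow> complex"
        using j by (intro prod.remove) auto
      show "(\<Prod>k<m. if k < j then f k (V k) else iexp ((t(j := s)) k * V k)) = (\<Prod>k\<in>{..<m} - {j}. g k (V k)) * iexp (s * V j)"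
        unfolding r by (subst mult.commute, rule arg_cong2[of _ _ _ _ "(*)"], rule prod.cong) (auto simp: g_def)
      show "(\<Prod>k<m. if k < Suc j then f k (V k) else iexp (t k * V k)) = (\<Prod>k\<in>{..<m} - {j}. g k (V k)) * f j (V j)"
        unfolding r by (subst mult.commute, rule arg_cong2[of _ _ _ _ "(*)"], rule prod.cong) (auto simp: g_def)
    qed
    show ?case
      unfolding eq
    proof (rule weighted_levy[OF M L, where B="max 1 C ^ card ({..<m} - {j})" and C=C])
      show "(\<lambda>n. \<integral>x. (\<Prod>k\<in>{..<m} - {j}. g k (U k n x)) * iexp (s * U j n x) \<partial>M) \<longlonglongrightarrow>
         (\<integral>x. (\<Prod>k\<in>{..<m} - {j}. g k (U' k x)) * iexp (s * U' j x) \<partial>L)" for s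
        using Suc.IH[of "t(j := s)"] j unfolding eq by simp
      have b: "norm (\<Prod>k\<in>{..<m} - {j}. g k (V k)) \<le> max 1 C ^ card ({..<m} - {j})" for V
      proof -
        have "norm (\<Prod>k\<in>{..<m} - {j}. g k (V k)) = (\<Prod>k\<in>{..<m} - {j}. norm (g k (V k)))"
          by (rule prod_norm[symmetric])
        also have "\<dots> \<le> (\<Prod>k\<in>{..<m} - {j}. max 1 C)"
          using g by (intro prod_mono) auto
        finally show ?thesis by simp
      qed
      show "norm (\<Prod>k\<in>{..<m} - {j}. g k (U k n x)) \<le> max 1 C ^ card ({..<m} - {j})"
         "norm (\<Prod>k\<in>{..<m} - {j}. g k (U' k y)) \<le> max 1 C ^ card ({..<m} - {j})" for n x y
        by (rule b)+
      \<comment> \<open>Setting all frequencies except that of \<open>j\<close> to 0 gives the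
        unweighted convergence.\<close>
      show "(\<lambda>n. \<integral>x. iexp (s * U j n x) \<partial>M) \<longlonglongrightarrow> (\<integral>x. iexp (s * U' j x) \<partial>L)" for s
        using conv[of "\<lambda>k. if k = j then s else 0"] j by (simp add: if_distrib if_distribR sum.delta cong: if_cong)
    qed (use j f in \<open>auto intro!: borel_measurable_prod measurable_compose[OF _ g(1)]\<close>)
  qed
  from this[of m "\<lambda>_. 0"] show ?thesis by simp
qed

section \<open>Convergence in probability\<close>

definition conv_prob :: "'a measure \<Rightarrow> (nat \<Rightarrow> 'a \<Rightarrow> real) \<Rightarrow> real \<Rightarrow> bool" where
  "conv_prob M Y c \<longleftrightarrow> (\<forall>n. Y n \<in> borel_measurable M) \<and>
     (\<forall>e>0. (\<lambda>n. measure M {x\<in>space M. e \<le> \<bar>Y n x - c\<bar>}) \<longlonglongrightarrow> 0)"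

text \<open>Tightness of the laws of the \<open>U n\<close>, with one bound for all \<open>n\<close>
  rather than for large \<open>n\<close>.\<close>

definition bounded_prob :: "'a measure \<Rightarrow> (nat \<Rightarrow> 'a \<Rightarrow> real) \<Rightarrow> bool" where
  "bounded_prob M U \<longleftrightarrow> (\<forall>n. U n \<in> borel_measurable M) \<and>
     (\<forall>e>0. \<exists>K. \<forall>n. measure M {x\<in>space M. K < \<bar>U n x\<bar>} \<le> e)"

text \<open>
  Limits along this filter on pairs \<open>(n, x)\<close> are limits as \<open>n\<close> grows and all \<open>Y k n x\<close>
  tend to \<open>c k\<close>, while the \<open>U l n x\<close> stay bounded by \<open>K\<close> and \<open>x\<close> stays in \<open>G\<close>.
\<close>

definition good_filter :: "'i set \<Rightarrow> ('i \<Rightarrow> nat \<Rightarrow> 'a \<Rightarrow> real) \<Rightarrow> ('i \<Rightarrow> real) \<Rightarrow> 'j set \<Rightarrow> ('j \<Rightarrow> nat \<Rightarrow> 'a \<Rightarrow> real) \<Rightarrow> real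
    \<Rightarrow> 'a set \<Rightarrow> (nat \<times> 'a) filter" where
  "good_filter I Y c J U K G =
     inf (filtercomap (\<lambda>(n, x). 1 / real (Suc n) + (\<Sum>k\<in>I. \<bar>Y k n x - c k\<bar>)) (nhds 0))
       (principal {(n, x). x \<in> G \<and> (\<forall>l\<in>J. \<bar>U l n x\<bar> \<le> K)})"

lemma eventually_good_filterD:
  assumes "eventually P (good_filter I Y c J U K G)" "finite I"
  shows "\<exists>e>0. \<exists>n0. \<forall>n\<ge>n0. \<forall>x\<in>G. (\<forall>l\<in>J. \<bar>U l n x\<bar> \<le> K) \<longrightarrow> (\<forall>k\<in>I. \<bar>Y k n x - c k\<bar> < e) \<longrightarrow> P (n, x)"
proof -
  obtain e where e: "e > 0" and P: "\<And>n x. \<bar>1 / real (Suc n) + (\<Sum>k\<in>I. \<bar>Y k n x - c k\<bar>)\<bar> < e \<Longrightarrow> x \<in> G \<Longrightarrow>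
      (\<forall>l\<in>J. \<bar>U l n x\<bar> \<le> K) \<Longrightarrow> P (n, x)"
    using assms(1) unfolding good_filter_def eventually_inf_principal eventually_filtercomap eventually_nhds_metric
    by (auto simp: dist_real_def)
  obtain n0 where n0: "1 / real (Suc n0) < e / 2"
    using e reals_Archimedean[of "e / 2"] by (auto simp: inverse_eq_divide)
  \<comment> \<open>The deviations over \<open>I\<close> then add up to at most
    \<open>e / 2\<close>, and the other half is left for \<open>1 / Suc n\<close>; the summand 2
    keeps the quotient meaningful for an empty \<open>I\<close>.\<close>
  let ?d = "e / (2 * real (card I) + 2)"
  show ?thesis
  proof (intro exI[of _ ?d] conjI exI[of _ n0] allI impI ballI)
    show "0 < ?d" using e by (auto intro!: divide_pos_pos)
    fix n x assume n: "n0 \<le> n" and x: "x \<in> G" "\<forall>l\<in>J. \<bar>U l n x\<bar> \<le> K" "\<forall>k\<in>I. \<bar>Y k n x - c k\<bar> < ?d"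
    have "1 / real (Suc n) \<le> 1 / real (Suc n0)" using n by (intro divide_left_mono) auto
    moreover have "(\<Sum>k\<in>I. \<bar>Y k n x - c k\<bar>) \<le> real (card I) * ?d"
      using x(3) by (intro sum_bounded_above) (auto intro: less_imp_le)
    moreover have "real (card I) * ?d \<le> e / 2" using e by (simp add: field_simps)
    ultimately have "1 / real (Suc n) + (\<Sum>k\<in>I. \<bar>Y k n x - c k\<bar>) < e" using n0 by linarith
    moreover have "0 \<le> 1 / real (Suc n) + (\<Sum>k\<in>I. \<bar>Y k n x - c k\<bar>)" by (intro add_nonneg_nonneg sum_nonneg) auto
    ultimately show "P (n, x)" using x by (intro P) auto
  qed
qed

lemma
  assumes "finite I"
  shows good_filter_fst: "filterlim fst at_top (good_filter I Y c J U K G)"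
    and good_filter_tendsto: "k \<in> I \<Longrightarrow> ((\<lambda>(n, x). Y k n x) \<longlongrightarrow> c k) (good_filter I Y c J U K G)"
    and good_filter_bounded: "l \<in> J \<Longrightarrow> \<forall>\<^sub>F (n, x) in good_filter I Y c J U K G. \<bar>U l n x\<bar> \<le> K"
    and good_filter_set: "\<forall>\<^sub>F (n, x) in good_filter I Y c J U K G. x \<in> G"
proof -
  let ?F = "good_filter I Y c J U K G"
  let ?D = "\<lambda>(n, x). 1 / real (Suc n) + (\<Sum>k\<in>I. \<bar>Y k n x - c k\<bar>)"
  have D: "(?D \<longlongrightarrow> 0) ?F"
    unfolding good_filter_def by (rule tendsto_mono[OF inf_le1 filterlim_filtercomap])
  have 1: "((\<lambda>(n, x). 1 / real (Suc n)) \<longlongrightarrow> 0) ?F"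
    by (rule tendsto_sandwich[OF _ _ tendsto_const D]) (auto intro!: always_eventually sum_nonneg)
  show "filterlim fst at_top ?F"
    unfolding filterlim_at_top
  proof
    fix m
    have "\<forall>\<^sub>F p in ?F. (case p of (n, x) \<Rightarrow> 1 / real (Suc n)) < 1 / real (Suc m)"
      by (intro order_tendstoD(2)[OF 1]) auto
    then show "\<forall>\<^sub>F p in ?F. m \<le> fst p"
      by (rule eventually_mono) (auto simp: field_simps)
  qed
  show "((\<lambda>(n, x). Y k n x) \<longlongrightarrow> c k) ?F" if "k \<in> I"
  proof -
    have "((\<lambda>p. (case p of (n, x) \<Rightarrow> Y k n x) - c k) \<longlongrightarrow> 0) ?F"
      using that assms
      by (intro Lim_null_comparison[OF always_eventually D])
         (auto intro!: add_increasing member_le_sum[of _ _ "\<lambda>k. \<bar>Y k n x - c k\<bar>" for n x])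
    then show ?thesis by (simp add: LIM_zero_iff)
  qed
  show "\<forall>\<^sub>F (n, x) in ?F. \<bar>U l n x\<bar> \<le> K" if "l \<in> J"
    unfolding good_filter_def using that by (auto simp: eventually_inf_principal intro!: always_eventually)
  show "\<forall>\<^sub>F (n, x) in ?F. x \<in> G"
    unfolding good_filter_def by (auto simp: eventually_inf_principal intro!: always_eventually)
qed

text \<open>
  Slutsky-type conclusions reduce to deterministic limits along \<^const>\<open>good_filter\<close>.
\<close>

lemma (in prob_space) conv_prob_good_filter:
  assumes "finite I" "finite J"
    and Y: "\<And>k. k \<in> I \<Longrightarrow> conv_prob M (Y k) (c k)"
    and U: "\<And>l. l \<in> J \<Longrightarrow> bounded_prob M (U l)"
    and G: "AE x in M. x \<in> G"
    and D[measurable]: "\<And>n. D n \<in> borel_measurable M"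
    and lim: "\<And>K. ((\<lambda>(n, x). D n x) \<longlongrightarrow> d) (good_filter I Y c J U K G)"
  shows "conv_prob M D d"
  unfolding conv_prob_def
proof (intro conjI allI impI D)
  fix e :: real assume e: "0 < e"
  have [measurable]: "Y k n \<in> borel_measurable M" if "k \<in> I" for k n
    using Y[OF that] by (auto simp: conv_prob_def)
  have [measurable]: "U l n \<in> borel_measurable M" if "l \<in> J" for l n
    using U[OF that] by (auto simp: bounded_prob_def)
  show "(\<lambda>n. measure M {x\<in>space M. e \<le> \<bar>D n x - d\<bar>}) \<longlonglongrightarrow> 0"
  proof (rule LIMSEQ_I)
    fix r :: real assume r: "0 < r"
    \<comment> \<open>Half of \<open>r\<close> is shared by the finitely many tightness events; the
      added 1 covers an empty \<open>J\<close>.\<close>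
    define \<eta> where "\<eta> = r / (2 * (real (card J) + 1))"
    have \<eta>: "0 < \<eta>" using r by (simp add: \<eta>_def)
    have "\<forall>l\<in>J. \<exists>K. \<forall>n. measure M {x\<in>space M. K < \<bar>U l n x\<bar>} \<le> \<eta>"
      using U \<eta> by (auto simp: bounded_prob_def)
    then obtain K where K: "\<And>l n. l \<in> J \<Longrightarrow> measure M {x\<in>space M. K l < \<bar>U l n x\<bar>} \<le> \<eta>"
      by metis
    \<comment> \<open>The filter has a single bound, so the individual bounds are replaced by their
      maximum.\<close>
    define K' where "K' = Max (insert 0 (K ` J))"
    have K': "measure M {x\<in>space M. K' < \<bar>U l n x\<bar>} \<le> \<eta>" if "l \<in> J" for l n
    proof -
      have "K l \<le> K'" using that assms(2) unfolding K'_def by (intro Max_ge) auto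
      then have "measure M {x\<in>space M. K' < \<bar>U l n x\<bar>} \<le> measure M {x\<in>space M. K l < \<bar>U l n x\<bar>}"
        using that by (intro finite_measure_mono) auto
      with K[OF that, of n] show ?thesis by simp
    qed
    have "\<forall>\<^sub>F p in good_filter I Y c J U K' G. \<bar>(case p of (n, x) \<Rightarrow> D n x) - d\<bar> < e"
      using tendstoD[OF lim e] by (simp add: dist_real_def)
    from eventually_good_filterD[OF this assms(1)] obtain \<epsilon> n0 where \<epsilon>: "\<epsilon> > 0" and
      *: "\<forall>n\<ge>n0. \<forall>x\<in>G. (\<forall>l\<in>J. \<bar>U l n x\<bar> \<le> K') \<longrightarrow> (\<forall>k\<in>I. \<bar>Y k n x - c k\<bar> < \<epsilon>) \<longrightarrow> \<bar>D n x - d\<bar> < e"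
      unfolding case_prod_conv by blast
    then have n0: "\<bar>D n x - d\<bar> < e" if "n \<ge> n0" "x \<in> G" "\<forall>l\<in>J. \<bar>U l n x\<bar> \<le> K'" "\<forall>k\<in>I. \<bar>Y k n x - c k\<bar> < \<epsilon>" for n x
      using that by blast
    have "(\<lambda>n. \<Sum>k\<in>I. measure M {x\<in>space M. \<epsilon> \<le> \<bar>Y k n x - c k\<bar>}) \<longlonglongrightarrow> (\<Sum>k\<in>I. 0)"
      using Y \<epsilon> by (intro tendsto_sum) (auto simp: conv_prob_def)
    then have "\<forall>\<^sub>F n in sequentially. (\<Sum>k\<in>I. measure M {x\<in>space M. \<epsilon> \<le> \<bar>Y k n x - c k\<bar>}) < r / 2"
      using r by (intro order_tendstoD(2)[where y="\<Sum>k\<in>I. 0"]) auto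
    then obtain n1 where n1: "\<And>n. n \<ge> n1 \<Longrightarrow> (\<Sum>k\<in>I. measure M {x\<in>space M. \<epsilon> \<le> \<bar>Y k n x - c k\<bar>}) < r / 2"
      by (auto simp: eventually_sequentially)
    show "\<exists>no. \<forall>n\<ge>no. norm (measure M {x\<in>space M. e \<le> \<bar>D n x - d\<bar>} - 0) < r"
    proof (intro exI[of _ "max n0 n1"] allI impI)
      fix n assume n: "max n0 n1 \<le> n"
      \<comment> \<open>Outside these two exceptional events, and for \<open>x\<close> in
        \<open>G\<close>, the deterministic limit already gives
        \<open>\<bar>D n x - d\<bar> < e\<close>.\<close>
      let ?A = "\<Union>k\<in>I. {x\<in>space M. \<epsilon> \<le> \<bar>Y k n x - c k\<bar>}" and ?B = "\<Union>l\<in>J. {x\<in>space M. K' < \<bar>U l n x\<bar>}"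
      have m: "?A \<in> sets M" "?B \<in> sets M"
        using assms(1,2) by (auto intro!: sets.finite_UN)
      have "measure M {x\<in>space M. e \<le> \<bar>D n x - d\<bar>} \<le> measure M (?A \<union> ?B)"
      proof (rule finite_measure_mono_AE)
        show "AE x in M. x \<in> {x\<in>space M. e \<le> \<bar>D n x - d\<bar>} \<longrightarrow> x \<in> ?A \<union> ?B"
          using G
        proof eventually_elim
          case (elim x)
          then show ?case using n0[of n x] n by (force simp: not_le not_less)
        qed
      qed (use m in auto)
      also have "\<dots> \<le> measure M ?A + measure M ?B"
        using m by (intro measure_Un_le) auto
      also have "measure M ?A \<le> (\<Sum>k\<in>I. measure M {x\<in>space M. \<epsilon> \<le> \<bar>Y k n x - c k\<bar>})"
        using assms(1) by (intro measure_UNION_le) auto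
      also have "\<dots> < r / 2" using n by (intro n1) auto
      also have "measure M ?B \<le> (\<Sum>l\<in>J. measure M {x\<in>space M. K' < \<bar>U l n x\<bar>})"
        using assms(2) by (intro measure_UNION_le) auto
      also have "\<dots> \<le> real (card J) * \<eta>" using K' by (intro sum_bounded_above)
      also have "\<dots> \<le> r / 2" using r by (simp add: \<eta>_def field_simps)
      finally show "norm (measure M {x\<in>space M. e \<le> \<bar>D n x - d\<bar>} - 0) < r" by simp
    qed
  qed
qed

section \<open>Moment criteria and the weak law of large numbers\<close>

lemma (in prob_space) bounded_prob_second_moment:
  assumes [measurable]: "\<And>n. U n \<in> borel_measurable M" and "\<And>n. integrable M (\<lambda>x. (U n x)\<^sup>2)" "\<And>n. (\<integral>x. (U n x)\<^sup>2 \<partial>M) \<le> B"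
  shows "bounded_prob M U"
  unfolding bounded_prob_def
proof (intro conjI allI impI)
  fix e :: real assume e: "0 < e"
  have B: "0 \<le> B" using assms(3)[of 0] by (rule order_trans[rotated]) simp
  \<comment> \<open>The added 1 makes \<open>K\<close> positive even for \<open>B = 0\<close>;
    Markov's inequality for the square then bounds the tail by \<open>B / K^2\<close>, which is at
    most \<open>e\<close>.\<close>
  define K where "K = sqrt (B / e) + 1"
  have K: "K > 0" unfolding K_def using B e by (intro add_nonneg_pos) auto
  have "B / e = (sqrt (B / e))\<^sup>2" using B e by simp
  also have "\<dots> \<le> K\<^sup>2" using B e by (intro power_mono) (auto simp: K_def)
  finally have Ke: "B / K\<^sup>2 \<le> e" using K e by (simp add: field_simps)
  show "\<exists>K. \<forall>n. measure M {x\<in>space M. K < \<bar>U n x\<bar>} \<le> e"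
  proof (intro exI allI)
    fix n
    have "measure M {x\<in>space M. K < \<bar>U n x\<bar>} \<le> measure M {x\<in>space M. K\<^sup>2 \<le> (U n x)\<^sup>2}"
      using K by (intro finite_measure_mono) (auto simp flip: abs_le_square_iff)
    also have "\<dots> \<le> (\<integral>x. (U n x)\<^sup>2 \<partial>M) / K\<^sup>2"
      using K assms(2) by (intro integral_Markov_inequality_measure[where A="{}"]) auto
    also have "\<dots> \<le> B / K\<^sup>2" using assms(3) by (intro divide_right_mono) auto
    finally show "measure M {x\<in>space M. K < \<bar>U n x\<bar>} \<le> e" using Ke by simp
  qed
qed simp

lemma (in prob_space) conv_prob_L1:
  assumes [measurable]: "\<And>n. Y n \<in> borel_measurable M" and "\<And>n. integrable M (Y n)"
    and "(\<lambda>n. \<integral>x. \<bar>Y n x - c\<bar> \<partial>M) \<longlonglongrightarrow> 0"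
  shows "conv_prob M Y c"
  unfolding conv_prob_def
proof (intro conjI allI impI)
  fix e :: real assume e: "0 < e"
  have "(\<lambda>n. (\<integral>x. \<bar>Y n x - c\<bar> \<partial>M) / e) \<longlonglongrightarrow> 0 / e"
    using assms(3) e by (intro tendsto_divide) auto
  then have lim: "(\<lambda>n. (\<integral>x. \<bar>Y n x - c\<bar> \<partial>M) / e) \<longlonglongrightarrow> 0" by simp
  have "measure M {x\<in>space M. e \<le> \<bar>Y n x - c\<bar>} \<le> (\<integral>x. \<bar>Y n x - c\<bar> \<partial>M) / e" for n
    using e assms(2)[of n] by (intro integral_Markov_inequality_measure[where A="{}"]) auto
  then show "(\<lambda>n. measure M {x\<in>space M. e \<le> \<bar>Y n x - c\<bar>}) \<longlonglongrightarrow> 0"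
    by (intro tendsto_sandwich[OF always_eventually always_eventually tendsto_const lim]) auto
qed simp

text \<open>Truncation makes integrability of the summands sufficient.\<close>

lemma (in prob_space) weak_law_large_numbers:
  fixes X :: "nat \<Rightarrow> 'a \<Rightarrow> real"
  assumes indep: "indep_vars (\<lambda>_. borel) X UNIV" and distr: "\<And>i. distr M borel (X i) = \<mu>"
    and int: "integrable \<mu> (\<lambda>y. y)"
  shows "conv_prob M (\<lambda>n x. (\<Sum>i<n. X i x) / real n) (\<integral>y. y \<partial>\<mu>)"
proof (rule conv_prob_L1)
  have rv[measurable]: "X i \<in> borel_measurable M" for i
    using indep by (auto simp: indep_vars_def)
  have sets_\<mu>[measurable_cong]: "sets \<mu> = sets borel" using distr[of 0] by auto
  interpret \<mu>: prob_space \<mu> using distr[of 0] by (auto intro!: prob_space_distr)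
  have borel_measurable_ident': "(\<lambda>y::real. y) \<in> borel_measurable borel" by simp
  have tr: "integrable \<mu> h \<longleftrightarrow> integrable M (\<lambda>x. h (X i x))" "(\<integral>y. h y \<partial>\<mu>) = (\<integral>x. h (X i x) \<partial>M)"
    if "h \<in> borel_measurable borel" for h :: "real \<Rightarrow> real" and i
    using that unfolding distr[of i, symmetric] by (auto simp: integrable_distr_eq integral_distr)
  have iX: "integrable M (X i)" for i by (rule iffD1[OF tr(1)[OF borel_measurable_ident'] int])
  show "(\<lambda>x. (\<Sum>i<n. X i x) / real n) \<in> borel_measurable M" for n by simp
  show "integrable M (\<lambda>x. (\<Sum>i<n. X i x) / real n)" for n using iX by simp
  let ?m = "\<integral>y. y \<partial>\<mu>"
  show "(\<lambda>n. \<integral>x. \<bar>(\<Sum>i<n. X i x) / real n - ?m\<bar> \<partial>M) \<longlonglongrightarrow> 0"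
  proof (rule LIMSEQ_I)
    fix r :: real assume r: "0 < r"
    \<comment> \<open>By dominated convergence one truncation level makes the mean loss smaller than
      \<open>r / 4\<close>; that level is then kept for all \<open>n\<close>.\<close>
    define h where "h K y = (if \<bar>y\<bar> \<le> K then y else 0)" for K y :: real
    have hm[measurable]: "h K \<in> borel_measurable borel" for K unfolding h_def by measurable
    have "(\<lambda>k. \<integral>y. \<bar>y - h (real k) y\<bar> \<partial>\<mu>) \<longlonglongrightarrow> (\<integral>y. 0 \<partial>\<mu>)"
    proof (rule integral_dominated_convergence[where w="\<lambda>y. \<bar>y\<bar>"])
      show "AE y in \<mu>. (\<lambda>k. \<bar>y - h (real k) y\<bar>) \<longlonglongrightarrow> 0"
      proof (rule AE_I2, rule tendsto_eventually)
        fix y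
        obtain k0 where "\<bar>y\<bar> \<le> real k0" using real_arch_simple by blast
        then show "\<forall>\<^sub>F k in sequentially. \<bar>y - h (real k) y\<bar> = 0"
          by (intro eventually_sequentiallyI[of k0]) (auto simp: h_def)
      qed
      show "AE y in \<mu>. norm \<bar>y - h (real k) y\<bar> \<le> \<bar>y\<bar>" for k by (auto simp: h_def)
      show "integrable \<mu> (\<lambda>y. \<bar>y\<bar>)" using int by simp
    qed measurable
    then have "(\<lambda>k. \<integral>y. \<bar>y - h (real k) y\<bar> \<partial>\<mu>) \<longlonglongrightarrow> 0" by simp
    then have "\<forall>\<^sub>F k in sequentially. (\<integral>y. \<bar>y - h (real k) y\<bar> \<partial>\<mu>) < r / 4"
      using r by (intro order_tendstoD(2)) auto
    then obtain k where k: "(\<integral>y. \<bar>y - h (real k) y\<bar> \<partial>\<mu>) < r / 4"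
      by (auto simp: eventually_sequentially)
    let ?h = "h (real k)"
    have hb: "\<bar>?h y\<bar> \<le> real k" for y by (simp add: h_def)
    define m' where "m' = (\<integral>y. ?h y \<partial>\<mu>)"
    have ih: "integrable \<mu> ?h" using hb by (intro \<mu>.integrable_const_bound[where B="real k"]) auto
    have mm: "\<bar>?m - m'\<bar> < r / 4"
    proof -
      have "\<bar>?m - m'\<bar> = \<bar>\<integral>y. y - ?h y \<partial>\<mu>\<bar>" unfolding m'_def using int ih by simp
      also have "\<dots> \<le> (\<integral>y. \<bar>y - ?h y\<bar> \<partial>\<mu>)" by (rule integral_abs_bound)
      finally show ?thesis using k by simp
    qed
    define Z where "Z i x = ?h (X i x) - m'" for i x
    have Zm[measurable]: "Z i \<in> borel_measurable M" for i unfolding Z_def by simp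
    have m'b: "\<bar>m'\<bar> \<le> real k"
    proof -
      have "\<bar>m'\<bar> \<le> (\<integral>y. \<bar>?h y\<bar> \<partial>\<mu>)" unfolding m'_def by (rule integral_abs_bound)
      also have "\<dots> \<le> (\<integral>y. real k \<partial>\<mu>)" using ih hb by (intro integral_mono) auto
      finally show ?thesis by (simp add: \<mu>.prob_space)
    qed
    have Zb: "\<bar>Z i x\<bar> \<le> 2 * real k" for i x using hb[of "X i x"] m'b unfolding Z_def by linarith
    have iZ: "integrable M (Z i)" for i using Zb by (intro integrable_const_bound[where B="2 * real k"]) auto
    have iZ2: "integrable M (\<lambda>x. Z i x * Z j x)" for i j
    proof (rule integrable_const_bound[where B="2 * real k * (2 * real k)"])
      show "AE x in M. norm (Z i x * Z j x) \<le> 2 * real k * (2 * real k)"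
        unfolding real_norm_def abs_mult by (intro AE_I2 mult_mono Zb) auto
    qed simp
    have EZ: "(\<integral>x. Z i x \<partial>M) = 0" for i
      using tr[OF hm, of k i] ih unfolding Z_def m'_def by (simp add: prob_space)
    \<comment> \<open>Independence and centring make the truncated summands uncorrelated, so the
      second moment of their sum grows only linearly in the number of terms.\<close>
    have cross: "(\<integral>x. Z i x * Z j x \<partial>M) = 0" if "i \<noteq> j" for i j
    proof -
      have "indep_var borel ((\<lambda>f. ?h (f i) - m') \<circ> (\<lambda>x. restrict (\<lambda>i. X i x) {i}))
         borel ((\<lambda>f. ?h (f j) - m') \<circ> (\<lambda>x. restrict (\<lambda>i. X i x) {j}))"
        using that by (intro indep_var_compose[OF indep_var_restrict[OF indep]]) auto
      then have "indep_var borel (Z i) borel (Z j)" by (simp add: Z_def[abs_def] comp_def)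
      from indep_var_lebesgue_integral[OF this iZ iZ] show ?thesis by (simp add: EZ)
    qed
    have second: "(\<integral>x. (\<Sum>i<n. Z i x)\<^sup>2 \<partial>M) \<le> real n * (4 * (real k)\<^sup>2)" for n
    proof -
      have "(\<integral>x. (\<Sum>i<n. Z i x)\<^sup>2 \<partial>M) = (\<Sum>i<n. \<Sum>j<n. \<integral>x. Z i x * Z j x \<partial>M)"
        using iZ2 by (simp add: power2_eq_square sum_product)
      also have "\<dots> = (\<Sum>i<n. \<Sum>j<n. if j = i then \<integral>x. Z i x * Z i x \<partial>M else 0)"
        by (intro sum.cong) (auto simp: cross)
      also have "\<dots> = (\<Sum>i<n. \<integral>x. Z i x * Z i x \<partial>M)" by simp
      also have "\<dots> \<le> (\<Sum>i<n. 4 * (real k)\<^sup>2)"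
      proof (rule sum_mono)
        fix i
        have "(\<integral>x. Z i x * Z i x \<partial>M) \<le> (\<integral>x. 4 * (real k)\<^sup>2 \<partial>M)"
        proof (intro integral_mono iZ2)
          fix x
          have "(Z i x)\<^sup>2 \<le> (2 * real k)\<^sup>2" using Zb[of i x] by (intro iffD1[OF abs_le_square_iff]) simp
          then show "Z i x * Z i x \<le> 4 * (real k)\<^sup>2" by (simp add: power2_eq_square)
        qed simp
        then show "(\<integral>x. Z i x * Z i x \<partial>M) \<le> 4 * (real k)\<^sup>2" by (simp add: prob_space)
      qed
      finally show ?thesis by simp
    qed
    have first: "(\<integral>x. \<bar>\<Sum>i<n. Z i x\<bar> \<partial>M) \<le> sqrt (real n) * (2 * real k)" for n
    proof -
      let ?S = "\<lambda>x. \<bar>\<Sum>i<n. Z i x\<bar>"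
      have iS: "integrable M ?S" "integrable M (\<lambda>x. (?S x)\<^sup>2)"
        using iZ iZ2 by (auto simp: power2_eq_square sum_product)
      \<comment> \<open>Nonnegativity of the variance bounds the squared first absolute moment by
        the second moment.\<close>
      have "variance ?S = (\<integral>x. (?S x)\<^sup>2 \<partial>M) - (expectation ?S)\<^sup>2"
        using iS by (intro variance_eq)
      then have "(expectation ?S)\<^sup>2 \<le> (\<integral>x. (?S x)\<^sup>2 \<partial>M)" using variance_positive[of ?S] by linarith
      also have "\<dots> \<le> (sqrt (real n) * (2 * real k))\<^sup>2" using second[of n] by (simp add: power_mult_distrib)
      finally show ?thesis by (rule power2_le_imp_le) simp
    qed
    \<comment> \<open>The threshold forces \<open>8 * (k + 1) / r \<le> sqrt n\<close>, which makes
      the mean fluctuation, at most \<open>2 * k / sqrt n\<close>, no larger than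
      \<open>r / 4\<close>.\<close>
    obtain n0 where n0: "64 * (real k + 1)\<^sup>2 / r\<^sup>2 \<le> real n0" using real_arch_simple by blast
    show "\<exists>no. \<forall>n\<ge>no. norm ((\<integral>x. \<bar>(\<Sum>i<n. X i x) / real n - ?m\<bar> \<partial>M) - 0) < r"
    proof (intro exI[of _ "Suc n0"] allI impI)
      fix n assume n: "Suc n0 \<le> n"
      have n_pos: "0 < real n" using n by simp
      \<comment> \<open>Truncation loss, centred fluctuation and shift of the mean; each contributes
        at most \<open>r / 4\<close> in mean.\<close>
      have pt: "\<bar>(\<Sum>i<n. X i x) / real n - ?m\<bar> \<le> (\<Sum>i<n. \<bar>X i x - ?h (X i x)\<bar>) / real n + \<bar>\<Sum>i<n. Z i x\<bar> / real n + \<bar>?m - m'\<bar>" for x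
      proof -
        have "(\<Sum>i<n. X i x) / real n - ?m = (\<Sum>i<n. X i x - ?h (X i x)) / real n + (\<Sum>i<n. Z i x) / real n - (?m - m')"
          using n_pos unfolding Z_def by (simp add: sum_subtractf field_simps)
        moreover have "\<bar>(\<Sum>i<n. X i x - ?h (X i x)) / real n\<bar> \<le> (\<Sum>i<n. \<bar>X i x - ?h (X i x)\<bar>) / real n"
          using n_pos by (simp add: divide_right_mono sum_abs)
        moreover have "\<bar>(\<Sum>i<n. Z i x) / real n\<bar> = \<bar>\<Sum>i<n. Z i x\<bar> / real n" by simp
        ultimately show ?thesis by linarith
      qed
      have iXh: "integrable M (\<lambda>x. \<bar>X i x - ?h (X i x)\<bar>)" for i
        using iX tr(1)[OF hm, of k i] ih by simp
      have EXh: "(\<integral>x. \<bar>X i x - ?h (X i x)\<bar> \<partial>M) = (\<integral>y. \<bar>y - ?h y\<bar> \<partial>\<mu>)" for i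
        by (rule tr(2)[symmetric]) simp
      have "(\<integral>x. \<bar>(\<Sum>i<n. X i x) / real n - ?m\<bar> \<partial>M) \<le>
         (\<integral>x. (\<Sum>i<n. \<bar>X i x - ?h (X i x)\<bar>) / real n + \<bar>\<Sum>i<n. Z i x\<bar> / real n + \<bar>?m - m'\<bar> \<partial>M)"
        using pt iX iXh iZ by (intro integral_mono) auto
      also have "\<dots> = (\<integral>y. \<bar>y - ?h y\<bar> \<partial>\<mu>) + (\<integral>x. \<bar>\<Sum>i<n. Z i x\<bar> \<partial>M) / real n + \<bar>?m - m'\<bar>"
        using iXh iZ n_pos by (simp add: EXh prob_space)
      also have "(\<integral>x. \<bar>\<Sum>i<n. Z i x\<bar> \<partial>M) / real n \<le> sqrt (real n) * (2 * real k) / real n"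
        using first[of n] n_pos by (intro divide_right_mono) auto
      also have "\<dots> \<le> r / 4"
      proof -
        have "(8 * (real k + 1) / r)\<^sup>2 = 64 * (real k + 1)\<^sup>2 / r\<^sup>2"
          unfolding power_divide power_mult_distrib by simp
        then have "(8 * (real k + 1) / r)\<^sup>2 \<le> real n" using n0 n by simp
        then have "8 * (real k + 1) / r \<le> sqrt (real n)" by (rule real_le_rsqrt)
        then have "8 * real k \<le> r * sqrt (real n)" using r by (simp add: field_simps)
        then have "8 * real k * sqrt (real n) \<le> r * sqrt (real n) * sqrt (real n)" by (intro mult_right_mono) auto
        also have "\<dots> = r * real n" by (simp add: mult.assoc)
        finally show ?thesis using n_pos by (simp add: field_simps)
      qed
      finally have "(\<integral>x. \<bar>(\<Sum>i<n. X i x) / real n - ?m\<bar> \<partial>M) < r" using k mm r by linarith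
      moreover have "0 \<le> (\<integral>x. \<bar>(\<Sum>i<n. X i x) / real n - ?m\<bar> \<partial>M)" by (intro integral_nonneg_AE) auto
      ultimately show "norm ((\<integral>x. \<bar>(\<Sum>i<n. X i x) / real n - ?m\<bar> \<partial>M) - 0) < r" by simp
    qed
  qed
qed

section \<open>Least squares\<close>

lemma smult_smult_assoc_mat: "a \<cdot>\<^sub>m (b \<cdot>\<^sub>m A) = (a * b) \<cdot>\<^sub>m (A :: real mat)"
  by (intro eq_matI) auto

lemma one_smult_mat: "1 \<cdot>\<^sub>m A = (A :: real mat)"
  by (intro eq_matI) auto

text \<open>At singular matrices \<open>inverse 0 = 0\<close> reproduces the zero matrix chosen as
  default, so the cofactor formula holds without exception and exhibits \<open>minv\<close> as a
  Borel function of the entries.\<close>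

lemma minv_eq_adj_mat:
  assumes A: "A \<in> carrier_mat n n"
  shows "minv A = inverse (Determinant.det A) \<cdot>\<^sub>m adj_mat A"
proof (cases "mat_inverse A")
  case None
  have "Determinant.det A = 0"
  proof (rule ccontr)
    assume "Determinant.det A \<noteq> 0"
    from det_non_zero_imp_unit[OF A this, where b="()"] mat_inverse(1)[OF A None, where b="()"] show False by blast
  qed
  then show ?thesis using None A by (auto simp: minv_def adj_mat_def intro!: eq_matI)
next
  case (Some B)
  note B = mat_inverse(2)[OF A Some]
  have "Determinant.det A * Determinant.det B = 1"
    using det_mult[OF A, of B] B by simp
  then have d: "Determinant.det A \<noteq> 0" by auto
  have "B = B * (inverse (Determinant.det A) \<cdot>\<^sub>m (A * adj_mat A))"
    using B d adj_mat[OF A] right_mult_one_mat[of B n n] by (auto simp: smult_smult_assoc_mat one_smult_mat)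
  also have "\<dots> = inverse (Determinant.det A) \<cdot>\<^sub>m (B * (A * adj_mat A))"
    using B adj_mat(1)[OF A] A by (intro mult_smult_distrib) auto
  also have "B * (A * adj_mat A) = (B * A) * adj_mat A"
    using B adj_mat(1)[OF A] A by (intro assoc_mult_mat[symmetric]) auto
  also have "\<dots> = adj_mat A" using B adj_mat(1)[OF A] by simp
  finally show ?thesis using Some by (simp add: minv_def)
qed

lemma minv_carrier: "A \<in> carrier_mat n n \<Longrightarrow> minv A \<in> carrier_mat n n"
  by (simp add: minv_eq_adj_mat adj_mat(1))

lemma minv_mult:
  assumes A: "A \<in> carrier_mat n n" and d: "Determinant.det A \<noteq> 0"
  shows "minv A * A = 1\<^sub>m n" "A * minv A = 1\<^sub>m n"
  using adj_mat[OF A] A d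
  by (simp_all add: minv_eq_adj_mat[OF A] smult_smult_assoc_mat mult_smult_distrib mult_smult_assoc_mat[of _ n n _ n] one_smult_mat)

lemma minv_smult:
  assumes A: "A \<in> carrier_mat n n" and c: "c \<noteq> 0" and d: "Determinant.det A \<noteq> 0"
  shows "minv (c \<cdot>\<^sub>m A) = inverse c \<cdot>\<^sub>m minv A"
proof -
  have cA: "c \<cdot>\<^sub>m A \<in> carrier_mat n n" using A by simp
  have "Determinant.det (c \<cdot>\<^sub>m A) \<noteq> 0" using c d A by (simp add: det_smult)
  note 1 = minv_mult[OF cA this] minv_carrier[OF cA]
  note 2 = minv_mult[OF A d] minv_carrier[OF A]
  have "minv (c \<cdot>\<^sub>m A) = minv (c \<cdot>\<^sub>m A) * ((c \<cdot>\<^sub>m A) * (inverse c \<cdot>\<^sub>m minv A))"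
    using A 1 2 c by (simp add: mult_smult_distrib smult_smult_assoc_mat mult_smult_assoc_mat[of _ n n _ n] one_smult_mat)
  also have "\<dots> = (minv (c \<cdot>\<^sub>m A) * (c \<cdot>\<^sub>m A)) * (inverse c \<cdot>\<^sub>m minv A)"
    using A 1 2 by (intro assoc_mult_mat[symmetric]) auto
  also have "\<dots> = inverse c \<cdot>\<^sub>m minv A" using 1 2 by simp
  finally show ?thesis .
qed

lemma
  assumes "\<And>j. j < n \<Longrightarrow> v j \<noteq> 0"
  shows det_diagonal_nonzero: "Determinant.det (Matrix.mat n n (\<lambda>(j, k). if j = k then v j else (0::real))) \<noteq> 0" (is "?thesis1")
    and minv_diagonal: "minv (Matrix.mat n n (\<lambda>(j, k). if j = k then v j else 0)) =
    Matrix.mat n n (\<lambda>(j, k). if j = k then inverse (v j) else 0)" (is "minv ?D = ?E")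
proof -
  have D: "?D \<in> carrier_mat n n" and E: "?E \<in> carrier_mat n n" by auto
  have DE: "?D * ?E = 1\<^sub>m n"
    using assms by (intro eq_matI) (auto simp: scalar_prod_def if_distrib[of "\<lambda>x. x * _"] if_distrib[of "\<lambda>x. _ * x"] sum.delta cong: if_cong)
  then have "Determinant.det ?D * Determinant.det ?E = 1" using det_mult[OF D E] DE by simp
  then have d: "Determinant.det ?D \<noteq> 0" by auto
  then show ?thesis1 .
  note i = minv_mult[OF D d] minv_carrier[OF D]
  have "minv ?D = minv ?D * (?D * ?E)" using i by (simp add: DE)
  also have "\<dots> = (minv ?D * ?D) * ?E" using i D E by (intro assoc_mult_mat[symmetric]) auto
  finally show "minv ?D = ?E" using i E by simp
qed

subsection \<open>Measurability and limits of matrix expressions\<close>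

text \<open>By the Leibniz formula the determinant is a polynomial in the entries.\<close>

lemma borel_measurable_det:
  assumes A: "\<And>w. A w \<in> carrier_mat n n"
    and m: "\<And>i j. i < n \<Longrightarrow> j < n \<Longrightarrow> (\<lambda>w. A w $$ (i, j)) \<in> borel_measurable M"
  shows "(\<lambda>w. Determinant.det (A w) :: real) \<in> borel_measurable M"
  unfolding det_def'[OF A]
  by (intro borel_measurable_sum borel_measurable_times borel_measurable_prod borel_measurable_const m)
     (auto simp: permutes_in_image[of _ "{0..<n}", simplified] permutes_def permutes_in_image)

lemma tendsto_det:
  assumes A: "\<And>w. A w \<in> carrier_mat n n" "B \<in> carrier_mat n n"
    and m: "\<And>i j. i < n \<Longrightarrow> j < n \<Longrightarrow> ((\<lambda>w. A w $$ (i, j)) \<longlongrightarrow> B $$ (i, j)) F"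
  shows "((\<lambda>w. Determinant.det (A w) :: real) \<longlongrightarrow> Determinant.det B) F"
  unfolding det_def'[OF A(1)] det_def'[OF A(2)]
  by (intro tendsto_sum tendsto_mult tendsto_prod tendsto_const m) (auto simp: permutes_in_image)

lemma mat_delete_index':
  "A \<in> carrier_mat n n \<Longrightarrow> i < n - 1 \<Longrightarrow> j < n - 1 \<Longrightarrow>
    mat_delete A a b $$ (i, j) = A $$ (if i < a then i else Suc i, if j < b then j else Suc j)"
  by (simp add: mat_delete_def)

lemma adj_mat_index: "A \<in> carrier_mat n n \<Longrightarrow> i < n \<Longrightarrow> j < n \<Longrightarrow>
   adj_mat A $$ (i, j) = (- 1) ^ (j + i) * Determinant.det (mat_delete A j i)"
  by (simp add: adj_mat_def cofactor_def)

lemma minv_index: "A \<in> carrier_mat n n \<Longrightarrow> i < n \<Longrightarrow> j < n \<Longrightarrow>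
   minv A $$ (i, j) = inverse (Determinant.det A) * ((- 1) ^ (j + i) * Determinant.det (mat_delete A j i))"
  using adj_mat(1)[of A n] by (simp add: minv_eq_adj_mat adj_mat_index)

text \<open>The reciprocal is Borel on the whole real line with value 0 at 0, so singular matrices
  need no separate treatment.\<close>

lemma borel_measurable_minv:
  assumes A: "\<And>w. A w \<in> carrier_mat n n"
    and m: "\<And>i j. i < n \<Longrightarrow> j < n \<Longrightarrow> (\<lambda>w. A w $$ (i, j)) \<in> borel_measurable M"
    and ij: "i < n" "j < n"
  shows "(\<lambda>w. minv (A w) $$ (i, j)) \<in> borel_measurable M"
proof -
  have "(\<lambda>w. Determinant.det (mat_delete (A w) j i)) \<in> borel_measurable M"
  proof (rule borel_measurable_det[where n="n - 1"])
    show "mat_delete (A w) j i \<in> carrier_mat (n - 1) (n - 1)" for w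
      using mat_delete_carrier[OF A] .
  qed (auto simp: mat_delete_index'[OF A] intro!: m)
  then show ?thesis
    unfolding minv_index[OF A ij] by (intro borel_measurable_times borel_measurable_inverse borel_measurable_const borel_measurable_det[OF A m])
qed

text \<open>Only the limit has to be nonsingular: the cofactor formula holds for every
  \<open>A w\<close>, and the reciprocal is continuous at the determinant of
  \<open>B\<close>.\<close>

lemma tendsto_minv:
  assumes A: "\<And>w. A w \<in> carrier_mat n n" "B \<in> carrier_mat n n" and d: "Determinant.det B \<noteq> 0"
    and m: "\<And>i j. i < n \<Longrightarrow> j < n \<Longrightarrow> ((\<lambda>w. A w $$ (i, j)) \<longlongrightarrow> B $$ (i, j)) F"
    and ij: "i < n" "j < n"
  shows "((\<lambda>w. minv (A w) $$ (i, j)) \<longlongrightarrow> minv B $$ (i, j)) F"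
proof -
  have "((\<lambda>w. Determinant.det (mat_delete (A w) j i)) \<longlongrightarrow> Determinant.det (mat_delete B j i)) F"
  proof (rule tendsto_det[where n="n - 1"])
    show "mat_delete (A w) j i \<in> carrier_mat (n - 1) (n - 1)" "mat_delete B j i \<in> carrier_mat (n - 1) (n - 1)" for w
      using mat_delete_carrier[OF A(1)] mat_delete_carrier[OF A(2)] .
  qed (auto simp: mat_delete_index'[OF A(1)] mat_delete_index'[OF A(2)] intro!: m)
  then show ?thesis
    unfolding minv_index[OF A(1) ij] minv_index[OF A(2) ij]
    by (intro tendsto_mult tendsto_inverse tendsto_const tendsto_det[OF A m] d)
qed

section \<open>Deterministic asymptotics of the statistics\<close>

text \<open>The residual vector enters only through \<open>r \<bullet> r\<close> and the score
  \<open>G^T r\<close>: the estimation error is linear in the score, and the residual sum of squares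
  is \<open>r \<bullet> r\<close> minus the squared norm of the projection of \<open>r\<close> onto
  the column space of \<open>G\<close>.\<close>

lemma
  assumes G: "G \<in> carrier_mat n m" and \<theta>: "\<theta> \<in> carrier_vec m" and r: "r \<in> carrier_vec n"
    and d: "Determinant.det (G\<^sup>T * G) \<noteq> 0"
  shows ols_linear_model: "ols G (G *\<^sub>v \<theta> + r) = \<theta> + minv (G\<^sup>T * G) *\<^sub>v (G\<^sup>T *\<^sub>v r)"
    and resid_var_linear_model: "resid_var G (G *\<^sub>v \<theta> + r) =
      (r \<bullet> r - (G\<^sup>T *\<^sub>v r) \<bullet> (minv (G\<^sup>T * G) *\<^sub>v (G\<^sup>T *\<^sub>v r))) / (real n - real m)"
proof -
  let ?A = "G\<^sup>T * G"
  let ?g = "G\<^sup>T *\<^sub>v r"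
  let ?w = "minv ?A *\<^sub>v ?g"
  have A: "?A \<in> carrier_mat m m" using G by simp
  note i = minv_mult[OF A d] minv_carrier[OF A]
  have g: "?g \<in> carrier_vec m" and w: "?w \<in> carrier_vec m" using G r i by auto
  have "ols G (G *\<^sub>v \<theta> + r) = minv ?A *\<^sub>v (?A *\<^sub>v \<theta> + ?g)"
    using G \<theta> r by (simp add: ols_def mult_add_distrib_mat_vec[of _ m n] assoc_mult_mat_vec[of _ m n _ m])
  also have "\<dots> = minv ?A *\<^sub>v (?A *\<^sub>v \<theta>) + ?w"
    using i A \<theta> g by (intro mult_add_distrib_mat_vec) auto
  also have "minv ?A *\<^sub>v (?A *\<^sub>v \<theta>) = \<theta>"
    using i A \<theta> by (simp flip: assoc_mult_mat_vec[of _ m m _ m])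
  finally show ols: "ols G (G *\<^sub>v \<theta> + r) = \<theta> + ?w" .
  have res: "(G *\<^sub>v \<theta> + r) - G *\<^sub>v (\<theta> + ?w) = r - G *\<^sub>v ?w"
    using G \<theta> r w by (subst mult_add_distrib_mat_vec[of _ n m]) (auto intro!: eq_vecI)
  have Gw: "G *\<^sub>v ?w \<in> carrier_vec n" using G w by simp
  have tr: "(G *\<^sub>v ?w) \<bullet> u = ?w \<bullet> (G\<^sup>T *\<^sub>v u)" if "u \<in> carrier_vec n" for u
    using G w that transpose_vec_mult_scalar[of "G\<^sup>T" m n u ?w] comm_scalar_prod[of "G *\<^sub>v ?w" n u]
      comm_scalar_prod[of ?w m "G\<^sup>T *\<^sub>v u"] by simp
  have "G\<^sup>T *\<^sub>v (G *\<^sub>v ?w) = ?A *\<^sub>v ?w"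
    using G w by (simp add: assoc_mult_mat_vec[of _ m n _ m])
  also have "\<dots> = ?g"
    using i A g by (simp flip: assoc_mult_mat_vec[of _ m m _ m])
  \<comment> \<open>The normal equations for the fit \<open>G w\<close> of \<open>r\<close>: its
    score is that of \<open>r\<close>, so the cross terms with \<open>r\<close> and the squared norm
    of the fit have the same value.\<close>
  finally have GGw: "G\<^sup>T *\<^sub>v (G *\<^sub>v ?w) = ?g" .
  have "(r - G *\<^sub>v ?w) \<bullet> (r - G *\<^sub>v ?w) = r \<bullet> r - r \<bullet> (G *\<^sub>v ?w) - (G *\<^sub>v ?w) \<bullet> r + (G *\<^sub>v ?w) \<bullet> (G *\<^sub>v ?w)"
    using r Gw by (simp add: minus_scalar_prod_distrib[of _ n] scalar_prod_minus_distrib[of _ n])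
  also have "\<dots> = r \<bullet> r - ?g \<bullet> ?w"
    using tr[OF r] tr[OF Gw] GGw comm_scalar_prod[OF r Gw] comm_scalar_prod[OF w g] by simp
  finally show "resid_var G (G *\<^sub>v \<theta> + r) = (r \<bullet> r - ?g \<bullet> ?w) / (real n - real m)"
    using G unfolding resid_var_def Let_def ols res by simp
qed

section \<open>Calculus of vanishing and bounded terms along a filter\<close>

lemma null_mult_bigo:
  fixes f g :: "'b \<Rightarrow> real"
  assumes "(f \<longlongrightarrow> 0) F" "g \<in> O[F](\<lambda>_. 1)"
  shows "((\<lambda>b. f b * g b) \<longlongrightarrow> 0) F"
proof -
  have "f \<in> o[F](\<lambda>_. 1)" using assms(1) by (intro smalloI_tendsto) auto
  from landau_o.small_big_mult[OF this assms(2)] show ?thesis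
    by (auto dest: smalloD_tendsto)
qed

lemma tendsto_imp_bigo_1: "(f \<longlongrightarrow> c) F \<Longrightarrow> f \<in> O[F](\<lambda>_. 1)" for f :: "'b \<Rightarrow> real"
  by (rule bigoI_tendsto[of _ _ c]) auto

lemma bigo_1_mult: "f \<in> O[F](\<lambda>_. 1) \<Longrightarrow> g \<in> O[F](\<lambda>_. 1) \<Longrightarrow> (\<lambda>b. f b * g b) \<in> O[F](\<lambda>_. 1)" for f :: "'b \<Rightarrow> real"
  using landau_o.big.mult[of f F "\<lambda>_. 1" g "\<lambda>_. 1"] by simp

text \<open>
  Column \<open>c < d\<close> of the array holds a covariate, column \<open>d\<close> the errors, and columns \<open>d + 1\<close>,
  \<open>d + 2\<close> the signs \<open>2 T - 1\<close> of two assignments.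
\<close>

locale array_limits =
  fixes F :: "'b filter" and N :: "'b \<Rightarrow> nat" and z :: "'b \<Rightarrow> nat \<Rightarrow> nat \<Rightarrow> real" and d :: nat and v :: "nat \<Rightarrow> real"
  assumes N: "filterlim N at_top F"
    and bounded: "\<And>A. A \<subseteq> {..<d+3} \<Longrightarrow> A \<noteq> {} \<Longrightarrow> (\<lambda>b. (\<Sum>i<N b. \<Prod>c\<in>A. z b i c) / sqrt (N b)) \<in> O[F](\<lambda>_. 1)"
    and squares: "\<And>c. c < d + 3 \<Longrightarrow> ((\<lambda>b. (\<Sum>i<N b. (z b i c)\<^sup>2) / N b) \<longlongrightarrow> v c) F"
    and signs: "\<And>s. s \<in> {d+1, d+2} \<Longrightarrow> \<forall>\<^sub>F b in F. \<forall>i. z b i s = 1 \<or> z b i s = -1"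
    and v_pos: "\<And>c. c < d + 3 \<Longrightarrow> 0 < v c"
begin

lemma N_pos: "\<forall>\<^sub>F b in F. 0 < N b"
  by (rule eventually_compose_filterlim[OF eventually_gt_at_top N])

lemma N_real: "filterlim (\<lambda>b. real (N b)) at_top F"
  using N by (rule filterlim_compose[OF filterlim_real_sequentially])

lemma inverse_sqrt_N: "((\<lambda>b. 1 / sqrt (N b)) \<longlongrightarrow> 0) F"
  by (intro tendsto_divide_0[OF tendsto_const] filterlim_at_top_imp_at_infinity
      filterlim_compose[OF sqrt_at_top N_real])

lemma bounded1: "c < d + 3 \<Longrightarrow> (\<lambda>b. (\<Sum>i<N b. z b i c) / sqrt (N b)) \<in> O[F](\<lambda>_. 1)"
  using bounded[of "{c}"] by simp

lemma bounded2: "c < d + 3 \<Longrightarrow> c' < d + 3 \<Longrightarrow> c \<noteq> c' \<Longrightarrow> (\<lambda>b. (\<Sum>i<N b. z b i c * z b i c') / sqrt (N b)) \<in> O[F](\<lambda>_. 1)"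
  using bounded[of "{c, c'}"] by simp

lemma average_null:
  assumes "(\<lambda>b. f b / sqrt (N b)) \<in> O[F](\<lambda>_. 1)"
  shows "((\<lambda>b. f b / N b) \<longlongrightarrow> 0) F"
proof -
  have "((\<lambda>b. 1 / sqrt (N b) * (f b / sqrt (N b))) \<longlongrightarrow> 0) F"
    by (rule null_mult_bigo[OF inverse_sqrt_N assms])
  then show ?thesis by simp
qed

lemmas average1 = average_null[OF bounded1]
lemmas average2 = average_null[OF bounded2]

end

lemma tendsto_diff_null:
  fixes f g :: "'b \<Rightarrow> real"
  assumes "((\<lambda>b. f b - g b) \<longlongrightarrow> 0) F" "g \<in> O[F](\<lambda>_. 1)"
  shows "f \<in> O[F](\<lambda>_. 1)"
proof -
  have "(\<lambda>b. (f b - g b) + g b) \<in> O[F](\<lambda>_. 1)"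
    by (rule sum_in_bigo(1)[OF tendsto_imp_bigo_1[OF assms(1)] assms(2)])
  then show ?thesis by simp
qed

text \<open>For a sign \<open>s\<close> the indicators of the groups are \<open>(1 + s) / 2\<close>
  and \<open>(1 - s) / 2\<close>; the common factor 1/2 cancels between the group total and the
  group size.\<close>

lemma group_mean_signs:
  assumes "\<And>i. s i = 1 \<or> s i = (-1::real)"
  shows "group_mean n True x (\<lambda>i. 0 < s i) j = ((\<Sum>i<n. x i j) + (\<Sum>i<n. x i j * s i)) / (real n + (\<Sum>i<n. s i))"
    and "group_mean n False x (\<lambda>i. 0 < s i) j = ((\<Sum>i<n. x i j) - (\<Sum>i<n. x i j * s i)) / (real n - (\<Sum>i<n. s i))"
proof -
  have s: "of_bool (0 < s i) = (1 + s i) / 2" "of_bool (\<not> 0 < s i) = (1 - s i) / 2" for i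
    using assms[of i] by auto
  have 1: "(\<Sum>i | i < n \<and> P i. f i) = (\<Sum>i<n. f i * of_bool (P i))" for f :: "nat \<Rightarrow> real" and P
  proof -
    have "{i. i < n \<and> P i} = {..<n} \<inter> {i. P i}" by auto
    then show ?thesis by simp
  qed
  have c: "real (card {i. i < n \<and> P i}) = (\<Sum>i<n. of_bool (P i))" for P
    using 1[of "\<lambda>_. 1" P] by simp
  have e: "(\<Sum>i<n. f i * ((1 + s i) / 2)) = ((\<Sum>i<n. f i) + (\<Sum>i<n. f i * s i)) / 2"
    "(\<Sum>i<n. f i * ((1 - s i) / 2)) = ((\<Sum>i<n. f i) - (\<Sum>i<n. f i * s i)) / 2" for f
    by (simp_all add: sum.distrib sum_subtractf sum_divide_distrib algebra_simps add_divide_distrib diff_divide_distrib)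
  show "group_mean n True x (\<lambda>i. 0 < s i) j = ((\<Sum>i<n. x i j) + (\<Sum>i<n. x i j * s i)) / (real n + (\<Sum>i<n. s i))"
    unfolding group_mean_def eq_True 1 c s e using e(1)[of "\<lambda>_. 1"] by simp
  show "group_mean n False x (\<lambda>i. 0 < s i) j = ((\<Sum>i<n. x i j) - (\<Sum>i<n. x i j * s i)) / (real n - (\<Sum>i<n. s i))"
    unfolding group_mean_def eq_False 1 c s e using e(2)[of "\<lambda>_. 1"] by simp
qed

context array_limits
begin

text \<open>Let \<open>X\<close> and \<open>U\<close> be the sums of \<open>x\<close> and of
  \<open>x * s\<close> over \<open>sqrt N\<close>, and \<open>S\<close> the mean sign. The scaled
  difference of means is \<open>(X + U) / (1 + S) - (X - U) / (1 - S)\<close>. As \<open>S\<close>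
  vanishes, \<open>X\<close> cancels, \<open>2 * U\<close> remains, and the rest is a vanishing
  factor times a bounded one.\<close>

lemma mean_diff_limit:
  assumes j: "j < d" and s: "s \<in> {d+1, d+2}"
  shows "((\<lambda>b. sqrt (N b) * (group_mean (N b) True (z b) (\<lambda>i. 0 < z b i s) j - group_mean (N b) False (z b) (\<lambda>i. 0 < z b i s) j)
      - 2 * ((\<Sum>i<N b. z b i j * z b i s) / sqrt (N b))) \<longlongrightarrow> 0) F"
proof -
  define X where "X b = (\<Sum>i<N b. z b i j) / sqrt (N b)" for b
  define U where "U b = (\<Sum>i<N b. z b i j * z b i s) / sqrt (N b)" for b
  define S where "S b = (\<Sum>i<N b. z b i s) / N b" for b
  have X: "X \<in> O[F](\<lambda>_. 1)" unfolding X_def[abs_def] using j s by (intro bounded1) auto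
  have U: "U \<in> O[F](\<lambda>_. 1)" unfolding U_def[abs_def] using j s by (intro bounded2) auto
  have S: "(S \<longlongrightarrow> 0) F" unfolding S_def[abs_def] using s by (intro average1) auto
  have "((\<lambda>b. 1 / (1 + S b) - 1) \<longlongrightarrow> 1 / (1 + 0) - 1) F" "((\<lambda>b. 1 / (1 - S b) - 1) \<longlongrightarrow> 1 / (1 - 0) - 1) F"
    by (intro tendsto_intros S; simp)+
  then have "((\<lambda>b. (1 / (1 + S b) - 1) * (X b + U b)) \<longlongrightarrow> 0) F" "((\<lambda>b. (1 / (1 - S b) - 1) * (X b - U b)) \<longlongrightarrow> 0) F"
    using X U by (auto intro!: null_mult_bigo sum_in_bigo)
  from tendsto_diff[OF this]
  have lim: "((\<lambda>b. (1 / (1 + S b) - 1) * (X b + U b) - (1 / (1 - S b) - 1) * (X b - U b)) \<longlongrightarrow> 0) F" by simp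
  show ?thesis
  proof (rule Lim_transform_eventually[OF lim])
    show "\<forall>\<^sub>F b in F. (1 / (1 + S b) - 1) * (X b + U b) - (1 / (1 - S b) - 1) * (X b - U b) =
       sqrt (N b) * (group_mean (N b) True (z b) (\<lambda>i. 0 < z b i s) j - group_mean (N b) False (z b) (\<lambda>i. 0 < z b i s) j)
      - 2 * ((\<Sum>i<N b. z b i j * z b i s) / sqrt (N b))"
      using N_pos signs[OF s]
    proof eventually_elim
      case (elim b)
      have n: "0 < real (N b)" using elim by simp
      have sq: "sqrt (N b) * sqrt (N b) = N b" by simp
      have "sqrt (N b) * (((\<Sum>i<N b. z b i j) + (\<Sum>i<N b. z b i j * z b i s)) / (real (N b) + (\<Sum>i<N b. z b i s))) = (X b + U b) / (1 + S b)"
      proof -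
        have "(\<Sum>i<N b. z b i j) + (\<Sum>i<N b. z b i j * z b i s) = sqrt (N b) * (X b + U b)"
          "real (N b) + (\<Sum>i<N b. z b i s) = sqrt (N b) * sqrt (N b) * (1 + S b)"
          using n by (auto simp: X_def U_def S_def field_simps)
        then show ?thesis using n by (simp add: mult.assoc[symmetric])
      qed
      moreover have "sqrt (N b) * (((\<Sum>i<N b. z b i j) - (\<Sum>i<N b. z b i j * z b i s)) / (real (N b) - (\<Sum>i<N b. z b i s))) = (X b - U b) / (1 - S b)"
      proof -
        have "(\<Sum>i<N b. z b i j) - (\<Sum>i<N b. z b i j * z b i s) = sqrt (N b) * (X b - U b)"
          "real (N b) - (\<Sum>i<N b. z b i s) = sqrt (N b) * sqrt (N b) * (1 - S b)"
          using n by (auto simp: X_def U_def S_def field_simps)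
        then show ?thesis using n by (simp add: mult.assoc[symmetric])
      qed
      ultimately show ?case
        unfolding right_diff_distrib U_def[symmetric] group_mean_signs[of "\<lambda>i. z b i s", OF elim(2)[rule_format]]
        by (simp add: algebra_simps diff_divide_distrib add_divide_distrib)
    qed
  qed
qed

text \<open>\<open>w\<close> stands for the variance of a difference of group means relative to that
  of the covariate. The scaled mean differences approach \<open>2 * U j\<close> and
  \<open>N * w\<close> approaches 4, so the factor 4 cancels.\<close>

lemma mahalanobis_limit:
  assumes s: "s \<in> {d+1, d+2}" and w: "((\<lambda>b. real (N b) * w (N b)) \<longlongrightarrow> 4) F"
  shows "((\<lambda>b. (\<Sum>j<d. (group_mean (N b) True (z b) (\<lambda>i. 0 < z b i s) j - group_mean (N b) False (z b) (\<lambda>i. 0 < z b i s) j)\<^sup>2 / (w (N b) * v j))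
     - (\<Sum>j<d. ((\<Sum>i<N b. z b i j * z b i s) / sqrt (N b))\<^sup>2 / v j)) \<longlongrightarrow> 0) F"
proof -
  define m where "m j b = sqrt (N b) * (group_mean (N b) True (z b) (\<lambda>i. 0 < z b i s) j - group_mean (N b) False (z b) (\<lambda>i. 0 < z b i s) j)" for j b
  define U where "U j b = (\<Sum>i<N b. z b i j * z b i s) / sqrt (N b)" for j b
  have U: "U j \<in> O[F](\<lambda>_. 1)" if "j < d" for j
    unfolding U_def[abs_def] using that s by (intro bounded2) auto
  have m: "((\<lambda>b. m j b - 2 * U j b) \<longlongrightarrow> 0) F" if "j < d" for j
    unfolding m_def U_def by (rule mean_diff_limit[OF that s])
  have m': "m j \<in> O[F](\<lambda>_. 1)" if "j < d" for j
    using U[OF that] by (intro tendsto_diff_null[OF m[OF that]]) simp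
  have "((\<lambda>b. (1 / (real (N b) * w (N b)) - 1 / 4) * (m j b * m j b) + (m j b - 2 * U j b) * ((m j b + 2 * U j b) / 4)) \<longlongrightarrow> 0 + 0) F" if "j < d" for j
  proof (intro tendsto_add null_mult_bigo m[OF that] bigo_1_mult m'[OF that])
    have "((\<lambda>b. 1 / (real (N b) * w (N b)) - 1 / 4) \<longlongrightarrow> 1 / 4 - 1 / 4) F"
      by (intro tendsto_intros w) simp
    then show "((\<lambda>b. 1 / (real (N b) * w (N b)) - 1 / 4) \<longlongrightarrow> 0) F" by simp
    show "(\<lambda>b. (m j b + 2 * U j b) / 4) \<in> O[F](\<lambda>_. 1)"
      using m'[OF that] U[OF that] by (auto intro!: sum_in_bigo)
  qed
  \<comment> \<open>Splits the error into that of replacing \<open>N * w\<close> by 4 and that of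
    replacing the scaled mean difference by \<open>2 * u\<close>.\<close>
  moreover have algebra: "(1 / a - 1 / 4) * (x * x) + (x - 2 * u) * ((x + 2 * u) / 4) = x\<^sup>2 / a - u\<^sup>2" for a x u :: real
    by (simp add: algebra_simps power2_eq_square add_divide_distrib diff_divide_distrib)
  ultimately have "((\<lambda>b. \<Sum>j<d. ((1 / (real (N b) * w (N b)) - 1 / 4) * (m j b * m j b) + (m j b - 2 * U j b) * ((m j b + 2 * U j b) / 4)) / v j) \<longlongrightarrow> (\<Sum>j<d. 0 / v j)) F"
    using v_pos by (intro tendsto_sum tendsto_divide) (auto simp: less_imp_neq[symmetric])
  then have lim: "((\<lambda>b. \<Sum>j<d. ((m j b)\<^sup>2 / (real (N b) * w (N b)) - (U j b)\<^sup>2) / v j) \<longlongrightarrow> 0) F"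
    by (simp only: algebra) simp
  show ?thesis
    unfolding U_def[symmetric]
  proof (rule Lim_transform_eventually[OF lim])
    show "\<forall>\<^sub>F b in F. (\<Sum>j<d. ((m j b)\<^sup>2 / (real (N b) * w (N b)) - (U j b)\<^sup>2) / v j) =
      (\<Sum>j<d. (group_mean (N b) True (z b) (\<lambda>i. 0 < z b i s) j - group_mean (N b) False (z b) (\<lambda>i. 0 < z b i s) j)\<^sup>2 / (w (N b) * v j)) -
        (\<Sum>j<d. (U j b)\<^sup>2 / v j)"
      using N_pos
    proof eventually_elim
      case (elim b)
      then show ?case
        by (simp add: sum_subtractf[symmetric] m_def power_mult_distrib diff_divide_distrib)
    qed
  qed
qed

subsection \<open>The test statistic\<close>

text \<open>The entries of the design matrix, with the treatment indicator expressed by the sign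
  column \<open>s\<close>.\<close>

definition g :: "nat \<Rightarrow> 'b \<Rightarrow> nat \<Rightarrow> nat \<Rightarrow> real" where
  "g s b i k = (if k = 0 then (1 + z b i s) / 2 else if k = 1 then (1 - z b i s) / 2 else z b i (k - 2))"

text \<open>The limit of the Gram matrix divided by the sample size: each group has half of the
  units, the group indicators never overlap, and the covariates are centred and uncorrelated with
  each other and with the signs.\<close>

definition gram_limit :: "nat \<Rightarrow> real mat" where
  "gram_limit p = Matrix.mat (p + 2) (p + 2) (\<lambda>(k, l). if k = l then (if k < 2 then 1 / 2 else v (k - 2)) else 0)"

text \<open>For a sign \<open>s\<close>, \<open>((1 + s) / 2)^2 = (1 + s) / 2\<close> and
  \<open>(1 + s) * (1 - s) = 0\<close>. Hence every entry reduces to averages of a column, of a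
  square, or of a product of two distinct columns.\<close>

lemma gram_average:
  assumes p: "p \<le> d" and s: "s \<in> {d+1, d+2}" and kl: "k < p + 2" "l < p + 2"
  shows "((\<lambda>b. (\<Sum>i<N b. g s b i k * g s b i l) / N b) \<longlongrightarrow> gram_limit p $$ (k, l)) F"
proof -
  have S: "((\<lambda>b. (\<Sum>i<N b. z b i s) / N b) \<longlongrightarrow> 0) F" using s by (intro average1) auto
  have X: "((\<lambda>b. (\<Sum>i<N b. z b i j) / N b) \<longlongrightarrow> 0) F" if "j < p" for j using that p by (intro average1) auto
  have SX: "((\<lambda>b. (\<Sum>i<N b. z b i j * z b i s) / N b) \<longlongrightarrow> 0) F" if "j < p" for j using that p s by (intro average2) auto
  have XX: "((\<lambda>b. (\<Sum>i<N b. z b i j * z b i j') / N b) \<longlongrightarrow> (if j = j' then v j else 0)) F" if "j < p" "j' < p" for j j'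
    using squares[of j] average2[of j j'] that p by (auto simp: power2_eq_square)
  note sg = signs[OF s]
  have *: "((\<lambda>b. (\<Sum>i<N b. g s b i k * g s b i l) / N b) \<longlongrightarrow> gram_limit p $$ (k, l)) F"
    if "k \<le> l" "l < p + 2" for k l
  proof -
    have "(k = 0 \<and> l = 0) \<or> (k = 0 \<and> l = 1) \<or> (k = 1 \<and> l = 1) \<or> (k = 0 \<and> (\<exists>j. l = j + 2)) \<or>
        (k = 1 \<and> (\<exists>j. l = j + 2)) \<or> (\<exists>j j'. k = j + 2 \<and> l = j' + 2)"
      using that(1) by presburger
    then consider "k = 0" "l = 0" | "k = 0" "l = 1" | "k = 1" "l = 1" | j where "k = 0" "l = j + 2" | j where "k = 1" "l = j + 2"
      | j j' where "k = j + 2" "l = j' + 2"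
      by blast
    then show ?thesis
    proof cases
      case 1
      have "((\<lambda>b. 1 / 2 + (\<Sum>i<N b. z b i s) / N b / 2) \<longlongrightarrow> 1 / 2 + 0 / 2) F" by (intro tendsto_intros S) auto
      then have "((\<lambda>b. 1 / 2 + (\<Sum>i<N b. z b i s) / N b / 2) \<longlongrightarrow> gram_limit p $$ (k, l)) F" using 1 by (simp add: gram_limit_def)
      then show ?thesis
      proof (rule Lim_transform_eventually)
        show "\<forall>\<^sub>F b in F. 1 / 2 + (\<Sum>i<N b. z b i s) / N b / 2 = (\<Sum>i<N b. g s b i k * g s b i l) / N b"
          using sg N_pos
        proof eventually_elim
          case (elim b)
          have "g s b i k * g s b i l = 1 / 2 + z b i s / 2" for i using elim(1) 1 by (auto simp: g_def dest: spec[of _ i])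
          then show ?case using elim(2) by (simp add: sum.distrib sum_divide_distrib[symmetric] add_divide_distrib)
        qed
      qed
    next
      case 2
      show ?thesis
      proof (rule tendsto_eventually)
        show "\<forall>\<^sub>F b in F. (\<Sum>i<N b. g s b i k * g s b i l) / N b = gram_limit p $$ (k, l)"
          using sg
        proof eventually_elim
          case (elim b)
          have "g s b i k * g s b i l = 0" for i using elim(1) 2 by (auto simp: g_def dest: spec[of _ i])
          then have "(\<Sum>i<N b. g s b i k * g s b i l) = 0" by (simp only: sum.neutral_const)
          moreover have "gram_limit p $$ (k, l) = 0" using 2 by (simp add: gram_limit_def)
          ultimately show ?case by (simp only: div_0)
        qed
      qed
    next
      case 3
      have "((\<lambda>b. 1 / 2 - (\<Sum>i<N b. z b i s) / N b / 2) \<longlongrightarrow> 1 / 2 - 0 / 2) F" by (intro tendsto_intros S) auto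
      then have "((\<lambda>b. 1 / 2 - (\<Sum>i<N b. z b i s) / N b / 2) \<longlongrightarrow> gram_limit p $$ (k, l)) F" using 3 by (simp add: gram_limit_def)
      then show ?thesis
      proof (rule Lim_transform_eventually)
        show "\<forall>\<^sub>F b in F. 1 / 2 - (\<Sum>i<N b. z b i s) / N b / 2 = (\<Sum>i<N b. g s b i k * g s b i l) / N b"
          using sg N_pos
        proof eventually_elim
          case (elim b)
          have "g s b i k * g s b i l = 1 / 2 - z b i s / 2" for i using elim(1) 3 by (auto simp: g_def dest: spec[of _ i])
          then show ?case using elim(2) by (simp add: sum_subtractf sum_divide_distrib[symmetric] diff_divide_distrib)
        qed
      qed
    next
      case (4 j)
      have "((\<lambda>b. (\<Sum>i<N b. z b i j) / N b / 2 + (\<Sum>i<N b. z b i j * z b i s) / N b / 2) \<longlongrightarrow> 0 / 2 + 0 / 2) F"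
        using 4 that by (intro tendsto_intros X SX) auto
      then show ?thesis using 4 that
        by (simp add: gram_limit_def g_def algebra_simps sum.distrib sum_divide_distrib[symmetric] add_divide_distrib)
    next
      case (5 j)
      have "((\<lambda>b. (\<Sum>i<N b. z b i j) / N b / 2 - (\<Sum>i<N b. z b i j * z b i s) / N b / 2) \<longlongrightarrow> 0 / 2 - 0 / 2) F"
        using 5 that by (intro tendsto_intros X SX) auto
      then show ?thesis using 5 that
        by (simp add: gram_limit_def g_def algebra_simps sum_subtractf sum_divide_distrib[symmetric] diff_divide_distrib)
    next
      case (6 j j')
      then show ?thesis using that XX[of j j'] by (cases "j = j'") (simp_all add: gram_limit_def g_def)
    qed
  qed
  show ?thesis
  proof (cases "k \<le> l")
    case False
    have "gram_limit p $$ (k, l) = gram_limit p $$ (l, k)" using kl by (auto simp: gram_limit_def)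
    moreover have "(\<Sum>i<N b. g s b i k * g s b i l) = (\<Sum>i<N b. g s b i l * g s b i k)" for b
      by (simp only: mult.commute)
    ultimately show ?thesis using *[of l k] kl False by simp
  qed (use * kl in auto)
qed

end

text \<open>The errors count as one more omitted covariate, in column \<open>d\<close> with
  coefficient 1, so that the residual is a single sum over the columns from \<open>p\<close> to
  \<open>d\<close>.\<close>

definition resid_coeff :: "nat \<Rightarrow> (nat \<Rightarrow> real) \<Rightarrow> nat \<Rightarrow> real" where
  "resid_coeff d \<beta> c = (if c = d then 1 else \<beta> c)"

context array_limits
begin

definition G :: "nat \<Rightarrow> nat \<Rightarrow> 'b \<Rightarrow> real mat" where
  "G p s b = Matrix.mat (N b) (p + 2) (\<lambda>(i, k). g s b i k)"

definition model_resid :: "nat \<Rightarrow> (nat \<Rightarrow> real) \<Rightarrow> 'b \<Rightarrow> nat \<Rightarrow> real" where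
  "model_resid p \<beta> b i = (\<Sum>c\<in>{p..d}. resid_coeff d \<beta> c * z b i c)"

lemma sum_Suc_Suc_shift: "(\<Sum>k<p + 2. f k) = f 0 + f 1 + (\<Sum>k<p. f (k + 2))" for f :: "nat \<Rightarrow> real"
  unfolding add_2_eq_Suc' sum.lessThan_Suc_shift by simp

lemma design_eq_G:
  assumes "\<forall>i. z b i s = 1 \<or> z b i s = -1"
  shows "design (N b) p (\<lambda>i. 0 < z b i s) (z b) = G p s b"
proof -
  have "of_bool (0 < z b i s) = (1 + z b i s) / 2" "1 - of_bool (0 < z b i s) = (1 - z b i s) / 2" for i
    using assms[rule_format, of i] by auto
  then show ?thesis
    unfolding design_def G_def g_def by (intro eq_matI) auto
qed

text \<open>The omitted covariates join the errors in the residual, so the least squares identities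
  apply although the working model is misspecified.\<close>

lemma outcome_eq_G:
  assumes sg: "\<forall>i. z b i s = 1 \<or> z b i s = -1" and p: "p \<le> d"
  shows "outcome (N b) d \<mu>1 \<mu>2 \<beta> (\<lambda>i. 0 < z b i s) (z b) (\<lambda>i. z b i d) =
    G p s b *\<^sub>v Matrix.vec (p + 2) (\<lambda>k. if k = 0 then \<mu>1 else if k = 1 then \<mu>2 else \<beta> (k - 2)) +
      Matrix.vec (N b) (model_resid p \<beta> b)"
proof (rule eq_vecI)
  fix i assume "i < dim_vec (G p s b *\<^sub>v Matrix.vec (p + 2) (\<lambda>k. if k = 0 then \<mu>1 else if k = 1 then \<mu>2 else \<beta> (k - 2)) +
      Matrix.vec (N b) (model_resid p \<beta> b))"
  then have i: "i < N b" by simp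
  have t: "of_bool (0 < z b i s) = (1 + z b i s) / 2" "1 - of_bool (0 < z b i s) = (1 - z b i s) / 2"
    using sg[rule_format, of i] by auto
  have "(\<Sum>j<d. \<beta> j * z b i j) = (\<Sum>j<p. \<beta> j * z b i j) + (\<Sum>j\<in>{p..<d}. \<beta> j * z b i j)"
    using p by (simp add: lessThan_atLeast0 sum.atLeastLessThan_concat)
  moreover have "model_resid p \<beta> b i = (\<Sum>j\<in>{p..<d}. \<beta> j * z b i j) + z b i d"
    using p unfolding model_resid_def resid_coeff_def
    by (simp add: sum.last_plus)
  moreover have Gi: "(G p s b *\<^sub>v Matrix.vec (p + 2) (\<lambda>k. if k = 0 then \<mu>1 else if k = 1 then \<mu>2 else \<beta> (k - 2))) $ i =
      \<mu>1 * ((1 + z b i s) / 2) + \<mu>2 * ((1 - z b i s) / 2) + (\<Sum>j<p. \<beta> j * z b i j)"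
  proof -
    have "(G p s b *\<^sub>v Matrix.vec (p + 2) (\<lambda>k. if k = 0 then \<mu>1 else if k = 1 then \<mu>2 else \<beta> (k - 2))) $ i =
      (\<Sum>k<p + 2. g s b i k * (if k = 0 then \<mu>1 else if k = 1 then \<mu>2 else \<beta> (k - 2)))"
      using i by (simp add: G_def scalar_prod_def lessThan_atLeast0 del: sum.op_ivl_Suc sum.lessThan_Suc)
    then show ?thesis unfolding sum_Suc_Suc_shift by (simp add: g_def mult.commute)
  qed
  ultimately show "outcome (N b) d \<mu>1 \<mu>2 \<beta> (\<lambda>i. 0 < z b i s) (z b) (\<lambda>i. z b i d) $ i =
     (G p s b *\<^sub>v Matrix.vec (p + 2) (\<lambda>k. if k = 0 then \<mu>1 else if k = 1 then \<mu>2 else \<beta> (k - 2)) +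
      Matrix.vec (N b) (model_resid p \<beta> b)) $ i"
    using i unfolding outcome_def t by (simp add: t algebra_simps add_divide_distrib diff_divide_distrib)
qed (simp add: outcome_def)

text \<open>Residual columns have index from \<open>p\<close> to \<open>d\<close>, covariate columns
  of the design have index below \<open>p\<close>, and the sign column lies beyond \<open>d\<close>.
  So no column meets itself, and only sums over one column or over a product of two distinct columns
  occur.\<close>

lemma score_bounded:
  assumes p: "p \<le> d" and s: "s \<in> {d+1, d+2}" and l: "l < p + 2"
  shows "(\<lambda>b. (\<Sum>i<N b. g s b i l * model_resid p \<beta> b i) / sqrt (N b)) \<in> O[F](\<lambda>_. 1)"
proof -
  have "(\<lambda>b. \<Sum>c\<in>{p..d}. resid_coeff d \<beta> c * ((\<Sum>i<N b. g s b i l * z b i c) / sqrt (N b))) \<in> O[F](\<lambda>_. 1)"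
  proof (rule big_sum_in_bigo)
    fix c assume c: "c \<in> {p..d}"
    have 1: "(\<lambda>b. (\<Sum>i<N b. z b i c) / sqrt (N b)) \<in> O[F](\<lambda>_. 1)" "(\<lambda>b. (\<Sum>i<N b. z b i s * z b i c) / sqrt (N b)) \<in> O[F](\<lambda>_. 1)"
      using c s by (auto intro!: bounded1 bounded2)
    consider "l = 0" | "l = 1" | j where "l = j + 2" by (metis One_nat_def add_2_eq_Suc' not0_implies_Suc)
    then have "(\<lambda>b. (\<Sum>i<N b. g s b i l * z b i c) / sqrt (N b)) \<in> O[F](\<lambda>_. 1)"
    proof cases
      case 1
      have "(\<lambda>b. 1 / 2 * ((\<Sum>i<N b. z b i c) / sqrt (N b) + (\<Sum>i<N b. z b i s * z b i c) / sqrt (N b))) \<in> O[F](\<lambda>_. 1)"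
        by (intro bigo_1_mult sum_in_bigo \<open>(\<lambda>b. (\<Sum>i<N b. z b i c) / sqrt (N b)) \<in> _\<close> \<open>(\<lambda>b. (\<Sum>i<N b. z b i s * z b i c) / sqrt (N b)) \<in> _\<close>) simp
      then show ?thesis using 1 by (simp add: g_def algebra_simps sum.distrib sum_divide_distrib[symmetric] add_divide_distrib)
    next
      case 2
      have "(\<lambda>b. 1 / 2 * ((\<Sum>i<N b. z b i c) / sqrt (N b) - (\<Sum>i<N b. z b i s * z b i c) / sqrt (N b))) \<in> O[F](\<lambda>_. 1)"
        by (intro bigo_1_mult sum_in_bigo \<open>(\<lambda>b. (\<Sum>i<N b. z b i c) / sqrt (N b)) \<in> _\<close> \<open>(\<lambda>b. (\<Sum>i<N b. z b i s * z b i c) / sqrt (N b)) \<in> _\<close>) simp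
      then show ?thesis using 2 by (simp add: g_def algebra_simps sum_subtractf sum_divide_distrib[symmetric] diff_divide_distrib)
    next
      case (3 j)
      then have "(\<lambda>b. (\<Sum>i<N b. z b i j * z b i c) / sqrt (N b)) \<in> O[F](\<lambda>_. 1)"
        using c l p by (intro bounded2) auto
      then show ?thesis using 3 by (simp add: g_def)
    qed
    then show "(\<lambda>b. resid_coeff d \<beta> c * ((\<Sum>i<N b. g s b i l * z b i c) / sqrt (N b))) \<in> O[F](\<lambda>_. 1)"
      by (intro bigo_1_mult) simp_all
  qed
  moreover have "(\<Sum>i<N b. g s b i l * model_resid p \<beta> b i) / sqrt (N b) =
     (\<Sum>c\<in>{p..d}. resid_coeff d \<beta> c * ((\<Sum>i<N b. g s b i l * z b i c) / sqrt (N b)))" for b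
    unfolding model_resid_def sum_distrib_left sum_divide_distrib
    by (subst sum.swap) (simp add: mult_ac)
  ultimately show ?thesis by (simp only:)
qed

text \<open>Products of distinct columns average out; what remains is the joint variance of the
  errors and the omitted covariates.\<close>

lemma resid_squares_average:
  "((\<lambda>b. (\<Sum>i<N b. (model_resid p \<beta> b i)\<^sup>2) / N b) \<longlongrightarrow> (\<Sum>c\<in>{p..d}. (resid_coeff d \<beta> c)\<^sup>2 * v c)) F"
proof -
  have "((\<lambda>b. (\<Sum>i<N b. z b i c * z b i c') / N b) \<longlongrightarrow> (if c' = c then v c else 0)) F" if "c \<le> d" "c' \<le> d" for c c'
    using squares[of c] average2[of c c'] that by (cases "c = c'") (auto simp: power2_eq_square)
  then have "((\<lambda>b. \<Sum>c\<in>{p..d}. \<Sum>c'\<in>{p..d}. resid_coeff d \<beta> c * resid_coeff d \<beta> c' * ((\<Sum>i<N b. z b i c * z b i c') / N b)) \<longlongrightarrow>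
     (\<Sum>c\<in>{p..d}. \<Sum>c'\<in>{p..d}. resid_coeff d \<beta> c * resid_coeff d \<beta> c' * (if c' = c then v c else 0))) F"
    by (intro tendsto_sum tendsto_mult tendsto_const) auto
  moreover have "(\<Sum>c\<in>{p..d}. \<Sum>c'\<in>{p..d}. resid_coeff d \<beta> c * resid_coeff d \<beta> c' * (if c' = c then v c else 0)) = (\<Sum>c\<in>{p..d}. (resid_coeff d \<beta> c)\<^sup>2 * v c)"
    by (intro sum.cong refl) (simp add: if_distrib sum.delta power2_eq_square cong: if_cong)
  moreover have "(\<Sum>i<N b. (model_resid p \<beta> b i)\<^sup>2) / N b =
      (\<Sum>c\<in>{p..d}. \<Sum>c'\<in>{p..d}. resid_coeff d \<beta> c * resid_coeff d \<beta> c' * ((\<Sum>i<N b. z b i c * z b i c') / N b))" for b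
  proof -
    have "(\<Sum>i<N b. (model_resid p \<beta> b i)\<^sup>2) = (\<Sum>i<N b. \<Sum>c\<in>{p..d}. \<Sum>c'\<in>{p..d}. resid_coeff d \<beta> c * resid_coeff d \<beta> c' * (z b i c * z b i c'))"
      unfolding model_resid_def power2_eq_square sum_product by (simp add: mult_ac)
    also have "\<dots> = (\<Sum>c\<in>{p..d}. \<Sum>i<N b. \<Sum>c'\<in>{p..d}. resid_coeff d \<beta> c * resid_coeff d \<beta> c' * (z b i c * z b i c'))"
      by (rule sum.swap)
    also have "\<dots> = (\<Sum>c\<in>{p..d}. \<Sum>c'\<in>{p..d}. \<Sum>i<N b. resid_coeff d \<beta> c * resid_coeff d \<beta> c' * (z b i c * z b i c'))"
      by (intro sum.cong refl sum.swap)
    finally show ?thesis by (simp add: sum_distrib_left sum_divide_distrib)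
  qed
  ultimately show ?thesis by (simp only:)
qed

text \<open>Let \<open>h\<close> be the score over \<open>sqrt N\<close> and \<open>C\<close> the
  inverse of the Gram matrix over \<open>N\<close>. The estimated effect times \<open>sqrt N\<close>
  is the drift plus \<open>\<Sum>l. (C 0 l - C 1 l) * h l\<close>, and \<open>C\<close> tends to a
  diagonal matrix with entry 2 at both group positions. So the numerator approaches
  \<open>2 * H\<close>, the denominator \<open>2 * \<sigma>w\<close>, and the quotient
  \<open>H / \<sigma>w\<close>.\<close>

lemma test_stat_limit:
  assumes p: "p \<le> d" and s: "s \<in> {d+1, d+2}"
    and \<mu>: "(\<lambda>b. sqrt (N b) * (\<mu>1 b - \<mu>2 b)) \<in> O[F](\<lambda>_. 1)"
    and \<sigma>w: "\<sigma>w = sqrt (\<Sum>c\<in>{p..d}. (resid_coeff d \<beta> c)\<^sup>2 * v c)"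
  shows "((\<lambda>b. test_stat (N b) p (\<lambda>i. 0 < z b i s) (z b)
        (outcome (N b) d (\<mu>1 b) (\<mu>2 b) \<beta> (\<lambda>i. 0 < z b i s) (z b) (\<lambda>i. z b i d))
     - (sqrt (N b) * (\<mu>1 b - \<mu>2 b) / 2 + (\<Sum>i<N b. z b i s * model_resid p \<beta> b i) / sqrt (N b)) / \<sigma>w) \<longlongrightarrow> 0) F"
proof -
  let ?m = "p + 2"
  define A where "A b = (G p s b)\<^sup>T * G p s b" for b
  define An where "An b = Matrix.mat ?m ?m (\<lambda>(k, l). (\<Sum>i<N b. g s b i k * g s b i l) / N b)" for b
  define C where "C b k l = minv (An b) $$ (k, l)" for b k l
  define h where "h b l = (\<Sum>i<N b. g s b i l * model_resid p \<beta> b i) / sqrt (N b)" for b l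
  define H where "H b = sqrt (N b) * (\<mu>1 b - \<mu>2 b) / 2 + (\<Sum>i<N b. z b i s * model_resid p \<beta> b i) / sqrt (N b)" for b
  define Q where "Q b = (\<Sum>i<N b. (model_resid p \<beta> b i)\<^sup>2) / N b" for b
  let ?w = "\<lambda>k. if k < 2 then 1 / 2 else v (k - 2)"
  have GL: "gram_limit p = Matrix.mat ?m ?m (\<lambda>(k, l). if k = l then ?w k else 0)"
    by (simp add: gram_limit_def)
  have wn: "?w k \<noteq> 0" if "k < ?m" for k proof -
    have "k - 2 < d + 3" using that p by arith
    then show ?thesis using v_pos[of "k - 2"] by auto
  qed
  have detGL: "Determinant.det (gram_limit p) \<noteq> 0" unfolding GL by (rule det_diagonal_nonzero[OF wn])
  have Anc: "An b \<in> carrier_mat ?m ?m" "gram_limit p \<in> carrier_mat ?m ?m" for b by (auto simp: An_def gram_limit_def)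
  have Anl: "((\<lambda>b. An b $$ (k, l)) \<longlongrightarrow> gram_limit p $$ (k, l)) F" if "k < ?m" "l < ?m" for k l
    using gram_average[OF p s that] that by (simp add: An_def)
  have Cl: "((\<lambda>b. C b k l) \<longlongrightarrow> (if k = l then inverse (?w k) else 0)) F" if "k < ?m" "l < ?m" for k l
  proof -
    have "minv (gram_limit p) $$ (k, l) = (if k = l then inverse (?w k) else 0)"
      unfolding GL using that by (subst minv_diagonal[OF wn]) auto
    then show ?thesis unfolding C_def using tendsto_minv[OF Anc detGL Anl that] by simp
  qed
  have C1: "(\<lambda>b. C b k l) \<in> O[F](\<lambda>_. 1)" if "k < ?m" "l < ?m" for k l
    using Cl[OF that] by (rule tendsto_imp_bigo_1)
  have h: "(\<lambda>b. h b l) \<in> O[F](\<lambda>_. 1)" if "l < ?m" for l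
    unfolding h_def by (rule score_bounded[OF p s that])
  \<comment> \<open>As the limit of the Gram matrices is nonsingular, the least squares identities
    eventually apply.\<close>
  have detAn: "\<forall>\<^sub>F b in F. Determinant.det (An b) \<noteq> 0"
    using tendsto_det[OF Anc Anl] detGL by (rule tendsto_imp_eventually_ne)
  have hdiff: "h b 0 - h b 1 = (\<Sum>i<N b. z b i s * model_resid p \<beta> b i) / sqrt (N b)" for b
    unfolding h_def diff_divide_distrib[symmetric] sum_subtractf[symmetric] g_def
    by (intro arg_cong[of _ _ "\<lambda>x. x / _"] sum.cong) (auto simp: algebra_simps add_divide_distrib diff_divide_distrib)
  have Hb: "H \<in> O[F](\<lambda>_. 1)"
  proof -
    have "(\<lambda>b. 1 / 2 * (sqrt (N b) * (\<mu>1 b - \<mu>2 b)) + (h b 0 - h b 1)) \<in> O[F](\<lambda>_. 1)"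
      by (intro sum_in_bigo(1) bigo_1_mult[OF _ \<mu>] sum_in_bigo(2) h) simp_all
    then show ?thesis by (simp add: H_def[abs_def] hdiff[unfolded One_nat_def])
  qed
  \<comment> \<open>Here the powers of \<open>N\<close> are taken out: \<open>num\<close> is
    \<open>sqrt N\<close> times the estimated effect, \<open>\<kappa>\<close> is \<open>N\<close>
    times the factor \<open>L^t (G^t G)^-1 L\<close>, and \<open>rv\<close> is the residual
    variance.\<close>
  define num where "num b = sqrt (N b) * (\<mu>1 b - \<mu>2 b) + (\<Sum>l<?m. (C b 0 l - C b 1 l) * h b l)" for b
  define \<kappa> where "\<kappa> b = C b 0 0 - C b 0 1 - C b 1 0 + C b 1 1" for b
  define rv where "rv b = (Q b - (\<Sum>k<?m. \<Sum>l<?m. h b k * (C b k l * h b l)) / N b) / ((real (N b) - real ?m) / N b)" for b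
  have num: "((\<lambda>b. num b - 2 * H b) \<longlongrightarrow> 0) F"
  proof -
    \<comment> \<open>The entries 2 and -2 come from inverting the group shares 1/2.\<close>
    let ?c = "\<lambda>l::nat. if l = 0 then 2 else if l = 1 then -2 else 0 :: real"
    have "((\<lambda>b. \<Sum>l<?m. (C b 0 l - C b 1 l - ?c l) * h b l) \<longlongrightarrow> (\<Sum>l<?m. 0)) F"
    proof (intro tendsto_sum null_mult_bigo h)
      fix l assume l: "l \<in> {..<?m}"
      have "((\<lambda>b. C b 0 l - C b 1 l - ?c l) \<longlongrightarrow> (if 0 = l then inverse (?w 0) else 0) - (if 1 = l then inverse (?w 1) else 0) - ?c l) F"
        using l by (intro tendsto_diff Cl tendsto_const) auto
      then show "((\<lambda>b. C b 0 l - C b 1 l - ?c l) \<longlongrightarrow> 0) F" by (auto split: if_splits)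
    qed simp
    moreover have "(\<Sum>l<?m. (C b 0 l - C b 1 l - ?c l) * h b l) = num b - 2 * H b" for b
    proof -
      have "(\<Sum>l<?m. (C b 0 l - C b 1 l - ?c l) * h b l) = (\<Sum>l<?m. (C b 0 l - C b 1 l) * h b l) - (\<Sum>l<?m. ?c l * h b l)"
        by (simp add: left_diff_distrib sum_subtractf)
      also have "(\<Sum>l<?m. ?c l * h b l) = 2 * (h b 0 - h b 1)"
        by (subst sum_Suc_Suc_shift) simp
      finally show ?thesis unfolding num_def H_def hdiff by simp
    qed
    ultimately show ?thesis by simp
  qed
  have \<kappa>: "(\<kappa> \<longlongrightarrow> 4) F"
  proof -
    have "(\<kappa> \<longlongrightarrow> inverse (?w 0) - 0 - 0 + inverse (?w 1)) F"
      unfolding \<kappa>_def[abs_def] using Cl[of 0 0] Cl[of 0 1] Cl[of 1 0] Cl[of 1 1] by (intro tendsto_intros) auto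
    then show ?thesis by simp
  qed
  have Nm: "((\<lambda>b. (real (N b) - real ?m) / N b) \<longlongrightarrow> 1) F"
  proof -
    have "((\<lambda>b. 1 - real ?m * (1 / sqrt (N b) * (1 / sqrt (N b)))) \<longlongrightarrow> 1 - real ?m * (0 * 0)) F"
      by (intro tendsto_intros inverse_sqrt_N)
    then have "((\<lambda>b. 1 - real ?m * (1 / sqrt (N b) * (1 / sqrt (N b)))) \<longlongrightarrow> 1) F" by simp
    then show ?thesis
      by (rule Lim_transform_eventually) (use N_pos in \<open>eventually_elim, simp add: field_simps\<close>)
  qed
  \<comment> \<open>The errors alone contribute a positive amount, so \<open>\<sigma>w\<close> is
    positive whatever \<open>\<beta>\<close> is.\<close>
  have W: "0 < (\<Sum>c\<in>{p..d}. (resid_coeff d \<beta> c)\<^sup>2 * v c)"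
  proof -
    have "(\<Sum>c\<in>{d}. (resid_coeff d \<beta> c)\<^sup>2 * v c) \<le> (\<Sum>c\<in>{p..d}. (resid_coeff d \<beta> c)\<^sup>2 * v c)"
      using p by (intro sum_mono2) (auto intro!: mult_nonneg_nonneg less_imp_le[OF v_pos])
    then show ?thesis using v_pos[of d] by (simp add: resid_coeff_def)
  qed
  then have \<sigma>pos: "0 < \<sigma>w" using \<sigma>w by simp
  have \<sigma>2: "(\<Sum>c\<in>{p..d}. (resid_coeff d \<beta> c)\<^sup>2 * v c) = \<sigma>w\<^sup>2" using W \<sigma>w by simp
  have rv: "(rv \<longlongrightarrow> \<sigma>w\<^sup>2) F"
  proof -
    have "(\<lambda>b. \<Sum>k<?m. \<Sum>l<?m. h b k * (C b k l * h b l)) \<in> O[F](\<lambda>_. 1)"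
      by (intro big_sum_in_bigo bigo_1_mult h C1) auto
    then have "((\<lambda>b. 1 / sqrt (N b) * (1 / sqrt (N b)) * (\<Sum>k<?m. \<Sum>l<?m. h b k * (C b k l * h b l))) \<longlongrightarrow> 0) F"
      by (rule null_mult_bigo[rotated]) (use tendsto_mult[OF inverse_sqrt_N inverse_sqrt_N] in simp)
    then have "((\<lambda>b. (\<Sum>k<?m. \<Sum>l<?m. h b k * (C b k l * h b l)) / N b) \<longlongrightarrow> 0) F" by simp
    then have "(rv \<longlongrightarrow> (\<sigma>w\<^sup>2 - 0) / 1) F"
      unfolding rv_def[abs_def] using resid_squares_average[of p \<beta>] Nm
      by (intro tendsto_intros) (auto simp: Q_def \<sigma>2)
    then show ?thesis by simp
  qed
  have den: "((\<lambda>b. sqrt (rv b * \<kappa> b)) \<longlongrightarrow> 2 * \<sigma>w) F"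
  proof -
    have "((\<lambda>b. sqrt (rv b * \<kappa> b)) \<longlongrightarrow> sqrt (\<sigma>w\<^sup>2 * 4)) F" by (intro tendsto_intros rv \<kappa>)
    also have "sqrt (\<sigma>w\<^sup>2 * 4) = 2 * \<sigma>w" using \<sigma>pos by (simp add: real_sqrt_mult)
    finally show ?thesis .
  qed
  have lim: "((\<lambda>b. num b / sqrt (rv b * \<kappa> b) - H b / \<sigma>w) \<longlongrightarrow> 0) F"
  proof -
    \<comment> \<open>The numerator is replaced by \<open>2 * H\<close> before the denominator is
      replaced by its limit.\<close>
    have "((\<lambda>b. (num b - 2 * H b) / sqrt (rv b * \<kappa> b)) \<longlongrightarrow> 0 / (2 * \<sigma>w)) F"
      using \<sigma>pos by (intro tendsto_divide num den) auto
    moreover have "((\<lambda>b. 2 / sqrt (rv b * \<kappa> b) - 1 / \<sigma>w) \<longlongrightarrow> 2 / (2 * \<sigma>w) - 1 / \<sigma>w) F"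
      using \<sigma>pos by (intro tendsto_intros den) auto
    then have "((\<lambda>b. (2 / sqrt (rv b * \<kappa> b) - 1 / \<sigma>w) * H b) \<longlongrightarrow> 0) F"
      using Hb by (intro null_mult_bigo) auto
    ultimately have "((\<lambda>b. (num b - 2 * H b) / sqrt (rv b * \<kappa> b) + (2 / sqrt (rv b * \<kappa> b) - 1 / \<sigma>w) * H b) \<longlongrightarrow> 0 / (2 * \<sigma>w) + 0) F"
      by (rule tendsto_add)
    then show ?thesis by (simp add: algebra_simps diff_divide_distrib)
  qed
  show ?thesis
    unfolding H_def[symmetric]
  proof (rule Lim_transform_eventually[OF lim])
    show "\<forall>\<^sub>F b in F. num b / sqrt (rv b * \<kappa> b) - H b / \<sigma>w =
       test_stat (N b) p (\<lambda>i. 0 < z b i s) (z b) (outcome (N b) d (\<mu>1 b) (\<mu>2 b) \<beta> (\<lambda>i. 0 < z b i s) (z b) (\<lambda>i. z b i d)) - H b / \<sigma>w"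
      using signs[OF s] N_pos detAn
    proof eventually_elim
      case (elim b)
      let ?G = "G p s b" and ?n = "real (N b)"
      let ?\<theta> = "Matrix.vec ?m (\<lambda>k. if k = 0 then \<mu>1 b else if k = 1 then \<mu>2 b else \<beta> (k - 2))"
      let ?r = "Matrix.vec (N b) (model_resid p \<beta> b)"
      have n: "0 < ?n" using elim by simp
      have Gc: "?G \<in> carrier_mat (N b) ?m" by (simp add: G_def)
      have A: "A b = ?n \<cdot>\<^sub>m An b"
        unfolding A_def An_def G_def using n by (intro eq_matI) (auto simp: scalar_prod_def lessThan_atLeast0)
      have detA: "Determinant.det (A b) \<noteq> 0" unfolding A using elim(3) n by (simp add: det_smult)
      have mA: "minv (A b) = inverse ?n \<cdot>\<^sub>m minv (An b)" unfolding A using elim(3) n by (intro minv_smult[OF Anc(1)]) auto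
      note mc = minv_carrier[OF Anc(1), of b]
      have gr: "(?G\<^sup>T *\<^sub>v ?r) $ l = sqrt ?n * h b l" if "l < ?m" for l
        using that n by (simp add: G_def h_def scalar_prod_def lessThan_atLeast0[symmetric])
      have grc: "?G\<^sup>T *\<^sub>v ?r \<in> carrier_vec ?m" using Gc by simp
      have mw: "(minv (A b) *\<^sub>v u) $ k = (\<Sum>l<?m. C b k l * u $ l) / ?n" if "k < ?m" "u \<in> carrier_vec ?m" for k u
        unfolding mA using that mc
        by (simp add: scalar_prod_def C_def lessThan_atLeast0 sum_divide_distrib divide_inverse mult_ac distrib_left sum_distrib_left)
      have mwc: "minv (A b) *\<^sub>v u \<in> carrier_vec ?m" if "u \<in> carrier_vec ?m" for u
        unfolding mA using that mc by (intro mult_mat_vec_carrier[of _ ?m ?m] smult_carrier_mat) simp_all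
      have dr: "dim_row (minv (A b)) = ?m" unfolding mA using mc by simp
      have Lc: "contrast p \<in> carrier_vec ?m" by (simp add: contrast_def)
      have Lu: "contrast p \<bullet> u = u $ 0 - u $ 1" if "u \<in> carrier_vec ?m" for u
      proof -
        have "contrast p \<bullet> u = (\<Sum>k<?m. (if k = 0 then 1 else if k = 1 then - 1 else 0) * u $ k)"
          using that unfolding scalar_prod_def contrast_def
          by (intro sum.cong) (auto simp del: sum.op_ivl_Suc sum.lessThan_Suc)
        then show ?thesis unfolding sum_Suc_Suc_shift by simp
      qed
      have ols: "ols ?G (?G *\<^sub>v ?\<theta> + ?r) = ?\<theta> + minv (A b) *\<^sub>v (?G\<^sup>T *\<^sub>v ?r)"
        unfolding A_def by (intro ols_linear_model[OF Gc]) (use detA in \<open>auto simp: A_def\<close>)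
      have rvr: "resid_var ?G (?G *\<^sub>v ?\<theta> + ?r) = (?r \<bullet> ?r - (?G\<^sup>T *\<^sub>v ?r) \<bullet> (minv (A b) *\<^sub>v (?G\<^sup>T *\<^sub>v ?r))) / (?n - real ?m)"
        unfolding A_def by (intro resid_var_linear_model[OF Gc]) (use detA in \<open>auto simp: A_def\<close>)
      have rr: "?r \<bullet> ?r = ?n * Q b" using n by (simp add: scalar_prod_def Q_def lessThan_atLeast0 power2_eq_square)
      have sq: "sqrt ?n * sqrt ?n = ?n" by simp
      have mg: "(minv (A b) *\<^sub>v (?G\<^sup>T *\<^sub>v ?r)) $ k = (\<Sum>l<?m. C b k l * h b l) / sqrt ?n" if "k < ?m" for k
      proof -
        have "(minv (A b) *\<^sub>v (?G\<^sup>T *\<^sub>v ?r)) $ k = (\<Sum>l<?m. C b k l * (sqrt ?n * h b l)) / ?n"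
          unfolding mw[OF that grc] by (intro arg_cong[of _ _ "\<lambda>x. x / _"] sum.cong) (auto simp: gr)
        also have "\<dots> = sqrt ?n * (\<Sum>l<?m. C b k l * h b l) / (sqrt ?n * sqrt ?n)"
          unfolding sq by (simp add: sum_distrib_left distrib_left mult_ac)
        also have "\<dots> = (\<Sum>l<?m. C b k l * h b l) / sqrt ?n"
          using n by (intro nonzero_mult_divide_mult_cancel_left) simp
        finally show ?thesis .
      qed
      have quad: "(?G\<^sup>T *\<^sub>v ?r) \<bullet> (minv (A b) *\<^sub>v (?G\<^sup>T *\<^sub>v ?r)) = (\<Sum>k<?m. \<Sum>l<?m. h b k * (C b k l * h b l))"
      proof -
        have "(?G\<^sup>T *\<^sub>v ?r) \<bullet> (minv (A b) *\<^sub>v (?G\<^sup>T *\<^sub>v ?r)) = (\<Sum>k<?m. (sqrt ?n * h b k) * ((\<Sum>l<?m. C b k l * h b l) / sqrt ?n))"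
          unfolding scalar_prod_def carrier_vecD[OF mwc[OF grc]]
          by (intro sum.cong) (auto simp: gr mg lessThan_atLeast0 simp del: index_mult_mat_vec)
        also have "\<dots> = (\<Sum>k<?m. h b k * (\<Sum>l<?m. C b k l * h b l))" using n by simp
        finally show ?thesis unfolding sum_distrib_left .
      qed
      have "resid_var ?G (?G *\<^sub>v ?\<theta> + ?r) = rv b"
      proof -
        have "(m * x - y) / (m - a) = (x - y / m) / ((m - a) / m)" if "0 < m" for m x y a :: real
        proof -
          have "x - y / m = (m * x - y) / m" using that by (simp add: diff_divide_distrib)
          then show ?thesis using that by simp
        qed
        then show ?thesis unfolding rvr quad rr rv_def using n by blast
      qed
      moreover have "contrast p \<bullet> (minv (A b) *\<^sub>v contrast p) = \<kappa> b / ?n"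
      proof -
        have "(\<Sum>l<?m. C b k l * contrast p $ l) = C b k 0 - C b k 1" for k
          unfolding sum_Suc_Suc_shift by (simp add: contrast_def)
        then have "(minv (A b) *\<^sub>v contrast p) $ k = (C b k 0 - C b k 1) / ?n" if "k < ?m" for k
          using mw[OF that Lc] by (simp only:)
        then show ?thesis
          unfolding Lu[OF mwc[OF Lc]]
          by (simp add: \<kappa>_def diff_divide_distrib add_divide_distrib del: index_mult_mat_vec)
      qed
      moreover have "contrast p \<bullet> ols ?G (?G *\<^sub>v ?\<theta> + ?r) = num b / sqrt ?n"
      proof -
        have "contrast p \<bullet> ols ?G (?G *\<^sub>v ?\<theta> + ?r) = (?\<theta> + minv (A b) *\<^sub>v (?G\<^sup>T *\<^sub>v ?r)) $ 0 - (?\<theta> + minv (A b) *\<^sub>v (?G\<^sup>T *\<^sub>v ?r)) $ 1"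
          unfolding ols by (rule Lu) (use mwc[OF grc] in auto)
        also have "\<dots> = (\<mu>1 b - \<mu>2 b) + ((\<Sum>l<?m. C b 0 l * h b l) / sqrt ?n - (\<Sum>l<?m. C b 1 l * h b l) / sqrt ?n)"
          using mg[of 0] mg[of 1] dr by (simp del: index_mult_mat_vec)
        also have "\<dots> = num b / sqrt ?n"
          using n unfolding num_def left_diff_distrib sum_subtractf by (simp add: add_divide_distrib diff_divide_distrib)
        finally show ?thesis .
      qed
      moreover have "num b / sqrt ?n / sqrt (rv b * (\<kappa> b / ?n)) = num b / sqrt (rv b * \<kappa> b)"
        using n by (simp add: real_sqrt_divide)
      ultimately show ?case
        unfolding test_stat_def Let_def design_eq_G[OF elim(1)] outcome_eq_G[OF elim(1) p] A_def by (simp only:)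
    qed
  qed
qed

end

section \<open>Covariance of the difference of group means\<close>

lemma set_pmf_CR: "set_pmf (CR n) = {t. \<forall>i\<ge>n. \<not> t i}"
  unfolding CR_def by (subst set_Pi_pmf) (auto simp: PiE_dflt_def)

lemma finite_set_pmf_CR: "finite (set_pmf (CR n))"
  unfolding CR_def by (subst set_Pi_pmf) auto

lemma pmf_CR: "t \<in> set_pmf (CR n) \<Longrightarrow> pmf (CR n) t = (1 / 2) ^ n"
  unfolding set_pmf_CR unfolding CR_def
  by (subst pmf_Pi') (auto simp: pmf_bernoulli_half[abs_def] bernoulli_pmf_half_conv_pmf_of_set intro!: prod.cong)

lemma (in prob_space)
  fixes f :: "'a \<times> 'b \<Rightarrow> real"
  assumes [measurable]: "f \<in> borel_measurable (M \<Otimes>\<^sub>M measure_pmf q)" and fin: "finite (set_pmf q)"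
    and int: "\<And>t. t \<in> set_pmf q \<Longrightarrow> integrable M (\<lambda>x. f (x, t))"
  shows integrable_pair_finite_pmf: "integrable (M \<Otimes>\<^sub>M measure_pmf q) f"
    and integral_pair_finite_pmf: "integral\<^sup>L (M \<Otimes>\<^sub>M measure_pmf q) f = (\<Sum>t\<in>set_pmf q. pmf q t * (\<integral>x. f (x, t) \<partial>M))"
proof -
  interpret q: prob_space "measure_pmf q" by (rule prob_space_measure_pmf)
  interpret pair_sigma_finite M "measure_pmf q" ..
  have E: "measure_pmf.expectation q h = (\<Sum>t\<in>set_pmf q. pmf q t * h t)" for h :: "'b \<Rightarrow> real"
    using fin by (subst integral_measure_pmf_real[of "set_pmf q"]) (auto simp: mult.commute)
  show i: "integrable (M \<Otimes>\<^sub>M measure_pmf q) f"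
  proof (rule Fubini_integrable)
    show "integrable M (\<lambda>x. \<integral>y. norm (f (x, y)) \<partial>measure_pmf q)"
      unfolding E using int by auto
    show "AE x in M. integrable (measure_pmf q) (\<lambda>y. f (x, y))"
      using fin by (intro AE_I2 integrable_measure_pmf_finite)
  qed simp
  have "integral\<^sup>L (M \<Otimes>\<^sub>M measure_pmf q) f = (\<integral>x. (\<integral>y. f (x, y) \<partial>measure_pmf q) \<partial>M)"
    using i by (simp add: integral_fst')
  also have "\<dots> = (\<Sum>t\<in>set_pmf q. pmf q t * (\<integral>x. f (x, t) \<partial>M))"
    unfolding E using int by simp
  finally show "integral\<^sup>L (M \<Otimes>\<^sub>M measure_pmf q) f = (\<Sum>t\<in>set_pmf q. pmf q t * (\<integral>x. f (x, t) \<partial>M))" .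
qed

text \<open>The variance of a difference of group means, for covariates of unit variance.\<close>

definition mean_diff_var :: "nat \<Rightarrow> real" where
  "mean_diff_var n = measure_pmf.expectation (CR n)
     (\<lambda>t. 1 / real (card {i. i < n \<and> t i}) + 1 / real (card {i. i < n \<and> \<not> t i}))"

text \<open>The coefficient of unit \<open>i\<close> in a difference of group means. Division by 0
  yields 0, in accordance with the convention for the mean of an empty group.\<close>

definition mean_weight :: "nat \<Rightarrow> (nat \<Rightarrow> bool) \<Rightarrow> nat \<Rightarrow> real" where
  "mean_weight n t i = of_bool (t i) / real (card {i. i < n \<and> t i}) - of_bool (\<not> t i) / real (card {i. i < n \<and> \<not> t i})"

lemma mean_diff_weight:
  "group_mean n True x t j - group_mean n False x t j = (\<Sum>i<n. mean_weight n t i * x i j)"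
proof -
  have 1: "(\<Sum>i | i < n \<and> P i. f i) = (\<Sum>i<n. f i * of_bool (P i))" for f :: "nat \<Rightarrow> real" and P
  proof -
    have "{i. i < n \<and> P i} = {..<n} \<inter> {i. P i}" by auto
    then show ?thesis by simp
  qed
  show ?thesis
    unfolding group_mean_def mean_weight_def eq_True eq_False 1 left_diff_distrib sum_subtractf sum_divide_distrib
    by (simp only: mult.commute times_divide_eq_right times_divide_eq_left)
qed

text \<open>A unit belongs to one group only, so the squares do not mix, and
  \<open>k / k^2 = 1 / k\<close> holds for an empty group as well, both sides being 0.\<close>

lemma sum_mean_weight_squares:
  "(\<Sum>i<n. (mean_weight n t i)\<^sup>2) = 1 / real (card {i. i < n \<and> t i}) + 1 / real (card {i. i < n \<and> \<not> t i})"
proof -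
  have c: "(\<Sum>i<n. of_bool (P i)) = real (card {i. i < n \<and> P i})" for P
  proof -
    have "{i. i < n \<and> P i} = {..<n} \<inter> {i. P i}" by auto
    then show ?thesis by simp
  qed
  have sq: "k / k\<^sup>2 = 1 / k" for k :: real by (simp add: power2_eq_square)
  have "(\<Sum>i<n. (mean_weight n t i)\<^sup>2) = (\<Sum>i<n. of_bool (t i) / (real (card {i. i < n \<and> t i}))\<^sup>2 + of_bool (\<not> t i) / (real (card {i. i < n \<and> \<not> t i}))\<^sup>2)"
    unfolding mean_weight_def by (intro sum.cong) (auto simp: power_divide)
  also have "\<dots> = real (card {i. i < n \<and> t i}) / (real (card {i. i < n \<and> t i}))\<^sup>2 + real (card {i. i < n \<and> \<not> t i}) / (real (card {i. i < n \<and> \<not> t i}))\<^sup>2"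
    unfolding sum.distrib sum_divide_distrib[symmetric] c ..
  finally show ?thesis unfolding sq .
qed

text \<open>For a fixed assignment the difference of means is a linear combination of centred
  covariates, independent between units, so its covariance is diagonal with entries
  \<open>V j\<close> times the sum of squared weights. Its mean is 0 for every assignment, so
  averaging over assignments adds no further term.\<close>

lemma
  assumes \<nu>: "prob_space \<nu>" "sets \<nu> = sets (covariate_space d)"
    and int: "\<And>j. j < d \<Longrightarrow> integrable \<nu> (\<lambda>y. (y j)\<^sup>2)" and mean: "\<And>j. j < d \<Longrightarrow> (\<integral>y. y j \<partial>\<nu>) = 0"
    and cov: "\<And>j k. j < d \<Longrightarrow> k < d \<Longrightarrow> (\<integral>y. y j * y k \<partial>\<nu>) = (if j = k then V j else 0)"
  shows cov_mat_CR: "cov_mat d (CR_law n \<nu>) (\<lambda>(x', t'). mean_diff n d x' t') =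
      Matrix.mat d d (\<lambda>(j, k). if j = k then mean_diff_var n * V j else 0)"
proof -
  interpret \<nu>: prob_space \<nu> by fact
  let ?M = "PiM {..<n} (\<lambda>_. \<nu>)"
  interpret M: prob_space ?M by (intro prob_space_PiM \<nu>)
  interpret product_prob_space "\<lambda>_. \<nu>" "{..<n}" ..
  have [measurable]: "(\<lambda>y. y j) \<in> borel_measurable \<nu>" if "j < d" for j
    using that by (subst measurable_cong_sets[OF \<nu>(2) refl]) auto
  have i1: "integrable \<nu> (\<lambda>y. y j)" if "j < d" for j
    using \<nu>.square_integrable_imp_integrable[OF _ int[OF that]] that by simp
  have i2: "integrable \<nu> (\<lambda>y. y j * y k)" if "j < d" "k < d" for j k
  proof (rule Bochner_Integration.integrable_bound[OF Bochner_Integration.integrable_add[OF int[OF that(1)] int[OF that(2)]]])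
    have "\<bar>a * b\<bar> \<le> \<bar>a\<^sup>2 + b\<^sup>2\<bar>" for a b :: real
    proof -
      have "0 \<le> (\<bar>a\<bar> - \<bar>b\<bar>)\<^sup>2" "0 \<le> a\<^sup>2 + b\<^sup>2" "0 \<le> \<bar>a\<bar> * \<bar>b\<bar>" by simp_all
      moreover from this(1) have "2 * (\<bar>a\<bar> * \<bar>b\<bar>) \<le> a\<^sup>2 + b\<^sup>2" by (simp add: power2_diff)
      ultimately show ?thesis unfolding abs_mult by linarith
    qed
    then show "AE y in \<nu>. norm (y j * y k) \<le> norm ((y j)\<^sup>2 + (y k)\<^sup>2)" by simp
  qed (use that in measurable)
  have e1: "integrable ?M (\<lambda>x. x i j)" "(\<integral>x. x i j \<partial>?M) = 0" if "i < n" "j < d" for i j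
  proof -
    have d: "distr ?M \<nu> (\<lambda>x. x i) = \<nu>" using that \<nu> by (intro distr_PiM_component) auto
    show "integrable ?M (\<lambda>x. x i j)"
      using i1[OF that(2)] that by (subst (asm) d[symmetric]) (simp add: integrable_distr_eq)
    have "(\<integral>x. x i j \<partial>?M) = (\<integral>y. y j \<partial>distr ?M \<nu> (\<lambda>x. x i))"
      using that by (subst integral_distr) auto
    then show "(\<integral>x. x i j \<partial>?M) = 0" by (simp add: d mean that)
  qed
  have e2: "integrable ?M (\<lambda>x. x i j * x l k)" "(\<integral>x. x i j * x l k \<partial>?M) = (if i = l \<and> j = k then V j else 0)"
    if "i < n" "l < n" "j < d" "k < d" for i j k l
  proof -
    have "integrable ?M (\<lambda>x. x i j * x l k) \<and> (\<integral>x. x i j * x l k \<partial>?M) = (if i = l \<and> j = k then V j else 0)"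
    proof (cases "i = l")
      case True
      have d: "distr ?M \<nu> (\<lambda>x. x i) = \<nu>" using that \<nu> by (intro distr_PiM_component) auto
      have "integrable ?M (\<lambda>x. x i j * x i k)"
        using i2[OF that(3,4)] that by (subst (asm) d[symmetric]) (simp add: integrable_distr_eq)
      moreover have "(\<integral>x. x i j * x i k \<partial>?M) = (\<integral>y. y j * y k \<partial>distr ?M \<nu> (\<lambda>x. x i))"
        using that by (subst integral_distr) auto
      ultimately show ?thesis using True cov[OF that(3,4)] by (simp add: d[unfolded True])
    next
      case False
      \<comment> \<open>For distinct units the product is written as a product over all units, with
        factor 1 elsewhere; its integral then factorizes, and the factor of unit \<open>i\<close>
        has mean 0.\<close>
      define f where "f m y = (if m = i then y j else if m = l then y k else 1 :: real)" for m and y :: "nat \<Rightarrow> real"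
      have fi: "integrable \<nu> (f m)" for m
        unfolding f_def using i1 that by (cases "m = i"; cases "m = l") simp_all
      have eq: "(\<Prod>m<n. f m (x m)) = x i j * x l k" for x
      proof -
        have "(\<Prod>m<n. f m (x m)) = f i (x i) * (f l (x l) * (\<Prod>m\<in>{..<n} - {i} - {l}. f m (x m)))"
          using that False by (subst prod.remove[of _ i], simp, simp, subst prod.remove[of _ l]) auto
        also have "(\<Prod>m\<in>{..<n} - {i} - {l}. f m (x m)) = 1" by (intro prod.neutral) (auto simp: f_def)
        finally show ?thesis using False by (simp add: f_def)
      qed
      have "integrable ?M (\<lambda>x. \<Prod>m<n. f m (x m))" by (intro product_integrable_prod fi) auto
      moreover have "(\<integral>x. (\<Prod>m<n. f m (x m)) \<partial>?M) = (\<Prod>m<n. integral\<^sup>L \<nu> (f m))"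
        by (intro product_integral_prod fi) auto
      moreover have "integral\<^sup>L \<nu> (f i) = 0" unfolding f_def using mean that by simp
      then have "(\<Prod>m<n. integral\<^sup>L \<nu> (f m)) = 0" using that by (intro prod_zero) auto
      ultimately show ?thesis using False by (simp add: eq)
    qed
    then show "integrable ?M (\<lambda>x. x i j * x l k)" "(\<integral>x. x i j * x l k \<partial>?M) = (if i = l \<and> j = k then V j else 0)" by auto
  qed
  let ?f = "\<lambda>j p. \<Sum>i<n. mean_weight n (snd p) i * fst p i j"
  have fm[measurable]: "?f j \<in> borel_measurable (?M \<Otimes>\<^sub>M measure_pmf (CR n))" if "j < d" for j
  proof (intro borel_measurable_sum borel_measurable_times)
    fix i assume i: "i \<in> {..<n}"
    show "(\<lambda>p. mean_weight n (snd p) i) \<in> borel_measurable (?M \<Otimes>\<^sub>M measure_pmf (CR n))"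
      by (rule measurable_compose[OF measurable_snd]) simp
    have [measurable]: "(\<lambda>x. x i j) \<in> borel_measurable ?M" using i that by measurable
    show "(\<lambda>p. fst p i j) \<in> borel_measurable (?M \<Otimes>\<^sub>M measure_pmf (CR n))" by measurable
  qed
  have md: "(case p of (x', t') \<Rightarrow> mean_diff n d x' t') $ j = ?f j p" if "j < d" for j p
    using that by (simp add: mean_diff_def mean_diff_weight split: prod.splits)
  have E1: "(\<integral>p. ?f j p \<partial>CR_law n \<nu>) = 0" if "j < d" for j
    unfolding CR_law_def using that e1
    by (subst M.integral_pair_finite_pmf) (auto simp: finite_set_pmf_CR)
  have E2: "(\<integral>p. ?f j p * ?f k p \<partial>CR_law n \<nu>) = (if j = k then mean_diff_var n * V j else 0)" if "j < d" "k < d" for j k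
  proof -
    have pr: "?f j (x, t) * ?f k (x, t) = (\<Sum>i<n. \<Sum>l<n. mean_weight n t i * mean_weight n t l * (x i j * x l k))" for x t
      by (simp add: sum_product mult_ac)
    have "(\<integral>p. ?f j p * ?f k p \<partial>CR_law n \<nu>) = (\<Sum>t\<in>set_pmf (CR n). pmf (CR n) t * (\<integral>x. ?f j (x, t) * ?f k (x, t) \<partial>?M))"
      unfolding CR_law_def
    proof (rule M.integral_pair_finite_pmf)
      show "integrable ?M (\<lambda>x. ?f j (x, t) * ?f k (x, t))" for t
        unfolding pr using e2 that by (intro Bochner_Integration.integrable_sum integrable_mult_right) auto
    qed (use that in \<open>auto simp: finite_set_pmf_CR\<close>)
    also have "\<dots> = (\<Sum>t\<in>set_pmf (CR n). pmf (CR n) t * (if j = k then (\<Sum>i<n. (mean_weight n t i)\<^sup>2) * V j else 0))"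
    proof (intro sum.cong refl arg_cong[of _ _ "\<lambda>x. _ * x"])
      fix t
      have "(\<integral>x. ?f j (x, t) * ?f k (x, t) \<partial>?M) = (\<Sum>i<n. \<Sum>l<n. mean_weight n t i * mean_weight n t l * (if i = l \<and> j = k then V j else 0))"
        unfolding pr using e2 that by (subst Bochner_Integration.integral_sum; auto intro!: sum.cong Bochner_Integration.integrable_sum)+
      also have "\<dots> = (if j = k then (\<Sum>i<n. (mean_weight n t i)\<^sup>2) * V j else 0)"
        by (simp add: if_distrib sum_distrib_right power2_eq_square cong: if_cong)
      finally show "(\<integral>x. ?f j (x, t) * ?f k (x, t) \<partial>?M) = (if j = k then (\<Sum>i<n. (mean_weight n t i)\<^sup>2) * V j else 0)" .
    qed
    also have "\<dots> = (if j = k then mean_diff_var n * V j else 0)"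
      unfolding mean_diff_var_def sum_mean_weight_squares
      by (subst integral_measure_pmf_real[OF finite_set_pmf_CR[of n]]) (auto simp: sum_distrib_left mult_ac)
    finally show ?thesis .
  qed
  show ?thesis
    unfolding cov_mat_def
  proof (rule eq_matI)
    fix j k assume "j < dim_row (Matrix.mat d d (\<lambda>(j, k). if j = k then mean_diff_var n * V j else 0))"
      "k < dim_col (Matrix.mat d d (\<lambda>(j, k). if j = k then mean_diff_var n * V j else 0))"
    then show "Matrix.mat d d (\<lambda>(j, k). LINT \<omega>|CR_law n \<nu>. ((case \<omega> of (x', t') \<Rightarrow> mean_diff n d x' t') $ j -
         (LINT \<omega>'|CR_law n \<nu>. (case \<omega>' of (x', t') \<Rightarrow> mean_diff n d x' t') $ j)) *
        ((case \<omega> of (x', t') \<Rightarrow> mean_diff n d x' t') $ k - (LINT \<omega>'|CR_law n \<nu>. (case \<omega>' of (x', t') \<Rightarrow> mean_diff n d x' t') $ k))) $$ (j, k) =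
       Matrix.mat d d (\<lambda>(j, k). if j = k then mean_diff_var n * V j else 0) $$ (j, k)"
      by (simp add: md E1 E2)
  qed auto
qed

lemma mahalanobis_eq:
  assumes "cov_mat d (CR_law n \<nu>) (\<lambda>(x', t'). mean_diff n d x' t') =
      Matrix.mat d d (\<lambda>(j, k). if j = k then w * V j else 0)" and w: "w \<noteq> 0" and V: "\<And>j. j < d \<Longrightarrow> V j \<noteq> 0"
  shows "mahalanobis n d \<nu> x t = (\<Sum>j<d. (group_mean n True x t j - group_mean n False x t j)\<^sup>2 / (w * V j))"
proof -
  have "minv (cov_mat d (CR_law n \<nu>) (\<lambda>(x', t'). mean_diff n d x' t')) = Matrix.mat d d (\<lambda>(j, k). if j = k then inverse (w * V j) else 0)"
    unfolding assms(1) using w V by (intro minv_diagonal) auto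
  moreover define v where "v = mean_diff n d x t"
  moreover have "v \<bullet> (Matrix.mat d d (\<lambda>(j, k). if j = k then inverse (w * V j) else 0) *\<^sub>v v) = (\<Sum>j<d. v $ j * (inverse (w * V j) * v $ j))"
    unfolding v_def scalar_prod_def
    by (simp add: mean_diff_def lessThan_atLeast0 scalar_prod_def if_distrib[of "\<lambda>x. x * _"] sum.delta cong: if_cong)
  moreover have "v $ j = group_mean n True x t j - group_mean n False x t j" if "j < d" for j
    using that by (simp add: v_def mean_diff_def)
  ultimately show ?thesis
    unfolding mahalanobis_def by (simp add: power2_eq_square divide_inverse mult_ac)
qed

text \<open>The treated group has binomial size, and exchanging \<open>k\<close> with
  \<open>n - k\<close> shows that both groups contribute the same amount. The term at
  \<open>k = 0\<close> is 0 by the convention on division.\<close>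

lemma mean_diff_var_eq: "mean_diff_var n = 2 * (\<Sum>k\<le>n. real (n choose k) / 2 ^ n / real k)"
proof -
  have 1: "measure_pmf.expectation (CR n) (\<lambda>t. h (card {i. i < n \<and> t i})) = (\<Sum>k\<le>n. real (n choose k) / 2 ^ n * h k)" for h :: "nat \<Rightarrow> real"
  proof -
    have "binomial_pmf n (1/2) = map_pmf (\<lambda>f. card {x\<in>{..<n}. f x}) (CR n)"
      unfolding CR_def by (rule binomial_pmf_altdef') auto
    then have "measure_pmf.expectation (CR n) (\<lambda>t. h (card {i. i < n \<and> t i})) = measure_pmf.expectation (binomial_pmf n (1/2)) h"
      by simp
    also have "\<dots> = (\<Sum>k\<le>n. h k * pmf (binomial_pmf n (1/2)) k)"
      by (intro integral_measure_pmf_real) auto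
    also have "\<dots> = (\<Sum>k\<le>n. real (n choose k) / 2 ^ n * h k)"
      by (intro sum.cong refl) (simp add: power_add[symmetric] power_divide mult_ac field_simps)
    finally show ?thesis .
  qed
  have 2: "card {i. i < n \<and> \<not> t i} = n - card {i. i < n \<and> t i}" for t
  proof -
    have "{i. i < n \<and> \<not> t i} = {..<n} - {i. i < n \<and> t i}" by auto
    then show ?thesis by (simp only:) (subst card_Diff_subset, auto)
  qed
  have "mean_diff_var n = (\<Sum>k\<le>n. real (n choose k) / 2 ^ n * (1 / real k + 1 / real (n - k)))"
    unfolding mean_diff_var_def 2 by (rule 1)
  also have "\<dots> = (\<Sum>k\<le>n. real (n choose k) / 2 ^ n / real k) + (\<Sum>k\<le>n. real (n choose k) / 2 ^ n / real (n - k))"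
    by (simp add: sum.distrib distrib_left)
  also have "(\<Sum>k\<le>n. real (n choose k) / 2 ^ n / real (n - k)) = (\<Sum>k\<le>n. real (n choose k) / 2 ^ n / real k)"
    by (rule sum.reindex_bij_witness[of _ "\<lambda>k. n - k" "\<lambda>k. n - k"]) (auto simp: binomial_symmetric[symmetric])
  finally show ?thesis by simp
qed

text \<open>\<open>1/k\<close> is compared with \<open>1/(k+1)\<close> and \<open>1/((k+1)(k+2))\<close>, whose binomial averages have closed forms.\<close>

lemma mean_diff_var_limit: "(\<lambda>n. real n * mean_diff_var n) \<longlonglongrightarrow> 4"
proof -
  have frac: "x / r / c = y / (m * r)" if "c * y = m * x" "c \<noteq> 0" "m \<noteq> 0" for x y c m r :: real
  proof -
    have "x = c * y / m" using that by (simp add: field_simps)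
    then show ?thesis using that(2,3) by simp
  qed
  \<comment> \<open>The absorption identity
    \<open>(k + 1) * (n + 1 choose k + 1) = (n + 1) * (n choose k)\<close> turns the weighted sum
    into the sum of the next row without its first term.\<close>
  have s1: "(\<Sum>k\<le>n. real (n choose k) / 2 ^ n / real (k + 1)) = (2 ^ Suc n - 1) / (real (n + 1) * 2 ^ n)" for n
  proof -
    have "real (n choose k) / 2 ^ n / real (k + 1) = real (Suc n choose Suc k) / (real (n + 1) * 2 ^ n)" for k
    proof -
      have "real (Suc k) * real (Suc n choose Suc k) = real (Suc n) * real (n choose k)"
        using Suc_times_binomial[of k n] by (metis of_nat_mult)
      then show ?thesis by (intro frac) simp_all
    qed
    then have "(\<Sum>k\<le>n. real (n choose k) / 2 ^ n / real (k + 1)) = (\<Sum>k\<le>n. real (Suc n choose Suc k)) / (real (n + 1) * 2 ^ n)"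
      by (simp only: sum_divide_distrib)
    also have "(\<Sum>k\<le>n. real (Suc n choose Suc k)) = 2 ^ Suc n - 1"
    proof -
      have "(\<Sum>k\<le>Suc n. real (Suc n choose k)) = real (2 ^ Suc n)"
        using choose_row_sum[of "Suc n"] by (metis of_nat_sum)
      then show ?thesis by (subst (asm) sum.atMost_Suc_shift) simp
    qed
    finally show ?thesis .
  qed
  \<comment> \<open>Absorbing twice reaches row \<open>n + 2\<close>; its two missing first terms
    only make the sum smaller.\<close>
  have s2: "(\<Sum>k\<le>n. real (n choose k) / 2 ^ n / (real (k + 1) * real (k + 2))) \<le> 4 / (real (n + 1) * real (n + 2))" for n
  proof -
    have "real (n choose k) / 2 ^ n / (real (k + 1) * real (k + 2)) = real (Suc (Suc n) choose Suc (Suc k)) / (real (n + 1) * real (n + 2) * 2 ^ n)" for k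
    proof -
      have "real (Suc k) * real (Suc n choose Suc k) = real (Suc n) * real (n choose k)"
         "real (Suc (Suc k)) * real (Suc (Suc n) choose Suc (Suc k)) = real (Suc (Suc n)) * real (Suc n choose Suc k)"
        using Suc_times_binomial[of k n] Suc_times_binomial[of "Suc k" "Suc n"] by (metis of_nat_mult)+
      then have "real (Suc k) * (real (Suc (Suc k)) * real (Suc (Suc n) choose Suc (Suc k))) = real (Suc (Suc n)) * (real (Suc n) * real (n choose k))"
        by (metis mult.left_commute)
      then show ?thesis by (intro frac) (simp_all add: mult_ac del: binomial_Suc_Suc)
    qed
    then have "(\<Sum>k\<le>n. real (n choose k) / 2 ^ n / (real (k + 1) * real (k + 2))) = (\<Sum>k\<le>n. real (Suc (Suc n) choose Suc (Suc k))) / (real (n + 1) * real (n + 2) * 2 ^ n)"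
      by (simp only: sum_divide_distrib)
    also have "(\<Sum>k\<le>n. real (Suc (Suc n) choose Suc (Suc k))) \<le> 2 ^ (n + 2)"
    proof -
      have "(\<Sum>k\<le>Suc (Suc n). real (Suc (Suc n) choose k)) = real (2 ^ (n + 2))"
        using choose_row_sum[of "Suc (Suc n)"] by (metis of_nat_sum add_2_eq_Suc')
      then show ?thesis by (subst (asm) sum.atMost_Suc_shift, subst (asm) sum.atMost_Suc_shift) (simp del: binomial_Suc_Suc)
    qed
    then have "(\<Sum>k\<le>n. real (Suc (Suc n) choose Suc (Suc k))) / (real (n + 1) * real (n + 2) * 2 ^ n) \<le> 2 ^ (n + 2) / (real (n + 1) * real (n + 2) * 2 ^ n)"
      by (intro divide_right_mono) auto
    also have "\<dots> = 4 / (real (n + 1) * real (n + 2))" by (simp add: power_add)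
    finally show ?thesis by simp
  qed
  have lo: "real n * (2 * ((2 ^ Suc n - 1) / (real (n + 1) * 2 ^ n) - 1 / 2 ^ n)) \<le> real n * mean_diff_var n" for n
  proof -
    \<comment> \<open>\<open>1 / real 0\<close> is 0 while \<open>1 / (0 + 1)\<close> is 1, so the
      term at \<open>k = 0\<close> is corrected by its binomial weight.\<close>
    have "(\<Sum>k\<le>n. real (n choose k) / 2 ^ n / real (k + 1) - (if k = 0 then 1 / 2 ^ n else 0)) \<le> (\<Sum>k\<le>n. real (n choose k) / 2 ^ n / real k)"
      by (intro sum_mono) (auto intro!: divide_left_mono)
    then show ?thesis unfolding mean_diff_var_eq s1[symmetric] by (intro mult_left_mono) (simp_all add: sum_subtractf)
  qed
  have hi: "real n * mean_diff_var n \<le> real n * (2 * ((2 ^ Suc n - 1) / (real (n + 1) * 2 ^ n) + 3 * (4 / (real (n + 1) * real (n + 2)))))" for n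
  proof -
    \<comment> \<open>The constant 3 comes from
      \<open>1 / k - 1 / (k + 1) = 1 / (k * (k + 1))\<close> and \<open>(k + 2) / k \<le> 3\<close>
      for \<open>k \<ge> 1\<close>; at \<open>k = 0\<close> the left side is 0.\<close>
    have "1 / real k \<le> 1 / real (k + 1) + 3 * (1 / (real (k + 1) * real (k + 2)))" for k
    proof (cases "k = 0")
      case False
      define x where "x = real k"
      have x: "1 \<le> x" using False by (simp add: x_def)
      have "1 / (x + 1) + 3 * (1 / ((x + 1) * (x + 2))) - 1 / x = (2 * x - 2) / (x * ((x + 1) * (x + 2)))"
        using x by (simp add: divide_simps) (simp add: algebra_simps)
      moreover have "0 \<le> (2 * x - 2) / (x * ((x + 1) * (x + 2)))" using x by (intro divide_nonneg_nonneg mult_nonneg_nonneg) auto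
      ultimately have "1 / x \<le> 1 / (x + 1) + 3 * (1 / ((x + 1) * (x + 2)))" by linarith
      then show ?thesis by (simp add: x_def add.commute)
    qed simp
    then have "real (n choose k) / 2 ^ n * (1 / real k) \<le> real (n choose k) / 2 ^ n * (1 / real (k + 1) + 3 * (1 / (real (k + 1) * real (k + 2))))" for k
      by (intro mult_left_mono) auto
    then have "(\<Sum>k\<le>n. real (n choose k) / 2 ^ n * (1 / real k)) \<le> (\<Sum>k\<le>n. real (n choose k) / 2 ^ n * (1 / real (k + 1) + 3 * (1 / (real (k + 1) * real (k + 2)))))"
      by (intro sum_mono)
    also have "\<dots> = (\<Sum>k\<le>n. real (n choose k) / 2 ^ n / real (k + 1)) + 3 * (\<Sum>k\<le>n. real (n choose k) / 2 ^ n / (real (k + 1) * real (k + 2)))"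
      by (simp add: distrib_left sum.distrib sum_distrib_left mult_ac)
    also have "\<dots> \<le> (2 ^ Suc n - 1) / (real (n + 1) * 2 ^ n) + 3 * (4 / (real (n + 1) * real (n + 2)))"
      unfolding s1 using s2[of n] by simp
    finally have "(\<Sum>k\<le>n. real (n choose k) / 2 ^ n / real k) \<le> (2 ^ Suc n - 1) / (real (n + 1) * 2 ^ n) + 3 * (4 / (real (n + 1) * real (n + 2)))"
      by simp
    then show ?thesis unfolding mean_diff_var_eq by (intro mult_left_mono) auto
  qed
  show ?thesis
  proof (rule tendsto_sandwich[OF always_eventually[OF allI[OF lo]] always_eventually[OF allI[OF hi]]])
    show "(\<lambda>n. real n * (2 * ((2 ^ Suc n - 1) / (real (n + 1) * 2 ^ n) - 1 / 2 ^ n))) \<longlonglongrightarrow> 4" by (real_asymp; simp add: exp_minus)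
    show "(\<lambda>n. real n * (2 * ((2 ^ Suc n - 1) / (real (n + 1) * 2 ^ n) + 3 * (4 / (real (n + 1) * real (n + 2)))))) \<longlonglongrightarrow> 4" by (real_asymp; simp add: exp_minus)
  qed
qed

section \<open>Measurability of the statistics\<close>

lemma borel_measurable_scalar_prod:
  assumes "\<And>w. u w \<in> carrier_vec n" "\<And>w. v w \<in> carrier_vec n"
    and "\<And>i. i < n \<Longrightarrow> (\<lambda>w. u w $ i :: real) \<in> borel_measurable M" "\<And>i. i < n \<Longrightarrow> (\<lambda>w. v w $ i) \<in> borel_measurable M"
  shows "(\<lambda>w. u w \<bullet> v w) \<in> borel_measurable M"
proof -
  have "(\<lambda>w. \<Sum>i\<in>{0..<n}. u w $ i * v w $ i) \<in> borel_measurable M"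
    using assms(3,4) by (intro borel_measurable_sum borel_measurable_times) auto
  moreover have "dim_vec (v w) = n" for w using assms(2)[of w] by simp
  ultimately show ?thesis by (simp only: scalar_prod_def)
qed

lemma borel_measurable_mult_mat_vec:
  assumes "\<And>w. A w \<in> carrier_mat m n" "\<And>w. v w \<in> carrier_vec n"
    and "\<And>i j. i < m \<Longrightarrow> j < n \<Longrightarrow> (\<lambda>w. A w $$ (i, j) :: real) \<in> borel_measurable M" "\<And>i. i < n \<Longrightarrow> (\<lambda>w. v w $ i) \<in> borel_measurable M"
    and i: "i < m"
  shows "(\<lambda>w. (A w *\<^sub>v v w) $ i) \<in> borel_measurable M"
proof -
  have "(\<lambda>w. row (A w) i \<bullet> v w) \<in> borel_measurable M"
  proof (rule borel_measurable_scalar_prod[OF _ assms(2)])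
    show "row (A w) i \<in> carrier_vec n" for w using row_carrier_vec[OF i assms(1)] .
    fix j assume j: "j < n"
    have "row (A w) i $ j = A w $$ (i, j)" for w using assms(1)[of w] i j by auto
    then show "(\<lambda>w. row (A w) i $ j) \<in> borel_measurable M" using assms(3)[OF i j] by simp
  qed (use assms in auto)
  moreover have "(A w *\<^sub>v v w) $ i = row (A w) i \<bullet> v w" for w using assms(1)[of w] i by auto
  ultimately show ?thesis by simp
qed

lemma borel_measurable_test_stat:
  assumes t: "\<And>i. i < n \<Longrightarrow> (\<lambda>w. of_bool (t w i) :: real) \<in> borel_measurable M"
    and x: "\<And>i j. i < n \<Longrightarrow> j < d \<Longrightarrow> (\<lambda>w. x w i j) \<in> borel_measurable M"
    and e: "\<And>i. i < n \<Longrightarrow> (\<lambda>w. e w i) \<in> borel_measurable M" and p: "p \<le> d"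
  shows "(\<lambda>w. test_stat n p (t w) (x w) (outcome n d \<mu>1 \<mu>2 \<beta> (t w) (x w) (e w))) \<in> borel_measurable M"
proof -
  let ?m = "p + 2"
  define G where "G w = design n p (t w) (x w)" for w
  define Y where "Y w = outcome n d \<mu>1 \<mu>2 \<beta> (t w) (x w) (e w)" for w
  define A where "A w = (G w)\<^sup>T * G w" for w
  define g where "g w = (G w)\<^sup>T *\<^sub>v Y w" for w
  define L where "L = contrast p"
  have G: "G w \<in> carrier_mat n ?m" "(G w)\<^sup>T \<in> carrier_mat ?m n" and Y: "Y w \<in> carrier_vec n"
    and L: "L \<in> carrier_vec ?m" for w
    by (simp_all add: G_def Y_def L_def design_def outcome_def contrast_def)
  have A: "A w \<in> carrier_mat ?m ?m" for w unfolding A_def by (rule mult_carrier_mat[OF G(2,1)])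
  have g: "g w \<in> carrier_vec ?m" for w
    unfolding g_def by (rule mult_mat_vec_carrier[OF G(2) Y])
  have mG: "(\<lambda>w. G w $$ (i, k)) \<in> borel_measurable M" if "i < n" "k < ?m" for i k
  proof -
    have "(\<lambda>w. if k = 0 then of_bool (t w i) else if k = 1 then 1 - of_bool (t w i) else x w i (k - 2)) \<in> borel_measurable M"
      using that p by (cases "k = 0"; cases "k = 1") (auto intro!: t x borel_measurable_diff)
    then show ?thesis using that by (simp add: G_def design_def)
  qed
  have mGT: "(\<lambda>w. (G w)\<^sup>T $$ (k, i)) \<in> borel_measurable M" if "i < n" "k < ?m" for i k
  proof -
    have "(G w)\<^sup>T $$ (k, i) = G w $$ (i, k)" for w
      using G(1)[of w] that by (intro index_transpose_mat) auto
    then show ?thesis using mG[OF that] by simp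
  qed
  have mY: "(\<lambda>w. Y w $ i) \<in> borel_measurable M" if "i < n" for i
    unfolding Y_def outcome_def using that
    by (auto intro!: borel_measurable_add borel_measurable_sum borel_measurable_times borel_measurable_diff t x e)
  have mA: "(\<lambda>w. A w $$ (k, l)) \<in> borel_measurable M" if "k < ?m" "l < ?m" for k l
  proof -
    have "A w $$ (k, l) = (\<Sum>i\<in>{0..<n}. G w $$ (i, k) * G w $$ (i, l))" for w
      using G[of w] that unfolding A_def by (auto simp: scalar_prod_def)
    then show ?thesis using that by (auto intro!: borel_measurable_sum borel_measurable_times mG)
  qed
  have mi: "minv (A w) \<in> carrier_mat ?m ?m" for w using minv_carrier[OF A] .
  have mmi: "(\<lambda>w. minv (A w) $$ (k, l)) \<in> borel_measurable M" if "k < ?m" "l < ?m" for k l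
    by (rule borel_measurable_minv[OF A mA that])
  have mg: "(\<lambda>w. g w $ k) \<in> borel_measurable M" if "k < ?m" for k
    unfolding g_def by (rule borel_measurable_mult_mat_vec[OF G(2) Y mGT mY that])
  have o: "ols (G w) (Y w) = minv (A w) *\<^sub>v g w" for w by (simp add: ols_def A_def g_def)
  have oc: "ols (G w) (Y w) \<in> carrier_vec ?m" for w unfolding o by (rule mult_mat_vec_carrier[OF mi g])
  have mo: "(\<lambda>w. ols (G w) (Y w) $ k) \<in> borel_measurable M" if "k < ?m" for k
    unfolding o by (rule borel_measurable_mult_mat_vec[OF mi g mmi mg that])
  have mGo: "(\<lambda>w. (G w *\<^sub>v ols (G w) (Y w)) $ i) \<in> borel_measurable M" if "i < n" for i
    by (rule borel_measurable_mult_mat_vec[OF G(1) oc mG mo that])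
  have mr: "(\<lambda>w. (Y w - G w *\<^sub>v ols (G w) (Y w)) $ i) \<in> borel_measurable M" if "i < n" for i
  proof -
    have "(Y w - G w *\<^sub>v ols (G w) (Y w)) $ i = Y w $ i - (G w *\<^sub>v ols (G w) (Y w)) $ i" for w
      using that G(1)[of w] by (intro index_minus_vec) auto
    then show ?thesis using mGo[OF that] mY[OF that] by simp
  qed
  have rc: "Y w - G w *\<^sub>v ols (G w) (Y w) \<in> carrier_vec n" for w
    by (rule minus_carrier_vec[OF Y mult_mat_vec_carrier[OF G(1) oc]])
  have "(\<lambda>w. resid_var (G w) (Y w)) \<in> borel_measurable M"
  proof -
    have "dim_row (G w) = n" "dim_col (G w) = ?m" for w using G(1)[of w] by auto
    then show ?thesis unfolding resid_var_def Let_def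
      by (simp only:) (intro borel_measurable_divide borel_measurable_const borel_measurable_scalar_prod[OF rc rc mr mr])
  qed
  moreover have "(\<lambda>w. L \<bullet> ols (G w) (Y w)) \<in> borel_measurable M"
    by (rule borel_measurable_scalar_prod[OF L oc _ mo]) simp
  moreover have "(\<lambda>w. L \<bullet> (minv (A w) *\<^sub>v L)) \<in> borel_measurable M"
  proof (rule borel_measurable_scalar_prod[OF L])
    show "minv (A w) *\<^sub>v L \<in> carrier_vec ?m" for w by (rule mult_mat_vec_carrier[OF mi L])
    show "(\<lambda>w. (minv (A w) *\<^sub>v L) $ i) \<in> borel_measurable M" if "i < ?m" for i
      by (rule borel_measurable_mult_mat_vec[OF mi L mmi _ that]) auto
  qed auto
  ultimately have [measurable]: "(\<lambda>w. resid_var (G w) (Y w)) \<in> borel_measurable M" "(\<lambda>w. L \<bullet> ols (G w) (Y w)) \<in> borel_measurable M"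
    "(\<lambda>w. L \<bullet> (minv (A w) *\<^sub>v L)) \<in> borel_measurable M"
    by simp_all
  have "(\<lambda>w. (L \<bullet> ols (G w) (Y w)) / sqrt (resid_var (G w) (Y w) * (L \<bullet> (minv (A w) *\<^sub>v L)))) \<in> borel_measurable M"
    by measurable
  then show ?thesis by (simp add: test_stat_def Let_def G_def Y_def A_def L_def)
qed

lemma borel_measurable_mean_difference:
  assumes t: "\<And>i. i < n \<Longrightarrow> (\<lambda>w. of_bool (t w i) :: real) \<in> borel_measurable M"
    and x: "\<And>i. i < n \<Longrightarrow> (\<lambda>w. x w i j) \<in> borel_measurable M"
  shows "(\<lambda>w. group_mean n True (x w) (t w) j - group_mean n False (x w) (t w) j) \<in> borel_measurable M"
proof -
  have c: "real (card {i. i < n \<and> P i}) = (\<Sum>i<n. of_bool (P i))" for P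
  proof -
    have "{i. i < n \<and> P i} = {..<n} \<inter> {i. P i}" by auto
    then show ?thesis by simp
  qed
  have "of_bool (\<not> t w i) = 1 - (of_bool (t w i) :: real)" for w i by simp
  then show ?thesis
    unfolding mean_diff_weight mean_weight_def c
    by (intro borel_measurable_sum borel_measurable_times borel_measurable_diff borel_measurable_divide)
       (auto intro!: t x borel_measurable_diff borel_measurable_sum)
qed

text \<open>This and the next two lemmas allow data to be restricted to the first \<open>n\<close>
  units, and assignments to be set to false beyond them, without changing the statistics.\<close>

lemma group_mean_cong:
  assumes "\<And>i. i < n \<Longrightarrow> t i = t' i" "\<And>i. i < n \<Longrightarrow> x i j = x' i j"
  shows "group_mean n b x t j = group_mean n b x' t' j"
proof -
  have "{i. i < n \<and> t i = b} = {i. i < n \<and> t' i = b}" using assms by auto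
  then show ?thesis unfolding group_mean_def using assms by (auto intro!: arg_cong2[of _ _ _ _ "(/)"] sum.cong)
qed

lemma mahalanobis_cong:
  assumes "\<And>i. i < n \<Longrightarrow> t i = t' i" "\<And>i j. i < n \<Longrightarrow> j < d \<Longrightarrow> x i j = x' i j"
  shows "mahalanobis n d \<nu> x t = mahalanobis n d \<nu> x' t'"
proof -
  have "mean_diff n d x t = mean_diff n d x' t'"
    unfolding mean_diff_def using assms by (intro eq_vecI) (auto intro!: arg_cong2[of _ _ _ _ "(-)"] group_mean_cong)
  then show ?thesis by (simp add: mahalanobis_def)
qed

lemma test_stat_cong:
  assumes "\<And>i. i < n \<Longrightarrow> t i = t' i" "\<And>i j. i < n \<Longrightarrow> j < d \<Longrightarrow> x i j = x' i j" "\<And>i. i < n \<Longrightarrow> e i = e' i" "p \<le> d"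
  shows "test_stat n p t x (outcome n d \<mu>1 \<mu>2 \<beta> t x e) = test_stat n p t' x' (outcome n d \<mu>1 \<mu>2 \<beta> t' x' e')"
proof -
  have "design n p t x = design n p t' x'"
    unfolding design_def using assms by (intro eq_matI) auto
  moreover have "outcome n d \<mu>1 \<mu>2 \<beta> t x e = outcome n d \<mu>1 \<mu>2 \<beta> t' x' e'"
    unfolding outcome_def using assms by (intro eq_vecI) auto
  ultimately show ?thesis by (simp add: test_stat_def)
qed

lemma borel_measurable_mahalanobis:
  assumes x: "\<And>i j. i < n \<Longrightarrow> j < d \<Longrightarrow> (\<lambda>w. x w i j) \<in> borel_measurable M"
  shows "(\<lambda>w. mahalanobis n d \<nu> (x w) t) \<in> borel_measurable M"
  unfolding mahalanobis_def
proof (rule borel_measurable_scalar_prod[where n=d])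
  let ?W = "minv (cov_mat d (CR_law n \<nu>) (\<lambda>(x', t'). mean_diff n d x' t'))"
  have c: "?W \<in> carrier_mat d d" by (rule minv_carrier) (simp add: cov_mat_def)
  have md: "(\<lambda>w. mean_diff n d (x w) t $ j) \<in> borel_measurable M" if "j < d" for j
    unfolding mean_diff_def using that x by (simp add: borel_measurable_mean_difference)
  show "mean_diff n d (x w) t \<in> carrier_vec d" for w by (simp add: mean_diff_def)
  show "?W *\<^sub>v mean_diff n d (x w) t \<in> carrier_vec d" for w
    by (rule mult_mat_vec_carrier[OF c]) (simp add: mean_diff_def)
  show "(\<lambda>w. (?W *\<^sub>v mean_diff n d (x w) t) $ i) \<in> borel_measurable M" if "i < d" for i
    by (rule borel_measurable_mult_mat_vec[OF c _ _ md that]) (auto simp: mean_diff_def)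
  show "(\<lambda>w. mean_diff n d (x w) t $ i) \<in> borel_measurable M" if "i < d" for i using md[OF that] .
qed

section \<open>Complete randomization\<close>

text \<open>Assignments are coded by real signs so that they become columns of the same array as
  covariates and errors.\<close>

definition sign_law :: "real measure" where
  "sign_law = distr (measure_pmf (bernoulli_pmf (1/2))) borel (\<lambda>b. if b then 1 else -1)"

lemma sign_law:
  shows prob_space_sign_law: "prob_space sign_law" and sets_sign_law: "sets sign_law = sets borel"
    and integral_sign_law: "h \<in> borel_measurable borel \<Longrightarrow> (\<integral>y. h y \<partial>sign_law) = (h 1 + h (-1)) / (2::real)"
    and integrable_sign_law: "h \<in> borel_measurable borel \<Longrightarrow> integrable sign_law h"
    and AE_sign_law: "AE y in sign_law. y = 1 \<or> y = -1"
    and measure_sign_law: "measure sign_law {y. (0 < y) = b} = 1 / 2"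
proof -
  show "prob_space sign_law" unfolding sign_law_def by (intro prob_space.prob_space_distr prob_space_measure_pmf) simp
  show "sets sign_law = sets borel" by (simp add: sign_law_def)
  show i: "(\<integral>y. h y \<partial>sign_law) = (h 1 + h (-1)) / (2::real)" if "h \<in> borel_measurable borel" for h
    using that unfolding sign_law_def by (subst integral_distr) (auto simp: integral_bernoulli_pmf field_simps)
  show "integrable sign_law h" if "h \<in> borel_measurable borel" for h :: "real \<Rightarrow> real"
    using that unfolding sign_law_def by (subst integrable_distr_eq) (auto intro!: integrable_measure_pmf_finite)
  show "AE y in sign_law. y = 1 \<or> y = -1"
    unfolding sign_law_def by (subst AE_distr_iff) (auto intro!: always_eventually)
  have "measure sign_law {y. (0 < y) = b} = (\<integral>y. indicator {y. (0 < y) = b} y \<partial>sign_law)"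
    by (simp add: sign_law_def)
  also have "\<dots> = (indicator {y::real. (0 < y) = b} 1 + indicator {y::real. (0 < y) = b} (-1)) / 2"
    by (rule i[of "indicator {y. (0 < y) = b}"]) (cases b; simp)
  finally show "measure sign_law {y. (0 < y) = b} = 1 / 2" by (cases b) auto
qed

abbreviation normals :: "nat \<Rightarrow> (nat \<Rightarrow> real) measure" where
  "normals m \<equiv> PiM {..<m} (\<lambda>_. std_normal_distribution)"

text \<open>Rows are units, and columns are as in \<open>array_limits\<close>. All sample sizes
  share one infinite product space, so that limit theorems for sequences apply.\<close>

locale coordinate_world =
  fixes d :: nat and law :: "nat \<Rightarrow> real measure" and v :: "nat \<Rightarrow> real"
  assumes law_prob: "\<And>c. prob_space (law c)" and sets_law: "\<And>c. sets (law c) = sets borel"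
    and law_sq: "\<And>c. c < d + 3 \<Longrightarrow> integrable (law c) (\<lambda>y. y\<^sup>2)"
    and law_mean: "\<And>c. c < d + 3 \<Longrightarrow> (\<integral>y. y \<partial>law c) = 0"
    and law_var: "\<And>c. c < d + 3 \<Longrightarrow> (\<integral>y. y\<^sup>2 \<partial>law c) = v c"
    and v_pos: "\<And>c. c < d + 3 \<Longrightarrow> 0 < v c"
    and law_sign: "\<And>s. s \<in> {d+1, d+2} \<Longrightarrow> law s = sign_law"
begin

definition Om :: "(nat \<times> nat \<Rightarrow> real) measure" where
  "Om = PiM UNIV (\<lambda>k. law (snd k))"

sublocale coords: product_prob_space "\<lambda>k. law (snd k)" "UNIV :: (nat \<times> nat) set"
  by (rule product_prob_spaceI) (rule law_prob)

sublocale Om: prob_space Om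
  unfolding Om_def by (rule prob_space_PiM) (rule law_prob)

lemma measurable_law [simp]: "measurable (law c) M = measurable borel M" "measurable M (law c) = measurable M borel"
  by (intro measurable_cong_sets sets_law refl)+

lemma coord_measurable [measurable]: "(\<lambda>\<omega>. \<omega> k) \<in> borel_measurable Om"
  using measurable_component_singleton[of k UNIV "\<lambda>k. law (snd k)"] by (simp add: Om_def)

lemma space_Om: "space Om = UNIV"
  using sets_eq_imp_space_eq[OF sets_law] by (simp add: Om_def space_PiM PiE_UNIV_domain)

lemma distr_coord: "distr Om borel (\<lambda>\<omega>. \<omega> k) = law (snd k)"
proof -
  have "distr Om (law (snd k)) (\<lambda>\<omega>. \<omega> k) = law (snd k)"
    unfolding Om_def by (rule distr_PiM_component) (auto intro: law_prob)
  moreover have "distr Om (law (snd k)) (\<lambda>\<omega>. \<omega> k) = distr Om borel (\<lambda>\<omega>. \<omega> k)"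
    by (intro distr_cong sets_law) auto
  ultimately show ?thesis by simp
qed

lemma indep_coords: "Om.indep_vars (\<lambda>_. borel) (\<lambda>k \<omega>. \<omega> k) UNIV"
proof (subst Om.indep_vars_iff_distr_eq_PiM)
  have "distr Om (PiM UNIV (\<lambda>_. borel)) (\<lambda>\<omega>. \<lambda>k\<in>UNIV. \<omega> k) = distr Om Om (\<lambda>\<omega>. \<omega>)"
    unfolding Om_def by (intro distr_cong sets_PiM_cong refl) (auto simp: sets_law)
  then show "distr Om (PiM UNIV (\<lambda>_. borel)) (\<lambda>\<omega>. \<lambda>k\<in>UNIV. \<omega> k) = PiM UNIV (\<lambda>k. distr Om borel (\<lambda>\<omega>. \<omega> k))"
    by (simp add: distr_coord) (simp add: Om_def distr_id)
qed simp_all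

definition row :: "nat \<Rightarrow> (nat \<times> nat \<Rightarrow> real) \<Rightarrow> nat \<Rightarrow> real" where
  "row i \<omega> = (\<lambda>c\<in>{..<d+3}. \<omega> (i, c))"

lemma row_measurable [measurable]: "row i \<in> measurable Om (PiM {..<d+3} (\<lambda>_. borel))"
  unfolding row_def by measurable

lemma indep_rows:
  assumes f: "f \<in> measurable (PiM {..<d+3} (\<lambda>_. borel)) N"
  shows "Om.indep_vars (\<lambda>_. N) (\<lambda>i \<omega>. f (row i \<omega>)) UNIV"
proof -
  have "Om.indep_vars (\<lambda>i. PiM (Pair i ` {..<d+3}) (\<lambda>_. borel)) (\<lambda>i \<omega>. restrict (\<lambda>k. \<omega> k) (Pair i ` {..<d+3})) UNIV"
    by (rule Om.indep_vars_restrict[OF indep_coords]) (auto simp: disjoint_family_on_def)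
  then have "Om.indep_vars (\<lambda>_. N) (\<lambda>i \<omega>. (\<lambda>g. f (\<lambda>c\<in>{..<d+3}. g (i, c))) (restrict (\<lambda>k. \<omega> k) (Pair i ` {..<d+3}))) UNIV"
  proof (rule Om.indep_vars_compose2)
    fix i :: nat
    have "(\<lambda>g. \<lambda>c\<in>{..<d+3}. g (i, c)) \<in> measurable (PiM (Pair i ` {..<d+3}) (\<lambda>_. borel)) (PiM {..<d+3} (\<lambda>_. borel :: real measure))"
      by (intro measurable_restrict measurable_component_singleton) auto
    from measurable_compose[OF this f]
    show "(\<lambda>g. f (\<lambda>c\<in>{..<d+3}. g (i, c))) \<in> measurable (PiM (Pair i ` {..<d+3}) (\<lambda>_. borel)) N" .
  qed
  moreover have "(\<lambda>c\<in>{..<d+3}. restrict (\<lambda>k. \<omega> k) (Pair i ` {..<d+3}) (i, c)) = row i \<omega>" for i and \<omega> :: "nat \<times> nat \<Rightarrow> real"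
    by (auto simp: row_def restrict_def fun_eq_iff)
  ultimately show ?thesis by simp
qed

lemma distr_row: "distr Om (PiM {..<d+3} (\<lambda>_. borel)) (row i) = PiM {..<d+3} law"
proof -
  have "distr Om (PiM {..<d+3} (\<lambda>c. law (snd (i, c)))) (\<lambda>\<omega>. \<lambda>c\<in>{..<d+3}. \<omega> (i, c)) = PiM {..<d+3} (\<lambda>c. law (snd (i, c)))"
    unfolding Om_def by (rule distr_PiM_reindex) (auto simp: law_prob inj_on_def)
  moreover have "distr Om (PiM {..<d+3} (\<lambda>c. law (snd (i, c)))) (\<lambda>\<omega>. \<lambda>c\<in>{..<d+3}. \<omega> (i, c)) = distr Om (PiM {..<d+3} (\<lambda>_. borel)) (row i)"
    by (intro distr_cong sets_PiM_cong) (auto simp: sets_law row_def)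
  ultimately show ?thesis by simp
qed

lemma distr_row_fun:
  assumes f: "f \<in> borel_measurable (PiM {..<d+3} (\<lambda>_. borel))"
  shows "distr Om borel (\<lambda>\<omega>. f (row i \<omega>)) = distr Om borel (\<lambda>\<omega>. f (row 0 \<omega>))"
  using distr_distr[OF f row_measurable[of i]] distr_distr[OF f row_measurable[of 0]]
  by (simp add: distr_row comp_def)

lemma law_integrable: "c < d + 3 \<Longrightarrow> integrable (law c) (\<lambda>y. y)"
proof -
  assume "c < d + 3"
  interpret prob_space "law c" by (rule law_prob)
  show ?thesis using square_integrable_imp_integrable[OF _ law_sq[OF \<open>c < d + 3\<close>]] by simp
qed

text \<open>A coordinate that occurs in only one of the monomials contributes its mean 0, one that
  occurs in both contributes its variance. By independence, distinct square-free monomials are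
  therefore orthogonal.\<close>

lemma
  assumes fin: "finite A" "finite B" and A: "\<And>k. k \<in> A \<union> B \<Longrightarrow> snd k < d + 3"
  shows integrable_monomials: "integrable Om (\<lambda>\<omega>. (\<Prod>k\<in>A. \<omega> k) * (\<Prod>k\<in>B. \<omega> k))"
    and integral_monomials: "(\<integral>\<omega>. (\<Prod>k\<in>A. \<omega> k) * (\<Prod>k\<in>B. \<omega> k) \<partial>Om) = (if A = B then \<Prod>k\<in>A. v (snd k) else 0)"
proof -
  define h where "h k y = (if k \<in> A then y else 1) * (if k \<in> B then y else 1 :: real)" for k :: "nat \<times> nat" and y
  have hm[measurable]: "h k \<in> borel_measurable borel" for k unfolding h_def by (cases "k \<in> A"; cases "k \<in> B") simp_all
  have hc: "integrable (law (snd k)) (h k) \<and> (\<integral>y. h k y \<partial>law (snd k)) = (if k \<in> A \<and> k \<in> B then v (snd k) else 0)" if "k \<in> A \<union> B" for k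
    using that A[OF that] law_integrable law_sq law_mean law_var unfolding h_def
    by (cases "k \<in> A"; cases "k \<in> B") (auto simp: power2_eq_square)
  have tr: "integrable Om (\<lambda>\<omega>. h k (\<omega> k)) = integrable (law (snd k)) (h k)" "(\<integral>\<omega>. h k (\<omega> k) \<partial>Om) = (\<integral>y. h k y \<partial>law (snd k))" for k
    unfolding distr_coord[of k, symmetric] by (auto simp: integrable_distr_eq integral_distr)
  have ind: "Om.indep_vars (\<lambda>_. borel) (\<lambda>k \<omega>. h k (\<omega> k)) (A \<union> B)"
    by (rule Om.indep_vars_compose2[OF Om.indep_vars_subset[OF indep_coords]]) auto
  have eq: "(\<Prod>k\<in>A. \<omega> k) * (\<Prod>k\<in>B. \<omega> k) = (\<Prod>k\<in>A\<union>B. h k (\<omega> k))" for \<omega>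
  proof -
    have "(\<Prod>k\<in>A. \<omega> k) = (\<Prod>k\<in>A\<union>B. if k \<in> A then \<omega> k else 1)" "(\<Prod>k\<in>B. \<omega> k) = (\<Prod>k\<in>A\<union>B. if k \<in> B then \<omega> k else 1)"
      using fin by (auto intro!: prod.mono_neutral_cong_left)
    then show ?thesis by (simp add: h_def prod.distrib)
  qed
  show "integrable Om (\<lambda>\<omega>. (\<Prod>k\<in>A. \<omega> k) * (\<Prod>k\<in>B. \<omega> k))"
    unfolding eq using hc fin by (intro Om.indep_vars_integrable[OF _ ind]) (auto simp: tr)
  have "(\<integral>\<omega>. (\<Prod>k\<in>A\<union>B. h k (\<omega> k)) \<partial>Om) = (\<Prod>k\<in>A\<union>B. \<integral>\<omega>. h k (\<omega> k) \<partial>Om)"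
    using hc fin by (intro Om.indep_vars_lebesgue_integral[OF _ ind]) (auto simp: tr)
  also have "\<dots> = (\<Prod>k\<in>A\<union>B. if k \<in> A \<and> k \<in> B then v (snd k) else 0)"
    using hc by (intro prod.cong refl) (simp only: tr)
  also have "\<dots> = (if A = B then \<Prod>k\<in>A. v (snd k) else 0)"
  proof (cases "A = B")
    case False
    then obtain k where "k \<in> A \<union> B" "\<not> (k \<in> A \<and> k \<in> B)" by auto
    then have "(\<Prod>k\<in>A\<union>B. if k \<in> A \<and> k \<in> B then v (snd k) else 0) = 0"
      using fin by (intro prod_zero) (auto intro!: bexI[of _ k])
    then show ?thesis using False by simp
  qed auto
  finally show "(\<integral>\<omega>. (\<Prod>k\<in>A. \<omega> k) * (\<Prod>k\<in>B. \<omega> k) \<partial>Om) = (if A = B then \<Prod>k\<in>A. v (snd k) else 0)"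
    unfolding eq .
qed

definition w :: "nat set \<Rightarrow> nat \<Rightarrow> (nat \<times> nat \<Rightarrow> real) \<Rightarrow> real" where
  "w A i \<omega> = (\<Prod>c\<in>A. \<omega> (i, c))"

lemma w_measurable [measurable]: "w A i \<in> borel_measurable Om"
  unfolding w_def by measurable

lemma w_eq_prod: "w A i \<omega> = (\<Prod>k\<in>Pair i ` A. \<omega> k)"
  unfolding w_def by (subst prod.reindex) (auto simp: inj_on_def)

lemma
  assumes A: "A \<subseteq> {..<d+3}" "A \<noteq> {}"
  shows integrable_w: "integrable Om (w A i)" and integral_w: "(\<integral>\<omega>. w A i \<omega> \<partial>Om) = 0"
proof -
  have fin: "finite A" using A finite_subset by blast
  have s: "snd k < d + 3" if "k \<in> Pair i ` A \<union> {}" for k using that A by auto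
  show "integrable Om (w A i)"
    unfolding w_eq_prod[abs_def] using integrable_monomials[of "Pair i ` A" "{}", OF _ _ s] fin by simp
  show "(\<integral>\<omega>. w A i \<omega> \<partial>Om) = 0"
    unfolding w_eq_prod using integral_monomials[of "Pair i ` A" "{}", OF _ _ s] fin A by simp
qed

lemma
  assumes A: "A \<subseteq> {..<d+3}" "A \<noteq> {}" and B: "B \<subseteq> {..<d+3}" "B \<noteq> {}"
  shows integrable_w_w: "integrable Om (\<lambda>\<omega>. w A i \<omega> * w B j \<omega>)"
    and integral_w_w: "(\<integral>\<omega>. w A i \<omega> * w B j \<omega> \<partial>Om) = (if i = j \<and> A = B then \<Prod>c\<in>A. v c else 0)"
proof -
  have fin: "finite A" "finite B" using A B finite_subset by blast+
  have P: "Pair i ` A = Pair j ` B \<longleftrightarrow> i = j \<and> A = B" 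
  proof (cases "i = j")
    case False
    then show ?thesis using A(2) by (auto dest!: equalityD1)
  qed (simp add: inj_image_eq_iff inj_on_def)
  have vA: "(\<Prod>k\<in>Pair i ` A. v (snd k)) = (\<Prod>c\<in>A. v c)" for i A by (subst prod.reindex) (auto simp: inj_on_def)
  show "integrable Om (\<lambda>\<omega>. w A i \<omega> * w B j \<omega>)"
    unfolding w_eq_prod using fin A B by (intro integrable_monomials) auto
  show "(\<integral>\<omega>. w A i \<omega> * w B j \<omega> \<partial>Om) = (if i = j \<and> A = B then \<Prod>c\<in>A. v c else 0)"
    unfolding w_eq_prod using fin A B by (subst integral_monomials) (auto simp: P vA)
qed

text \<open>For \<open>A = {j, s}\<close> with \<open>j < d\<close> this is, up to the factor
  \<open>sqrt (v j)\<close>, the normalized sum in the Mahalanobis distance; the other sets supply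
  the boundedness that \<open>array_limits\<close> asks for.\<close>

definition U :: "nat set \<Rightarrow> nat \<Rightarrow> (nat \<times> nat \<Rightarrow> real) \<Rightarrow> real" where
  "U A n \<omega> = (\<Sum>i<n. w A i \<omega>) / sqrt n"

lemma U_measurable [measurable]: "U A n \<in> borel_measurable Om"
  unfolding U_def by measurable

text \<open>The products of different units are orthogonal, so the second moment equals
  \<open>\<Prod>c\<in>A. v c\<close> for every positive \<open>n\<close>.\<close>

lemma U_bounded:
  assumes A: "A \<subseteq> {..<d+3}" "A \<noteq> {}"
  shows "bounded_prob Om (U A)"
proof (rule Om.bounded_prob_second_moment)
  have sq: "(U A n \<omega>)\<^sup>2 = (\<Sum>i<n. \<Sum>j<n. w A i \<omega> * w A j \<omega>) / n" for n \<omega>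
    by (simp add: U_def power_divide power2_eq_square sum_product)
  show "integrable Om (\<lambda>\<omega>. (U A n \<omega>)\<^sup>2)" for n
    unfolding sq using integrable_w_w[OF A A] by auto
  show "(\<integral>\<omega>. (U A n \<omega>)\<^sup>2 \<partial>Om) \<le> (\<Prod>c\<in>A. v c)" for n
  proof -
    have "(\<integral>\<omega>. (U A n \<omega>)\<^sup>2 \<partial>Om) = (\<Sum>i<n. \<Sum>j<n. if i = j \<and> A = A then \<Prod>c\<in>A. v c else 0) / n"
      unfolding sq using integrable_w_w[OF A A] integral_w_w[OF A A] by simp
    also have "\<dots> = (if n = 0 then 0 else (\<Prod>c\<in>A. v c))" by simp
    also have "\<dots> \<le> (\<Prod>c\<in>A. v c)"
    proof -
      have "0 \<le> v c" if "c \<in> A" for c using v_pos[of c] that A by auto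
      then show ?thesis by (simp add: prod_nonneg)
    qed
    finally show ?thesis .
  qed
qed simp

lemma squares_conv_prob:
  assumes c: "c < d + 3"
  shows "conv_prob Om (\<lambda>n \<omega>. (\<Sum>i<n. (\<omega> (i, c))\<^sup>2) / real n) (v c)"
proof -
  let ?\<mu> = "distr (law c) borel (\<lambda>y. y\<^sup>2)"
  have "conv_prob Om (\<lambda>n \<omega>. (\<Sum>i<n. (\<omega> (i, c))\<^sup>2) / real n) (\<integral>y. y \<partial>?\<mu>)"
  proof (rule Om.weak_law_large_numbers)
    have f: "(\<lambda>y. (y c :: real)\<^sup>2) \<in> borel_measurable (PiM {..<d+3} (\<lambda>_. borel))" using c
      by (intro borel_measurable_power measurable_component_singleton) auto
    show "Om.indep_vars (\<lambda>_. borel) (\<lambda>i \<omega>. (\<omega> (i, c))\<^sup>2) UNIV"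
      using indep_rows[OF f] c by (simp add: row_def)
    show "distr Om borel (\<lambda>\<omega>. (\<omega> (i, c))\<^sup>2) = ?\<mu>" for i
      using distr_distr[of "\<lambda>y. y\<^sup>2" borel borel "\<lambda>\<omega>. \<omega> (i, c)" Om] by (simp add: distr_coord comp_def)
    show "integrable ?\<mu> (\<lambda>y. y)" using law_sq[OF c] by (subst integrable_distr_eq) auto
  qed
  also have "(\<integral>y. y \<partial>?\<mu>) = v c" using law_var[OF c] by (subst integral_distr) auto
  finally show ?thesis .
qed

section \<open>Joint central limit theorem for products of columns\<close>

lemma normals_char: "(\<integral>\<omega>. iexp (\<Sum>k<m. a k * \<omega> k) \<partial>normals m) = exp (- complex_of_real ((\<Sum>k<m. (a k)\<^sup>2) / 2))"
proof -
  interpret N: prob_space std_normal_distribution by (rule prob_space_normal_density) simp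
  interpret product_sigma_finite "\<lambda>_::nat. std_normal_distribution" ..
  have "iexp (\<Sum>k<m. a k * \<omega> k) = (\<Prod>k<m. iexp (a k * \<omega> k))" for \<omega>
    by (simp add: exp_sum[symmetric] sum_distrib_left)
  then have "(\<integral>\<omega>. iexp (\<Sum>k<m. a k * \<omega> k) \<partial>normals m) = (\<integral>\<omega>. (\<Prod>k<m. iexp (a k * \<omega> k)) \<partial>normals m)"
    by (simp only:)
  also have "\<dots> = (\<Prod>k<m. \<integral>y. iexp (a k * y) \<partial>std_normal_distribution)"
    by (rule product_integral_prod) (auto intro!: N.integrable_bounded_complex[of _ 1])
  also have "\<dots> = (\<Prod>k<m. exp (- complex_of_real ((a k)\<^sup>2 / 2)))"
    using char_std_normal_distribution by (auto simp: char_def fun_eq_iff exp_of_real[symmetric] intro!: prod.cong)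
  finally show ?thesis by (simp add: exp_sum[symmetric] sum_negf sum_divide_distrib)
qed

text \<open>The Cramer-Wold idea: a linear combination of the \<open>U (A k)\<close> is a normalized
  sum of independent, identically distributed functions of the rows. Distinct sets
  \<open>A k\<close> give orthogonal products, so its variance is
  \<open>\<Sum>k. (t k)^2 * vA k\<close>, that of the same combination of independent Gaussian
  coordinates.\<close>

lemma joint_char_conv:
  assumes A: "\<And>k. k < m \<Longrightarrow> A k \<subseteq> {..<d+3}" "\<And>k. k < m \<Longrightarrow> A k \<noteq> {}" and inj: "inj_on A {..<m}"
  shows "(\<lambda>n. \<integral>\<omega>. iexp (\<Sum>k<m. t k * U (A k) n \<omega>) \<partial>Om) \<longlonglongrightarrow>
     (\<integral>\<omega>. iexp (\<Sum>k<m. t k * (sqrt (\<Prod>c\<in>A k. v c) * \<omega> k)) \<partial>normals m)"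
proof -
  define vA where "vA k = (\<Prod>c\<in>A k. v c)" for k
  have vA: "0 < vA k" if "k < m" for k unfolding vA_def using A[OF that] v_pos by (intro prod_pos) auto
  define \<tau>2 where "\<tau>2 = (\<Sum>k<m. (t k)\<^sup>2 * vA k)"
  have \<tau>2: "0 \<le> \<tau>2" unfolding \<tau>2_def using vA by (intro sum_nonneg) (simp add: less_imp_le)
  have lim: "(\<integral>\<omega>. iexp (\<Sum>k<m. t k * (sqrt (\<Prod>c\<in>A k. v c) * \<omega> k)) \<partial>normals m) = exp (- complex_of_real (\<tau>2 / 2))"
  proof -
    have "(\<Sum>k<m. (t k * sqrt (vA k))\<^sup>2) = \<tau>2"
      unfolding \<tau>2_def using vA by (intro sum.cong) (auto simp: power_mult_distrib less_imp_le)
    then show ?thesis using normals_char[where a="\<lambda>k. t k * sqrt (vA k)" and m=m] by (simp only: vA_def mult.assoc)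
  qed
  define X where "X i \<omega> = (\<Sum>k<m. t k * w (A k) i \<omega>)" for i \<omega>
  have sumU: "(\<Sum>k<m. t k * U (A k) n \<omega>) = (\<Sum>i<n. X i \<omega>) / sqrt n" for n \<omega>
  proof -
    have "(\<Sum>i<n. X i \<omega>) = (\<Sum>k<m. \<Sum>i<n. t k * w (A k) i \<omega>)" unfolding X_def by (rule sum.swap)
    then show ?thesis by (simp add: U_def sum_distrib_left sum_divide_distrib)
  qed
  show ?thesis
  proof (cases "\<tau>2 = 0")
    \<comment> \<open>The central limit theorem asks for positive variance; variance 0 forces all
      frequencies to be 0.\<close>
    case True
    have "t k = 0" if "k < m" for k
    proof -
      have "(t k)\<^sup>2 * vA k = 0"
        using True vA that unfolding \<tau>2_def by (subst (asm) sum_nonneg_eq_0_iff) (auto simp: less_imp_le)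
      then show ?thesis using vA[OF that] by simp
    qed
    then show ?thesis by (simp add: Om.prob_space prob_space.prob_space[OF prob_space_PiM] prob_space_normal_density)
  next
    case False
    define \<tau> where "\<tau> = sqrt \<tau>2"
    have \<tau>: "0 < \<tau>" "\<tau>\<^sup>2 = \<tau>2" using False \<tau>2 by (auto simp: \<tau>_def)
    define f where "f y = (\<Sum>k<m. t k * (\<Prod>c\<in>A k. y c))" for y :: "nat \<Rightarrow> real"
    have f: "f \<in> borel_measurable (PiM {..<d+3} (\<lambda>_. borel))"
      unfolding f_def using A(1) by (intro borel_measurable_sum borel_measurable_times borel_measurable_prod measurable_component_singleton) auto
    have Xf: "X i \<omega> = f (row i \<omega>)" for i \<omega>
      unfolding X_def f_def w_def row_def using A(1) by (intro sum.cong arg_cong2[of _ _ _ _ "(*)"] prod.cong) auto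
    have sq: "(X i \<omega>)\<^sup>2 = (\<Sum>k<m. \<Sum>l<m. t k * t l * (w (A k) i \<omega> * w (A l) i \<omega>))" for i \<omega>
      unfolding X_def power2_eq_square sum_product by (simp add: mult_ac)
    have iww: "integrable Om (\<lambda>\<omega>. w (A k) i \<omega> * w (A l) i \<omega>)" "(\<integral>\<omega>. w (A k) i \<omega> * w (A l) i \<omega> \<partial>Om) = (if k = l then vA k else 0)"
      if "k < m" "l < m" for k l i
      using integrable_w_w[OF A(1,2)[OF that(1)] A(1,2)[OF that(2)]] integral_w_w[OF A(1,2)[OF that(1)] A(1,2)[OF that(2)]] inj that
      by (auto simp: inj_on_eq_iff vA_def)
    have X2: "integrable Om (\<lambda>\<omega>. (X i \<omega>)\<^sup>2)" "(\<integral>\<omega>. (X i \<omega>)\<^sup>2 \<partial>Om) = \<tau>2" for i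
    proof -
      have i1: "integrable Om (\<lambda>\<omega>. t k * t l * (w (A k) i \<omega> * w (A l) i \<omega>))" if "k < m" "l < m" for k l
        by (intro integrable_mult_right iww that)
      then show "integrable Om (\<lambda>\<omega>. (X i \<omega>)\<^sup>2)"
        unfolding sq by (intro Bochner_Integration.integrable_sum) auto
      have "(\<integral>\<omega>. (X i \<omega>)\<^sup>2 \<partial>Om) = (\<Sum>k<m. \<integral>\<omega>. (\<Sum>l<m. t k * t l * (w (A k) i \<omega> * w (A l) i \<omega>)) \<partial>Om)"
        unfolding sq by (intro Bochner_Integration.integral_sum Bochner_Integration.integrable_sum i1) auto
      also have "\<dots> = (\<Sum>k<m. \<Sum>l<m. \<integral>\<omega>. t k * t l * (w (A k) i \<omega> * w (A l) i \<omega>) \<partial>Om)"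
        by (intro sum.cong refl Bochner_Integration.integral_sum i1) auto
      also have "\<dots> = (\<Sum>k<m. \<Sum>l<m. t k * t l * (if k = l then vA k else 0))"
        by (intro sum.cong refl) (simp add: iww)
      finally have "(\<integral>\<omega>. (X i \<omega>)\<^sup>2 \<partial>Om) = (\<Sum>k<m. \<Sum>l<m. t k * t l * (if k = l then vA k else 0))" .
      then show "(\<integral>\<omega>. (X i \<omega>)\<^sup>2 \<partial>Om) = \<tau>2" by (simp add: \<tau>2_def if_distrib power2_eq_square cong: if_cong)
    qed
    have X1: "(\<integral>\<omega>. X i \<omega> \<partial>Om) = 0" for i
      unfolding X_def using integrable_w[OF A] integral_w[OF A] by (subst Bochner_Integration.integral_sum) auto
    have weak: "weak_conv_m (\<lambda>n. distr Om borel (\<lambda>x. (\<Sum>i<n. X i x) / sqrt (n * \<tau>\<^sup>2))) std_normal_distribution"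
    proof (rule Om.central_limit_theorem_zero_mean[where \<mu>="distr Om borel (X 0)"])
      show "Om.indep_vars (\<lambda>i. borel) X UNIV" using indep_rows[OF f] by (simp add: Xf[abs_def])
      show "distr Om borel (X n) = distr Om borel (X 0)" for n using distr_row_fun[OF f, of n] by (simp add: Xf[abs_def])
    qed (use X1 X2 \<tau> in auto)
    have [measurable]: "X i \<in> borel_measurable Om" for i unfolding X_def by measurable
    \<comment> \<open>Evaluating at frequency \<open>\<tau>\<close> undoes the standardization by
      \<open>\<tau>\<close>.\<close>
    have "(\<lambda>n. char (distr Om borel (\<lambda>x. (\<Sum>i<n. X i x) / sqrt (n * \<tau>\<^sup>2))) \<tau>) \<longlonglongrightarrow> char std_normal_distribution \<tau>"
      by (rule levy_continuity1[OF _ _ weak]) (auto intro!: Om.real_distribution_distr real_dist_normal_dist)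
    also have "char std_normal_distribution \<tau> = exp (- complex_of_real (\<tau>2 / 2))"
      by (simp add: char_std_normal_distribution \<tau>(2)[symmetric] exp_of_real[symmetric])
    also have "(\<lambda>n. char (distr Om borel (\<lambda>x. (\<Sum>i<n. X i x) / sqrt (n * \<tau>\<^sup>2))) \<tau>) = (\<lambda>n. \<integral>\<omega>. iexp (\<Sum>k<m. t k * U (A k) n \<omega>) \<partial>Om)"
      unfolding char_def sumU using \<tau> by (intro ext, subst integral_distr) (auto simp: real_sqrt_mult intro!: Bochner_Integration.integral_cong)
    finally show ?thesis unfolding lim .
  qed
qed

end

text \<open>\<open>iexp\<close> has modulus 1 and Lipschitz constant 1 on the reals, so the
  integrands differ by at most \<open>r / 2\<close> off an event of vanishing probability and by at
  most 2 on it.\<close>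

lemma (in prob_space) iexp_conv_prob:
  assumes [measurable]: "\<And>n. A n \<in> borel_measurable M" "\<And>n. B n \<in> borel_measurable M"
    and D: "conv_prob M (\<lambda>n x. A n x - B n x) 0"
  shows "(\<lambda>n. (\<integral>x. iexp (A n x) \<partial>M) - (\<integral>x. iexp (B n x) \<partial>M)) \<longlonglongrightarrow> 0"
proof (rule LIMSEQ_I)
  fix r :: real assume r: "0 < r"
  have "(\<lambda>n. measure M {x\<in>space M. r / 2 \<le> \<bar>A n x - B n x\<bar>}) \<longlonglongrightarrow> 0"
    using D r unfolding conv_prob_def by (auto dest!: spec[of _ "r / 2"])
  then have "\<forall>\<^sub>F n in sequentially. measure M {x\<in>space M. r / 2 \<le> \<bar>A n x - B n x\<bar>} < r / 4"
    using r by (intro order_tendstoD(2)) auto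
  then obtain n0 where n0: "\<And>n. n \<ge> n0 \<Longrightarrow> measure M {x\<in>space M. r / 2 \<le> \<bar>A n x - B n x\<bar>} < r / 4"
    by (auto simp: eventually_sequentially)
  show "\<exists>no. \<forall>n\<ge>no. norm ((\<integral>x. iexp (A n x) \<partial>M) - (\<integral>x. iexp (B n x) \<partial>M) - 0) < r"
  proof (intro exI allI impI)
    fix n assume n: "n0 \<le> n"
    let ?E = "{x\<in>space M. r / 2 \<le> \<bar>A n x - B n x\<bar>}"
    have i: "integrable M (\<lambda>x. iexp (A n x))" "integrable M (\<lambda>x. iexp (B n x))"
      by (auto intro!: integrable_bounded_complex[of _ 1])
    have pt: "norm (iexp (A n x) - iexp (B n x)) \<le> r / 2 + 2 * indicator ?E x" if "x \<in> space M" for x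
    proof (cases "x \<in> ?E")
      case True
      have "norm (iexp (A n x) - iexp (B n x)) \<le> norm (iexp (A n x)) + norm (iexp (B n x))" by (rule norm_triangle_ineq4)
      then show ?thesis using True r by simp
    next
      case False
      have "iexp (A n x) - iexp (B n x) = iexp (B n x) * (iexp (A n x - B n x) - 1)"
        by (simp add: algebra_simps exp_add[symmetric])
      then have "norm (iexp (A n x) - iexp (B n x)) = norm (iexp (A n x - B n x) - 1)"
        by (simp add: norm_mult)
      also have "\<dots> \<le> \<bar>A n x - B n x\<bar>" using iexp_approx1[of "A n x - B n x" 0] by simp
      finally show ?thesis using False that by simp
    qed
    have "norm ((\<integral>x. iexp (A n x) \<partial>M) - (\<integral>x. iexp (B n x) \<partial>M)) = norm (\<integral>x. iexp (A n x) - iexp (B n x) \<partial>M)"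
      using i by simp
    also have "\<dots> \<le> (\<integral>x. norm (iexp (A n x) - iexp (B n x)) \<partial>M)" by (rule integral_norm_bound)
    also have "\<dots> \<le> (\<integral>x. r / 2 + 2 * indicator ?E x \<partial>M)"
    proof (rule integral_mono)
      show "integrable M (\<lambda>x. norm (iexp (A n x) - iexp (B n x)))" using i by auto
      show "integrable M (\<lambda>x. r / 2 + 2 * indicator ?E x)"
        by (rule integrable_const_bound[where B="r / 2 + 2"]) (use r in \<open>auto simp: indicator_def\<close>)
    qed (rule pt)
    also have "\<dots> = r / 2 + 2 * measure M ?E"
    proof -
      have iE: "integrable M (\<lambda>x. 2 * indicator ?E x :: real)"
        by (rule integrable_const_bound[where B=2]) (auto simp: indicator_def)
      have "(\<integral>x. r / 2 + 2 * indicator ?E x \<partial>M) = (\<integral>x. r / 2 \<partial>M) + (\<integral>x. 2 * indicator ?E x \<partial>M)"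
        by (rule Bochner_Integration.integral_add[OF _ iE]) simp
      also have "(\<integral>x. 2 * indicator ?E x \<partial>M) = 2 * measure M ?E"
        by (subst integral_mult_right_zero) (simp add: Int_absorb2)
      finally show ?thesis by (simp add: prob_space)
    qed
    also have "\<dots> < r" using n0[OF n] by simp
    finally show "norm ((\<integral>x. iexp (A n x) \<partial>M) - (\<integral>x. iexp (B n x) \<partial>M) - 0) < r" by simp
  qed
qed

text \<open>An indicator is continuous off the frontier of its set, so the convergence of integrated
  products applies to two indicators, whose product is the indicator of the joint event.\<close>

lemma joint_char_imp_joint_prob:
  fixes A0 A1 :: "nat \<Rightarrow> 'a \<Rightarrow> real" and B0 B1 :: "'l \<Rightarrow> real"
  assumes M: "prob_space M" and L: "prob_space L"
    and [measurable]: "\<And>n. A0 n \<in> borel_measurable M" "\<And>n. A1 n \<in> borel_measurable M" "B0 \<in> borel_measurable L" "B1 \<in> borel_measurable L"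
    and conv: "\<And>s t. (\<lambda>n. \<integral>x. iexp (s * A0 n x + t * A1 n x) \<partial>M) \<longlonglongrightarrow> (\<integral>x. iexp (s * B0 x + t * B1 x) \<partial>L)"
    and C: "C0 \<in> sets borel" "C1 \<in> sets borel" "AE x in L. B0 x \<notin> frontier C0" "AE x in L. B1 x \<notin> frontier C1"
  shows "(\<lambda>n. measure M {x\<in>space M. A0 n x \<in> C0 \<and> A1 n x \<in> C1}) \<longlonglongrightarrow> measure L {x\<in>space L. B0 x \<in> C0 \<and> B1 x \<in> C1}"
proof -
  interpret M: prob_space M by fact
  interpret L: prob_space L by fact
  define C where "C k = (if k = 0 then C0 else C1)" for k :: nat
  define f where "f k u = complex_of_real (indicator (C k) u)" for k u
  have [measurable]: "C k \<in> sets borel" for k using C by (simp add: C_def)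
  have two: "{..<2} = {0, 1::nat}" by auto
  have cont: "isCont (f k) u" if "u \<notin> frontier (C k)" for k u
    unfolding f_def using that isCont_indicator[of u "C k"] by (intro isCont_of_real) auto
  have "(\<lambda>n. \<integral>x. (\<Prod>k<2. f k ((if k = 0 then A0 else A1) n x)) \<partial>M) \<longlonglongrightarrow> (\<integral>x. (\<Prod>k<2. f k ((if k = 0 then B0 else B1) x)) \<partial>L)"
  proof (rule joint_char_imp_prod_conv[OF M L, where C=1])
    show "AE x in L. isCont (f k) ((if k = 0 then B0 else B1) x)" if "k < 2" for k
    proof (cases "k = 0")
      case True
      show ?thesis using C(3) by eventually_elim (use True in \<open>auto intro!: cont simp: C_def\<close>)
    next
      case False
      show ?thesis using C(4) by eventually_elim (use False in \<open>auto intro!: cont simp: C_def\<close>)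
    qed
    show "(\<lambda>n. \<integral>x. iexp (\<Sum>k<2. t k * (if k = 0 then A0 else A1) n x) \<partial>M) \<longlonglongrightarrow> (\<integral>x. iexp (\<Sum>k<2. t k * (if k = 0 then B0 else B1) x) \<partial>L)" for t :: "nat \<Rightarrow> real"
      using conv[of "t 0" "t 1"] by (simp add: two)
    show "norm (f k x) \<le> 1" for k x by (simp add: f_def indicator_def)
    show "f k \<in> borel_measurable borel" for k unfolding f_def by measurable
    show "(if k = 0 then A0 else A1) n \<in> borel_measurable M" for k n by simp
    show "(if k = 0 then B0 else B1) \<in> borel_measurable L" for k by simp
  qed
  moreover have "(\<integral>x. (\<Prod>k<2. f k ((if k = 0 then A0 else A1) n x)) \<partial>M) = complex_of_real (measure M {x\<in>space M. A0 n x \<in> C0 \<and> A1 n x \<in> C1})" for n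
  proof -
    have "(\<integral>x. (\<Prod>k<2. f k ((if k = 0 then A0 else A1) n x)) \<partial>M) = (\<integral>x. complex_of_real (indicator {x\<in>space M. A0 n x \<in> C0 \<and> A1 n x \<in> C1} x) \<partial>M)"
      by (intro Bochner_Integration.integral_cong refl) (auto simp: two f_def C_def indicator_def)
    then show ?thesis using C(1,2) by simp
  qed
  moreover have "(\<integral>x. (\<Prod>k<2. f k ((if k = 0 then B0 else B1) x)) \<partial>L) = complex_of_real (measure L {x\<in>space L. B0 x \<in> C0 \<and> B1 x \<in> C1})"
  proof -
    have "(\<integral>x. (\<Prod>k<2. f k ((if k = 0 then B0 else B1) x)) \<partial>L) = (\<integral>x. complex_of_real (indicator {x\<in>space L. B0 x \<in> C0 \<and> B1 x \<in> C1} x) \<partial>L)"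
      by (intro Bochner_Integration.integral_cong refl) (auto simp: two f_def C_def indicator_def)
    then show ?thesis using C(1,2) by simp
  qed
  ultimately show ?thesis by (simp add: tendsto_of_real_iff)
qed

text \<open>Fubini in coordinate \<open>k\<close>: each section is finite, hence null for a law with
  a density.\<close>

lemma normals_null_set:
  assumes k: "k < m" and E: "E \<in> sets (normals m)" and fin: "\<And>\<omega>. finite {y. fun_upd \<omega> k y \<in> E}"
  shows "AE \<omega> in normals m. \<omega> \<notin> E"
proof -
  interpret N: prob_space std_normal_distribution by (rule prob_space_normal_density) simp
  interpret product_sigma_finite "\<lambda>_::nat. std_normal_distribution" ..
  let ?I = "{..<m} - {k}"
  have I: "{..<m} = insert k ?I" using k by auto
  have null: "emeasure std_normal_distribution A = 0" if "finite A" for A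
  proof -
    have "A \<in> null_sets lborel" using that by (rule finite_imp_null_set_lborel)
    then have "AE x in lborel. x \<notin> A" by (rule AE_not_in)
    moreover have "A \<in> sets lborel" using that by (simp add: finite_imp_closed borel_closed)
    ultimately show ?thesis by (subst emeasure_density) (auto intro!: nn_integral_zero' simp: indicator_def elim!: eventually_mono)
  qed
  have "emeasure (normals m) E = (\<integral>\<^sup>+\<omega>. indicator E \<omega> \<partial>PiM (insert k ?I) (\<lambda>_. std_normal_distribution))"
    using E I by simp
  also have "\<dots> = (\<integral>\<^sup>+\<omega>. (\<integral>\<^sup>+y. indicator E (fun_upd \<omega> k y) \<partial>std_normal_distribution) \<partial>PiM ?I (\<lambda>_. std_normal_distribution))"
    using E I by (intro product_nn_integral_insert) auto
  also have "\<dots> = (\<integral>\<^sup>+\<omega>. 0 \<partial>PiM ?I (\<lambda>_. std_normal_distribution))"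
  proof (intro nn_integral_cong)
    fix \<omega> assume "\<omega> \<in> space (PiM ?I (\<lambda>_. std_normal_distribution))"
    have "(\<integral>\<^sup>+y. indicator E (fun_upd \<omega> k y) \<partial>std_normal_distribution) = (\<integral>\<^sup>+y. indicator {y. fun_upd \<omega> k y \<in> E} y \<partial>std_normal_distribution)"
      by (intro nn_integral_cong) (simp add: indicator_def)
    also have "\<dots> = emeasure std_normal_distribution {y. fun_upd \<omega> k y \<in> E}"
      using fin[of \<omega>] by (intro nn_integral_indicator) (simp add: finite_imp_closed borel_closed)
    finally show "(\<integral>\<^sup>+y. indicator E (fun_upd \<omega> k y) \<partial>std_normal_distribution) = 0" using null[OF fin] by simp
  qed
  finally have "E \<in> null_sets (normals m)" using E by (simp add: null_sets_def)
  then show ?thesis by (rule AE_not_in)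
qed

section \<open>Passage from the random array to deterministic limits\<close>

context coordinate_world
begin

definition good_set :: "(nat \<times> nat \<Rightarrow> real) set" where
  "good_set = {\<omega>. \<forall>i. \<forall>s\<in>{d+1, d+2}. \<omega> (i, s) = 1 \<or> \<omega> (i, s) = -1}"

definition good :: "real \<Rightarrow> (nat \<times> (nat \<times> nat \<Rightarrow> real)) filter" where
  "good K = good_filter {..<d+3} (\<lambda>c n \<omega>. (\<Sum>i<n. (\<omega> (i, c))\<^sup>2) / real n) v (Pow {..<d+3} - {{}}) U K good_set"

text \<open>A pair consists of a sample size and a realization. Along \<open>good K\<close> the
  averages of squares, the bounds and the signs behave as required by construction, so the
  deterministic asymptotics apply to the random array.\<close>

lemma array_limits_good: "array_limits (good K) fst (\<lambda>b i c. snd b (i, c)) d v"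
proof
  show "filterlim fst at_top (good K)"
    unfolding good_def by (rule good_filter_fst) simp
  show "(\<lambda>b. (\<Sum>i<fst b. \<Prod>c\<in>A. snd b (i, c)) / sqrt (real (fst b))) \<in> O[good K](\<lambda>_. 1)"
    if "A \<subseteq> {..<d + 3}" "A \<noteq> {}" for A
  proof (rule bigoI[where c=K])
    have "A \<in> Pow {..<d+3} - {{}}" using that by simp
    from good_filter_bounded[OF _ this, of "{..<d+3}" U K "\<lambda>c n \<omega>. (\<Sum>i<n. (\<omega> (i, c))\<^sup>2) / real n" v good_set]
    have "\<forall>\<^sub>F (n, x) in good K. \<bar>U A n x\<bar> \<le> K" by (simp add: good_def)
    then show "\<forall>\<^sub>F b in good K. norm ((\<Sum>i<fst b. \<Prod>c\<in>A. snd b (i, c)) / sqrt (real (fst b))) \<le> K * norm (1 :: real)"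
      by eventually_elim (auto simp: U_def w_def split: prod.splits)
  qed
  show "((\<lambda>b. (\<Sum>i<fst b. (snd b (i, c))\<^sup>2) / real (fst b)) \<longlongrightarrow> v c) (good K)" if "c < d + 3" for c
    using good_filter_tendsto[of "{..<d+3}" c "\<lambda>c n \<omega>. (\<Sum>i<n. (\<omega> (i, c))\<^sup>2) / real n" v] that
    by (simp add: good_def case_prod_beta')
  show "\<forall>\<^sub>F b in good K. \<forall>i. snd b (i, s) = 1 \<or> snd b (i, s) = - 1" if "s \<in> {d + 1, d + 2}" for s
  proof -
    have "\<forall>\<^sub>F (n, x) in good K. x \<in> good_set" unfolding good_def by (rule good_filter_set) simp
    then show ?thesis by eventually_elim (use that in \<open>auto simp: good_set_def split: prod.splits\<close>)
  qed
qed (rule v_pos)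

lemma AE_good_set: "AE \<omega> in Om. \<omega> \<in> good_set"
proof -
  have "AE \<omega> in Om. \<omega> (i, s) = 1 \<or> \<omega> (i, s) = -1" if "s \<in> {d+1, d+2}" for i s
  proof -
    have "AE y in distr Om borel (\<lambda>\<omega>. \<omega> (i, s)). y = 1 \<or> y = -1"
      unfolding distr_coord snd_conv law_sign[OF that] by (rule AE_sign_law)
    then show ?thesis by (rule AE_distrD[OF coord_measurable])
  qed
  then show ?thesis unfolding good_set_def mem_Collect_eq by (auto simp: AE_all_countable AE_conj_iff)
qed

lemma v_sign: "s \<in> {d+1, d+2} \<Longrightarrow> v s = 1"
  using law_var[of s] law_sign[of s] by (auto simp: integral_sign_law)

text \<open>The conditions that define \<open>good K\<close> hold with high probability: the squares
  by the law of large numbers, the bounds by second moments, the signs almost surely. Deterministic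
  limits for every \<open>K\<close> therefore give limits in probability.\<close>

lemma conv_prob_good:
  assumes "\<And>n. D n \<in> borel_measurable Om" "\<And>K. ((\<lambda>b. D (fst b) (snd b)) \<longlongrightarrow> c) (good K)"
  shows "conv_prob Om D c"
proof (rule Om.conv_prob_good_filter[where I="{..<d+3}" and J="Pow {..<d+3} - {{}}"])
  show "conv_prob Om (\<lambda>n \<omega>. (\<Sum>i<n. (\<omega> (i, c))\<^sup>2) / real n) (v c)" if "c \<in> {..<d+3}" for c
    using that by (intro squares_conv_prob) simp
  show "bounded_prob Om (U A)" if "A \<in> Pow {..<d+3} - {{}}" for A using that by (intro U_bounded) auto
  show "((\<lambda>(n, x). D n x) \<longlongrightarrow> c) (good_filter {..<d+3} (\<lambda>c n \<omega>. (\<Sum>i<n. (\<omega> (i, c))\<^sup>2) / real n) v (Pow {..<d+3} - {{}}) U K good_set)" for K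
    using assms(2)[of K] by (simp add: good_def case_prod_beta')
qed (use assms AE_good_set in auto)

definition assign :: "nat \<Rightarrow> (nat \<times> nat \<Rightarrow> real) \<Rightarrow> nat \<Rightarrow> bool" where
  "assign s \<omega> i = (0 < \<omega> (i, s))"

definition covar :: "(nat \<times> nat \<Rightarrow> real) \<Rightarrow> nat \<Rightarrow> nat \<Rightarrow> real" where
  "covar \<omega> i j = \<omega> (i, j)"

text \<open>The Mahalanobis distance with its diagonal covariance already inverted; it agrees with
  \<open>mahalanobis\<close> once \<open>mean_diff_var n\<close> is nonzero.\<close>

definition MM :: "nat \<Rightarrow> nat \<Rightarrow> (nat \<times> nat \<Rightarrow> real) \<Rightarrow> real" where
  "MM s n \<omega> = (\<Sum>j<d. (group_mean n True (covar \<omega>) (assign s \<omega>) j - group_mean n False (covar \<omega>) (assign s \<omega>) j)\<^sup>2 / (mean_diff_var n * v j))"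

definition SS :: "nat \<Rightarrow> (nat \<Rightarrow> real) \<Rightarrow> (nat \<Rightarrow> real) \<Rightarrow> (nat \<Rightarrow> real) \<Rightarrow> nat \<Rightarrow> (nat \<times> nat \<Rightarrow> real) \<Rightarrow> real" where
  "SS p \<mu>1 \<mu>2 \<beta> n \<omega> = test_stat n p (assign (d+1) \<omega>) (covar \<omega>)
     (outcome n d (\<mu>1 n) (\<mu>2 n) \<beta> (assign (d+1) \<omega>) (covar \<omega>) (\<lambda>i. \<omega> (i, d)))"

lemma assign_measurable: "(\<lambda>\<omega>. of_bool (assign s \<omega> i) :: real) \<in> borel_measurable Om"
  unfolding assign_def of_bool_def by measurable

lemma covar_measurable: "(\<lambda>\<omega>. covar \<omega> i j) \<in> borel_measurable Om"
  unfolding covar_def by measurable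

lemma MM_measurable [measurable]: "MM s n \<in> borel_measurable Om"
  unfolding MM_def
  by (intro borel_measurable_sum borel_measurable_divide borel_measurable_power borel_measurable_const
      borel_measurable_mean_difference assign_measurable covar_measurable)

lemma SS_measurable: "p \<le> d \<Longrightarrow> SS p \<mu>1 \<mu>2 \<beta> n \<in> borel_measurable Om"
  unfolding SS_def by (intro borel_measurable_test_stat assign_measurable covar_measurable) auto

definition MM' :: "nat \<Rightarrow> nat \<Rightarrow> (nat \<times> nat \<Rightarrow> real) \<Rightarrow> real" where
  "MM' s n \<omega> = (\<Sum>j<d. (U {j, s} n \<omega>)\<^sup>2 / v j)"

definition SS' :: "nat \<Rightarrow> (nat \<Rightarrow> real) \<Rightarrow> real \<Rightarrow> real \<Rightarrow> nat \<Rightarrow> (nat \<times> nat \<Rightarrow> real) \<Rightarrow> real" where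
  "SS' p \<beta> \<delta> \<sigma>w n \<omega> = (\<delta> / 2 + (\<Sum>c\<in>{p..d}. resid_coeff d \<beta> c * U {c, d+1} n \<omega>)) / \<sigma>w"

lemma U_pair: "c \<noteq> s \<Longrightarrow> U {c, s} n \<omega> = (\<Sum>i<n. \<omega> (i, c) * \<omega> (i, s)) / sqrt n"
  by (simp add: U_def w_def)

lemma MM_limit:
  assumes s: "s \<in> {d+1, d+2}"
  shows "((\<lambda>b. MM s (fst b) (snd b) - MM' s (fst b) (snd b)) \<longlongrightarrow> 0) (good K)"
proof -
  interpret A: array_limits "good K" fst "\<lambda>b i c. snd b (i, c)" d v by (rule array_limits_good)
  have "((\<lambda>b. real (fst b) * mean_diff_var (fst b)) \<longlongrightarrow> 4) (good K)"
    by (rule filterlim_compose[OF mean_diff_var_limit A.N])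
  moreover have "MM' s (fst b) (snd b) = (\<Sum>j<d. ((\<Sum>i<fst b. snd b (i, j) * snd b (i, s)) / sqrt (real (fst b)))\<^sup>2 / v j)" for b
    unfolding MM'_def using s by (intro sum.cong refl) (auto simp: U_pair)
  ultimately show ?thesis
    using A.mahalanobis_limit[OF s, of mean_diff_var] by (simp add: MM_def assign_def[abs_def] covar_def[abs_def])
qed

lemma SS_limit:
  assumes p: "p \<le> d" and \<mu>: "\<And>n. 1 \<le> n \<Longrightarrow> sqrt (real n) * (\<mu>1 n - \<mu>2 n) = \<delta>"
    and \<sigma>w: "\<sigma>w = sqrt (\<Sum>c\<in>{p..d}. (resid_coeff d \<beta> c)\<^sup>2 * v c)"
  shows "((\<lambda>b. SS p \<mu>1 \<mu>2 \<beta> (fst b) (snd b) - SS' p \<beta> \<delta> \<sigma>w (fst b) (snd b)) \<longlongrightarrow> 0) (good K)"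
proof -
  interpret A: array_limits "good K" fst "\<lambda>b i c. snd b (i, c)" d v by (rule array_limits_good)
  have ev: "\<forall>\<^sub>F b in good K. sqrt (real (fst b)) * (\<mu>1 (fst b) - \<mu>2 (fst b)) = \<delta>"
    using A.N_pos by eventually_elim (use \<mu> in auto)
  have \<mu>1: "(\<lambda>b. sqrt (real (fst b)) * (\<mu>1 (fst b) - \<mu>2 (fst b))) \<in> O[good K](\<lambda>_. 1)"
    using tendsto_eventually[OF ev] by (rule tendsto_imp_bigo_1)
  have r: "(\<Sum>i<fst b. snd b (i, d+1) * A.model_resid p \<beta> b i) / sqrt (real (fst b)) = (\<Sum>c\<in>{p..d}. resid_coeff d \<beta> c * U {c, d+1} (fst b) (snd b))" for b
  proof -
    have "(\<Sum>i<fst b. snd b (i, d+1) * A.model_resid p \<beta> b i) = (\<Sum>i<fst b. \<Sum>c\<in>{p..d}. resid_coeff d \<beta> c * (snd b (i, c) * snd b (i, d+1)))"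
      unfolding A.model_resid_def sum_distrib_left by (simp add: mult_ac)
    also have "\<dots> = (\<Sum>c\<in>{p..d}. \<Sum>i<fst b. resid_coeff d \<beta> c * (snd b (i, c) * snd b (i, d+1)))" by (rule sum.swap)
    finally have "(\<Sum>i<fst b. snd b (i, d+1) * A.model_resid p \<beta> b i) / sqrt (real (fst b)) =
        (\<Sum>c\<in>{p..d}. resid_coeff d \<beta> c * ((\<Sum>i<fst b. snd b (i, c) * snd b (i, d+1)) / sqrt (real (fst b))))"
      by (simp add: sum_distrib_left sum_divide_distrib)
    also have "\<dots> = (\<Sum>c\<in>{p..d}. resid_coeff d \<beta> c * U {c, d+1} (fst b) (snd b))"
      by (intro sum.cong refl arg_cong2[of _ _ _ _ "(*)"] U_pair[symmetric]) auto
    finally show ?thesis .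
  qed
  have "((\<lambda>b. SS p \<mu>1 \<mu>2 \<beta> (fst b) (snd b) - (sqrt (real (fst b)) * (\<mu>1 (fst b) - \<mu>2 (fst b)) / 2 + (\<Sum>c\<in>{p..d}. resid_coeff d \<beta> c * U {c, d+1} (fst b) (snd b))) / \<sigma>w) \<longlongrightarrow> 0) (good K)"
    using A.test_stat_limit[OF p, of "d + 1" "\<lambda>b. \<mu>1 (fst b)" "\<lambda>b. \<mu>2 (fst b)", OF _ \<mu>1 \<sigma>w]
    unfolding r by (simp add: SS_def assign_def[abs_def] covar_def[abs_def])
  then show ?thesis
  proof (rule Lim_transform_eventually)
    show "\<forall>\<^sub>F b in good K. SS p \<mu>1 \<mu>2 \<beta> (fst b) (snd b) - (sqrt (real (fst b)) * (\<mu>1 (fst b) - \<mu>2 (fst b)) / 2 + (\<Sum>c\<in>{p..d}. resid_coeff d \<beta> c * U {c, d+1} (fst b) (snd b))) / \<sigma>w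
       = SS p \<mu>1 \<mu>2 \<beta> (fst b) (snd b) - SS' p \<beta> \<delta> \<sigma>w (fst b) (snd b)"
      using ev by eventually_elim (simp only: SS'_def)
  qed
qed

text \<open>
  Coordinates \<open>k < d\<close> of the Gaussian limit belong to the covariates under the first assignment,
  coordinate \<open>d\<close> to the errors, and coordinates \<open>d + 1 + k\<close> to the covariates under the second assignment.
\<close>

definition pair_index :: "nat \<Rightarrow> nat set" where
  "pair_index k = (if k \<le> d then {k, d+1} else {k - Suc d, d+2})"

text \<open>The form has no mixed terms, so its exponential is a product of bounded continuous
  functions of single coordinates. Convergence of integrated products thus leads from linear
  characteristic functions to those of quadratic statistics.\<close>

lemma quadratic_form_char_conv:
  fixes a :: real
  shows "(\<lambda>n. \<integral>\<omega>. iexp (a + (\<Sum>k<2*d+1. b k * U (pair_index k) n \<omega> + q k * (U (pair_index k) n \<omega>)\<^sup>2)) \<partial>Om) \<longlonglongrightarrow>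
    (\<integral>\<omega>. iexp (a + (\<Sum>k<2*d+1. b k * (sqrt (\<Prod>c\<in>pair_index k. v c) * \<omega> k) + q k * (sqrt (\<Prod>c\<in>pair_index k. v c) * \<omega> k)\<^sup>2)) \<partial>normals (2*d+1))"
proof -
  let ?m = "2*d+1"
  let ?N = "\<lambda>k \<omega>. sqrt (\<Prod>c\<in>pair_index k. v c) * \<omega> k"
  define f where "f k u = iexp (b k * u + q k * u\<^sup>2)" for k u
  have N: "prob_space (normals ?m)" by (intro prob_space_PiM prob_space_normal_density) simp
  have cont: "isCont (f k) u" for k u unfolding f_def by (intro continuous_intros)
  have "(\<lambda>n. \<integral>\<omega>. (\<Prod>k<?m. f k (U (pair_index k) n \<omega>)) \<partial>Om) \<longlonglongrightarrow> (\<integral>\<omega>. (\<Prod>k<?m. f k (?N k \<omega>)) \<partial>normals ?m)"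
  proof (rule joint_char_imp_prod_conv[OF Om.prob_space_axioms N, where C=1])
    show "(\<lambda>n. \<integral>\<omega>. iexp (\<Sum>k<?m. t k * U (pair_index k) n \<omega>) \<partial>Om) \<longlonglongrightarrow> (\<integral>\<omega>. iexp (\<Sum>k<?m. t k * ?N k \<omega>) \<partial>normals ?m)" for t
    proof (rule joint_char_conv)
      \<comment> \<open>The sign column tells the two blocks apart, the other column the index
        within a block.\<close>
      show "inj_on pair_index {..<?m}"
      proof (rule inj_onI)
        fix k l assume "k \<in> {..<?m}" "l \<in> {..<?m}" "pair_index k = pair_index l"
        then show "k = l" by (auto simp: pair_index_def doubleton_eq_iff split: if_splits)
      qed
    qed (auto simp: pair_index_def split: if_splits)
    show "?N k \<in> borel_measurable (normals ?m)" if "k < ?m" for k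
      using measurable_component_singleton[of k "{..<?m}" "\<lambda>_. std_normal_distribution"] that
      by (intro borel_measurable_times borel_measurable_const) simp
    show "f k \<in> borel_measurable borel" for k unfolding f_def by measurable
    show "norm (f k x) \<le> 1" for k x by (simp add: f_def)
    show "AE x in normals ?m. isCont (f k) (?N k x)" for k by (simp add: cont)
  qed simp
  from tendsto_mult[OF tendsto_const[of "iexp a"] this]
  have "(\<lambda>n. \<integral>\<omega>. iexp a * (\<Prod>k<?m. f k (U (pair_index k) n \<omega>)) \<partial>Om) \<longlonglongrightarrow> (\<integral>\<omega>. iexp a * (\<Prod>k<?m. f k (?N k \<omega>)) \<partial>normals ?m)"
    by simp
  moreover have "iexp a * (\<Prod>k<?m. f k (x k)) = iexp (a + (\<Sum>k<?m. b k * x k + q k * (x k)\<^sup>2))" for x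
  proof -
    have "(\<Prod>k<?m. f k (x k)) = exp (\<Sum>k<?m. \<i> * complex_of_real (b k * x k + q k * (x k)\<^sup>2))"
      unfolding f_def by (rule exp_sum[symmetric]) simp
    also have "(\<Sum>k<?m. \<i> * complex_of_real (b k * x k + q k * (x k)\<^sup>2)) = \<i> * complex_of_real (\<Sum>k<?m. b k * x k + q k * (x k)\<^sup>2)"
      by (simp only: sum_distrib_left of_real_sum)
    finally show ?thesis by (simp only: exp_add[symmetric] of_real_add distrib_left)
  qed
  ultimately show ?thesis by (simp only:)
qed

definition S_lim :: "nat \<Rightarrow> (nat \<Rightarrow> real) \<Rightarrow> real \<Rightarrow> real \<Rightarrow> (nat \<Rightarrow> real) \<Rightarrow> real" where
  "S_lim p \<beta> \<delta> \<sigma>w \<omega> = (\<delta> / 2 + (\<Sum>c\<in>{p..d}. resid_coeff d \<beta> c * (sqrt (v c) * \<omega> c))) / \<sigma>w"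

text \<open>The offset \<open>l\<close> selects the block of coordinates: 0 for the first
  assignment, \<open>Suc d\<close> for the second.\<close>

definition M_lim :: "nat \<Rightarrow> (nat \<Rightarrow> real) \<Rightarrow> real" where
  "M_lim l \<omega> = (\<Sum>j<d. (\<omega> (l + j))\<^sup>2)"

end

section \<open>Joint limits of the statistic and of the distances\<close>

context coordinate_world
begin

lemma sum_first_block: "(\<Sum>k<2*d+1. if k < d then g k else 0) = (\<Sum>j<d. g j)" for g :: "nat \<Rightarrow> real"
  by (intro sum.mono_neutral_cong_right) auto

lemma sum_middle_block: "p \<le> d \<Longrightarrow> (\<Sum>k<2*d+1. if p \<le> k \<and> k \<le> d then g k else 0) = (\<Sum>c\<in>{p..d}. g c)" for g :: "nat \<Rightarrow> real"
  by (intro sum.mono_neutral_cong_right) auto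

lemma sum_last_block: "(\<Sum>k<2*d+1. if d < k then g k else 0) = (\<Sum>j<d. g (Suc d + j))" for g :: "nat \<Rightarrow> real"
proof -
  have "(\<Sum>k<2*d+1. if d < k then g k else 0) = (\<Sum>k\<in>{Suc d..<2*d+1}. g k)"
    by (intro sum.mono_neutral_cong_right) auto
  also have "\<dots> = (\<Sum>j<d. g (Suc d + j))"
    by (rule sum.reindex_bij_witness[of _ "\<lambda>j. Suc d + j" "\<lambda>k. k - Suc d"]) auto
  finally show ?thesis .
qed

lemma sqrt_prod_pair_index:
  "k \<le> d \<Longrightarrow> sqrt (\<Prod>c\<in>pair_index k. v c) = sqrt (v k)"
  "d < k \<Longrightarrow> k < 2*d+1 \<Longrightarrow> sqrt (\<Prod>c\<in>pair_index k. v c) = sqrt (v (k - Suc d))"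
  using v_sign by (auto simp: pair_index_def)

text \<open>A linear combination of two forms without mixed terms is again such a form, so the joint
  characteristic function of the two forms converges; the differences from \<open>A0\<close> and
  \<open>A1\<close> vanish in probability and do not affect it.\<close>

lemma joint_limit_prob:
  assumes [measurable]: "\<And>n. A0 n \<in> borel_measurable Om" "\<And>n. A1 n \<in> borel_measurable Om"
      "B0 \<in> borel_measurable (normals (2*d+1))" "B1 \<in> borel_measurable (normals (2*d+1))"
    and A0: "\<And>K. ((\<lambda>b. A0 (fst b) (snd b) - (a0 + (\<Sum>k<2*d+1. b0 k * U (pair_index k) (fst b) (snd b) + q0 k * (U (pair_index k) (fst b) (snd b))\<^sup>2))) \<longlongrightarrow> 0) (good K)"
    and A1: "\<And>K. ((\<lambda>b. A1 (fst b) (snd b) - (a1 + (\<Sum>k<2*d+1. b1 k * U (pair_index k) (fst b) (snd b) + q1 k * (U (pair_index k) (fst b) (snd b))\<^sup>2))) \<longlongrightarrow> 0) (good K)"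
    and B0: "\<And>\<omega>. B0 \<omega> = a0 + (\<Sum>k<2*d+1. b0 k * (sqrt (\<Prod>c\<in>pair_index k. v c) * \<omega> k) + q0 k * (sqrt (\<Prod>c\<in>pair_index k. v c) * \<omega> k)\<^sup>2)"
    and B1: "\<And>\<omega>. B1 \<omega> = a1 + (\<Sum>k<2*d+1. b1 k * (sqrt (\<Prod>c\<in>pair_index k. v c) * \<omega> k) + q1 k * (sqrt (\<Prod>c\<in>pair_index k. v c) * \<omega> k)\<^sup>2)"
    and C: "C0 \<in> sets borel" "C1 \<in> sets borel" "AE x in normals (2*d+1). B0 x \<notin> frontier C0" "AE x in normals (2*d+1). B1 x \<notin> frontier C1"
  shows "(\<lambda>n. measure Om {\<omega>. A0 n \<omega> \<in> C0 \<and> A1 n \<omega> \<in> C1}) \<longlonglongrightarrow>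
    measure (normals (2*d+1)) {\<omega>\<in>space (normals (2*d+1)). B0 \<omega> \<in> C0 \<and> B1 \<omega> \<in> C1}"
proof -
  let ?m = "2*d+1"
  have N: "prob_space (normals ?m)" by (intro prob_space_PiM prob_space_normal_density) simp
  define Q where "Q a b q n \<omega> = a + (\<Sum>k<?m. b k * U (pair_index k) n \<omega> + q k * (U (pair_index k) n \<omega>)\<^sup>2)" for a b q n \<omega>
  have [measurable]: "Q a b q n \<in> borel_measurable Om" for a b q n unfolding Q_def by measurable
  have comb: "s * (a0 + (\<Sum>k<?m. b0 k * X k + q0 k * (X k)\<^sup>2)) + t * (a1 + (\<Sum>k<?m. b1 k * X k + q1 k * (X k)\<^sup>2)) =
     (s * a0 + t * a1) + (\<Sum>k<?m. (s * b0 k + t * b1 k) * X k + (s * q0 k + t * q1 k) * (X k)\<^sup>2)" for s t X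
    by (simp only: sum_distrib_left sum.distrib distrib_left distrib_right) (simp add: algebra_simps sum.distrib)
  have "(\<lambda>n. measure Om {\<omega>\<in>space Om. A0 n \<omega> \<in> C0 \<and> A1 n \<omega> \<in> C1}) \<longlonglongrightarrow>
    measure (normals ?m) {\<omega>\<in>space (normals ?m). B0 \<omega> \<in> C0 \<and> B1 \<omega> \<in> C1}"
  proof (rule joint_char_imp_joint_prob[OF Om.prob_space_axioms N _ _ _ _ _ C])
    fix s t :: real
    have "(\<lambda>n. (\<integral>\<omega>. iexp (s * A0 n \<omega> + t * A1 n \<omega>) \<partial>Om) - (\<integral>\<omega>. iexp (s * Q a0 b0 q0 n \<omega> + t * Q a1 b1 q1 n \<omega>) \<partial>Om)) \<longlonglongrightarrow> 0"
    proof (rule Om.iexp_conv_prob)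
      show "conv_prob Om (\<lambda>n \<omega>. s * A0 n \<omega> + t * A1 n \<omega> - (s * Q a0 b0 q0 n \<omega> + t * Q a1 b1 q1 n \<omega>)) 0"
      proof (rule conv_prob_good)
        fix K
        have "((\<lambda>b. s * (A0 (fst b) (snd b) - Q a0 b0 q0 (fst b) (snd b)) + t * (A1 (fst b) (snd b) - Q a1 b1 q1 (fst b) (snd b))) \<longlongrightarrow> s * 0 + t * 0) (good K)"
          unfolding Q_def by (intro tendsto_add tendsto_mult tendsto_const A0 A1)
        then show "((\<lambda>b. s * A0 (fst b) (snd b) + t * A1 (fst b) (snd b) - (s * Q a0 b0 q0 (fst b) (snd b) + t * Q a1 b1 q1 (fst b) (snd b))) \<longlongrightarrow> 0) (good K)"
          by (simp add: algebra_simps)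
      qed measurable
    qed measurable
    moreover have "(\<lambda>n. \<integral>\<omega>. iexp (s * Q a0 b0 q0 n \<omega> + t * Q a1 b1 q1 n \<omega>) \<partial>Om) \<longlonglongrightarrow> (\<integral>x. iexp (s * B0 x + t * B1 x) \<partial>normals ?m)"
      unfolding Q_def B0 B1 comb by (rule quadratic_form_char_conv)
    ultimately have "(\<lambda>n. ((\<integral>\<omega>. iexp (s * A0 n \<omega> + t * A1 n \<omega>) \<partial>Om) - (\<integral>\<omega>. iexp (s * Q a0 b0 q0 n \<omega> + t * Q a1 b1 q1 n \<omega>) \<partial>Om)) +
        (\<integral>\<omega>. iexp (s * Q a0 b0 q0 n \<omega> + t * Q a1 b1 q1 n \<omega>) \<partial>Om)) \<longlonglongrightarrow> 0 + (\<integral>x. iexp (s * B0 x + t * B1 x) \<partial>normals ?m)"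
      by (rule tendsto_add)
    then show "(\<lambda>n. \<integral>\<omega>. iexp (s * A0 n \<omega> + t * A1 n \<omega>) \<partial>Om) \<longlonglongrightarrow> (\<integral>x. iexp (s * B0 x + t * B1 x) \<partial>normals ?m)"
      by simp
  qed measurable
  then show ?thesis by (simp add: space_Om)
qed

text \<open>The zero constant and the zero coefficients give the sum the shape in which
  \<open>joint_limit_prob\<close> is stated; the five lemmas after it serve the same
  purpose.\<close>

lemma MM'_first: "MM' (d+1) n \<omega> = 0 + (\<Sum>k<2*d+1. 0 * U (pair_index k) n \<omega> + (if k < d then 1 / v k else 0) * (U (pair_index k) n \<omega>)\<^sup>2)"
proof -
  have "(\<Sum>k<2*d+1. 0 * U (pair_index k) n \<omega> + (if k < d then 1 / v k else 0) * (U (pair_index k) n \<omega>)\<^sup>2)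
     = (\<Sum>k<2*d+1. if k < d then (U (pair_index k) n \<omega>)\<^sup>2 / v k else 0)" by (intro sum.cong) auto
  then show ?thesis unfolding sum_first_block MM'_def by (simp add: pair_index_def)
qed

lemma MM'_second: "MM' (d+2) n \<omega> = 0 + (\<Sum>k<2*d+1. 0 * U (pair_index k) n \<omega> + (if d < k then 1 / v (k - Suc d) else 0) * (U (pair_index k) n \<omega>)\<^sup>2)"
proof -
  have "(\<Sum>k<2*d+1. 0 * U (pair_index k) n \<omega> + (if d < k then 1 / v (k - Suc d) else 0) * (U (pair_index k) n \<omega>)\<^sup>2)
     = (\<Sum>k<2*d+1. if d < k then (U (pair_index k) n \<omega>)\<^sup>2 / v (k - Suc d) else 0)" by (intro sum.cong) auto
  then show ?thesis unfolding sum_last_block MM'_def by (simp add: pair_index_def)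
qed

lemma SS'_form:
  assumes "p \<le> d"
  shows "SS' p \<beta> \<delta> \<sigma>w n \<omega> = \<delta> / 2 / \<sigma>w + (\<Sum>k<2*d+1. (if p \<le> k \<and> k \<le> d then resid_coeff d \<beta> k / \<sigma>w else 0) * U (pair_index k) n \<omega> + 0 * (U (pair_index k) n \<omega>)\<^sup>2)"
proof -
  have "(\<Sum>k<2*d+1. (if p \<le> k \<and> k \<le> d then resid_coeff d \<beta> k / \<sigma>w else 0) * U (pair_index k) n \<omega> + 0 * (U (pair_index k) n \<omega>)\<^sup>2)
     = (\<Sum>k<2*d+1. if p \<le> k \<and> k \<le> d then resid_coeff d \<beta> k * U (pair_index k) n \<omega> / \<sigma>w else 0)" by (intro sum.cong) auto
  then show ?thesis unfolding sum_middle_block[OF assms] SS'_def by (simp add: pair_index_def sum_divide_distrib add_divide_distrib)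
qed

lemma M_lim_first: "M_lim 0 \<omega> = 0 + (\<Sum>k<2*d+1. 0 * (sqrt (\<Prod>c\<in>pair_index k. v c) * \<omega> k) + (if k < d then 1 / v k else 0) * (sqrt (\<Prod>c\<in>pair_index k. v c) * \<omega> k)\<^sup>2)"
proof -
  have "(\<Sum>k<2*d+1. 0 * (sqrt (\<Prod>c\<in>pair_index k. v c) * \<omega> k) + (if k < d then 1 / v k else 0) * (sqrt (\<Prod>c\<in>pair_index k. v c) * \<omega> k)\<^sup>2)
     = (\<Sum>k<2*d+1. if k < d then (\<omega> k)\<^sup>2 else 0)"
    using v_pos by (intro sum.cong refl) (auto simp: sqrt_prod_pair_index power_mult_distrib less_imp_le less_imp_neq[symmetric])
  then show ?thesis unfolding sum_first_block M_lim_def by simp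
qed

lemma M_lim_second: "M_lim (Suc d) \<omega> = 0 + (\<Sum>k<2*d+1. 0 * (sqrt (\<Prod>c\<in>pair_index k. v c) * \<omega> k) + (if d < k then 1 / v (k - Suc d) else 0) * (sqrt (\<Prod>c\<in>pair_index k. v c) * \<omega> k)\<^sup>2)"
proof -
  have "(\<Sum>k<2*d+1. 0 * (sqrt (\<Prod>c\<in>pair_index k. v c) * \<omega> k) + (if d < k then 1 / v (k - Suc d) else 0) * (sqrt (\<Prod>c\<in>pair_index k. v c) * \<omega> k)\<^sup>2)
     = (\<Sum>k<2*d+1. if d < k then (\<omega> k)\<^sup>2 else 0)"
  proof (intro sum.cong refl)
    fix k assume k: "k \<in> {..<2*d+1}"
    have "0 < v (k - Suc d)" using k by (intro v_pos) auto
    then show "0 * (sqrt (\<Prod>c\<in>pair_index k. v c) * \<omega> k) + (if d < k then 1 / v (k - Suc d) else 0) * (sqrt (\<Prod>c\<in>pair_index k. v c) * \<omega> k)\<^sup>2 = (if d < k then (\<omega> k)\<^sup>2 else 0)"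
      using k by (auto simp: sqrt_prod_pair_index power_mult_distrib)
  qed
  then show ?thesis unfolding sum_last_block M_lim_def by simp
qed

lemma S_lim_form:
  assumes "p \<le> d"
  shows "S_lim p \<beta> \<delta> \<sigma>w \<omega> = \<delta> / 2 / \<sigma>w + (\<Sum>k<2*d+1. (if p \<le> k \<and> k \<le> d then resid_coeff d \<beta> k / \<sigma>w else 0) * (sqrt (\<Prod>c\<in>pair_index k. v c) * \<omega> k) + 0 * (sqrt (\<Prod>c\<in>pair_index k. v c) * \<omega> k)\<^sup>2)"
proof -
  have "(\<Sum>k<2*d+1. (if p \<le> k \<and> k \<le> d then resid_coeff d \<beta> k / \<sigma>w else 0) * (sqrt (\<Prod>c\<in>pair_index k. v c) * \<omega> k) + 0 * (sqrt (\<Prod>c\<in>pair_index k. v c) * \<omega> k)\<^sup>2)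
     = (\<Sum>k<2*d+1. if p \<le> k \<and> k \<le> d then resid_coeff d \<beta> k * (sqrt (v k) * \<omega> k) / \<sigma>w else 0)"
    by (intro sum.cong) (auto simp: sqrt_prod_pair_index)
  then show ?thesis unfolding sum_middle_block[OF assms] S_lim_def by (simp add: sum_divide_distrib add_divide_distrib)
qed

lemma S_lim_measurable: "p \<le> d \<Longrightarrow> d < m \<Longrightarrow> S_lim p \<beta> \<delta> \<sigma>w \<in> borel_measurable (PiM {..<m} (\<lambda>_. borel))"
  unfolding S_lim_def
  by (intro borel_measurable_divide borel_measurable_add borel_measurable_sum borel_measurable_times borel_measurable_const measurable_component_singleton) auto

lemma M_lim_measurable: "l + d \<le> m \<Longrightarrow> M_lim l \<in> borel_measurable (PiM {..<m} (\<lambda>_. borel))"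
  unfolding M_lim_def
  by (intro borel_measurable_sum borel_measurable_power measurable_component_singleton) auto

lemma measurable_normals: "measurable (normals m) N = measurable (PiM {..<m} (\<lambda>_. borel)) N"
  by (intro measurable_cong_sets sets_PiM_cong) auto

text \<open>The limit statistic is affine in the error coordinate \<open>d\<close> with nonzero
  slope, so each section of the event has at most one point.\<close>

lemma AE_S_lim:
  assumes "p \<le> d" "d < m" "\<sigma>w \<noteq> 0"
  shows "AE \<omega> in normals m. S_lim p \<beta> \<delta> \<sigma>w \<omega> \<noteq> y"
proof -
  let ?E = "{\<omega>\<in>space (normals m). S_lim p \<beta> \<delta> \<sigma>w \<omega> = y}"
  have [measurable]: "S_lim p \<beta> \<delta> \<sigma>w \<in> borel_measurable (normals m)"
    unfolding measurable_normals by (rule S_lim_measurable[OF assms(1,2)])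
  have vd: "0 < v d" by (rule v_pos) simp
  have "AE \<omega> in normals m. \<omega> \<notin> ?E"
  proof (rule normals_null_set[OF assms(2)])
    fix \<omega> :: "nat \<Rightarrow> real"
    define r where "r = (\<Sum>c\<in>{p..<d}. resid_coeff d \<beta> c * (sqrt (v c) * \<omega> c))"
    have "S_lim p \<beta> \<delta> \<sigma>w (fun_upd \<omega> d u) = (\<delta> / 2 + (r + sqrt (v d) * u)) / \<sigma>w" for u
      using assms(1) unfolding S_lim_def r_def by (simp add: sum.last_plus resid_coeff_def)
    then have "{u. fun_upd \<omega> d u \<in> ?E} \<subseteq> {(y * \<sigma>w - \<delta> / 2 - r) / sqrt (v d)}"
      using assms(3) vd by (auto simp: field_simps)
    then show "finite {u. fun_upd \<omega> d u \<in> ?E}" by (rule finite_subset) simp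
  qed measurable
  then show ?thesis by (auto elim!: AE_mp intro!: AE_I2)
qed

text \<open>Along the coordinate \<open>l\<close> the sum of squares is \<open>u^2 + r\<close>,
  which takes the value \<open>a\<close> at most twice. Without covariates the sum is 0, which
  differs from \<open>a\<close>.\<close>

lemma AE_M_lim:
  assumes "l + d \<le> m" "a \<noteq> 0"
  shows "AE \<omega> in normals m. M_lim l \<omega> \<noteq> a"
proof (cases "d = 0")
  case True
  then show ?thesis unfolding M_lim_def using assms by simp
next
  case False
  let ?E = "{\<omega>\<in>space (normals m). M_lim l \<omega> = a}"
  have [measurable]: "M_lim l \<in> borel_measurable (normals m)"
    unfolding measurable_normals by (rule M_lim_measurable[OF assms(1)])
  have lm: "l < m" using assms False by simp
  have "AE \<omega> in normals m. \<omega> \<notin> ?E"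
  proof (rule normals_null_set[OF lm])
    fix \<omega> :: "nat \<Rightarrow> real"
    define r where "r = (\<Sum>j\<in>{..<d} - {0}. (\<omega> (l + j))\<^sup>2)"
    have "M_lim l (fun_upd \<omega> l u) = u\<^sup>2 + r" for u
      using False unfolding M_lim_def r_def by (subst sum.remove[of _ 0]) (auto intro!: sum.cong)
    then have "{u. fun_upd \<omega> l u \<in> ?E} \<subseteq> {sqrt (a - r), - sqrt (a - r)}"
      by (auto simp: power2_eq_iff real_sqrt_abs)
    then show "finite {u. fun_upd \<omega> l u \<in> ?E}" by (rule finite_subset) simp
  qed measurable
  then show ?thesis by (auto elim!: AE_mp intro!: AE_I2)
qed

lemma SS_MM_limit:
  assumes p: "p \<le> d" and \<mu>: "\<And>n. 1 \<le> n \<Longrightarrow> sqrt (real n) * (\<mu>1 n - \<mu>2 n) = \<delta>"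
    and \<sigma>w: "\<sigma>w = sqrt (\<Sum>c\<in>{p..d}. (resid_coeff d \<beta> c)\<^sup>2 * v c)" "\<sigma>w \<noteq> 0" and a: "0 < a"
  shows "(\<lambda>n. measure Om {\<omega>. SS p \<mu>1 \<mu>2 \<beta> n \<omega> \<le> y \<and> MM (d+1) n \<omega> < a}) \<longlonglongrightarrow>
    measure (normals (2*d+1)) {\<omega>\<in>space (normals (2*d+1)). S_lim p \<beta> \<delta> \<sigma>w \<omega> \<le> y \<and> M_lim 0 \<omega> < a}"
proof -
  have "(\<lambda>n. measure Om {\<omega>. SS p \<mu>1 \<mu>2 \<beta> n \<omega> \<in> {..y} \<and> MM (d+1) n \<omega> \<in> {..<a}}) \<longlonglongrightarrow>
    measure (normals (2*d+1)) {\<omega>\<in>space (normals (2*d+1)). S_lim p \<beta> \<delta> \<sigma>w \<omega> \<in> {..y} \<and> M_lim 0 \<omega> \<in> {..<a}}"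
  proof (rule joint_limit_prob[OF SS_measurable[OF p] MM_measurable _ _ SS_limit[OF p \<mu> \<sigma>w(1), unfolded SS'_form[OF p]]
        MM_limit[of "d+1", unfolded MM'_first] S_lim_form[OF p] M_lim_first])
    show "AE x in normals (2*d+1). S_lim p \<beta> \<delta> \<sigma>w x \<notin> frontier {..y}"
      using AE_S_lim[OF p, of "2*d+1" \<sigma>w \<beta> \<delta> y] \<sigma>w(2) by (auto elim!: AE_mp intro!: AE_I2)
    show "AE x in normals (2*d+1). M_lim 0 x \<notin> frontier {..<a}"
      using AE_M_lim[of 0 "2*d+1" a] a by (auto elim!: AE_mp intro!: AE_I2)
  qed (use p in \<open>auto simp: measurable_normals intro!: S_lim_measurable M_lim_measurable\<close>)
  then show ?thesis by simp
qed

lemma MM_MM_limit: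
  assumes a: "0 < a"
  shows "(\<lambda>n. measure Om {\<omega>. MM (d+1) n \<omega> < a \<and> MM (d+2) n \<omega> < a}) \<longlonglongrightarrow>
    measure (normals (2*d+1)) {\<omega>\<in>space (normals (2*d+1)). M_lim 0 \<omega> < a \<and> M_lim (Suc d) \<omega> < a}"
proof -
  have "(\<lambda>n. measure Om {\<omega>. MM (d+1) n \<omega> \<in> {..<a} \<and> MM (d+2) n \<omega> \<in> {..<a}}) \<longlonglongrightarrow>
    measure (normals (2*d+1)) {\<omega>\<in>space (normals (2*d+1)). M_lim 0 \<omega> \<in> {..<a} \<and> M_lim (Suc d) \<omega> \<in> {..<a}}"
  proof (rule joint_limit_prob[OF MM_measurable MM_measurable _ _ MM_limit[of "d+1", unfolded MM'_first]
        MM_limit[of "d+2", unfolded MM'_second] M_lim_first M_lim_second])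
    show "AE x in normals (2*d+1). M_lim 0 x \<notin> frontier {..<a}" "AE x in normals (2*d+1). M_lim (Suc d) x \<notin> frontier {..<a}"
      using AE_M_lim[of 0 "2*d+1" a] AE_M_lim[of "Suc d" "2*d+1" a] a by (auto elim!: AE_mp intro!: AE_I2)
  qed (auto simp: measurable_normals intro!: M_lim_measurable)
  then show ?thesis by simp
qed

end

section \<open>Rerandomization\<close>

lemma indep_rv_distr_pair:
  assumes P: "prob_space P" and ind: "indep_rv P A f B g"
  shows "distr P (A \<Otimes>\<^sub>M B) (\<lambda>\<omega>. (f \<omega>, g \<omega>)) = distr P A f \<Otimes>\<^sub>M distr P B g"
proof -
  interpret P: prob_space P by fact
  have [measurable]: "f \<in> measurable P A" "g \<in> measurable P B" using ind by (auto simp: indep_rv_def)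
  interpret f: prob_space "distr P A f" by (rule P.prob_space_distr) simp
  interpret g: prob_space "distr P B g" by (rule P.prob_space_distr) simp
  interpret pair_sigma_finite "distr P A f" "distr P B g" ..
  have pr: "P.prob ((f -` C \<inter> space P) \<inter> (g -` D \<inter> space P)) = P.prob (f -` C \<inter> space P) * P.prob (g -` D \<inter> space P)"
    if "C \<in> sets A" "D \<in> sets B" for C D
    using ind that unfolding indep_rv_def by (intro P.indep_setD) auto
  show ?thesis
  proof (rule pair_measure_eqI[symmetric])
    fix C D assume "C \<in> sets (distr P A f)" "D \<in> sets (distr P B g)"
    then have [measurable]: "C \<in> sets A" "D \<in> sets B" by simp_all
    have "(\<lambda>\<omega>. (f \<omega>, g \<omega>)) -` (C \<times> D) \<inter> space P = (f -` C \<inter> space P) \<inter> (g -` D \<inter> space P)" by auto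
    then have "emeasure (distr P (A \<Otimes>\<^sub>M B) (\<lambda>\<omega>. (f \<omega>, g \<omega>))) (C \<times> D) = P.prob ((f -` C \<inter> space P) \<inter> (g -` D \<inter> space P))"
      by (subst emeasure_distr) (auto simp: P.emeasure_eq_measure)
    also have "\<dots> = emeasure (distr P A f) C * emeasure (distr P B g) D"
      unfolding pr[OF \<open>C \<in> sets A\<close> \<open>D \<in> sets B\<close>]
      by (subst (1 2) emeasure_distr) (auto simp: P.emeasure_eq_measure ennreal_mult)
    finally show "emeasure (distr P A f) C * emeasure (distr P B g) D = emeasure (distr P (A \<Otimes>\<^sub>M B) (\<lambda>\<omega>. (f \<omega>, g \<omega>))) (C \<times> D)" ..
  qed (auto intro: f.sigma_finite_measure_axioms g.sigma_finite_measure_axioms)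
qed

definition accept_prob :: "nat \<Rightarrow> ('x \<Rightarrow> (nat \<Rightarrow> bool) \<Rightarrow> real) \<Rightarrow> real \<Rightarrow> 'x \<Rightarrow> real" where
  "accept_prob n Mdist a x = measure_pmf.prob (CR n) {t. Mdist x t < a}"

lemma accept_prob_sum: "accept_prob n Mdist a x = (\<Sum>t\<in>set_pmf (CR n). (1 / 2) ^ n * indicator {t. Mdist x t < a} t)"
proof -
  have "accept_prob n Mdist a x = measure_pmf.expectation (CR n) (indicator {t. Mdist x t < a})"
    unfolding accept_prob_def by simp
  also have "\<dots> = (\<Sum>t\<in>set_pmf (CR n). indicator {t. Mdist x t < a} t * pmf (CR n) t)"
    by (rule integral_measure_pmf_real) (auto simp: finite_set_pmf_CR)
  finally show ?thesis by (simp add: pmf_CR mult.commute)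
qed

lemma (in prob_space) measure_pair_section:
  assumes N: "prob_space N" and E: "Measurable.pred (M \<Otimes>\<^sub>M N) (\<lambda>p. \<Phi> (fst p) (snd p))"
  shows "measure (M \<Otimes>\<^sub>M N) {p\<in>space (M \<Otimes>\<^sub>M N). \<Phi> (fst p) (snd p)} = (\<integral>x. measure N {y\<in>space N. \<Phi> x y} \<partial>M)"
    and "(\<lambda>x. measure N {y\<in>space N. \<Phi> x y}) \<in> borel_measurable M"
proof -
  interpret N: prob_space N by fact
  interpret pair_prob_space M N ..
  let ?E = "{p\<in>space (M \<Otimes>\<^sub>M N). \<Phi> (fst p) (snd p)}"
  have [measurable]: "?E \<in> sets (M \<Otimes>\<^sub>M N)" using E by measurable
  have sec: "(\<integral>y. indicator ?E (x, y) \<partial>N) = measure N {y\<in>space N. \<Phi> x y}" if "x \<in> space M" for x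
  proof -
    have "(\<integral>y. indicator ?E (x, y) \<partial>N) = (\<integral>y. indicator {y\<in>space N. \<Phi> x y} y \<partial>N :: real)"
      using that by (intro Bochner_Integration.integral_cong) (auto simp: indicator_def space_pair_measure)
    then show ?thesis by (simp add: Int_absorb2)
  qed
  have "measure (M \<Otimes>\<^sub>M N) ?E = (\<integral>p. indicator ?E p \<partial>(M \<Otimes>\<^sub>M N))" by simp
  also have "\<dots> = (\<integral>x. (\<integral>y. indicator ?E (x, y) \<partial>N) \<partial>M)"
    by (rule integral_fst'[symmetric]) (intro P.integrable_const_bound[where B=1], auto)
  also have "\<dots> = (\<integral>x. measure N {y\<in>space N. \<Phi> x y} \<partial>M)"
    by (intro Bochner_Integration.integral_cong refl sec)
  finally show "measure (M \<Otimes>\<^sub>M N) ?E = (\<integral>x. measure N {y\<in>space N. \<Phi> x y} \<partial>M)" .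
  have "(\<lambda>x. \<integral>y. (indicator ?E (x, y) :: real) \<partial>N) \<in> borel_measurable M"
    by (rule N.borel_measurable_lebesgue_integral) (simp add: case_prod_beta')
  then show "(\<lambda>x. measure N {y\<in>space N. \<Phi> x y}) \<in> borel_measurable M"
    by (rule measurable_cong[THEN iffD1, rotated]) (rule sec)
qed

text \<open>
  Conditionally on the covariates an accepted assignment has the complete-randomization law reweighted
  by the inverse of the acceptance probability, which is close to the constant \<open>c\<close>.
\<close>

lemma rerandomized_prob_approx:
  fixes x :: "nat \<Rightarrow> nat \<Rightarrow> 'a \<Rightarrow> real" and T :: "nat \<Rightarrow> 'a \<Rightarrow> bool" and e :: "nat \<Rightarrow> 'a \<Rightarrow> real"
  assumes P: "prob_space P"
    and ind: "indep_rv P (PiM {..<n} (\<lambda>_. count_space UNIV) \<Otimes>\<^sub>M PiM {..<n} (\<lambda>_. covariate_space d))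
               (\<lambda>\<omega>. (\<lambda>i\<in>{..<n}. T i \<omega>, \<lambda>i\<in>{..<n}. \<lambda>j\<in>{..<d}. x i j \<omega>))
               (PiM {..<n} (\<lambda>_. borel)) (\<lambda>\<omega>. \<lambda>i\<in>{..<n}. e i \<omega>)"
    and lawX: "distr P (PiM {..<n} (\<lambda>_. covariate_space d)) (\<lambda>\<omega>. \<lambda>i\<in>{..<n}. \<lambda>j\<in>{..<d}. x i j \<omega>) = Xn"
    and lawE: "distr P (PiM {..<n} (\<lambda>_. borel)) (\<lambda>\<omega>. \<lambda>i\<in>{..<n}. e i \<omega>) = En"
    and rr: "rerandomized P n d Mdist a x T"
    and Mdist: "\<And>t. (\<lambda>x. Mdist x t) \<in> borel_measurable (PiM {..<n} (\<lambda>_. covariate_space d))"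
    and Mdist_cong: "\<And>y z t. (\<And>i j. i < n \<Longrightarrow> j < d \<Longrightarrow> y i j = z i j) \<Longrightarrow> Mdist y t = Mdist z t"
    and \<Phi>: "\<And>t. Measurable.pred (PiM {..<n} (\<lambda>_. covariate_space d) \<Otimes>\<^sub>M PiM {..<n} (\<lambda>_. borel)) (\<lambda>p. \<Phi> t (fst p) (snd p))"
    and c: "0 < c"
  shows "\<bar>measure P {\<omega>\<in>space P. \<Phi> (\<lambda>i. i < n \<and> T i \<omega>) (\<lambda>i\<in>{..<n}. \<lambda>j\<in>{..<d}. x i j \<omega>) (\<lambda>i\<in>{..<n}. e i \<omega>)}
      - (\<Sum>t\<in>set_pmf (CR n). (1 / 2) ^ n * measure (Xn \<Otimes>\<^sub>M En) {p\<in>space (Xn \<Otimes>\<^sub>M En). \<Phi> t (fst p) (snd p) \<and> Mdist (fst p) t < a}) / c\<bar>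
    \<le> 2 * (\<integral>x. \<bar>1 - accept_prob n Mdist a x / c\<bar> \<partial>Xn)"
proof -
  interpret P: prob_space P by fact
  let ?A = "PiM {..<n} (\<lambda>_. count_space UNIV) :: (nat \<Rightarrow> bool) measure" and ?B = "PiM {..<n} (\<lambda>_. covariate_space d)"
    and ?C = "PiM {..<n} (\<lambda>_. borel) :: (nat \<Rightarrow> real) measure"
  define Y where "Y \<omega> = (\<lambda>i\<in>{..<n}. \<lambda>j\<in>{..<d}. x i j \<omega>)" for \<omega>
  define Tr where "Tr \<omega> = (\<lambda>i\<in>{..<n}. T i \<omega>)" for \<omega>
  define Er where "Er \<omega> = (\<lambda>i\<in>{..<n}. e i \<omega>)" for \<omega>
  \<comment> \<open>Setting the assignment to false beyond the first \<open>n\<close> units puts it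
    into the support of \<open>CR n\<close>.\<close>
  define Tb where "Tb \<omega> = (\<lambda>i. i < n \<and> T i \<omega>)" for \<omega>
  define pr where "pr y = accept_prob n Mdist a y" for y
  let ?CR = "set_pmf (CR n)"
  have fCR: "finite ?CR" by (rule finite_set_pmf_CR)
  have TY[measurable]: "(\<lambda>\<omega>. (Tr \<omega>, Y \<omega>)) \<in> measurable P (?A \<Otimes>\<^sub>M ?B)" and [measurable]: "Er \<in> measurable P ?C"
    using ind unfolding indep_rv_def Tr_def[abs_def] Y_def[abs_def] Er_def[abs_def] by auto
  have [measurable]: "Tr \<in> measurable P ?A" "Y \<in> measurable P ?B"
    using measurable_comp[OF TY measurable_fst] measurable_comp[OF TY measurable_snd] by (auto simp: comp_def)
  have sX[measurable_cong]: "sets Xn = sets ?B" and sE[measurable_cong]: "sets En = sets ?C" using lawX lawE by auto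
  interpret X: prob_space Xn unfolding lawX[symmetric] Y_def[symmetric] by (rule P.prob_space_distr) simp
  interpret E: prob_space En unfolding lawE[symmetric] Er_def[symmetric] by (rule P.prob_space_distr) simp
  note [measurable] = Mdist
  have [measurable]: "pr \<in> borel_measurable ?B"
    unfolding pr_def[abs_def] accept_prob_sum indicator_def by measurable
  have pr0: "0 \<le> pr y" "pr y \<le> 1" for y unfolding pr_def accept_prob_def by auto
  \<comment> \<open>The conditional probability of the event given assignment \<open>t\<close> and
    covariates \<open>y\<close>, the errors being integrated out.\<close>
  define g where "g t y = measure En {z\<in>space En. \<Phi> t y z}" for t y
  have \<Phi>XE: "Measurable.pred (Xn \<Otimes>\<^sub>M En) (\<lambda>p. \<Phi> t (fst p) (snd p))" for t
    using \<Phi>[of t] by (simp add: measurable_cong_sets[OF sets_pair_measure_cong[OF sX sE] refl])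
  have [measurable]: "g t \<in> borel_measurable Xn" for t
    unfolding g_def by (rule X.measure_pair_section(2)[OF E.prob_space_axioms \<Phi>XE])
  then have [measurable]: "g t \<in> borel_measurable ?B" for t by (simp add: measurable_cong_sets[OF sX refl])
  have g01: "0 \<le> g t y" "g t y \<le> 1" for t y unfolding g_def by auto
  have intX: "(\<integral>\<omega>. h (Y \<omega>) \<partial>P) = (\<integral>y. h y \<partial>Xn)" if "h \<in> borel_measurable ?B" for h :: "_ \<Rightarrow> real"
    unfolding lawX[symmetric] Y_def[symmetric] using that by (simp add: integral_distr)
  define Et where "Et t = {\<omega>\<in>space P. Tb \<omega> = t}" for t
  have Et_eq: "Et t = {\<omega>\<in>space P. \<forall>i<n. Tr \<omega> i = t i}" if "t \<in> ?CR" for t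
  proof -
    have tn: "\<not> t i" if "\<not> i < n" for i using \<open>t \<in> ?CR\<close> that unfolding set_pmf_CR by simp
    have "Tb \<omega> = t \<longleftrightarrow> (\<forall>i<n. Tr \<omega> i = t i)" for \<omega>
    proof
      assume "\<forall>i<n. Tr \<omega> i = t i"
      then show "Tb \<omega> = t" using tn unfolding Tb_def Tr_def by (intro ext) auto
    qed (auto simp: Tb_def Tr_def)
    then show ?thesis unfolding Et_def by simp
  qed
  have Trm: "{\<tau>\<in>space ?A. \<forall>i<n. \<tau> i = t i} \<in> sets ?A" for t by measurable
  have [measurable]: "Et t \<in> sets P" if "t \<in> ?CR" for t
  proof -
    have "Et t = Tr -` {\<tau>\<in>space ?A. \<forall>i<n. \<tau> i = t i} \<inter> space P"
      unfolding Et_eq[OF that] using measurable_space[OF \<open>Tr \<in> measurable P ?A\<close>] by auto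
    then show ?thesis using measurable_sets[OF \<open>Tr \<in> measurable P ?A\<close> Trm] by simp
  qed
  have Tb_CR: "Tb \<omega> \<in> ?CR" for \<omega> by (auto simp: set_pmf_CR Tb_def)
  \<comment> \<open>The errors are independent of assignment and covariates jointly, so they can be
    integrated out first.\<close>
  have E1: "measure P {\<omega>\<in>space P. Tb \<omega> = t \<and> \<Phi> t (Y \<omega>) (Er \<omega>)} = (\<integral>\<omega>. indicator (Et t) \<omega> * g t (Y \<omega>) \<partial>P)" if t: "t \<in> ?CR" for t
  proof -
    let ?D = "distr P (?A \<Otimes>\<^sub>M ?B) (\<lambda>\<omega>. (Tr \<omega>, Y \<omega>))"
    interpret D: prob_space ?D by (rule P.prob_space_distr) simp
    define \<Psi> where "\<Psi> u z = ((\<forall>i<n. fst u i = t i) \<and> \<Phi> t (snd u) z)" for u z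
    have \<Psi>m: "Measurable.pred ((?A \<Otimes>\<^sub>M ?B) \<Otimes>\<^sub>M ?C) (\<lambda>p. \<Psi> (fst p) (snd p))"
    proof -
      have "(\<lambda>p. (snd (fst p), snd p)) \<in> measurable ((?A \<Otimes>\<^sub>M ?B) \<Otimes>\<^sub>M ?C) (?B \<Otimes>\<^sub>M ?C)" by measurable
      from measurable_compose[OF this \<Phi>[of t]]
      have [measurable]: "Measurable.pred ((?A \<Otimes>\<^sub>M ?B) \<Otimes>\<^sub>M ?C) (\<lambda>p. \<Phi> t (snd (fst p)) (snd p))" by simp
      show ?thesis unfolding \<Psi>_def by measurable
    qed
    have s: "sets (?D \<Otimes>\<^sub>M En) = sets ((?A \<Otimes>\<^sub>M ?B) \<Otimes>\<^sub>M ?C)" by (intro sets_pair_measure_cong) (auto simp: sE)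
    have \<Psi>m': "Measurable.pred (?D \<Otimes>\<^sub>M En) (\<lambda>p. \<Psi> (fst p) (snd p))"
      using \<Psi>m by (simp add: measurable_cong_sets[OF s refl])
    have joint: "distr P ((?A \<Otimes>\<^sub>M ?B) \<Otimes>\<^sub>M ?C) (\<lambda>\<omega>. ((Tr \<omega>, Y \<omega>), Er \<omega>)) = ?D \<Otimes>\<^sub>M En"
      using indep_rv_distr_pair[OF P ind] lawE unfolding Tr_def[symmetric] Y_def[symmetric] Er_def[symmetric] by simp
    have mE: "{p\<in>space ((?A \<Otimes>\<^sub>M ?B) \<Otimes>\<^sub>M ?C). \<Psi> (fst p) (snd p)} \<in> sets ((?A \<Otimes>\<^sub>M ?B) \<Otimes>\<^sub>M ?C)" using \<Psi>m by measurable
    have mJ: "(\<lambda>\<omega>. ((Tr \<omega>, Y \<omega>), Er \<omega>)) \<in> measurable P ((?A \<Otimes>\<^sub>M ?B) \<Otimes>\<^sub>M ?C)" by measurable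
    have "{\<omega>\<in>space P. Tb \<omega> = t \<and> \<Phi> t (Y \<omega>) (Er \<omega>)} = (\<lambda>\<omega>. ((Tr \<omega>, Y \<omega>), Er \<omega>)) -` {p\<in>space ((?A \<Otimes>\<^sub>M ?B) \<Otimes>\<^sub>M ?C). \<Psi> (fst p) (snd p)} \<inter> space P"
      using Et_eq[OF t] measurable_space[OF mJ] unfolding Et_def \<Psi>_def by auto
    then have "measure P {\<omega>\<in>space P. Tb \<omega> = t \<and> \<Phi> t (Y \<omega>) (Er \<omega>)} = measure (?D \<Otimes>\<^sub>M En) {p\<in>space ((?A \<Otimes>\<^sub>M ?B) \<Otimes>\<^sub>M ?C). \<Psi> (fst p) (snd p)}"
      unfolding joint[symmetric] by (simp add: measure_distr[OF mJ mE])
    also have "space ((?A \<Otimes>\<^sub>M ?B) \<Otimes>\<^sub>M ?C) = space (?D \<Otimes>\<^sub>M En)" by (rule sets_eq_imp_space_eq[OF s[symmetric]])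
    also have "measure (?D \<Otimes>\<^sub>M En) {p\<in>space (?D \<Otimes>\<^sub>M En). \<Psi> (fst p) (snd p)} = (\<integral>u. measure En {z\<in>space En. \<Psi> u z} \<partial>?D)"
      by (rule D.measure_pair_section(1)[OF E.prob_space_axioms \<Psi>m'])
    also have "\<dots> = (\<integral>\<omega>. measure En {z\<in>space En. \<Psi> (Tr \<omega>, Y \<omega>) z} \<partial>P)"
      using D.measure_pair_section(2)[OF E.prob_space_axioms \<Psi>m'] by (intro integral_distr) auto
    also have "\<dots> = (\<integral>\<omega>. indicator (Et t) \<omega> * g t (Y \<omega>) \<partial>P)"
    proof (intro Bochner_Integration.integral_cong refl)
      fix \<omega> assume "\<omega> \<in> space P"
      then show "measure En {z\<in>space En. \<Psi> (Tr \<omega>, Y \<omega>) z} = indicator (Et t) \<omega> * g t (Y \<omega>)"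
      proof (cases "\<forall>i<n. Tr \<omega> i = t i")
        case True
        then show ?thesis using \<open>\<omega> \<in> space P\<close> unfolding Et_eq[OF t] \<Psi>_def g_def by simp
      next
        case False
        then have "{z\<in>space En. \<Psi> (Tr \<omega>, Y \<omega>) z} = {}" "\<omega> \<notin> Et t" unfolding Et_eq[OF t] \<Psi>_def by auto
        then show ?thesis by (simp only: measure_empty) (simp add: indicator_def)
      qed
    qed
    finally show ?thesis .
  qed
  define F where "F = vimage_algebra (space P) Y ?B"
  have rr': "AE \<omega> in P. ?CR \<inter> {t. Mdist (\<lambda>i j. x i j \<omega>) t < a} \<noteq> {} \<longrightarrow>
       real_cond_exp P F (indicator {\<omega>'. \<forall>i<n. T i \<omega>' = t i}) \<omega> = pmf (cond_pmf (CR n) {t. Mdist (\<lambda>i j. x i j \<omega>) t < a}) t" if "t \<in> ?CR" for t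
    using rr that unfolding rerandomized_def Let_def F_def Y_def[abs_def] by blast
  have MY: "Mdist (\<lambda>i j. x i j \<omega>) t = Mdist (Y \<omega>) t" for \<omega> t
    by (rule Mdist_cong) (simp add: Y_def)
  have YF: "Y \<in> measurable F ?B" unfolding F_def
    using measurable_space[OF \<open>Y \<in> measurable P ?B\<close>] by (intro measurable_vimage_algebra1) auto
  have subF: "subalgebra P F" unfolding subalgebra_def F_def
    using measurable_sets[OF \<open>Y \<in> measurable P ?B\<close>] measurable_space[OF \<open>Y \<in> measurable P ?B\<close>] by (auto simp: sets_vimage_algebra2)
  interpret F: finite_measure_subalgebra P F by unfold_locales (rule subF)
  have acc_ne: "?CR \<inter> {t. Mdist y t < a} \<noteq> {} \<longleftrightarrow> 0 < pr y" for y
  proof -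
    have "pr y = 0 \<longleftrightarrow> ?CR \<inter> {t. Mdist y t < a} = {}"
      unfolding pr_def accept_prob_def by (subst measure_pmf_zero_iff) simp
    then show ?thesis using pr0(1)[of y] by auto
  qed
  \<comment> \<open>The conditional probability of assignment \<open>t\<close> under
    rerandomization, set to 0 where no assignment is acceptable.\<close>
  define r where "r t y = (if 0 < pr y then (1/2)^n * indicator {t. Mdist y t < a} t / pr y else 0)" for t y
  have [measurable]: "r t \<in> borel_measurable ?B" for t unfolding r_def[abs_def] indicator_def by measurable
  \<comment> \<open>Where some assignment is acceptable, the indicator of \<open>t\<close> is
    replaced by its conditional expectation; its cofactor is a function of the covariates
    alone.\<close>
  have E2: "(\<integral>\<omega>. indicator (Et t) \<omega> * (g t (Y \<omega>) * indicator {y. 0 < pr y} (Y \<omega>)) \<partial>P) = (\<integral>y. g t y * r t y \<partial>Xn)" if t: "t \<in> ?CR" for t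
  proof -
    let ?h = "\<lambda>y. g t y * indicator {y. 0 < pr y} y"
    let ?I = "indicator {\<omega>'. \<forall>i<n. T i \<omega>' = t i} :: 'a \<Rightarrow> real"
    have I: "?I \<omega> = indicator (Et t) \<omega>" if "\<omega> \<in> space P" for \<omega>
      unfolding Et_eq[OF t] Tr_def using that by (auto simp: indicator_def)
    have Im: "?I \<in> borel_measurable P"
      by (rule measurable_cong[THEN iffD2, OF I]) (use t in measurable)
    have hm[measurable]: "?h \<in> borel_measurable ?B" by measurable
    have hF: "(\<lambda>\<omega>. ?h (Y \<omega>)) \<in> borel_measurable F" by (rule measurable_compose[OF YF hm])
    have ih: "integrable P (\<lambda>\<omega>. ?h (Y \<omega>) * ?I \<omega>)"
    proof (rule P.integrable_const_bound[where B=1])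
      show "AE \<omega> in P. norm (?h (Y \<omega>) * ?I \<omega>) \<le> 1" using g01 by (auto simp: indicator_def)
      show "(\<lambda>\<omega>. ?h (Y \<omega>) * ?I \<omega>) \<in> borel_measurable P"
        by (intro borel_measurable_times Im measurable_compose[OF _ hm]) simp
    qed
    have "(\<integral>\<omega>. indicator (Et t) \<omega> * ?h (Y \<omega>) \<partial>P) = (\<integral>\<omega>. ?h (Y \<omega>) * ?I \<omega> \<partial>P)"
      by (intro Bochner_Integration.integral_cong refl) (simp add: I)
    also have "\<dots> = (\<integral>\<omega>. ?h (Y \<omega>) * real_cond_exp P F ?I \<omega> \<partial>P)"
      by (rule F.real_cond_exp_intg(2)[symmetric, OF ih hF Im])
    also have "\<dots> = (\<integral>\<omega>. g t (Y \<omega>) * r t (Y \<omega>) \<partial>P)"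
    proof (rule integral_cong_AE)
      show "AE \<omega> in P. ?h (Y \<omega>) * real_cond_exp P F ?I \<omega> = g t (Y \<omega>) * r t (Y \<omega>)"
        using rr'[OF t]
      proof eventually_elim
        case (elim \<omega>)
        show ?case
        proof (cases "0 < pr (Y \<omega>)")
          case True
          then have ne: "?CR \<inter> {t. Mdist (Y \<omega>) t < a} \<noteq> {}" using acc_ne by blast
          then have "real_cond_exp P F ?I \<omega> = pmf (cond_pmf (CR n) {t. Mdist (Y \<omega>) t < a}) t"
            using elim unfolding MY by blast
          also have "\<dots> = r t (Y \<omega>)"
            using pmf_cond[OF ne, of t] True t by (auto simp: r_def pr_def accept_prob_def pmf_CR)
          finally show ?thesis using True by simp
        qed (simp add: r_def)
      qed
      show "(\<lambda>\<omega>. ?h (Y \<omega>) * real_cond_exp P F ?I \<omega>) \<in> borel_measurable P"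
        by (intro borel_measurable_times borel_measurable_cond_exp2 measurable_compose[OF _ hm]) simp
    qed measurable
    also have "\<dots> = (\<integral>y. g t y * r t y \<partial>Xn)" by (rule intX) measurable
    finally show ?thesis .
  qed
  \<comment> \<open>The conditional probability, under complete randomization, that the event occurs
    and the assignment is accepted; \<open>A / pr\<close> is the rerandomized probability of the
    event.\<close>
  define A where "A y = (\<Sum>t\<in>?CR. (1/2)^n * (g t y * indicator {t. Mdist y t < a} t))" for y
  have Am[measurable]: "A \<in> borel_measurable ?B" unfolding A_def[abs_def] indicator_def by measurable
  have A0: "0 \<le> A y" for y unfolding A_def using g01 by (intro sum_nonneg) auto
  have Apr: "A y \<le> pr y" for y
    unfolding A_def pr_def accept_prob_sum using g01 by (intro sum_mono) (auto simp: indicator_def)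
  have sum_r: "(\<Sum>t\<in>?CR. g t y * r t y) = (if 0 < pr y then A y / pr y else 0)" for y
    unfolding A_def r_def by (auto simp: sum_divide_distrib mult_ac)
  have "{\<omega>\<in>space P. \<Phi> (Tb \<omega>) (Y \<omega>) (Er \<omega>)} = (\<Union>t\<in>?CR. {\<omega>\<in>space P. Tb \<omega> = t \<and> \<Phi> t (Y \<omega>) (Er \<omega>)})"
    using Tb_CR by auto
  also have "measure P \<dots> = (\<Sum>t\<in>?CR. measure P {\<omega>\<in>space P. Tb \<omega> = t \<and> \<Phi> t (Y \<omega>) (Er \<omega>)})"
  proof (rule P.finite_measure_finite_Union[OF fCR])
    have "{\<omega>\<in>space P. Tb \<omega> = t \<and> \<Phi> t (Y \<omega>) (Er \<omega>)} \<in> sets P" if "t \<in> ?CR" for t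
    proof -
      have "(\<lambda>\<omega>. (Y \<omega>, Er \<omega>)) \<in> measurable P (?B \<Otimes>\<^sub>M ?C)" by measurable
      from measurable_compose[OF this \<Phi>[of t]] have [measurable]: "Measurable.pred P (\<lambda>\<omega>. \<Phi> t (Y \<omega>) (Er \<omega>))" by simp
      have "{\<omega>\<in>space P. Tb \<omega> = t \<and> \<Phi> t (Y \<omega>) (Er \<omega>)} = Et t \<inter> {\<omega>\<in>space P. \<Phi> t (Y \<omega>) (Er \<omega>)}" by (auto simp: Et_def)
      then show ?thesis using that by simp
    qed
    then show "(\<lambda>t. {\<omega>\<in>space P. Tb \<omega> = t \<and> \<Phi> t (Y \<omega>) (Er \<omega>)}) ` ?CR \<subseteq> sets P" by auto
    show "disjoint_family_on (\<lambda>t. {\<omega>\<in>space P. Tb \<omega> = t \<and> \<Phi> t (Y \<omega>) (Er \<omega>)}) ?CR" by (auto simp: disjoint_family_on_def)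
  qed
  also have "\<dots> = (\<Sum>t\<in>?CR. (\<integral>y. g t y * r t y \<partial>Xn) + (\<integral>\<omega>. indicator (Et t) \<omega> * (g t (Y \<omega>) * indicator {y. pr y = 0} (Y \<omega>)) \<partial>P))"
  proof (intro sum.cong refl)
    fix t assume t: "t \<in> ?CR"
    have "(\<integral>\<omega>. indicator (Et t) \<omega> * g t (Y \<omega>) \<partial>P) = (\<integral>\<omega>. indicator (Et t) \<omega> * (g t (Y \<omega>) * indicator {y. 0 < pr y} (Y \<omega>)) +
        indicator (Et t) \<omega> * (g t (Y \<omega>) * indicator {y. pr y = 0} (Y \<omega>)) \<partial>P)"
      using pr0(1) by (intro Bochner_Integration.integral_cong refl) (auto simp: indicator_def less_le)
    also have "\<dots> = (\<integral>\<omega>. indicator (Et t) \<omega> * (g t (Y \<omega>) * indicator {y. 0 < pr y} (Y \<omega>)) \<partial>P) +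
        (\<integral>\<omega>. indicator (Et t) \<omega> * (g t (Y \<omega>) * indicator {y. pr y = 0} (Y \<omega>)) \<partial>P)"
      using t g01 by (intro Bochner_Integration.integral_add P.integrable_const_bound[where B=1]) (auto simp: indicator_def)
    finally show "measure P {\<omega>\<in>space P. Tb \<omega> = t \<and> \<Phi> t (Y \<omega>) (Er \<omega>)} = (\<integral>y. g t y * r t y \<partial>Xn) +
        (\<integral>\<omega>. indicator (Et t) \<omega> * (g t (Y \<omega>) * indicator {y. pr y = 0} (Y \<omega>)) \<partial>P)"
      unfolding E1[OF t] E2[OF t] .
  qed
  also have "\<dots> = (\<integral>y. (if 0 < pr y then A y / pr y else 0) \<partial>Xn) + (\<Sum>t\<in>?CR. \<integral>\<omega>. indicator (Et t) \<omega> * (g t (Y \<omega>) * indicator {y. pr y = 0} (Y \<omega>)) \<partial>P)"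
  proof -
    have "integrable Xn (\<lambda>y. g t y * r t y)" if "t \<in> ?CR" for t
    proof (rule X.integrable_const_bound[where B="1 * 1"])
      have "r t y \<le> 1" "0 \<le> r t y" for y
      proof -
        have "(1/2)^n * indicator {t. Mdist y t < a} t \<le> pr y"
          unfolding pr_def accept_prob_sum using that fCR by (intro member_le_sum) auto
        then show "r t y \<le> 1" "0 \<le> r t y" by (auto simp: r_def divide_le_eq)
      qed
      then have "norm (g t y * r t y) \<le> 1 * 1" for y
        unfolding norm_mult using g01 by (intro mult_mono) auto
      then show "AE y in Xn. norm (g t y * r t y) \<le> 1 * 1" by (intro AE_I2)
    qed measurable
    then have "(\<Sum>t\<in>?CR. \<integral>y. g t y * r t y \<partial>Xn) = (\<integral>y. (\<Sum>t\<in>?CR. g t y * r t y) \<partial>Xn)"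
      by (intro Bochner_Integration.integral_sum[symmetric]) auto
    then show ?thesis unfolding sum.distrib sum_r by simp
  qed
  \<comment> \<open>\<open>?R\<close> collects the covariates that admit no acceptable assignment,
    where the law of the assignment is unspecified.\<close>
  finally have main: "measure P {\<omega>\<in>space P. \<Phi> (Tb \<omega>) (Y \<omega>) (Er \<omega>)} = (\<integral>y. (if 0 < pr y then A y / pr y else 0) \<partial>Xn) +
     (\<Sum>t\<in>?CR. \<integral>\<omega>. indicator (Et t) \<omega> * (g t (Y \<omega>) * indicator {y. pr y = 0} (Y \<omega>)) \<partial>P)" (is "_ = _ + ?R") .
  let ?J = "\<integral>y. \<bar>1 - pr y / c\<bar> \<partial>Xn"
  have iJ: "integrable Xn (\<lambda>y. \<bar>1 - pr y / c\<bar>)"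
  proof (rule X.integrable_const_bound[where B="1 + 1 / c"])
    have "0 \<le> pr y / c" "pr y / c \<le> 1 / c" for y using pr0[of y] c by (auto intro: divide_right_mono)
    then have "norm \<bar>1 - pr y / c\<bar> \<le> 1 + 1 / c" for y by (smt (verit) real_norm_def)
    then show "AE y in Xn. norm \<bar>1 - pr y / c\<bar> \<le> 1 + 1 / c" by simp
  qed measurable
  have R0: "0 \<le> ?R" using g01 by (intro sum_nonneg Bochner_Integration.integral_nonneg) auto
  \<comment> \<open>Where \<open>pr\<close> vanishes, \<open>\<bar>1 - pr / c\<bar>\<close> equals
    1, which dominates the unspecified contribution.\<close>
  have RJ: "?R \<le> ?J"
  proof -
    have "?R = (\<integral>\<omega>. (\<Sum>t\<in>?CR. indicator (Et t) \<omega> * (g t (Y \<omega>) * indicator {y. pr y = 0} (Y \<omega>))) \<partial>P)"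
      using g01 by (intro Bochner_Integration.integral_sum[symmetric] P.integrable_const_bound[where B=1]) (auto simp: indicator_def)
    also have "\<dots> \<le> (\<integral>\<omega>. \<bar>1 - pr (Y \<omega>) / c\<bar> \<partial>P)"
    proof (rule integral_mono)
      show "integrable P (\<lambda>\<omega>. \<Sum>t\<in>?CR. indicator (Et t) \<omega> * (g t (Y \<omega>) * indicator {y. pr y = 0} (Y \<omega>)))"
        using g01 by (intro Bochner_Integration.integrable_sum P.integrable_const_bound[where B=1]) (auto simp: indicator_def)
      show "integrable P (\<lambda>\<omega>. \<bar>1 - pr (Y \<omega>) / c\<bar>)"
        using iJ unfolding lawX[symmetric] Y_def[symmetric] by (subst (asm) integrable_distr_eq) auto
      fix \<omega> assume "\<omega> \<in> space P"
      have "(\<Sum>t\<in>?CR. indicator (Et t) \<omega> * (g t (Y \<omega>) * indicator {y. pr y = 0} (Y \<omega>))) = (\<Sum>t\<in>?CR. if t = Tb \<omega> then g t (Y \<omega>) * indicator {y. pr y = 0} (Y \<omega>) else 0)"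
        using \<open>\<omega> \<in> space P\<close> by (intro sum.cong) (auto simp: Et_def indicator_def)
      also have "\<dots> = g (Tb \<omega>) (Y \<omega>) * indicator {y. pr y = 0} (Y \<omega>)"
        using Tb_CR fCR by (simp add: sum.delta)
      also have "\<dots> \<le> \<bar>1 - pr (Y \<omega>) / c\<bar>" using g01 by (auto simp: indicator_def)
      finally show "(\<Sum>t\<in>?CR. indicator (Et t) \<omega> * (g t (Y \<omega>) * indicator {y. pr y = 0} (Y \<omega>))) \<le> \<bar>1 - pr (Y \<omega>) / c\<bar>" .
    qed
    also have "\<dots> = ?J" by (rule intX) measurable
    finally show ?thesis .
  qed
  have iA: "integrable Xn A" using A0 order_trans[OF Apr pr0(2)] by (intro X.integrable_const_bound[where B=1]) auto
  have iAp: "integrable Xn (\<lambda>y. if 0 < pr y then A y / pr y else 0)"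
    using A0 Apr by (intro X.integrable_const_bound[where B=1]) (auto simp: divide_le_eq)
  \<comment> \<open>\<open>A / pr - A / c = A / pr * (1 - pr / c)\<close>, and \<open>A / pr\<close>
    lies between 0 and 1.\<close>
  have D: "\<bar>(\<integral>y. (if 0 < pr y then A y / pr y else 0) \<partial>Xn) - (\<integral>y. A y \<partial>Xn) / c\<bar> \<le> ?J"
  proof -
    have "\<bar>(\<integral>y. (if 0 < pr y then A y / pr y else 0) \<partial>Xn) - (\<integral>y. A y \<partial>Xn) / c\<bar> = \<bar>\<integral>y. (if 0 < pr y then A y / pr y else 0) - A y / c \<partial>Xn\<bar>"
      using iA iAp by simp
    also have "\<dots> \<le> (\<integral>y. \<bar>(if 0 < pr y then A y / pr y else 0) - A y / c\<bar> \<partial>Xn)" by (rule integral_abs_bound)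
    also have "\<dots> \<le> ?J"
    proof (rule integral_mono[OF _ iJ])
      show "integrable Xn (\<lambda>y. \<bar>(if 0 < pr y then A y / pr y else 0) - A y / c\<bar>)" using iA iAp by auto
      fix y
      show "\<bar>(if 0 < pr y then A y / pr y else 0) - A y / c\<bar> \<le> \<bar>1 - pr y / c\<bar>"
      proof (cases "0 < pr y")
        case True
        have "A y / pr y - A y / c = A y / pr y * (1 - pr y / c)" using True by (simp add: field_simps)
        then have "\<bar>A y / pr y - A y / c\<bar> = A y / pr y * \<bar>1 - pr y / c\<bar>" using A0[of y] True by (simp add: abs_mult)
        also have "\<dots> \<le> 1 * \<bar>1 - pr y / c\<bar>" using A0[of y] Apr[of y] True by (intro mult_right_mono) auto
        finally show ?thesis using True by simp
      next
        case False
        then have "A y = 0" using A0[of y] Apr[of y] by simp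
        then show ?thesis using False by simp
      qed
    qed
    finally show ?thesis .
  qed
  have intA: "(\<integral>y. A y \<partial>Xn) = (\<Sum>t\<in>?CR. (1 / 2) ^ n * measure (Xn \<Otimes>\<^sub>M En) {p\<in>space (Xn \<Otimes>\<^sub>M En). \<Phi> t (fst p) (snd p) \<and> Mdist (fst p) t < a})"
  proof -
    have "measure (Xn \<Otimes>\<^sub>M En) {p\<in>space (Xn \<Otimes>\<^sub>M En). \<Phi> t (fst p) (snd p) \<and> Mdist (fst p) t < a} = (\<integral>y. g t y * indicator {t. Mdist y t < a} t \<partial>Xn)" for t
    proof -
      have "Measurable.pred (Xn \<Otimes>\<^sub>M En) (\<lambda>p. \<Phi> t (fst p) (snd p) \<and> Mdist (fst p) t < a)"
        using \<Phi>XE[of t] by measurable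
      from X.measure_pair_section(1)[OF E.prob_space_axioms this]
      have "measure (Xn \<Otimes>\<^sub>M En) {p\<in>space (Xn \<Otimes>\<^sub>M En). \<Phi> t (fst p) (snd p) \<and> Mdist (fst p) t < a} = (\<integral>y. measure En {z\<in>space En. \<Phi> t y z \<and> Mdist y t < a} \<partial>Xn)" .
      also have "\<dots> = (\<integral>y. g t y * indicator {t. Mdist y t < a} t \<partial>Xn)"
        by (intro Bochner_Integration.integral_cong refl) (auto simp: g_def indicator_def)
      finally show ?thesis .
    qed
    moreover have "integrable Xn (\<lambda>y. (1/2)^n * (g t y * indicator {t. Mdist y t < a} t))" for t
    proof -
      have "(\<lambda>y. indicator {t. Mdist y t < a} t :: real) \<in> borel_measurable ?B" unfolding indicator_def by measurable
      then have "(\<lambda>y. indicator {t. Mdist y t < a} t :: real) \<in> borel_measurable Xn" by (simp add: measurable_cong_sets[OF sX refl])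
      then show ?thesis using g01
        by (intro integrable_mult_right X.integrable_const_bound[where B=1]) (auto simp: indicator_def)
    qed
    ultimately show ?thesis unfolding A_def by simp
  qed
  \<comment> \<open>The factor 2 adds the bound on the unspecified contribution to the bound on
    replacing \<open>pr\<close> by \<open>c\<close>.\<close>
  have "\<bar>measure P {\<omega>\<in>space P. \<Phi> (Tb \<omega>) (Y \<omega>) (Er \<omega>)} - (\<integral>y. A y \<partial>Xn) / c\<bar> \<le> 2 * ?J"
    using main R0 RJ D by linarith
  then show ?thesis
    unfolding intA by (simp add: Tb_def Y_def Er_def pr_def)
qed

text \<open>The empty index set is included, for \<open>n = 0\<close> and for models without
  covariates; both sides are then point masses.\<close>

lemma (in prob_space) distr_PiM_indep_vars:
  assumes "indep_vars N X I"
  shows "distr M (PiM I N) (\<lambda>x. \<lambda>i\<in>I. X i x) = PiM I (\<lambda>i. distr M (N i) (X i))"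
proof (cases "I = {}")
  case True
  have "(\<lambda>x. \<lambda>i\<in>I. X i x) = (\<lambda>_ _. undefined)" using True by (auto simp: fun_eq_iff)
  then have "distr M (PiM I N) (\<lambda>x. \<lambda>i\<in>I. X i x) = return (PiM I N) (\<lambda>_. undefined)"
    using True by (simp add: distr_const space_PiM)
  also have "\<dots> = PiM I (\<lambda>i. distr M (N i) (X i))"
    using True by (intro measure_eqI) (auto simp: PiM_empty subset_singleton_iff)
  finally show ?thesis .
next
  case False
  have "random_variable (N i) (X i)" if "i \<in> I" for i using assms that by (auto simp: indep_vars_def)
  then show ?thesis using indep_vars_iff_distr_eq_PiM'[OF False, where M'=N and X=X] assms by blast
qed

section \<open>Finite experiments as blocks of the infinite array\<close>

context coordinate_world
begin

lemma indep_rv_blocks: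
  assumes IJ: "I \<inter> J = {}"
    and f: "f \<in> measurable (PiM I (\<lambda>_. borel)) N1" and g: "g \<in> measurable (PiM J (\<lambda>_. borel)) N2"
  shows "indep_rv Om N1 (\<lambda>\<omega>. f (restrict \<omega> I)) N2 (\<lambda>\<omega>. g (restrict \<omega> J))"
proof -
  have iv: "Om.indep_var (PiM I (\<lambda>_. borel)) (\<lambda>\<omega>. restrict \<omega> I) (PiM J (\<lambda>_. borel)) (\<lambda>\<omega>. restrict \<omega> J)"
    using Om.indep_var_restrict[OF indep_coords IJ] by simp
  have rI: "(\<lambda>\<omega>. restrict \<omega> I) \<in> measurable Om (PiM I (\<lambda>_. borel))" and rJ: "(\<lambda>\<omega>. restrict \<omega> J) \<in> measurable Om (PiM J (\<lambda>_. borel))"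
    by measurable
  have mf: "(\<lambda>\<omega>. f (restrict \<omega> I)) \<in> measurable Om N1" and mg: "(\<lambda>\<omega>. g (restrict \<omega> J)) \<in> measurable Om N2"
    using measurable_compose[OF rI f] measurable_compose[OF rJ g] by simp_all
  show ?thesis
    unfolding indep_rv_def Om.indep_sets2_eq
  proof (intro conjI mf mg)
    show "{(\<lambda>\<omega>. f (restrict \<omega> I)) -` E \<inter> space Om |E. E \<in> sets N1} \<subseteq> sets Om" using measurable_sets[OF mf] by auto
    show "{(\<lambda>\<omega>. g (restrict \<omega> J)) -` E \<inter> space Om |E. E \<in> sets N2} \<subseteq> sets Om" using measurable_sets[OF mg] by auto
    have "Om.prob (((\<lambda>\<omega>. f (restrict \<omega> I)) -` C \<inter> space Om) \<inter> ((\<lambda>\<omega>. g (restrict \<omega> J)) -` D \<inter> space Om)) =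
       Om.prob ((\<lambda>\<omega>. f (restrict \<omega> I)) -` C \<inter> space Om) * Om.prob ((\<lambda>\<omega>. g (restrict \<omega> J)) -` D \<inter> space Om)"
      if CD: "C \<in> sets N1" "D \<in> sets N2" for C D
    proof -
      let ?C = "f -` C \<inter> space (PiM I (\<lambda>_. borel))" and ?D = "g -` D \<inter> space (PiM J (\<lambda>_. borel))"
      have "Om.prob ((\<lambda>\<omega>. (restrict \<omega> I, restrict \<omega> J)) -` (?C \<times> ?D) \<inter> space Om) =
         Om.prob ((\<lambda>\<omega>. restrict \<omega> I) -` ?C \<inter> space Om) * Om.prob ((\<lambda>\<omega>. restrict \<omega> J) -` ?D \<inter> space Om)"
        by (rule Om.indep_varD[OF iv]) (use measurable_sets[OF f] measurable_sets[OF g] CD in auto)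
      moreover have "(\<lambda>\<omega>. restrict \<omega> I) -` ?C \<inter> space Om = (\<lambda>\<omega>. f (restrict \<omega> I)) -` C \<inter> space Om"
        using measurable_space[OF rI] by auto
      moreover have "(\<lambda>\<omega>. restrict \<omega> J) -` ?D \<inter> space Om = (\<lambda>\<omega>. g (restrict \<omega> J)) -` D \<inter> space Om"
        using measurable_space[OF rJ] by auto
      moreover have "(\<lambda>\<omega>. (restrict \<omega> I, restrict \<omega> J)) -` (?C \<times> ?D) \<inter> space Om =
          ((\<lambda>\<omega>. restrict \<omega> I) -` ?C \<inter> space Om) \<inter> ((\<lambda>\<omega>. restrict \<omega> J) -` ?D \<inter> space Om)" by auto
      ultimately show ?thesis by simp
    qed
    then show "\<forall>a\<in>{(\<lambda>\<omega>. f (restrict \<omega> I)) -` E \<inter> space Om |E. E \<in> sets N1}. \<forall>b\<in>{(\<lambda>\<omega>. g (restrict \<omega> J)) -` E \<inter> space Om |E. E \<in> sets N2}.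
       Om.prob (a \<inter> b) = Om.prob a * Om.prob b" by blast
  qed
qed

definition covar_block :: "nat \<Rightarrow> (nat \<times> nat \<Rightarrow> real) \<Rightarrow> nat \<Rightarrow> nat \<Rightarrow> real" where
  "covar_block n \<omega> = (\<lambda>i\<in>{..<n}. \<lambda>j\<in>{..<d}. \<omega> (i, j))"

definition error_block :: "nat \<Rightarrow> (nat \<times> nat \<Rightarrow> real) \<Rightarrow> nat \<Rightarrow> real" where
  "error_block n \<omega> = (\<lambda>i\<in>{..<n}. \<omega> (i, d))"

text \<open>False beyond the first \<open>n\<close> units, so that the values lie in the support of
  \<open>CR n\<close>.\<close>

definition assign_block :: "nat \<Rightarrow> nat \<Rightarrow> (nat \<times> nat \<Rightarrow> real) \<Rightarrow> nat \<Rightarrow> bool" where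
  "assign_block n s \<omega> = (\<lambda>i. i < n \<and> 0 < \<omega> (i, s))"

abbreviation PX :: "nat \<Rightarrow> (nat \<Rightarrow> nat \<Rightarrow> real) measure" where
  "PX n \<equiv> PiM {..<n} (\<lambda>_. covariate_space d)"

abbreviation PE :: "nat \<Rightarrow> (nat \<Rightarrow> real) measure" where
  "PE n \<equiv> PiM {..<n} (\<lambda>_. borel)"

definition Xn :: "nat \<Rightarrow> (nat \<Rightarrow> nat \<Rightarrow> real) measure" where
  "Xn n = PiM {..<n} (\<lambda>_. PiM {..<d} law)"

definition En :: "nat \<Rightarrow> (nat \<Rightarrow> real) measure" where
  "En n = PiM {..<n} (\<lambda>_. law d)"

lemma sets_Xn [measurable_cong]: "sets (Xn n) = sets (PX n)" and sets_En [measurable_cong]: "sets (En n) = sets (PE n)"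
  unfolding Xn_def En_def by (intro sets_PiM_cong sets_law refl)+

lemma prob_space_Xn: "prob_space (Xn n)" and prob_space_En: "prob_space (En n)"
  unfolding Xn_def En_def by (intro prob_space_PiM law_prob)+

lemma distr_covar_block: "distr Om (PX n) (covar_block n) = Xn n"
proof -
  have f: "(\<lambda>y. \<lambda>j\<in>{..<d}. y j) \<in> measurable (PiM {..<d+3} (\<lambda>_. borel)) (covariate_space d)"
    by (intro measurable_restrict measurable_component_singleton) auto
  have "(\<lambda>j\<in>{..<d}. row i \<omega> j) = (\<lambda>j\<in>{..<d}. \<omega> (i, j))" for i and \<omega> :: "nat \<times> nat \<Rightarrow> real"
    by (auto simp: row_def)
  then have "Om.indep_vars (\<lambda>_. covariate_space d) (\<lambda>i \<omega>. \<lambda>j\<in>{..<d}. \<omega> (i, j)) {..<n}"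
    using Om.indep_vars_subset[OF indep_rows[OF f]] by simp
  from Om.distr_PiM_indep_vars[OF this]
  have "distr Om (PX n) (covar_block n) = PiM {..<n} (\<lambda>i. distr Om (covariate_space d) (\<lambda>\<omega>. \<lambda>j\<in>{..<d}. \<omega> (i, j)))"
    by (simp add: covar_block_def[abs_def])
  moreover have "distr Om (covariate_space d) (\<lambda>\<omega>. \<lambda>j\<in>{..<d}. \<omega> (i, j)) = PiM {..<d} law" for i
  proof -
    have "distr Om (PiM {..<d} (\<lambda>j. law (snd (i, j)))) (\<lambda>\<omega>. \<lambda>j\<in>{..<d}. \<omega> (i, j)) = PiM {..<d} (\<lambda>j. law (snd (i, j)))"
      unfolding Om_def by (rule distr_PiM_reindex) (auto simp: law_prob inj_on_def)
    moreover have "distr Om (PiM {..<d} (\<lambda>j. law (snd (i, j)))) (\<lambda>\<omega>. \<lambda>j\<in>{..<d}. \<omega> (i, j)) = distr Om (covariate_space d) (\<lambda>\<omega>. \<lambda>j\<in>{..<d}. \<omega> (i, j))"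
      by (intro distr_cong sets_PiM_cong) (auto simp: sets_law)
    ultimately show ?thesis by simp
  qed
  ultimately show ?thesis by (simp only: Xn_def)
qed

lemma distr_error_block: "distr Om (PE n) (error_block n) = En n"
proof -
  have "distr Om (PiM {..<n} (\<lambda>i. law (snd (i, d)))) (\<lambda>\<omega>. \<lambda>i\<in>{..<n}. \<omega> (i, d)) = PiM {..<n} (\<lambda>i. law (snd (i, d)))"
    unfolding Om_def by (rule distr_PiM_reindex) (auto simp: law_prob inj_on_def)
  moreover have "distr Om (PiM {..<n} (\<lambda>i. law (snd (i, d)))) (\<lambda>\<omega>. \<lambda>i\<in>{..<n}. \<omega> (i, d)) = distr Om (PE n) (error_block n)"
    by (intro distr_cong sets_PiM_cong) (auto simp: sets_law error_block_def)
  ultimately show ?thesis by (simp add: En_def)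
qed

lemma covar_block_measurable_restrict:
  "{..<n} \<times> {..<d} \<subseteq> B \<Longrightarrow> covar_block n \<in> measurable (PiM B (\<lambda>_. borel)) (PX n)"
  unfolding covar_block_def by (intro measurable_restrict measurable_component_singleton) auto

lemma error_block_measurable_restrict:
  "{..<n} \<times> {d} \<subseteq> B \<Longrightarrow> error_block n \<in> measurable (PiM B (\<lambda>_. borel)) (PE n)"
  unfolding error_block_def by (intro measurable_restrict measurable_component_singleton) auto

lemma distr_covar_error_block: "distr Om (PX n \<Otimes>\<^sub>M PE n) (\<lambda>\<omega>. (covar_block n \<omega>, error_block n \<omega>)) = Xn n \<Otimes>\<^sub>M En n"
proof -
  have "indep_rv Om (PX n) (\<lambda>\<omega>. covar_block n (restrict \<omega> ({..<n} \<times> {..<d}))) (PE n) (\<lambda>\<omega>. error_block n (restrict \<omega> ({..<n} \<times> {d})))"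
    by (rule indep_rv_blocks[OF _ covar_block_measurable_restrict error_block_measurable_restrict]) auto
  moreover have "covar_block n (restrict \<omega> ({..<n} \<times> {..<d})) = covar_block n \<omega>" "error_block n (restrict \<omega> ({..<n} \<times> {d})) = error_block n \<omega>" for \<omega>
    by (auto simp: covar_block_def error_block_def fun_eq_iff)
  ultimately have "indep_rv Om (PX n) (covar_block n) (PE n) (error_block n)" by simp
  from indep_rv_distr_pair[OF Om.prob_space_axioms this] show ?thesis
    by (simp add: distr_covar_block distr_error_block)
qed

lemma measure_signs:
  "measure Om {\<omega>. \<forall>k\<in>{..<n} \<times> {d+1, d+2}. (0 < \<omega> k) = b k} = (1 / 4) ^ n"
proof -
  let ?J = "{..<n} \<times> {d+1, d+2}"
  have m: "measure (law (snd k)) {y. (0 < y) = b k} = 1 / 2" if "k \<in> ?J" for k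
    using that law_sign[of "snd k"] measure_sign_law[of "b k"] by auto
  have "emeasure Om {\<omega>\<in>space Om. \<forall>k\<in>?J. \<omega> k \<in> {y. (0 < y) = b k}} = (\<Prod>k\<in>?J. emeasure (law (snd k)) {y. (0 < y) = b k})"
    unfolding Om_def
  proof (rule coords.emeasure_PiM_Collect)
    show "{y. (0 < y) = b k} \<in> sets (law (snd k))" for k
      unfolding sets_law by (cases "b k") simp_all
  qed auto
  also have "\<dots> = (\<Prod>k\<in>?J. ennreal (1 / 2))"
  proof (intro prod.cong refl)
    fix k assume "k \<in> ?J"
    show "emeasure (law (snd k)) {y. (0 < y) = b k} = ennreal (1 / 2)" by (simp only: finite_measure.emeasure_eq_measure[OF prob_space.finite_measure[OF law_prob]] m[OF \<open>k \<in> ?J\<close>])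
  qed
  also have "\<dots> = ennreal ((1 / 2) ^ (2 * n))" by (subst prod_ennreal) (simp_all add: mult_2 mult_2_right)
  finally have "measure Om {\<omega>. \<forall>k\<in>?J. (0 < \<omega> k) = b k} = (1 / 2) ^ (2 * n)"
    by (simp add: space_Om measure_def)
  also have "\<dots> = (1 / 4 :: real) ^ n" by (simp add: power_mult power2_eq_square)
  finally show ?thesis .
qed

text \<open>The signs and the pair of covariates and errors occupy disjoint sets of columns, hence
  are independent, and each pair of assignments has probability
  \<open>(1 / 2)^n * (1 / 2)^n\<close>.\<close>

lemma measure_blocks:
  assumes t: "t \<in> set_pmf (CR n)" "t' \<in> set_pmf (CR n)"
    and \<Psi>: "Measurable.pred (PX n \<Otimes>\<^sub>M PE n) (\<lambda>p. \<Psi> (fst p) (snd p))"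
  shows "{\<omega>. assign_block n (d+1) \<omega> = t \<and> assign_block n (d+2) \<omega> = t' \<and> \<Psi> (covar_block n \<omega>) (error_block n \<omega>)} \<in> sets Om" (is "?E \<in> _")
    and "measure Om {\<omega>. assign_block n (d+1) \<omega> = t \<and> assign_block n (d+2) \<omega> = t' \<and> \<Psi> (covar_block n \<omega>) (error_block n \<omega>)} =
      (1 / 4) ^ n * measure (Xn n \<Otimes>\<^sub>M En n) {p\<in>space (Xn n \<Otimes>\<^sub>M En n). \<Psi> (fst p) (snd p)}"
proof -
  let ?J = "{..<n} \<times> {d+1, d+2}" and ?B = "{..<n} \<times> {..d}"
  define b where "b k = (if snd k = d + 1 then t (fst k) else t' (fst k))" for k :: "nat \<times> nat"
  define C where "C = {y\<in>space (PiM ?J (\<lambda>_. borel :: real measure)). \<forall>k\<in>?J. (0 < y k) = b k}"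
  define D where "D = {p\<in>space (PX n \<Otimes>\<^sub>M PE n). \<Psi> (fst p) (snd p)}"
  have D: "D \<in> sets (PX n \<Otimes>\<^sub>M PE n)" unfolding D_def using \<Psi> by measurable
  have C: "C \<in> sets (PiM ?J (\<lambda>_. borel))" unfolding C_def
  proof (rule sets.sets_Collect_finite_All)
    fix k assume "k \<in> ?J"
    then have "(\<lambda>y. y k) \<in> borel_measurable (PiM ?J (\<lambda>_. borel :: real measure))" by (rule measurable_component_singleton)
    then show "{y\<in>space (PiM ?J (\<lambda>_. borel :: real measure)). (0 < y k) = b k} \<in> sets (PiM ?J (\<lambda>_. borel))"
      by (cases "b k") (simp_all add: not_less)
  qed simp
  have g: "(\<lambda>\<omega>. (covar_block n \<omega>, error_block n \<omega>)) \<in> measurable (PiM ?B (\<lambda>_. borel)) (PX n \<Otimes>\<^sub>M PE n)"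
    by (intro measurable_Pair covar_block_measurable_restrict error_block_measurable_restrict) auto
  have "indep_rv Om (PiM ?J (\<lambda>_. borel)) (\<lambda>\<omega>. (\<lambda>y. y) (restrict \<omega> ?J)) (PX n \<Otimes>\<^sub>M PE n) (\<lambda>\<omega>. (\<lambda>\<omega>. (covar_block n \<omega>, error_block n \<omega>)) (restrict \<omega> ?B))"
    by (rule indep_rv_blocks[OF _ _ g]) auto
  moreover have "covar_block n (restrict \<omega> ?B) = covar_block n \<omega>" "error_block n (restrict \<omega> ?B) = error_block n \<omega>" for \<omega>
    by (auto simp: covar_block_def error_block_def fun_eq_iff)
  ultimately have ind: "indep_rv Om (PiM ?J (\<lambda>_. borel)) (\<lambda>\<omega>. restrict \<omega> ?J) (PX n \<Otimes>\<^sub>M PE n) (\<lambda>\<omega>. (covar_block n \<omega>, error_block n \<omega>))" by simp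
  let ?r = "\<lambda>\<omega>. restrict \<omega> ?J" and ?g = "\<lambda>\<omega>. (covar_block n \<omega>, error_block n \<omega>)"
  have mr: "?r \<in> measurable Om (PiM ?J (\<lambda>_. borel))" and mg: "?g \<in> measurable Om (PX n \<Otimes>\<^sub>M PE n)"
    using ind by (auto simp: indep_rv_def)
  have tn: "\<not> t i" "\<not> t' i" if "\<not> i < n" for i using t that unfolding set_pmf_CR by simp_all
  have signs: "assign_block n (d+1) \<omega> = t \<and> assign_block n (d+2) \<omega> = t' \<longleftrightarrow> (\<forall>k\<in>?J. (0 < \<omega> k) = b k)" for \<omega>
  proof
    assume "\<forall>k\<in>?J. (0 < \<omega> k) = b k"
    then have "(0 < \<omega> (i, d+1)) = t i" "(0 < \<omega> (i, d+2)) = t' i" if "i < n" for i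
      using that by (auto simp: b_def)
    then show "assign_block n (d+1) \<omega> = t \<and> assign_block n (d+2) \<omega> = t'" using tn unfolding assign_block_def by (intro conjI ext) metis+
  qed (auto simp: assign_block_def b_def)
  have r1: "?r -` C \<inter> space Om = {\<omega>. \<forall>k\<in>?J. (0 < \<omega> k) = b k}"
    using measurable_space[OF mr] by (auto simp: C_def space_Om)
  have r2: "?g -` D \<inter> space Om = {\<omega>. \<Psi> (covar_block n \<omega>) (error_block n \<omega>)}"
    using measurable_space[OF mg] by (auto simp: D_def space_Om)
  have E: "?E = (?r -` C \<inter> space Om) \<inter> (?g -` D \<inter> space Om)"
    unfolding r1 r2 using signs by blast
  show "?E \<in> sets Om" unfolding E by (intro sets.Int measurable_sets[OF mr C] measurable_sets[OF mg D])
  have "measure Om ?E = measure Om (?r -` C \<inter> space Om) * measure Om (?g -` D \<inter> space Om)"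
    unfolding E using ind C D unfolding indep_rv_def by (intro Om.indep_setD) blast+
  also have "measure Om (?r -` C \<inter> space Om) = (1 / 4) ^ n" unfolding r1 by (rule measure_signs)
  also have "measure Om (?g -` D \<inter> space Om) = measure (Xn n \<Otimes>\<^sub>M En n) D"
    unfolding distr_covar_error_block[symmetric] by (rule measure_distr[OF mg D, symmetric])
  also have "D = {p\<in>space (Xn n \<Otimes>\<^sub>M En n). \<Psi> (fst p) (snd p)}"
    unfolding D_def by (simp add: sets_eq_imp_space_eq[OF sets_pair_measure_cong[OF sets_Xn sets_En]])
  finally show "measure Om ?E = (1 / 4) ^ n * measure (Xn n \<Otimes>\<^sub>M En n) {p\<in>space (Xn n \<Otimes>\<^sub>M En n). \<Psi> (fst p) (snd p)}" .
qed

lemma assign_block_CR: "assign_block n s \<omega> \<in> set_pmf (CR n)"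
  by (auto simp: set_pmf_CR assign_block_def)

lemma measure_Om_assign:
  assumes "\<And>t t'. Measurable.pred (PX n \<Otimes>\<^sub>M PE n) (\<lambda>p. \<Theta> t t' (fst p) (snd p))"
  shows "measure Om {\<omega>. \<Theta> (assign_block n (d+1) \<omega>) (assign_block n (d+2) \<omega>) (covar_block n \<omega>) (error_block n \<omega>)} =
    (\<Sum>t\<in>set_pmf (CR n). \<Sum>t'\<in>set_pmf (CR n). (1 / 4) ^ n * measure (Xn n \<Otimes>\<^sub>M En n) {p\<in>space (Xn n \<Otimes>\<^sub>M En n). \<Theta> t t' (fst p) (snd p)})"
proof -
  let ?CR = "set_pmf (CR n)"
  let ?F = "\<lambda>(t, t'). {\<omega>. assign_block n (d+1) \<omega> = t \<and> assign_block n (d+2) \<omega> = t' \<and> \<Theta> t t' (covar_block n \<omega>) (error_block n \<omega>)}"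
  have u: "{\<omega>. \<Theta> (assign_block n (d+1) \<omega>) (assign_block n (d+2) \<omega>) (covar_block n \<omega>) (error_block n \<omega>)} = (\<Union>k\<in>?CR \<times> ?CR. ?F k)"
    using assign_block_CR by blast
  have "measure Om {\<omega>. \<Theta> (assign_block n (d+1) \<omega>) (assign_block n (d+2) \<omega>) (covar_block n \<omega>) (error_block n \<omega>)} = (\<Sum>k\<in>?CR \<times> ?CR. measure Om (?F k))"
    unfolding u
  proof (rule Om.finite_measure_finite_Union)
    show "?F ` (?CR \<times> ?CR) \<subseteq> sets Om" using measure_blocks(1)[OF _ _ assms] by auto
  qed (auto simp: finite_set_pmf_CR disjoint_family_on_def)
  also have "\<dots> = (\<Sum>t\<in>?CR. \<Sum>t'\<in>?CR. measure Om (?F (t, t')))" by (simp add: sum.cartesian_product case_prod_beta')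
  also have "\<dots> = (\<Sum>t\<in>?CR. \<Sum>t'\<in>?CR. (1 / 4) ^ n * measure (Xn n \<Otimes>\<^sub>M En n) {p\<in>space (Xn n \<Otimes>\<^sub>M En n). \<Theta> t t' (fst p) (snd p)})"
    by (intro sum.cong refl) (simp only: prod.case measure_blocks(2)[OF _ _ assms])
  finally show ?thesis .
qed

text \<open>The second assignment is summed out: it has \<open>2^n\<close> values, which turns the
  weight \<open>(1 / 4)^n\<close> into \<open>(1 / 2)^n\<close>.\<close>

lemma measure_Om_assign1:
  assumes "\<And>t. Measurable.pred (PX n \<Otimes>\<^sub>M PE n) (\<lambda>p. \<Theta> t (fst p) (snd p))"
  shows "measure Om {\<omega>. \<Theta> (assign_block n (d+1) \<omega>) (covar_block n \<omega>) (error_block n \<omega>)} =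
    (\<Sum>t\<in>set_pmf (CR n). (1 / 2) ^ n * measure (Xn n \<Otimes>\<^sub>M En n) {p\<in>space (Xn n \<Otimes>\<^sub>M En n). \<Theta> t (fst p) (snd p)})"
proof -
  have "(\<Sum>t'\<in>set_pmf (CR n). (1 / 2) ^ n) = (\<Sum>t'\<in>set_pmf (CR n). pmf (CR n) t')" by (intro sum.cong) (simp_all add: pmf_CR)
  also have "\<dots> = 1" by (rule sum_pmf_eq_1) (auto simp: finite_set_pmf_CR)
  finally have 1: "real (card (set_pmf (CR n))) * (1 / 2) ^ n = 1" by simp
  have "(1 / 4 :: real) ^ n = (1 / 2) ^ n * (1 / 2) ^ n" by (simp add: power_mult_distrib[symmetric])
  then have "real (card (set_pmf (CR n))) * (1 / 4) ^ n = (1 / 2) ^ n" using 1 by simp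
  then show ?thesis
    using measure_Om_assign[where n=n and \<Theta>="\<lambda>t t'. \<Theta> t", OF assms] by (simp add: mult.assoc[symmetric])
qed

section \<open>Moments of the acceptance probability\<close>

context
  fixes n :: nat and Mdist :: "(nat \<Rightarrow> nat \<Rightarrow> real) \<Rightarrow> (nat \<Rightarrow> bool) \<Rightarrow> real" and a :: real
  assumes Mdist: "\<And>t. (\<lambda>x. Mdist x t) \<in> borel_measurable (PX n)"
begin

lemma measure_Xn_section:
  assumes "Measurable.pred (PX n) \<Psi>"
  shows "measure (Xn n \<Otimes>\<^sub>M En n) {p\<in>space (Xn n \<Otimes>\<^sub>M En n). \<Psi> (fst p)} = (\<integral>x. indicator {x. \<Psi> x} x \<partial>Xn n)"
proof -
  interpret X: prob_space "Xn n" by (rule prob_space_Xn)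
  interpret E: prob_space "En n" by (rule prob_space_En)
  have "Measurable.pred (Xn n) \<Psi>" using assms by (simp add: measurable_cong_sets[OF sets_Xn refl])
  then have "Measurable.pred (Xn n \<Otimes>\<^sub>M En n) (\<lambda>p. \<Psi> (fst p))" by measurable
  from X.measure_pair_section(1)[OF E.prob_space_axioms this]
  have "measure (Xn n \<Otimes>\<^sub>M En n) {p\<in>space (Xn n \<Otimes>\<^sub>M En n). \<Psi> (fst p)} = (\<integral>x. measure (En n) {y\<in>space (En n). \<Psi> x} \<partial>Xn n)" .
  also have "\<dots> = (\<integral>x. indicator {x. \<Psi> x} x \<partial>Xn n)"
    by (intro Bochner_Integration.integral_cong refl) (auto simp: indicator_def E.prob_space)
  finally show ?thesis .
qed

lemma integrable_indicator_Xn: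
  assumes "Measurable.pred (PX n) \<Psi>"
  shows "integrable (Xn n) (\<lambda>x. indicator {x. \<Psi> x} x :: real)"
proof -
  interpret X: prob_space "Xn n" by (rule prob_space_Xn)
  have "Measurable.pred (Xn n) \<Psi>" using assms by (simp add: measurable_cong_sets[OF sets_Xn refl])
  then have "(\<lambda>x. indicator {x. \<Psi> x} x :: real) \<in> borel_measurable (Xn n)" unfolding indicator_def by measurable
  then show ?thesis by (rule X.integrable_const_bound[where B=1, rotated]) (auto simp: indicator_def)
qed

lemma expectation_accept_prob:
  "(\<integral>x. accept_prob n Mdist a x \<partial>Xn n) = measure Om {\<omega>. Mdist (covar_block n \<omega>) (assign_block n (d+1) \<omega>) < a}"
proof -
  note [measurable] = Mdist
  have m1: "Measurable.pred (PX n) (\<lambda>x. Mdist x t < a)" for t by measurable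
  have m: "Measurable.pred (PX n \<Otimes>\<^sub>M PE n) (\<lambda>p. Mdist (fst p) t < a)" for t by measurable
  have i: "(indicator {t. Mdist x t < a} t :: real) = indicator {x. Mdist x t < a} x" for x t by (simp add: indicator_def)
  show ?thesis
    unfolding measure_Om_assign1[where n=n and \<Theta>="\<lambda>t x e. Mdist x t < a", OF m] measure_Xn_section[OF m1] accept_prob_sum i
    using integrable_indicator_Xn[OF m1] by simp
qed

text \<open>The square of the sum over assignments is a sum over pairs with weight
  \<open>(1 / 4)^n\<close>, the law of two assignments drawn independently for the same
  covariates.\<close>

lemma second_moment_accept_prob:
  "(\<integral>x. (accept_prob n Mdist a x)\<^sup>2 \<partial>Xn n) =
    measure Om {\<omega>. Mdist (covar_block n \<omega>) (assign_block n (d+1) \<omega>) < a \<and> Mdist (covar_block n \<omega>) (assign_block n (d+2) \<omega>) < a}"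
proof -
  note [measurable] = Mdist
  have m1: "Measurable.pred (PX n) (\<lambda>x. Mdist x t < a \<and> Mdist x t' < a)" for t t' by measurable
  have m: "Measurable.pred (PX n \<Otimes>\<^sub>M PE n) (\<lambda>p. Mdist (fst p) t < a \<and> Mdist (fst p) t' < a)" for t t' by measurable
  have i: "(accept_prob n Mdist a x)\<^sup>2 = (\<Sum>t\<in>set_pmf (CR n). \<Sum>t'\<in>set_pmf (CR n). (1 / 4) ^ n * indicator {x. Mdist x t < a \<and> Mdist x t' < a} x)" for x
  proof -
    have "(1 / 4 :: real) ^ n = (1 / 2) ^ n * (1 / 2) ^ n" by (simp add: power_mult_distrib[symmetric])
    then show ?thesis unfolding accept_prob_sum power2_eq_square sum_product
      by (intro sum.cong refl) (auto simp: indicator_def)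
  qed
  show ?thesis
    unfolding measure_Om_assign[where n=n and \<Theta>="\<lambda>t t' x e. Mdist x t < a \<and> Mdist x t' < a", OF m] measure_Xn_section[OF m1] i
    using integrable_indicator_Xn[OF m1] by simp
qed

text \<open>The mean absolute deviation is at most the root mean square deviation, whose square
  expands into the first two moments.\<close>

lemma accept_prob_deviation:
  assumes c: "0 < c"
  shows "(\<integral>x. \<bar>1 - accept_prob n Mdist a x / c\<bar> \<partial>Xn n) \<le>
    sqrt (1 - 2 * (\<integral>x. accept_prob n Mdist a x \<partial>Xn n) / c + (\<integral>x. (accept_prob n Mdist a x)\<^sup>2 \<partial>Xn n) / c\<^sup>2)"
proof -
  interpret X: prob_space "Xn n" by (rule prob_space_Xn)
  let ?p = "accept_prob n Mdist a"
  note [measurable] = Mdist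
  have [measurable]: "?p \<in> borel_measurable (Xn n)"
  proof -
    have "?p \<in> borel_measurable (PX n)" unfolding accept_prob_sum[abs_def] indicator_def by measurable
    then show ?thesis by (simp add: measurable_cong_sets[OF sets_Xn refl])
  qed
  have p01: "0 \<le> ?p x" "?p x \<le> 1" for x by (auto simp: accept_prob_def)
  have ip: "integrable (Xn n) ?p" using p01 by (intro X.integrable_const_bound[where B=1]) auto
  have ip2: "integrable (Xn n) (\<lambda>x. (?p x)\<^sup>2)" using p01 by (intro X.integrable_const_bound[where B=1]) (auto simp: power_le_one)
  let ?h = "\<lambda>x. \<bar>1 - ?p x / c\<bar>"
  have sq: "(?h x)\<^sup>2 = 1 - 2 * ?p x / c + (?p x)\<^sup>2 / c\<^sup>2" for x by (simp add: power2_diff power_divide)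
  have ih: "integrable (Xn n) ?h" "integrable (Xn n) (\<lambda>x. (?h x)\<^sup>2)" unfolding sq using ip ip2 by auto
  have "X.variance ?h = (\<integral>x. (?h x)\<^sup>2 \<partial>Xn n) - (\<integral>x. ?h x \<partial>Xn n)\<^sup>2" using ih by (intro X.variance_eq)
  then have "(\<integral>x. ?h x \<partial>Xn n)\<^sup>2 \<le> (\<integral>x. (?h x)\<^sup>2 \<partial>Xn n)" using X.variance_positive[of ?h] by linarith
  also have "\<dots> = 1 - 2 * (\<integral>x. ?p x \<partial>Xn n) / c + (\<integral>x. (?p x)\<^sup>2 \<partial>Xn n) / c\<^sup>2"
    unfolding sq using ip ip2 by (simp add: X.prob_space)
  finally show ?thesis by (rule real_le_rsqrt)
qed

end

end

section \<open>Identification of the limit\<close>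

lemma prob_space_normals: "prob_space (normals m)"
  by (intro prob_space_PiM prob_space_normal_density) simp

lemma sets_normals_borel: "sets (normals m) = sets (PiM {..<m} (\<lambda>_. borel))"
  by (intro sets_PiM_cong) auto

lemma distr_normals_reindex:
  assumes "inj_on f {..<m'}" "f \<in> {..<m'} \<rightarrow> {..<m}"
  shows "distr (normals m) (normals m') (\<lambda>\<omega>. \<lambda>k\<in>{..<m'}. \<omega> (f k)) = normals m'"
  using assms by (intro distr_PiM_reindex) (auto intro!: prob_space_normal_density)

lemma measure_normals_reindex:
  assumes f: "inj_on f {..<m'}" "f \<in> {..<m'} \<rightarrow> {..<m}" and \<Psi>: "Measurable.pred (normals m') \<Psi>"
  shows "measure (normals m) {\<omega>\<in>space (normals m). \<Psi> (\<lambda>k\<in>{..<m'}. \<omega> (f k))} = measure (normals m') {\<omega>\<in>space (normals m'). \<Psi> \<omega>}"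
proof -
  let ?r = "\<lambda>\<omega>. \<lambda>k\<in>{..<m'}. \<omega> (f k) :: real"
  have r: "?r \<in> measurable (normals m) (normals m')"
    using f(2) by (intro measurable_restrict measurable_component_singleton) auto
  have E: "{\<omega>\<in>space (normals m'). \<Psi> \<omega>} \<in> sets (normals m')" using \<Psi> by measurable
  have "measure (normals m') {\<omega>\<in>space (normals m'). \<Psi> \<omega>} = measure (distr (normals m) (normals m') ?r) {\<omega>\<in>space (normals m'). \<Psi> \<omega>}"
    by (simp only: distr_normals_reindex[OF f])
  also have "\<dots> = measure (normals m) (?r -` {\<omega>\<in>space (normals m'). \<Psi> \<omega>} \<inter> space (normals m))"
    by (rule measure_distr[OF r E])
  also have "?r -` {\<omega>\<in>space (normals m'). \<Psi> \<omega>} \<inter> space (normals m) = {\<omega>\<in>space (normals m). \<Psi> (?r \<omega>)}"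
    using measurable_space[OF r] by auto
  finally show ?thesis ..
qed

lemma indep_normals:
  assumes "0 < m"
  shows "prob_space.indep_vars (normals m) (\<lambda>_. borel) (\<lambda>k \<omega>. \<omega> k) {..<m}"
proof -
  interpret N: prob_space "normals m" by (rule prob_space_normals)
  have ne: "{..<m} \<noteq> {}" using assms by auto
  have c: "distr (normals m) borel (\<lambda>\<omega>. \<omega> k) = std_normal_distribution" if "k < m" for k
  proof -
    have "distr (normals m) std_normal_distribution (\<lambda>\<omega>. \<omega> k) = std_normal_distribution"
      using that by (intro distr_PiM_component) (auto intro!: prob_space_normal_density)
    moreover have "distr (normals m) std_normal_distribution (\<lambda>\<omega>. \<omega> k) = distr (normals m) borel (\<lambda>\<omega>. \<omega> k)"
      by (intro distr_cong) auto
    ultimately show ?thesis by simp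
  qed
  have m: "(\<lambda>\<omega>. \<omega> k) \<in> borel_measurable (normals m)" if "k \<in> {..<m}" for k
    using measurable_component_singleton[OF that, of "\<lambda>_. std_normal_distribution"] by simp
  have "distr (normals m) (PiM {..<m} (\<lambda>_. borel)) (\<lambda>\<omega>. \<lambda>k\<in>{..<m}. \<omega> k) = distr (normals m) (normals m) (\<lambda>\<omega>. \<lambda>k\<in>{..<m}. \<omega> k)"
    by (intro distr_cong sets_normals_borel[symmetric] refl)
  also have "\<dots> = normals m" by (rule distr_normals_reindex[where f="\<lambda>k. k"]) auto
  also have "\<dots> = PiM {..<m} (\<lambda>k. distr (normals m) borel (\<lambda>\<omega>. \<omega> k))" by (intro PiM_cong) (auto simp: c)
  finally show ?thesis using N.indep_vars_iff_distr_eq_PiM'[OF ne, where M'="\<lambda>_. borel" and X="\<lambda>k \<omega>. \<omega> k", OF m] by blast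
qed

lemma std_normal_interval_pos: "0 < r \<Longrightarrow> 0 < emeasure std_normal_distribution {-r<..<r}"
proof (rule ccontr)
  assume r: "0 < r" and "\<not> 0 < emeasure std_normal_distribution {-r<..<r}"
  then have "(\<integral>\<^sup>+x. ennreal (std_normal_density x) * indicator {-r<..<r} x \<partial>lborel) = 0"
    by (simp add: emeasure_density)
  then have "AE x in lborel. ennreal (std_normal_density x) * indicator {-r<..<r} x = 0"
    by (subst (asm) nn_integral_0_iff_AE) auto
  then have "AE x in lborel. x \<notin> {-r<..<r}"
  proof eventually_elim
    case (elim x)
    have "0 < std_normal_density x" by (rule normal_density_pos) simp
    then show ?case using elim by (auto simp: indicator_def split: if_splits)
  qed
  then have "{-r<..<r} \<in> null_sets lborel" by (subst AE_iff_null_sets) auto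
  then show False using r by (auto simp: null_sets_def)
qed

text \<open>The ball contains a cube around the origin, whose probability is a product of positive
  factors. This legitimates conditioning on the ball and dividing by its probability.\<close>

lemma normals_ball_pos:
  assumes a: "0 < a"
  shows "0 < measure (normals d) {D\<in>space (normals d). (\<Sum>j<d. (D j)\<^sup>2) < a}"
proof -
  interpret N: prob_space "normals d" by (rule prob_space_normals)
  interpret std: prob_space std_normal_distribution by (rule prob_space_normal_density) simp
  interpret product_sigma_finite "\<lambda>_::nat. std_normal_distribution" ..
  \<comment> \<open>Dividing by \<open>d + 1\<close> instead of \<open>d\<close> makes the sum of
    squares strictly smaller than \<open>a\<close> and covers \<open>d = 0\<close>.\<close>
  define r where "r = sqrt (a / (real d + 1))"
  have r: "0 < r" "r\<^sup>2 = a / (real d + 1)" using a by (auto simp: r_def)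
  let ?box = "PiE {..<d} (\<lambda>_. {-r<..<r})" and ?E = "{D\<in>space (normals d). (\<Sum>j<d. (D j)\<^sup>2) < a}"
  have E: "?E \<in> sets (normals d)" unfolding sets_normals_borel
  proof -
    have "(\<lambda>D. \<Sum>j<d. (D j)\<^sup>2) \<in> borel_measurable (normals d)"
      by (subst measurable_cong_sets[OF sets_normals_borel refl]) (intro borel_measurable_sum borel_measurable_power measurable_component_singleton)
    then have "?E \<in> sets (normals d)" by measurable
    then show "?E \<in> sets (PiM {..<d} (\<lambda>_. borel))" by (simp only: sets_normals_borel)
  qed
  have sub: "?box \<subseteq> ?E"
  proof
    fix D assume D: "D \<in> ?box"
    have "(D j)\<^sup>2 \<le> r\<^sup>2" if "j < d" for j
    proof -
      have "\<bar>D j\<bar> \<le> \<bar>r\<bar>" using D that r by (auto simp: PiE_def Pi_def)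
      then show ?thesis by (simp add: abs_le_square_iff)
    qed
    then have "(\<Sum>j<d. (D j)\<^sup>2) \<le> (\<Sum>j<d. r\<^sup>2)" by (intro sum_mono) auto
    also have "\<dots> = real d * (a / (real d + 1))" by (simp add: r)
    also have "\<dots> < a" using a by (simp add: field_simps)
    finally show "D \<in> ?E" using D by (auto simp: space_PiM PiE_def Pi_def)
  qed
  have "0 < (\<Prod>j<d. emeasure std_normal_distribution {-r<..<r})"
  proof -
    have "emeasure std_normal_distribution {-r<..<r} \<noteq> 0" by (rule std_normal_interval_pos[OF r(1), unfolded zero_less_iff_neq_zero])
    then show ?thesis unfolding zero_less_iff_neq_zero by simp
  qed
  also have "\<dots> = emeasure (normals d) ?box" by (intro emeasure_PiM[symmetric]) auto
  also have "\<dots> \<le> emeasure (normals d) ?E" by (intro emeasure_mono sub E)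
  finally show ?thesis by (simp add: N.emeasure_eq_measure)
qed

context coordinate_world
begin

definition cov_law :: "(nat \<Rightarrow> real) measure" where
  "cov_law = PiM {..<d} law"

abbreviation acc_const :: "real \<Rightarrow> real" where
  "acc_const a \<equiv> measure (normals d) {D\<in>space (normals d). (\<Sum>j<d. (D j)\<^sup>2) < a}"

lemma M_lim_reindex: "M_lim l \<omega> = (\<Sum>j<d. ((\<lambda>k\<in>{..<d}. \<omega> (l + k)) j)\<^sup>2)"
  unfolding M_lim_def by (intro sum.cong) auto

lemma sum_squares_pred: "Measurable.pred (normals d) (\<lambda>D. (\<Sum>j<d. (D j)\<^sup>2) < a)"
proof -
  have "(\<lambda>D. \<Sum>j<d. (D j)\<^sup>2) \<in> borel_measurable (normals d)"
    by (subst measurable_cong_sets[OF sets_normals_borel refl]) (intro borel_measurable_sum borel_measurable_power measurable_component_singleton)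
  then show ?thesis by measurable
qed

lemma measure_M_lim: "l + d \<le> m \<Longrightarrow> measure (normals m) {\<omega>\<in>space (normals m). M_lim l \<omega> < a} = acc_const a"
  unfolding M_lim_reindex
  by (rule measure_normals_reindex[where f="\<lambda>k. l + k", OF _ _ sum_squares_pred]) auto

text \<open>The two distances read disjoint blocks of coordinates, so the events are independent
  with equal probability. The limit of the second moment of the acceptance probability is thus the
  square of the limit of the first, and its variance vanishes asymptotically.\<close>

lemma measure_M_lim_pair:
  "measure (normals (2*d+1)) {\<omega>\<in>space (normals (2*d+1)). M_lim 0 \<omega> < a \<and> M_lim (Suc d) \<omega> < a} = (acc_const a)\<^sup>2"
proof -
  let ?m = "2*d+1"
  interpret N: prob_space "normals ?m" by (rule prob_space_normals)
  let ?I = "{..<d}" and ?J = "{Suc d..<?m}"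
  have "N.indep_var borel (M_lim 0 \<circ> (\<lambda>\<omega>. restrict (\<lambda>k. \<omega> k) ?I)) borel (M_lim (Suc d) \<circ> (\<lambda>\<omega>. restrict (\<lambda>k. \<omega> k) ?J))"
  proof (rule N.indep_var_compose[OF N.indep_var_restrict[OF indep_normals]])
    show "M_lim 0 \<in> borel_measurable (PiM ?I (\<lambda>_. borel))" "M_lim (Suc d) \<in> borel_measurable (PiM ?J (\<lambda>_. borel))"
      unfolding M_lim_def by (intro borel_measurable_sum borel_measurable_power measurable_component_singleton; force)+
  qed auto
  moreover have "M_lim 0 \<circ> (\<lambda>\<omega>. restrict (\<lambda>k. \<omega> k) ?I) = M_lim 0" "M_lim (Suc d) \<circ> (\<lambda>\<omega>. restrict (\<lambda>k. \<omega> k) ?J) = M_lim (Suc d)"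
    by (auto simp: M_lim_def fun_eq_iff intro!: sum.cong)
  ultimately have iv: "N.indep_var borel (M_lim 0) borel (M_lim (Suc d))" by simp
  have "N.prob ((\<lambda>\<omega>. (M_lim 0 \<omega>, M_lim (Suc d) \<omega>)) -` ({..<a} \<times> {..<a}) \<inter> space (normals ?m)) =
     N.prob (M_lim 0 -` {..<a} \<inter> space (normals ?m)) * N.prob (M_lim (Suc d) -` {..<a} \<inter> space (normals ?m))"
    by (rule N.indep_varD[OF iv]) auto
  moreover have "(\<lambda>\<omega>. (M_lim 0 \<omega>, M_lim (Suc d) \<omega>)) -` ({..<a} \<times> {..<a}) \<inter> space (normals ?m) = {\<omega>\<in>space (normals ?m). M_lim 0 \<omega> < a \<and> M_lim (Suc d) \<omega> < a}"
    "M_lim l -` {..<a} \<inter> space (normals ?m) = {\<omega>\<in>space (normals ?m). M_lim l \<omega> < a}" for l by auto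
  ultimately show ?thesis by (simp add: measure_M_lim power2_eq_square)
qed

lemma
  shows prob_space_cov_law: "prob_space cov_law" and sets_cov_law: "sets cov_law = sets (covariate_space d)"
    and cov_law_sq: "j < d \<Longrightarrow> integrable cov_law (\<lambda>y. (y j)\<^sup>2)" and cov_law_mean: "j < d \<Longrightarrow> (\<integral>y. y j \<partial>cov_law) = 0"
    and cov_law_cov: "j < d \<Longrightarrow> k < d \<Longrightarrow> (\<integral>y. y j * y k \<partial>cov_law) = (if j = k then v j else 0)"
proof -
  show "prob_space cov_law" unfolding cov_law_def by (rule prob_space_PiM) (rule law_prob)
  show s: "sets cov_law = sets (covariate_space d)" unfolding cov_law_def by (intro sets_PiM_cong sets_law refl)
  let ?r = "\<lambda>\<omega>. \<lambda>j\<in>{..<d}. \<omega> (0, j) :: real"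
  have d: "distr Om (covariate_space d) ?r = cov_law"
  proof -
    have "distr Om (PiM {..<d} (\<lambda>j. law (snd (0::nat, j)))) ?r = PiM {..<d} (\<lambda>j. law (snd (0::nat, j)))"
      unfolding Om_def by (rule distr_PiM_reindex) (auto simp: law_prob inj_on_def)
    moreover have "distr Om (PiM {..<d} (\<lambda>j. law (snd (0::nat, j)))) ?r = distr Om (covariate_space d) ?r"
      by (intro distr_cong sets_PiM_cong) (auto simp: sets_law)
    ultimately show ?thesis by (simp add: cov_law_def)
  qed
  have r: "?r \<in> measurable Om (covariate_space d)" by measurable
  have tr: "(\<integral>y. h y \<partial>cov_law) = (\<integral>\<omega>. h (?r \<omega>) \<partial>Om)" "integrable cov_law h = integrable Om (\<lambda>\<omega>. h (?r \<omega>))"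
    if "h \<in> borel_measurable (covariate_space d)" for h :: "(nat \<Rightarrow> real) \<Rightarrow> real"
    unfolding d[symmetric] using that r by (auto simp: integral_distr integrable_distr_eq)
  have m: "(\<lambda>y. y j) \<in> borel_measurable (covariate_space d)" if "j < d" for j
    using that by (intro measurable_component_singleton) auto
  have b: "snd x < d + 3" if "j < d" "k < d" "x \<in> {(0, j)} \<union> {(0, k)}" for x :: "nat \<times> nat" and j k using that by auto
  have M2: "integrable Om (\<lambda>\<omega>. \<omega> (0, j) * \<omega> (0, k))" "(\<integral>\<omega>. \<omega> (0, j) * \<omega> (0, k) \<partial>Om) = (if j = k then v j else 0)" if "j < d" "k < d" for j k
    using integrable_monomials[of "{(0, j)}" "{(0, k)}", OF _ _ b[OF that]] integral_monomials[of "{(0, j)}" "{(0, k)}", OF _ _ b[OF that]] by simp_all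
  show "integrable cov_law (\<lambda>y. (y j)\<^sup>2)" if "j < d"
    using that M2[of j j] by (subst tr(2)) (auto intro!: borel_measurable_power m simp: power2_eq_square)
  have b1: "snd x < d + 3" if "j < d" "x \<in> {(0, j)} \<union> {}" for x :: "nat \<times> nat" and j using that by auto
  show "(\<integral>y. y j \<partial>cov_law) = 0" if "j < d"
    using that integral_monomials[of "{(0, j)}" "{}", OF _ _ b1[OF that]] by (subst tr(1)) (auto intro!: m)
  show "(\<integral>y. y j * y k \<partial>cov_law) = (if j = k then v j else 0)" if "j < d" "k < d"
    using that M2[of j k] by (subst tr(1)) (auto intro!: m borel_measurable_times)
qed

text \<open>As \<open>n * mean_diff_var n\<close> tends to 4, the covariance matrix is invertible
  for large \<open>n\<close>; at \<open>n = 0\<close> the factor \<open>mean_diff_var n\<close> is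
  0.\<close>

lemma mahalanobis_eventually:
  "\<forall>\<^sub>F n in sequentially. \<forall>\<omega> s. mahalanobis n d cov_law (covar_block n \<omega>) (assign_block n s \<omega>) = MM s n \<omega>"
proof -
  have "\<forall>\<^sub>F n in sequentially. real n * mean_diff_var n \<noteq> 0"
    by (rule tendsto_imp_eventually_ne[OF mean_diff_var_limit]) simp
  then show ?thesis
  proof eventually_elim
    case (elim n)
    then have w: "mean_diff_var n \<noteq> 0" by simp
    have c: "cov_mat d (CR_law n cov_law) (\<lambda>(x', t'). mean_diff n d x' t') = Matrix.mat d d (\<lambda>(j, k). if j = k then mean_diff_var n * v j else 0)"
      by (rule cov_mat_CR[OF prob_space_cov_law sets_cov_law cov_law_sq cov_law_mean cov_law_cov])
    have v: "v j \<noteq> 0" if "j < d" for j using v_pos[of j] that by simp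
    have g: "group_mean n u (covar_block n \<omega>) (assign_block n s \<omega>) j = group_mean n u (covar \<omega>) (assign s \<omega>) j" if "j < d" for u \<omega> s j
      using that by (intro group_mean_cong) (auto simp: assign_block_def assign_def covar_block_def covar_def)
    show ?case
    proof (intro allI)
      fix \<omega> s
      show "mahalanobis n d cov_law (covar_block n \<omega>) (assign_block n s \<omega>) = MM s n \<omega>"
        unfolding MM_def by (subst mahalanobis_eq[OF c w v]) (auto simp: g)
    qed
  qed
qed

lemma mahalanobis_measurable: "(\<lambda>x. mahalanobis n d \<nu> x t) \<in> borel_measurable (PX n)"
proof (rule borel_measurable_mahalanobis)
  fix i j assume "i < n" "j < d"
  then have "(\<lambda>x. x i) \<in> measurable (PX n) (covariate_space d)" "(\<lambda>y. y j) \<in> borel_measurable (covariate_space d)"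
    by (auto intro!: measurable_component_singleton)
  from measurable_compose[OF this] show "(\<lambda>x. x i j) \<in> borel_measurable (PX n)" .
qed

lemma accept_deviation_limit:
  assumes a: "0 < a"
  shows "(\<lambda>n. \<integral>x. \<bar>1 - accept_prob n (mahalanobis n d cov_law) a x / acc_const a\<bar> \<partial>Xn n) \<longlonglongrightarrow> 0"
proof -
  let ?c = "acc_const a"
  let ?p = "\<lambda>n. accept_prob n (mahalanobis n d cov_law) a"
  have c: "0 < ?c" by (rule normals_ball_pos[OF a])
  have m2: "(\<lambda>n. \<integral>x. (?p n x)\<^sup>2 \<partial>Xn n) \<longlonglongrightarrow> ?c\<^sup>2"
  proof (rule Lim_transform_eventually)
    show "(\<lambda>n. measure Om {\<omega>. MM (d+1) n \<omega> < a \<and> MM (d+2) n \<omega> < a}) \<longlonglongrightarrow> ?c\<^sup>2"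
      using MM_MM_limit[OF a] unfolding measure_M_lim_pair .
    show "\<forall>\<^sub>F n in sequentially. measure Om {\<omega>. MM (d+1) n \<omega> < a \<and> MM (d+2) n \<omega> < a} = (\<integral>x. (?p n x)\<^sup>2 \<partial>Xn n)"
      using mahalanobis_eventually
      by eventually_elim (simp only: second_moment_accept_prob[OF mahalanobis_measurable])
  qed
  have m1: "(\<lambda>n. \<integral>x. ?p n x \<partial>Xn n) \<longlonglongrightarrow> ?c"
  proof (rule Lim_transform_eventually)
    \<comment> \<open>The limit for a single event is obtained from that for pairs by taking the
      same event twice.\<close>
    have "(\<lambda>n. measure Om {\<omega>. MM (d+1) n \<omega> \<in> {..<a} \<and> MM (d+1) n \<omega> \<in> {..<a}}) \<longlonglongrightarrow>
      measure (normals (2*d+1)) {\<omega>\<in>space (normals (2*d+1)). M_lim 0 \<omega> \<in> {..<a} \<and> M_lim 0 \<omega> \<in> {..<a}}"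
    proof (rule joint_limit_prob[OF MM_measurable MM_measurable _ _ MM_limit[of "d+1", unfolded MM'_first]
          MM_limit[of "d+1", unfolded MM'_first] M_lim_first M_lim_first])
      show "AE x in normals (2*d+1). M_lim 0 x \<notin> frontier {..<a}" "AE x in normals (2*d+1). M_lim 0 x \<notin> frontier {..<a}"
        using AE_M_lim[of 0 "2*d+1" a] a by (auto elim!: AE_mp intro!: AE_I2)
    qed (auto simp: measurable_normals intro!: M_lim_measurable)
    then show "(\<lambda>n. measure Om {\<omega>. MM (d+1) n \<omega> < a}) \<longlonglongrightarrow> ?c"
      using measure_M_lim[of 0 "2*d+1" a] by simp
    show "\<forall>\<^sub>F n in sequentially. measure Om {\<omega>. MM (d+1) n \<omega> < a} = (\<integral>x. ?p n x \<partial>Xn n)"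
      using mahalanobis_eventually
      by eventually_elim (simp only: expectation_accept_prob[OF mahalanobis_measurable])
  qed
  \<comment> \<open>With limiting moments \<open>?c\<close> and its square, the expression under the
    root becomes \<open>1 - 2 + 1\<close>.\<close>
  have "(\<lambda>n. sqrt (1 - 2 * (\<integral>x. ?p n x \<partial>Xn n) / ?c + (\<integral>x. (?p n x)\<^sup>2 \<partial>Xn n) / ?c\<^sup>2)) \<longlonglongrightarrow> sqrt (1 - 2 * ?c / ?c + ?c\<^sup>2 / ?c\<^sup>2)"
    using c by (intro tendsto_intros m1 m2) auto
  then have lim: "(\<lambda>n. sqrt (1 - 2 * (\<integral>x. ?p n x \<partial>Xn n) / ?c + (\<integral>x. (?p n x)\<^sup>2 \<partial>Xn n) / ?c\<^sup>2)) \<longlonglongrightarrow> 0" using c by simp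
  show ?thesis
    by (rule tendsto_sandwich[OF always_eventually always_eventually tendsto_const lim])
       (auto intro!: accept_prob_deviation[OF mahalanobis_measurable c] Bochner_Integration.integral_nonneg)
qed

definition stat_event :: "nat \<Rightarrow> (nat \<Rightarrow> real) \<Rightarrow> (nat \<Rightarrow> real) \<Rightarrow> (nat \<Rightarrow> real) \<Rightarrow> real \<Rightarrow> nat \<Rightarrow>
    (nat \<Rightarrow> bool) \<Rightarrow> (nat \<Rightarrow> nat \<Rightarrow> real) \<Rightarrow> (nat \<Rightarrow> real) \<Rightarrow> bool" where
  "stat_event p \<mu>1 \<mu>2 \<beta> y n t x e \<longleftrightarrow> test_stat n p t x (outcome n d (\<mu>1 n) (\<mu>2 n) \<beta> t x e) \<le> y"

lemma stat_event_measurable: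
  assumes "p \<le> d"
  shows "Measurable.pred (PX n \<Otimes>\<^sub>M PE n) (\<lambda>q. stat_event p \<mu>1 \<mu>2 \<beta> y n t (fst q) (snd q))"
proof -
  have "(\<lambda>q. test_stat n p t (fst q) (outcome n d (\<mu>1 n) (\<mu>2 n) \<beta> t (fst q) (snd q))) \<in> borel_measurable (PX n \<Otimes>\<^sub>M PE n)"
  proof (rule borel_measurable_test_stat[OF _ _ _ assms])
    fix i assume i: "i < n"
    have "(\<lambda>e. e i) \<in> borel_measurable (PE n)" using i by (intro measurable_component_singleton) auto
    from measurable_compose[OF measurable_snd this] show "(\<lambda>q. snd q i) \<in> borel_measurable (PX n \<Otimes>\<^sub>M PE n)" .
    fix j assume j: "j < d"
    have "(\<lambda>x. x i) \<in> measurable (PX n) (covariate_space d)" "(\<lambda>y. y j) \<in> borel_measurable (covariate_space d)"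
      using i j by (auto intro!: measurable_component_singleton)
    from measurable_compose[OF measurable_fst measurable_compose[OF this]]
    show "(\<lambda>q. fst q i j) \<in> borel_measurable (PX n \<Otimes>\<^sub>M PE n)" .
  qed simp
  then show ?thesis unfolding stat_event_def by measurable
qed

text \<open>The sum over assignments is the probability of one joint event on \<open>Om\<close>, to
  which the joint limit of statistic and distance applies.\<close>

lemma CR_stat_limit:
  assumes p: "p \<le> d" and \<mu>: "\<And>n. 1 \<le> n \<Longrightarrow> sqrt (real n) * (\<mu>1 n - \<mu>2 n) = \<delta>"
    and \<sigma>w: "\<sigma>w = sqrt (\<Sum>c\<in>{p..d}. (resid_coeff d \<beta> c)\<^sup>2 * v c)" "\<sigma>w \<noteq> 0" and a: "0 < a"
  shows "(\<lambda>n. \<Sum>t\<in>set_pmf (CR n). (1 / 2) ^ n * measure (Xn n \<Otimes>\<^sub>M En n) {q\<in>space (Xn n \<Otimes>\<^sub>M En n).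
      stat_event p \<mu>1 \<mu>2 \<beta> y n t (fst q) (snd q) \<and> mahalanobis n d cov_law (fst q) t < a}) \<longlonglongrightarrow>
    measure (normals (2*d+1)) {\<omega>\<in>space (normals (2*d+1)). S_lim p \<beta> \<delta> \<sigma>w \<omega> \<le> y \<and> M_lim 0 \<omega> < a}"
proof (rule Lim_transform_eventually[OF SS_MM_limit[OF p \<mu> \<sigma>w a]])
  show "\<forall>\<^sub>F n in sequentially. measure Om {\<omega>. SS p \<mu>1 \<mu>2 \<beta> n \<omega> \<le> y \<and> MM (d+1) n \<omega> < a} =
    (\<Sum>t\<in>set_pmf (CR n). (1 / 2) ^ n * measure (Xn n \<Otimes>\<^sub>M En n) {q\<in>space (Xn n \<Otimes>\<^sub>M En n).
      stat_event p \<mu>1 \<mu>2 \<beta> y n t (fst q) (snd q) \<and> mahalanobis n d cov_law (fst q) t < a})"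
    using mahalanobis_eventually
  proof eventually_elim
    case (elim n)
    have [measurable]: "Measurable.pred (PX n \<Otimes>\<^sub>M PE n) (\<lambda>q. stat_event p \<mu>1 \<mu>2 \<beta> y n t (fst q) (snd q))" for t
      by (rule stat_event_measurable[OF p])
    have [measurable]: "(\<lambda>q. mahalanobis n d cov_law (fst q) t) \<in> borel_measurable (PX n \<Otimes>\<^sub>M PE n)" for t
      by (rule measurable_compose[OF measurable_fst mahalanobis_measurable])
    have m: "Measurable.pred (PX n \<Otimes>\<^sub>M PE n) (\<lambda>q. stat_event p \<mu>1 \<mu>2 \<beta> y n t (fst q) (snd q) \<and> mahalanobis n d cov_law (fst q) t < a)" for t
      by measurable
    have "SS p \<mu>1 \<mu>2 \<beta> n \<omega> \<le> y \<longleftrightarrow> stat_event p \<mu>1 \<mu>2 \<beta> y n (assign_block n (d+1) \<omega>) (covar_block n \<omega>) (error_block n \<omega>)" for \<omega>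
    proof -
      have "SS p \<mu>1 \<mu>2 \<beta> n \<omega> = test_stat n p (assign_block n (d+1) \<omega>) (covar_block n \<omega>) (outcome n d (\<mu>1 n) (\<mu>2 n) \<beta> (assign_block n (d+1) \<omega>) (covar_block n \<omega>) (error_block n \<omega>))"
        unfolding SS_def by (rule test_stat_cong[OF _ _ _ p]) (auto simp: assign_def assign_block_def covar_def covar_block_def error_block_def)
      then show ?thesis by (simp add: stat_event_def)
    qed
    then show ?case
      using measure_Om_assign1[where n=n and \<Theta>="\<lambda>t x e. stat_event p \<mu>1 \<mu>2 \<beta> y n t x e \<and> mahalanobis n d cov_law x t < a", OF m] elim
      by (simp only:)
  qed
qed

end

section \<open>The rerandomized limit and its mixture form\<close>

context coordinate_world
begin

text \<open>The experiments may have different spaces for different \<open>n\<close>: covariates and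
  errors enter through their laws, which are those of blocks of \<open>Om\<close>, and the
  assignment through its conditional law.\<close>

lemma rerandomized_stat_limit:
  fixes P :: "nat \<Rightarrow> 'a measure" and x :: "nat \<Rightarrow> nat \<Rightarrow> nat \<Rightarrow> 'a \<Rightarrow> real" and T :: "nat \<Rightarrow> nat \<Rightarrow> 'a \<Rightarrow> bool"
    and e :: "nat \<Rightarrow> nat \<Rightarrow> 'a \<Rightarrow> real"
  assumes p: "p \<le> d" and \<mu>: "\<And>n. 1 \<le> n \<Longrightarrow> sqrt (real n) * (\<mu>1 n - \<mu>2 n) = \<delta>"
    and \<sigma>w: "\<sigma>w = sqrt (\<Sum>c\<in>{p..d}. (resid_coeff d \<beta> c)\<^sup>2 * v c)" "\<sigma>w \<noteq> 0" and a: "0 < a"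
    and P: "\<And>n. prob_space (P n)"
    and ind: "\<And>n. indep_rv (P n) (PiM {..<n} (\<lambda>_. count_space UNIV) \<Otimes>\<^sub>M PiM {..<n} (\<lambda>_. covariate_space d))
               (\<lambda>\<omega>. (\<lambda>i\<in>{..<n}. T n i \<omega>, \<lambda>i\<in>{..<n}. \<lambda>j\<in>{..<d}. x n i j \<omega>))
               (PiM {..<n} (\<lambda>_. borel)) (\<lambda>\<omega>. \<lambda>i\<in>{..<n}. e n i \<omega>)"
    and lawX: "\<And>n. distr (P n) (PX n) (\<lambda>\<omega>. \<lambda>i\<in>{..<n}. \<lambda>j\<in>{..<d}. x n i j \<omega>) = Xn n"
    and lawE: "\<And>n. distr (P n) (PE n) (\<lambda>\<omega>. \<lambda>i\<in>{..<n}. e n i \<omega>) = En n"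
    and rr: "\<And>n. rerandomized (P n) n d (mahalanobis n d cov_law) a (x n) (T n)"
  shows "(\<lambda>n. measure (P n) {\<omega>\<in>space (P n). test_stat n p (\<lambda>i. T n i \<omega>) (\<lambda>i j. x n i j \<omega>)
       (outcome n d (\<mu>1 n) (\<mu>2 n) \<beta> (\<lambda>i. T n i \<omega>) (\<lambda>i j. x n i j \<omega>) (\<lambda>i. e n i \<omega>)) \<le> y}) \<longlonglongrightarrow>
    measure (normals (2*d+1)) {\<omega>\<in>space (normals (2*d+1)). S_lim p \<beta> \<delta> \<sigma>w \<omega> \<le> y \<and> M_lim 0 \<omega> < a} / acc_const a"
proof -
  let ?c = "acc_const a"
  have c: "0 < ?c" by (rule normals_ball_pos[OF a])
  define A where "A n = (\<Sum>t\<in>set_pmf (CR n). (1 / 2) ^ n * measure (Xn n \<Otimes>\<^sub>M En n) {q\<in>space (Xn n \<Otimes>\<^sub>M En n).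
      stat_event p \<mu>1 \<mu>2 \<beta> y n t (fst q) (snd q) \<and> mahalanobis n d cov_law (fst q) t < a})" for n
  define J where "J n = (\<integral>x. \<bar>1 - accept_prob n (mahalanobis n d cov_law) a x / ?c\<bar> \<partial>Xn n)" for n
  define B where "B n = measure (P n) {\<omega>\<in>space (P n). test_stat n p (\<lambda>i. T n i \<omega>) (\<lambda>i j. x n i j \<omega>)
       (outcome n d (\<mu>1 n) (\<mu>2 n) \<beta> (\<lambda>i. T n i \<omega>) (\<lambda>i j. x n i j \<omega>) (\<lambda>i. e n i \<omega>)) \<le> y}" for n
  have AB: "\<bar>B n - A n / ?c\<bar> \<le> 2 * J n" for n
  proof -
    have "test_stat n p (\<lambda>i. T n i \<omega>) (\<lambda>i j. x n i j \<omega>)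
       (outcome n d (\<mu>1 n) (\<mu>2 n) \<beta> (\<lambda>i. T n i \<omega>) (\<lambda>i j. x n i j \<omega>) (\<lambda>i. e n i \<omega>)) \<le> y \<longleftrightarrow>
      stat_event p \<mu>1 \<mu>2 \<beta> y n (\<lambda>i. i < n \<and> T n i \<omega>) (\<lambda>i\<in>{..<n}. \<lambda>j\<in>{..<d}. x n i j \<omega>) (\<lambda>i\<in>{..<n}. e n i \<omega>)" for \<omega>
      unfolding stat_event_def
      by (subst test_stat_cong[where t'="\<lambda>i. i < n \<and> T n i \<omega>" and x'="\<lambda>i\<in>{..<n}. \<lambda>j\<in>{..<d}. x n i j \<omega>" and e'="\<lambda>i\<in>{..<n}. e n i \<omega>", OF _ _ _ p]) auto
    then have "B n = measure (P n) {\<omega>\<in>space (P n). stat_event p \<mu>1 \<mu>2 \<beta> y n (\<lambda>i. i < n \<and> T n i \<omega>) (\<lambda>i\<in>{..<n}. \<lambda>j\<in>{..<d}. x n i j \<omega>) (\<lambda>i\<in>{..<n}. e n i \<omega>)}"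
      by (simp only: B_def)
    then show ?thesis
      unfolding A_def J_def
      using rerandomized_prob_approx[where \<Phi>="stat_event p \<mu>1 \<mu>2 \<beta> y n", OF P ind lawX lawE rr mahalanobis_measurable mahalanobis_cong[OF refl] stat_event_measurable[OF p] c]
      by simp
  qed
  have "(\<lambda>n. B n - A n / ?c) \<longlonglongrightarrow> 0"
  proof (rule tendsto_rabs_zero_cancel, rule tendsto_sandwich[OF always_eventually always_eventually tendsto_const])
    show "(\<lambda>n. 2 * J n) \<longlonglongrightarrow> 0"
      using tendsto_mult[OF tendsto_const[of 2] accept_deviation_limit[OF a]] by (simp add: J_def)
  qed (use AB in auto)
  moreover have "(\<lambda>n. A n / ?c) \<longlonglongrightarrow> measure (normals (2*d+1)) {\<omega>\<in>space (normals (2*d+1)). S_lim p \<beta> \<delta> \<sigma>w \<omega> \<le> y \<and> M_lim 0 \<omega> < a} / ?c"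
    unfolding A_def using c by (intro tendsto_divide tendsto_const CR_stat_limit[OF p \<mu> \<sigma>w a]) auto
  ultimately have "(\<lambda>n. (B n - A n / ?c) + A n / ?c) \<longlonglongrightarrow> 0 + measure (normals (2*d+1)) {\<omega>\<in>space (normals (2*d+1)). S_lim p \<beta> \<delta> \<sigma>w \<omega> \<le> y \<and> M_lim 0 \<omega> < a} / ?c"
    by (rule tendsto_add)
  then show ?thesis by (simp add: B_def)
qed

text \<open>The distance reads the coordinates below \<open>d\<close>, the statistic at most
  coordinate \<open>d\<close> besides. So the later coordinates are dropped and the error coordinate
  is integrated out given \<open>D\<close>, which yields a mixture over \<open>D\<close>.\<close>

lemma S_lim_M_lim_split:
  assumes p: "p \<le> d"
  shows "measure (normals (2*d+1)) {\<omega>\<in>space (normals (2*d+1)). S_lim p \<beta> \<delta> \<sigma>w \<omega> \<le> y \<and> M_lim 0 \<omega> < a} =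
    (\<integral>D. indicator {D\<in>space (normals d). (\<Sum>j<d. (D j)\<^sup>2) < a} D * measure std_normal_distribution {z. S_lim p \<beta> \<delta> \<sigma>w (fun_upd D d z) \<le> y} \<partial>normals d)"
proof -
  interpret Nd: prob_space "normals d" by (rule prob_space_normals)
  interpret NS: prob_space "normals (Suc d)" by (rule prob_space_normals)
  interpret std: prob_space std_normal_distribution by (rule prob_space_normal_density) simp
  interpret product_sigma_finite "\<lambda>_::nat. std_normal_distribution" ..
  let ?\<Psi> = "\<lambda>\<omega>. S_lim p \<beta> \<delta> \<sigma>w \<omega> \<le> y \<and> M_lim 0 \<omega> < a"
  let ?E = "{D\<in>space (normals d). (\<Sum>j<d. (D j)\<^sup>2) < a}"
  have \<Psi>: "Measurable.pred (normals (Suc d)) ?\<Psi>"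
  proof -
    have [measurable]: "S_lim p \<beta> \<delta> \<sigma>w \<in> borel_measurable (normals (Suc d))" "M_lim 0 \<in> borel_measurable (normals (Suc d))"
      unfolding measurable_normals using p by (auto intro!: S_lim_measurable M_lim_measurable)
    show ?thesis by measurable
  qed
  have "?\<Psi> (\<lambda>k\<in>{..<Suc d}. \<omega> k) = ?\<Psi> \<omega>" for \<omega>
  proof -
    have "S_lim p \<beta> \<delta> \<sigma>w (\<lambda>k\<in>{..<Suc d}. \<omega> k) = S_lim p \<beta> \<delta> \<sigma>w \<omega>"
      unfolding S_lim_def by (intro arg_cong[of _ _ "\<lambda>s. (\<delta> / 2 + s) / \<sigma>w"] sum.cong) auto
    moreover have "M_lim 0 (\<lambda>k\<in>{..<Suc d}. \<omega> k) = M_lim 0 \<omega>"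
      unfolding M_lim_def by (intro sum.cong) auto
    ultimately show ?thesis by simp
  qed
  then have "measure (normals (2*d+1)) {\<omega>\<in>space (normals (2*d+1)). ?\<Psi> \<omega>} = measure (normals (Suc d)) {\<omega>\<in>space (normals (Suc d)). ?\<Psi> \<omega>}"
    using measure_normals_reindex[where f="\<lambda>k. k" and m="2*d+1" and m'="Suc d" and \<Psi>="?\<Psi>", OF _ _ \<Psi>] by (simp only:) auto
  also have "\<dots> = (\<integral>D. measure std_normal_distribution {z\<in>space std_normal_distribution. ?\<Psi> (fun_upd D d z)} \<partial>normals d)"
  proof -
    let ?S = "{\<omega>\<in>space (normals (Suc d)). ?\<Psi> \<omega>}"
    have S: "?S \<in> sets (normals (Suc d))" using \<Psi> by measurable
    have I: "{..<Suc d} = insert d {..<d}" by auto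
    have upd: "(\<lambda>(D, z). fun_upd D d z) \<in> measurable (normals d \<Otimes>\<^sub>M std_normal_distribution) (normals (Suc d))"
      unfolding I by (rule measurable_add_dim)
    have pm: "Measurable.pred (normals d \<Otimes>\<^sub>M std_normal_distribution) (\<lambda>q. ?\<Psi> (fun_upd (fst q) d (snd q)))"
      using measurable_compose[OF upd \<Psi>] by (simp add: case_prod_beta')
    note mm = Nd.measure_pair_section(2)[OF std.prob_space_axioms pm]
    have "emeasure (normals (Suc d)) ?S = (\<integral>\<^sup>+\<omega>. indicator ?S \<omega> \<partial>PiM (insert d {..<d}) (\<lambda>_. std_normal_distribution))"
      using S I by simp
    also have "\<dots> = (\<integral>\<^sup>+D. (\<integral>\<^sup>+z. indicator ?S (fun_upd D d z) \<partial>std_normal_distribution) \<partial>normals d)"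
      using S I by (intro product_nn_integral_insert) auto
    also have "\<dots> = (\<integral>\<^sup>+D. ennreal (measure std_normal_distribution {z\<in>space std_normal_distribution. ?\<Psi> (fun_upd D d z)}) \<partial>normals d)"
    proof (intro nn_integral_cong)
      fix D assume D: "D \<in> space (normals d)"
      have sp: "fun_upd D d z \<in> space (normals (Suc d))" for z
        using measurable_space[OF upd, of "(D, z)"] D by (simp add: space_pair_measure)
      have Dm: "(\<lambda>z. fun_upd D d z) \<in> measurable std_normal_distribution (normals (Suc d))"
        using measurable_compose[OF measurable_Pair1'[OF D] upd] by simp
      have E: "{z\<in>space std_normal_distribution. ?\<Psi> (fun_upd D d z)} \<in> sets std_normal_distribution"
        using measurable_compose[OF Dm \<Psi>] by measurable
      have "(\<integral>\<^sup>+z. indicator ?S (fun_upd D d z) \<partial>std_normal_distribution) = (\<integral>\<^sup>+z. indicator {z\<in>space std_normal_distribution. ?\<Psi> (fun_upd D d z)} z \<partial>std_normal_distribution)"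
        using sp by (intro nn_integral_cong) (simp add: indicator_def)
      also have "\<dots> = emeasure std_normal_distribution {z\<in>space std_normal_distribution. ?\<Psi> (fun_upd D d z)}"
        using E by simp
      finally show "(\<integral>\<^sup>+z. indicator ?S (fun_upd D d z) \<partial>std_normal_distribution) = ennreal (measure std_normal_distribution {z\<in>space std_normal_distribution. ?\<Psi> (fun_upd D d z)})"
        by (simp only: std.emeasure_eq_measure)
    qed
    also have "\<dots> = ennreal (\<integral>D. measure std_normal_distribution {z\<in>space std_normal_distribution. ?\<Psi> (fun_upd D d z)} \<partial>normals d)"
      by (intro nn_integral_eq_integral Nd.integrable_const_bound[where B=1] mm) auto
    finally show ?thesis
      by (simp add: NS.emeasure_eq_measure Bochner_Integration.integral_nonneg)
  qed
  also have "\<dots> = (\<integral>D. indicator ?E D * measure std_normal_distribution {z. S_lim p \<beta> \<delta> \<sigma>w (fun_upd D d z) \<le> y} \<partial>normals d)"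
  proof (intro Bochner_Integration.integral_cong refl)
    fix D assume "D \<in> space (normals d)"
    moreover have "M_lim 0 (fun_upd D d z) = (\<Sum>j<d. (D j)\<^sup>2)" for z unfolding M_lim_def by (intro sum.cong) auto
    ultimately show "measure std_normal_distribution {z\<in>space std_normal_distribution. ?\<Psi> (fun_upd D d z)} =
      indicator ?E D * measure std_normal_distribution {z. S_lim p \<beta> \<delta> \<sigma>w (fun_upd D d z) \<le> y}"
      by (cases "(\<Sum>j<d. (D j)\<^sup>2) < a") simp_all
  qed
  finally show ?thesis .
qed

end

lemma indep_rv_commute:
  assumes "prob_space P" "indep_rv P A f B g" shows "indep_rv P B g A f"
proof -
  interpret prob_space P by fact
  have fg: "f \<in> measurable P A" "g \<in> measurable P B" and ind: "indep_set {f -` E \<inter> space P | E. E \<in> sets A} {g -` E \<inter> space P | E. E \<in> sets B}"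
    using assms(2) by (auto simp: indep_rv_def)
  from ind have "indep_set {g -` E \<inter> space P | E. E \<in> sets B} {f -` E \<inter> space P | E. E \<in> sets A}"
    unfolding indep_sets2_eq by (metis (no_types, lifting) Int_commute mult.commute)
  with fg show ?thesis by (simp add: indep_rv_def)
qed

text \<open>Brings the announced limit into the same mixture form: \<open>Z\<close> is integrated
  out given \<open>\<xi>\<close>, and \<open>\<xi>\<close> is a coordinatewise scaling of normals
  weighted by the indicator of the ball over its probability.\<close>

lemma xi_RR_mixture:
  fixes Z :: "'c \<Rightarrow> real" and \<xi> :: "'c \<Rightarrow> nat \<Rightarrow> real" and f :: "(nat \<Rightarrow> real) \<Rightarrow> real"
  assumes R: "prob_space R" and Z: "distributed R lborel Z std_normal_density"
    and \<xi>: "\<xi> \<in> measurable R (covariate_space d)" and law: "distr R (covariate_space d) \<xi> = xi_RR_law d V a"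
    and ind: "indep_rv R borel Z (PiM {p..<d} (\<lambda>_. borel)) (\<lambda>\<omega>. \<lambda>j\<in>{p..<d}. \<xi> \<omega> j)"
    and f: "f \<in> borel_measurable (PiM {p..<d} (\<lambda>_. borel))" and a: "0 < a"
  shows "measure R {\<omega>\<in>space R. b * Z \<omega> + f (\<lambda>j\<in>{p..<d}. \<xi> \<omega> j) \<le> y} =
    (\<integral>D. indicator {D\<in>space (normals d). (\<Sum>j<d. (D j)\<^sup>2) < a} D *
       measure std_normal_distribution {z. b * z + f (\<lambda>j\<in>{p..<d}. sqrt (V j) * D j) \<le> y} \<partial>normals d)
    / measure (normals d) {D\<in>space (normals d). (\<Sum>j<d. (D j)\<^sup>2) < a}"
proof -
  interpret R: prob_space R by fact
  interpret Nd: prob_space "normals d" by (rule prob_space_normals)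
  interpret std: prob_space std_normal_distribution by (rule prob_space_normal_density) simp
  let ?Ex = "PiM {p..<d} (\<lambda>_. borel) :: (nat \<Rightarrow> real) measure"
  let ?x = "\<lambda>\<omega>. \<lambda>j\<in>{p..<d}. \<xi> \<omega> j"
  let ?E = "{D\<in>space (normals d). (\<Sum>j<d. (D j)\<^sup>2) < a}"
  let ?c = "measure (normals d) ?E"
  have c: "0 < ?c" by (rule normals_ball_pos[OF a])
  have xm[measurable]: "?x \<in> measurable R ?Ex" and Zm[measurable]: "Z \<in> borel_measurable R" using ind by (auto simp: indep_rv_def)
  note [measurable] = f
  have dZ: "distr R borel Z = std_normal_distribution"
  proof -
    have "distr R borel Z = distr R lborel Z" by (intro distr_cong) auto
    then show ?thesis using Z by (simp add: distributed_def)
  qed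
  let ?L = "distr R ?Ex ?x"
  interpret L: prob_space ?L by (rule R.prob_space_distr) simp
  have joint: "distr R (?Ex \<Otimes>\<^sub>M borel) (\<lambda>\<omega>. (?x \<omega>, Z \<omega>)) = ?L \<Otimes>\<^sub>M std_normal_distribution"
    using indep_rv_distr_pair[OF R indep_rv_commute[OF R ind]] by (simp add: dZ)
  let ?k = "\<lambda>u. measure std_normal_distribution {z\<in>space std_normal_distribution. b * z + f u \<le> y}"
  have pm: "Measurable.pred (?L \<Otimes>\<^sub>M std_normal_distribution) (\<lambda>q. b * snd q + f (fst q) \<le> y)" by measurable
  note sec = L.measure_pair_section[OF std.prob_space_axioms pm]
  have km: "?k \<in> borel_measurable ?Ex" using sec(2) by simp
  have "measure R {\<omega>\<in>space R. b * Z \<omega> + f (?x \<omega>) \<le> y} = measure (distr R (?Ex \<Otimes>\<^sub>M borel) (\<lambda>\<omega>. (?x \<omega>, Z \<omega>))) {q\<in>space (?Ex \<Otimes>\<^sub>M borel). b * snd q + f (fst q) \<le> y}"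
  proof (subst measure_distr)
    show "{q\<in>space (?Ex \<Otimes>\<^sub>M borel). b * snd q + f (fst q) \<le> y} \<in> sets (?Ex \<Otimes>\<^sub>M borel)" by measurable
    show "measure R {\<omega>\<in>space R. b * Z \<omega> + f (?x \<omega>) \<le> y} = measure R ((\<lambda>\<omega>. (?x \<omega>, Z \<omega>)) -` {q\<in>space (?Ex \<Otimes>\<^sub>M borel). b * snd q + f (fst q) \<le> y} \<inter> space R)"
      using measurable_space[OF xm] by (intro arg_cong[of _ _ "measure R"]) (auto simp: space_pair_measure)
  qed measurable
  also have "\<dots> = measure (?L \<Otimes>\<^sub>M std_normal_distribution) {q\<in>space (?L \<Otimes>\<^sub>M std_normal_distribution). b * snd q + f (fst q) \<le> y}"
    unfolding joint by (simp add: space_pair_measure)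
  also have "\<dots> = (\<integral>u. ?k u \<partial>?L)" by (rule sec(1))
  also have "\<dots> = (\<integral>\<omega>. ?k (?x \<omega>) \<partial>R)" by (rule integral_distr[OF xm km])
  also have "\<dots> = (\<integral>w. ?k (\<lambda>j\<in>{p..<d}. w j) \<partial>distr R (covariate_space d) \<xi>)"
  proof (rule integral_distr[OF \<xi>, symmetric])
    have "(\<lambda>w. \<lambda>j\<in>{p..<d}. w j) \<in> measurable (covariate_space d) ?Ex"
      by (intro measurable_restrict measurable_component_singleton) auto
    from measurable_compose[OF this km] show "(\<lambda>w. ?k (\<lambda>j\<in>{p..<d}. w j)) \<in> borel_measurable (covariate_space d)" .
  qed
  also have "\<dots> = (\<integral>D. ?k (\<lambda>j\<in>{p..<d}. (\<lambda>j\<in>{..<d}. sqrt (V j) * D j) j) \<partial>uniform_measure (normals d) ?E)"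
    unfolding law xi_RR_law_def
  proof (rule integral_distr)
    show "(\<lambda>D. \<lambda>j\<in>{..<d}. sqrt (V j) * D j) \<in> measurable (uniform_measure (normals d) ?E) (covariate_space d)"
      by (subst measurable_cong_sets[OF trans[OF sets_uniform_measure sets_normals_borel] refl])
         (intro measurable_restrict borel_measurable_times borel_measurable_const measurable_component_singleton)
    have "(\<lambda>w. \<lambda>j\<in>{p..<d}. w j) \<in> measurable (covariate_space d) ?Ex"
      by (intro measurable_restrict measurable_component_singleton) auto
    from measurable_compose[OF this km] show "(\<lambda>w. ?k (\<lambda>j\<in>{p..<d}. w j)) \<in> borel_measurable (covariate_space d)" .
  qed
  also have "\<dots> = (\<integral>D. ?k (\<lambda>j\<in>{p..<d}. sqrt (V j) * D j) \<partial>uniform_measure (normals d) ?E)"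
  proof -
    have "(\<lambda>j\<in>{p..<d}. (\<lambda>j\<in>{..<d}. sqrt (V j) * D j) j) = (\<lambda>j\<in>{p..<d}. sqrt (V j) * D j)" for D by auto
    then show ?thesis by (simp only:)
  qed
  also have "uniform_measure (normals d) ?E = density (normals d) (\<lambda>D. ennreal (indicator ?E D / ?c))"
    unfolding uniform_measure_def Nd.emeasure_eq_measure
    using c by (intro arg_cong2[of _ _ _ _ density] refl ext) (simp add: divide_ennreal[symmetric] ennreal_indicator)
  also have "(\<integral>D. ?k (\<lambda>j\<in>{p..<d}. sqrt (V j) * D j) \<partial>density (normals d) (\<lambda>D. ennreal (indicator ?E D / ?c))) =
     (\<integral>D. (indicator ?E D / ?c) *\<^sub>R ?k (\<lambda>j\<in>{p..<d}. sqrt (V j) * D j) \<partial>normals d)"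
  proof (rule integral_density)
    have "(\<lambda>D. \<lambda>j\<in>{p..<d}. sqrt (V j) * D j) \<in> measurable (normals d) ?Ex"
      by (subst measurable_cong_sets[OF sets_normals_borel refl])
         (intro measurable_restrict borel_measurable_times borel_measurable_const measurable_component_singleton, auto)
    from measurable_compose[OF this km] show "(\<lambda>D. ?k (\<lambda>j\<in>{p..<d}. sqrt (V j) * D j)) \<in> borel_measurable (normals d)" .
    have "(\<lambda>D. \<Sum>j<d. (D j)\<^sup>2) \<in> borel_measurable (normals d)"
      by (subst measurable_cong_sets[OF sets_normals_borel refl]) (intro borel_measurable_sum borel_measurable_power measurable_component_singleton)
    then have "?E \<in> sets (normals d)" by measurable
    then show "(\<lambda>D. indicator ?E D / ?c) \<in> borel_measurable (normals d)" by measurable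
  qed (use c in auto)
  also have "\<dots> = (\<integral>D. (indicator ?E D * ?k (\<lambda>j\<in>{p..<d}. sqrt (V j) * D j)) / ?c \<partial>normals d)"
    by (intro Bochner_Integration.integral_cong) auto
  also have "\<dots> = (\<integral>D. indicator ?E D * ?k (\<lambda>j\<in>{p..<d}. sqrt (V j) * D j) \<partial>normals d) / ?c" by (rule integral_divide_zero)
  finally show ?thesis by (simp only: space_density space_lborel space_borel UNIV_I simp_thms)
qed

lemma sum_resid_coeff:
  "(\<Sum>c\<in>{p..p+q}. g c (resid_coeff (p+q) \<beta> c)) = g (p+q) 1 + (\<Sum>j<q. g (p+j) (\<beta> (p+j)))"
proof -
  have "{p..p+q} = insert (p+q) {p..<p+q}" by auto
  then have "(\<Sum>c\<in>{p..p+q}. g c (resid_coeff (p+q) \<beta> c)) = g (p+q) 1 + (\<Sum>c\<in>{p..<p+q}. g c (resid_coeff (p+q) \<beta> c))"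
    by (simp add: resid_coeff_def)
  also have "(\<Sum>c\<in>{p..<p+q}. g c (resid_coeff (p+q) \<beta> c)) = (\<Sum>c\<in>{p..<p+q}. g c (\<beta> c))"
    by (intro sum.cong) (auto simp: resid_coeff_def)
  also have "\<dots> = (\<Sum>j<q. g (p+j) (\<beta> (p+j)))"
    using sum.shift_bounds_nat_ivl[of "\<lambda>c. g c (\<beta> c)" 0 p q] by (simp add: lessThan_atLeast0 add.commute)
  finally show ?thesis .
qed

lemma cdf_distr:
  assumes "W \<in> borel_measurable M" shows "cdf (distr M borel W) y = measure M {\<omega>\<in>space M. W \<omega> \<le> y}"
  using assms unfolding cdf_def by (subst measure_distr) (auto intro!: arg_cong[of _ _ "measure M"])

theorem theorem4p1:
  fixes p q :: nat
    and a \<sigma>\<epsilon> \<sigma>w lam1 lam2 :: real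
    and \<beta> V :: "nat \<Rightarrow> real"
    and \<mu>1 \<mu>2 :: "nat \<Rightarrow> real"
    and Q :: "'b measure" and X :: "nat \<Rightarrow> 'b \<Rightarrow> real"
    and noise :: "real measure"
    and P :: "nat \<Rightarrow> 'a measure"
    and x :: "nat \<Rightarrow> nat \<Rightarrow> nat \<Rightarrow> 'a \<Rightarrow> real"
    and T :: "nat \<Rightarrow> nat \<Rightarrow> 'a \<Rightarrow> bool"
    and \<epsilon> :: "nat \<Rightarrow> nat \<Rightarrow> 'a \<Rightarrow> real"
    and S :: "nat \<Rightarrow> 'a \<Rightarrow> real"
    and R :: "'c measure" and Z :: "'c \<Rightarrow> real" and \<xi> :: "'c \<Rightarrow> nat \<Rightarrow> real"
  \<comment> \<open>the reference covariates\<close>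
  assumes "prob_space Q"
    and "prob_space.indep_vars Q (\<lambda>_. borel) X {..<p+q}"
    and "\<And>j. j < p + q \<Longrightarrow> integrable Q (\<lambda>\<omega>. (X j \<omega>)\<^sup>2)"
    and "\<And>j. j < p + q \<Longrightarrow> prob_space.expectation Q (X j) = 0"
    and "\<And>j. V j = prob_space.variance Q (X j)"
    and "\<And>j. j < p + q \<Longrightarrow> 0 < V j"
  \<comment> \<open>the law of the errors\<close>
    and "prob_space noise"
    and "integrable noise (\<lambda>e. e\<^sup>2)"
    and "prob_space.expectation noise (\<lambda>e. e) = 0"
    and "prob_space.variance noise (\<lambda>e. e) = \<sigma>\<epsilon>\<^sup>2"
    and "0 < \<sigma>\<epsilon>"
  \<comment> \<open>the experiment with \<open>n\<close> units, for each \<open>n\<close>\<close>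
    and "\<And>n. prob_space (P n)"
    and "\<And>n. prob_space.indep_vars (P n) (\<lambda>_. covariate_space (p+q))
               (\<lambda>i \<omega>. \<lambda>j\<in>{..<p+q}. x n i j \<omega>) {..<n}"
    and "\<And>n i. i < n \<Longrightarrow> covariate_law (p+q) (P n) (x n i) = covariate_law (p+q) Q X"
    and "\<And>n. prob_space.indep_vars (P n) (\<lambda>_. borel) (\<epsilon> n) {..<n}"
    and "\<And>n i. i < n \<Longrightarrow> distr (P n) borel (\<epsilon> n i) = noise"
    and "\<And>n. indep_rv (P n)
               (PiM {..<n} (\<lambda>_. count_space UNIV) \<Otimes>\<^sub>M PiM {..<n} (\<lambda>_. covariate_space (p+q)))
               (\<lambda>\<omega>. (\<lambda>i\<in>{..<n}. T n i \<omega>, \<lambda>i\<in>{..<n}. \<lambda>j\<in>{..<p+q}. x n i j \<omega>))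
               (PiM {..<n} (\<lambda>_. borel))
               (\<lambda>\<omega>. \<lambda>i\<in>{..<n}. \<epsilon> n i \<omega>)"
  \<comment> \<open>rerandomization\<close>
    and "0 < a"
    and "\<And>n. rerandomized (P n) n (p+q) (mahalanobis n (p+q) (covariate_law (p+q) Q X)) a
               (x n) (T n)"
  \<comment> \<open>the test statistic\<close>
    and "\<And>n \<omega>. S n \<omega> =
           test_stat n p (\<lambda>i. T n i \<omega>) (\<lambda>i j. x n i j \<omega>)
             (outcome n (p+q) (\<mu>1 n) (\<mu>2 n) \<beta> (\<lambda>i. T n i \<omega>) (\<lambda>i j. x n i j \<omega>) (\<lambda>i. \<epsilon> n i \<omega>))"
  \<comment> \<open>the limit\<close>
    and "\<sigma>w = sqrt (\<sigma>\<epsilon>\<^sup>2 + (\<Sum>j<q. (\<beta> (p+j))\<^sup>2 * V (p+j)))"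
    and "lam1 = \<sigma>\<epsilon> / \<sigma>w"
    and "lam2 = 1 / \<sigma>w"
    and "prob_space R"
    and "distributed R lborel Z std_normal_density"
    and "\<xi> \<in> measurable R (covariate_space (p+q))"
    and "distr R (covariate_space (p+q)) \<xi> = xi_RR_law (p+q) V a"
    and "indep_rv R borel Z (PiM {p..<p+q} (\<lambda>_. borel)) (\<lambda>\<omega>. \<lambda>j\<in>{p..<p+q}. \<xi> \<omega> j)"
  shows "((\<forall>n\<ge>1. \<mu>1 n - \<mu>2 n = 0) \<longrightarrow>
            weak_conv_m (\<lambda>n. distr (P n) borel (S n))
              (distr R borel (\<lambda>\<omega>. lam1 * Z \<omega> + lam2 * (\<Sum>j<q. \<beta> (p+j) * \<xi> \<omega> (p+j)))))
       \<and> (\<forall>\<delta>. \<delta> \<noteq> 0 \<longrightarrow> (\<forall>n\<ge>1. \<mu>1 n - \<mu>2 n = \<delta> / sqrt (real n)) \<longrightarrow>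
            weak_conv_m (\<lambda>n. distr (P n) borel (S n))
              (distr R borel (\<lambda>\<omega>. lam1 * Z \<omega> + lam2 * (\<Sum>j<q. \<beta> (p+j) * \<xi> \<omega> (p+j)) + lam2 * \<delta> / 2)))"
proof -
  note Q = assms(1) and indX = assms(2) and sqX = assms(3) and meanX = assms(4) and V = assms(5) and Vpos = assms(6)
  note noise = assms(7) and sqN = assms(8) and meanN = assms(9) and varN = assms(10) and \<sigma>\<epsilon> = assms(11)
  note P = assms(12) and indx = assms(13) and lawx = assms(14) and ind\<epsilon> = assms(15) and law\<epsilon> = assms(16) and ind = assms(17)
  note a = assms(18) and rr = assms(19) and S = assms(20)
  note \<sigma>w = assms(21) and lam1 = assms(22) and lam2 = assms(23)
  note R = assms(24) and Z = assms(25) and \<xi> = assms(26) and law\<xi> = assms(27) and indR = assms(28)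
  interpret Q: prob_space Q by (rule Q)
  interpret N: prob_space noise by (rule noise)
  interpret R: prob_space R by (rule R)
  let ?d = "p + q"
  \<comment> \<open>The sigma-algebra of \<open>noise\<close> is read off from the law of the only
    error in the experiment with one unit.\<close>
  have sN: "sets noise = sets borel" using law\<epsilon>[of 0 1] by (auto simp: sets_distr[symmetric])
  have Xm: "X j \<in> borel_measurable Q" if "j < ?d" for j using indX that by (auto simp: Q.indep_vars_def)
  have xm: "(\<lambda>\<omega>. \<lambda>j\<in>{..<?d}. x n i j \<omega>) \<in> measurable (P n) (covariate_space ?d)" if "i < n" for n i
    using indx[of n] that by (auto simp: prob_space.indep_vars_def[OF P])
  have xm': "x n i j \<in> borel_measurable (P n)" if "i < n" "j < ?d" for n i j
    using measurable_compose[OF xm[OF that(1)] measurable_component_singleton[of j]] that by simp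
  have \<epsilon>m: "\<epsilon> n i \<in> borel_measurable (P n)" if "i < n" for n i
    using ind\<epsilon>[of n] that by (auto simp: prob_space.indep_vars_def[OF P])
  have Tm: "(\<lambda>\<omega>. of_bool (T n i \<omega>) :: real) \<in> borel_measurable (P n)" if "i < n" for n i
  proof -
    have "(\<lambda>\<omega>. \<lambda>i\<in>{..<n}. T n i \<omega>) \<in> measurable (P n) (PiM {..<n} (\<lambda>_. count_space UNIV))"
      using ind[of n] measurable_fst unfolding indep_rv_def by (auto dest: measurable_compose[OF _ measurable_fst])
    from measurable_compose[OF this measurable_component_singleton[of i]] that
    have "T n i \<in> measurable (P n) (count_space UNIV)" by simp
    from measurable_compose[OF this, of of_bool "borel :: real measure"] show ?thesis by simp
  qed

  \<comment> \<open>Both assignment columns, and all columns after them, carry the sign law.\<close>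
  define law where "law c = (if c < ?d then distr Q borel (X c) else if c = ?d then noise else sign_law)" for c
  define vv where "vv c = (if c < ?d then V c else if c = ?d then \<sigma>\<epsilon>\<^sup>2 else 1)" for c
  interpret coordinate_world ?d law vv
  proof (rule coordinate_world.intro)
    fix c
    show "prob_space (law c)"
      using Xm by (auto simp: law_def intro!: Q.prob_space_distr noise prob_space_sign_law)
    show "sets (law c) = sets borel" by (auto simp: law_def sN sets_sign_law)
    show "integrable (law c) (\<lambda>y. y\<^sup>2)"
      using sqX[of c] sqN Xm[of c] by (auto simp: law_def integrable_distr_eq integrable_sign_law)
    show "(\<integral>y. y \<partial>law c) = 0"
      using meanX[of c] meanN Xm[of c] by (auto simp: law_def integral_distr integral_sign_law)
    show "(\<integral>y. y\<^sup>2 \<partial>law c) = vv c"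
      using V[of c] varN meanX[of c] meanN Xm[of c] by (auto simp: law_def vv_def integral_distr integral_sign_law)
    show "0 < vv c" using Vpos[of c] \<sigma>\<epsilon> by (auto simp: vv_def)
  qed (auto simp: law_def)

  have cov: "covariate_law ?d Q X = cov_law"
    unfolding Q.distr_PiM_indep_vars[OF indX] cov_law_def by (intro PiM_cong refl) (simp add: law_def)
  have lawX: "distr (P n) (PX n) (\<lambda>\<omega>. \<lambda>i\<in>{..<n}. \<lambda>j\<in>{..<?d}. x n i j \<omega>) = Xn n" for n
    unfolding prob_space.distr_PiM_indep_vars[OF P indx] Xn_def
    by (intro PiM_cong refl) (simp add: lawx cov cov_law_def)
  have lawE: "distr (P n) (PE n) (\<lambda>\<omega>. \<lambda>i\<in>{..<n}. \<epsilon> n i \<omega>) = En n" for n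
    unfolding prob_space.distr_PiM_indep_vars[OF P ind\<epsilon>] En_def
    by (intro PiM_cong refl) (simp add: law\<epsilon> law_def)
  have sum_vv: "(\<Sum>c\<in>{p..?d}. (resid_coeff ?d \<beta> c)\<^sup>2 * vv c) = \<sigma>\<epsilon>\<^sup>2 + (\<Sum>j<q. (\<beta> (p+j))\<^sup>2 * V (p+j))"
    using sum_resid_coeff[where g="\<lambda>c b. b\<^sup>2 * vv c"] by (simp add: vv_def)
  have \<sigma>w_pos: "0 < \<sigma>w"
  proof -
    have "0 \<le> (\<Sum>j<q. (\<beta> (p+j))\<^sup>2 * V (p+j))" using Vpos by (intro sum_nonneg) (simp add: less_imp_le)
    then show ?thesis using \<sigma>\<epsilon> by (simp add: \<sigma>w add_pos_nonneg)
  qed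
  have Sm: "S n \<in> borel_measurable (P n)" for n
    unfolding S[abs_def] using Tm xm' \<epsilon>m by (intro borel_measurable_test_stat[where d="?d"]) auto

  \<comment> \<open>Both parts are instances of one statement, the first with
    \<open>\<delta> = 0\<close>.\<close>
  have conv: "weak_conv_m (\<lambda>n. distr (P n) borel (S n))
      (distr R borel (\<lambda>\<omega>. lam1 * Z \<omega> + (lam2 * (\<Sum>j<q. \<beta> (p+j) * \<xi> \<omega> (p+j)) + lam2 * \<delta> / 2)))"
    if \<mu>: "\<And>n. 1 \<le> n \<Longrightarrow> sqrt (real n) * (\<mu>1 n - \<mu>2 n) = \<delta>" for \<delta>
  proof -
    define f where "f u = lam2 * (\<Sum>j<q. \<beta> (p+j) * u (p+j)) + lam2 * \<delta> / 2" for u :: "nat \<Rightarrow> real"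
    let ?x = "\<lambda>\<omega>. \<lambda>j\<in>{p..<?d}. \<xi> \<omega> j"
    have fm[measurable]: "f \<in> borel_measurable (PiM {p..<?d} (\<lambda>_. borel))"
      unfolding f_def
      by (intro borel_measurable_add borel_measurable_times borel_measurable_sum borel_measurable_const measurable_component_singleton) auto
    have fx: "f (?x \<omega>) = f (\<xi> \<omega>)" for \<omega>
      unfolding f_def by (intro arg_cong[of _ _ "\<lambda>s. lam2 * s + lam2 * \<delta> / 2"] sum.cong) auto
    have [measurable]: "?x \<in> measurable R (PiM {p..<?d} (\<lambda>_. borel))" "Z \<in> borel_measurable R"
      using indR by (auto simp: indep_rv_def)
    have Wm: "(\<lambda>\<omega>. lam1 * Z \<omega> + f (\<xi> \<omega>)) \<in> borel_measurable R"
      unfolding fx[symmetric] by measurable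
    \<comment> \<open>Coordinate \<open>p + q\<close> carries the errors and becomes
      \<open>lam1 * z\<close>; the coordinates of the omitted covariates become the term with
      \<open>\<xi>\<close>.\<close>
    have S_lim: "S_lim p \<beta> \<delta> \<sigma>w (fun_upd D ?d z) = lam1 * z + f (\<lambda>j\<in>{p..<?d}. sqrt (V j) * D j)" for D z
    proof -
      have "(\<Sum>c\<in>{p..?d}. resid_coeff ?d \<beta> c * (sqrt (vv c) * fun_upd D ?d z c)) =
          \<sigma>\<epsilon> * z + (\<Sum>j<q. \<beta> (p+j) * (sqrt (V (p+j)) * D (p+j)))"
        using sum_resid_coeff[where g="\<lambda>c b. b * (sqrt (vv c) * fun_upd D ?d z c)"] \<sigma>\<epsilon> by (simp add: vv_def)
      then show ?thesis
        using \<sigma>w_pos by (simp add: S_lim_def f_def lam1 lam2 add_divide_distrib)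
    qed
    \<comment> \<open>The distribution functions converge at every \<open>y\<close>, not only at the
      continuity points of the limit.\<close>
    have "(\<lambda>n. measure (P n) {\<omega>\<in>space (P n). S n \<omega> \<le> y}) \<longlonglongrightarrow> measure R {\<omega>\<in>space R. lam1 * Z \<omega> + f (\<xi> \<omega>) \<le> y}" for y
    proof -
      have "(\<lambda>n. measure (P n) {\<omega>\<in>space (P n). S n \<omega> \<le> y}) \<longlonglongrightarrow>
          measure (normals (2*?d+1)) {\<omega>\<in>space (normals (2*?d+1)). S_lim p \<beta> \<delta> \<sigma>w \<omega> \<le> y \<and> M_lim 0 \<omega> < a} / acc_const a"
        unfolding S
        by (rule rerandomized_stat_limit[OF _ \<mu> _ _ a P ind lawX lawE rr[unfolded cov]])
           (use \<sigma>w sum_vv \<sigma>w_pos in auto)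
      \<comment> \<open>Both sides are the same mixture over the Gaussian covariate coordinates
        conditioned on the ball.\<close>
      moreover have "measure (normals (2*?d+1)) {\<omega>\<in>space (normals (2*?d+1)). S_lim p \<beta> \<delta> \<sigma>w \<omega> \<le> y \<and> M_lim 0 \<omega> < a} / acc_const a =
          measure R {\<omega>\<in>space R. lam1 * Z \<omega> + f (?x \<omega>) \<le> y}"
        unfolding xi_RR_mixture[OF R Z \<xi> law\<xi> indR fm a] S_lim_M_lim_split[OF le_add1] S_lim by simp
      ultimately show ?thesis unfolding fx by simp
    qed
    then show ?thesis
      using Sm Wm by (simp add: weak_conv_m_def weak_conv_def f_def cdf_distr)
  qed
  show ?thesis
  proof (intro conjI allI impI)
    assume "\<forall>n\<ge>1. \<mu>1 n - \<mu>2 n = 0"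
    then show "weak_conv_m (\<lambda>n. distr (P n) borel (S n))
        (distr R borel (\<lambda>\<omega>. lam1 * Z \<omega> + lam2 * (\<Sum>j<q. \<beta> (p+j) * \<xi> \<omega> (p+j))))"
      using conv[of 0] by simp
  next
    fix \<delta> :: real assume "\<forall>n\<ge>1. \<mu>1 n - \<mu>2 n = \<delta> / sqrt (real n)"
    then show "weak_conv_m (\<lambda>n. distr (P n) borel (S n))
        (distr R borel (\<lambda>\<omega>. lam1 * Z \<omega> + lam2 * (\<Sum>j<q. \<beta> (p+j) * \<xi> \<omega> (p+j)) + lam2 * \<delta> / 2))"
      using conv[of \<delta>] by (simp add: add.assoc)
  qed
qed

end
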